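(* Let $\sigma>1$ and suppose the noise density $g$ is known, its Fourier transform does not vanish on $\mathbb{R}$, and $|\Phi^g(u)|\sim c_g|u|^{-\sigma}$ as $|u|\to\infty$ for some $c_g>0$. Let $L>0$, let $\mathcal{T}$ be a parameter set as described in the context (with $\underline{\beta}<\overline{\beta}$), and let $f_0\in\mathcal{F}(\alpha_0,0,\overline{\beta},L)$ with $\alpha_0\ge\underline{\alpha}$. Put $N=\lceil\log n\rceil$ and, for $1\le i\le N$, $\beta_i=\underline{\beta}+(i-1)(\overline{\beta}-\underline{\beta})/(N-1)$, $$h_n^i=\Big(\frac{n}{\sqrt{\log\log n}}\Big)^{-2/(4\beta_i+4\sigma+1)},\qquad t_{n,i}^2=\Big(\frac{n}{\sqrt{\log\log n}}\Big)^{-4\beta_i/(4\beta_i+4\sigma+1)},$$ and $$h_n^{N+1}=n^{-2/(4\overline{\beta}+4\sigma+1)},\qquad t_{n,N+1}^2=n^{-4\overline{\beta}/(4\overline{\beta}+4\sigma+1)}.$$ Let $\Delta_n^\star=1$ if $\max_{1\le i\le N+1}|T_{n,h_n^i}|\,t_{n,i}^{-2}>\mathcal{C}^\star$ and $\Delta_n^\star=0$ otherwise. For $\tau=(\alpha,r,\beta)\in\mathcal{T}$ define $$\psi_{n,\tau}=\Big(\frac{n}{\sqrt{\log\log n}}\Big)^{-2\beta/(4\beta+4\sigma+1)}1_{r=0}+n^{-2\overline{\beta}/(4\overline{\beta}+4\sigma+1)}1_{r>0},$$ $\Psi_n=\{\psi_{n,\tau}\}_{\tau\in\mathcal{T}}$,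 and $$H_1(\mathcal{C},\Psi_n)=\bigcup_{\tau\in\mathcal{T}}\{f\in\mathcal{F}(\tau,L):\ \psi_{n,\tau}^{-2}\|f-f_0\|_2^2\ge\mathcal{C}\}.$$ (Upper bound) For every $\epsilon\in(0,1)$ and every large enough constant $\mathcal{C}^\star>0$, there exists $\mathcal{C}^0>0$ such that for all $\mathcal{C}>\mathcal{C}^0$ $$\limsup_{n\to\infty}\Big\{\mathbb{P}_{f_0}[\Delta_n^\star=1]+\sup_{f\in H_1(\mathcal{C},\Psi_n)}\mathbb{P}_f[\Delta_n^\star=0]\Big\}\le\epsilon.$$ (Lower bound) If moreover $f_0\in\mathcal{F}(\alpha_0,0,\overline{\beta},cL)$ for some $0<c<1$, and Assumptions (T) and (P) of the context hold, then the rate is adaptive minimax over the family $\{\mathcal{F}(\tau,L):\tau\in[\underline{\alpha},\infty)\times\{0\}\times[\underline{\beta},\overline{\beta}]\}$, i.e. for every $\epsilon\in(0,1)$ there exists $\mathcal{C}_0>0$ such that for all $0<\mathcal{C}<\mathcal{C}_0$ $$\liminf_{n\to\infty}\inf_{\Delta_n}\Big\{\mathbb{P}_{f_0}[\Delta_n=1]+\sup_{f\in H_1(\mathcal{C},\Psi_n)}\mathbb{P}_f[\Delta_n=0]\Big\}\ge\epsilon,$$ where here $H_1(\mathcal{C},\Psi_n)$ is defined with the union over $\tau\in[\underline{\alpha},\infty)\times\{0\}\times[\underline{\beta},\overline{\beta}]$, and the infimum is over all tests $\Delta_n$ (measurable $\{0,1\}$-valued functions of $Y_1,\dots,Y_n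$).
   Context: Convolution model: one observes i.i.d. $Y_j=X_j+\varepsilon_j$, $1\le j\le n$, where the $X_j$ are i.i.d. with unknown density $f\in\mathbb{L}_1\cap\mathbb{L}_2(\mathbb{R})$, the $\varepsilon_j$ are i.i.d. with density $g$ and independent of the $X_j$. $\Phi,\Phi^g$ denote the Fourier transforms of $f,g$. $\mathbb{P}_f,\mathbb{E}_f$ denote probability and expectation for the law of $(Y_1,\dots,Y_n)$ when the $X_j$ have density $f$. $\|\cdot\|_2$ is the $\mathbb{L}_2(\mathbb{R})$-norm and $\langle M,N\rangle=\int M\overline{N}$. Smoothness classes: for $\tau=(\alpha,r,\beta)$ and $L>0$, $$\mathcal{F}(\tau,L)=\mathcal{F}(\alpha,r,\beta,L)=\Big\{f:\mathbb{R}\to\mathbb{R}_+,\ \int f=1,\ \frac1{2\pi}\int|\Phi(u)|^2|u|^{2\beta}\exp(2\alpha|u|^r)\,du\le L\Big\}$$ (for $r=0$, $|u|^r=1$). Parameter set: $\mathcal{T}$ is the set of $\tau=(\alpha,r,\beta)$ with $r\in[\underline{r},\overline{r}]$, $\beta\in[\underline{\beta},\overline{\beta}]$, $0\le\underline{r}\le\overline{r}\le2$, $0\le\underline{\beta}<\overline{\beta}$, $\underline{\alpha}>0$, where either $\underline{r}>0$ and $\alpha$ ranges over $[\underline{\alpha},\overline{\alpha}]$ (for some finite $\overline{\alpha}\ge\underline{\alpha}$), or $\underline{r}=\overline{r}=0$, $\underline{\beta}>0$ and $\alpha$ ranges over $[\underline{\alpha},\infty)$. Test statistic: for $h>0$ let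 $K_h$ be the function with Fourier transform $\Phi^{K_h}(u)=\Phi^g(u)^{-1}1_{|u|\le1/h}$, and $$T_{n,h}=\frac{2}{n(n-1)}\sum_{1\le k<j\le n}\langle K_h(\cdot-Y_k)-f_0,\ K_h(\cdot-Y_j)-f_0\rangle.$$ Assumption (T): there is $c_0>0$ with $f_0(x)\ge c_0/(1+|x|^2)$ for all $x\in\mathbb{R}$. Assumption (P): $\Phi^g$ is three times continuously differentiable and there exist $A_1,A_2$ such that $|(\Phi^g)'(u)|\le A_1|u|^{-\sigma-1}$ and $|(\Phi^g)''(u)|\le A_2|u|^{-\sigma-2}$ as $|u|\to\infty$. *)

theory Defs
  imports "HOL-Probability.Probability" "HOL-Library.Landau_Symbols"
begin

section \<open>Densities, Fourier transforms and the $L_2$ structure\<close>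

definition is_density :: "(real \<Rightarrow> real) \<Rightarrow> bool" where
  "is_density f \<longleftrightarrow> f \<in> borel_measurable lborel \<and> (\<forall>x. 0 \<le> f x) \<and>
     integrable lborel f \<and> integral\<^sup>L lborel f = 1"

definition fourier :: "(real \<Rightarrow> real) \<Rightarrow> real \<Rightarrow> complex" where
  "fourier f u = (\<integral>x. iexp (u * x) * complex_of_real (f x) \<partial>lborel)"

definition inverse_fourier :: "(real \<Rightarrow> complex) \<Rightarrow> real \<Rightarrow> complex" where
  "inverse_fourier F x = complex_of_real (1 / (2 * pi)) * (\<integral>u. iexp (- (u * x)) * F u \<partial>lborel)"

definition L2_inner :: "(real \<Rightarrow> complex) \<Rightarrow> (real \<Rightarrow> complex) \<Rightarrow> complex" where
  "L2_inner M N = (\<integral>x. M x * cnj (N x) \<partial>lborel)"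

definition L2_norm :: "(real \<Rightarrow> real) \<Rightarrow> real" where
  "L2_norm f = sqrt (\<integral>x. (f x)\<^sup>2 \<partial>lborel)"


section \<open>Smoothness classes and parameter sets\<close>

text \<open>
  The convention that $|u|^r = 1$ for $r = 0$ is imposed explicitly. For the factor
  $|u|^{2\beta}$ the value of \<open>0 powr 0\<close> only matters at the single point $u = 0$, which does
  not affect the integrals below.
\<close>

definition smoothness_weight :: "real \<Rightarrow> real \<Rightarrow> real \<Rightarrow> real \<Rightarrow> real" where
  "smoothness_weight \<alpha> r \<beta> u =
     \<bar>u\<bar> powr (2 * \<beta>) * exp (2 * \<alpha> * (if r = 0 then 1 else \<bar>u\<bar> powr r))"

text \<open>
  All densities of the model belong to $L_1 \cap L_2$, hence the square integrability below. The
  smoothness integral has values in $[0,\infty]$, so the inequality includes its finiteness.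
\<close>

definition smoothness_class :: "real \<times> real \<times> real \<Rightarrow> real \<Rightarrow> (real \<Rightarrow> real) set" where
  "smoothness_class = (\<lambda>(\<alpha>, r, \<beta>) L. {f. is_density f \<and> integrable lborel (\<lambda>x. (f x)\<^sup>2) \<and>
     ennreal (1 / (2 * pi)) *
       (\<integral>\<^sup>+u. ennreal ((cmod (fourier f u))\<^sup>2 * smoothness_weight \<alpha> r \<beta> u) \<partial>lborel) \<le> ennreal L})"

text \<open>Parameters are triples $\tau = (\alpha, r, \beta)$.\<close>

definition parameter_set ::
    "real \<Rightarrow> real \<Rightarrow> real \<Rightarrow> real \<Rightarrow> real \<Rightarrow> (real \<times> real \<times> real) set \<Rightarrow> bool" where
  "parameter_set \<alpha>lo rlo rhi \<beta>lo \<beta>hi \<T> \<longleftrightarrow>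
     0 \<le> rlo \<and> rlo \<le> rhi \<and> rhi \<le> 2 \<and> 0 \<le> \<beta>lo \<and> \<beta>lo < \<beta>hi \<and> 0 < \<alpha>lo \<and>
     ((0 < rlo \<and> (\<exists>\<alpha>hi\<ge>\<alpha>lo. \<T> = {\<alpha>lo..\<alpha>hi} \<times> {rlo..rhi} \<times> {\<beta>lo..\<beta>hi})) \<or>
      (rlo = 0 \<and> rhi = 0 \<and> 0 < \<beta>lo \<and> \<T> = {\<alpha>lo..} \<times> {0} \<times> {\<beta>lo..\<beta>hi}))"


section \<open>The convolution model\<close>

text \<open>
  Law of $(Y_1,\dots,Y_n)$ with $Y_j = X_j + \varepsilon_j$; the convolution of measures is the
  distribution of a sum of independent variables. Samples are functions on the index set
  $\{1,\dots,n\}$.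
\<close>

definition sample_law :: "(real \<Rightarrow> real) \<Rightarrow> (real \<Rightarrow> real) \<Rightarrow> nat \<Rightarrow> (nat \<Rightarrow> real) measure" where
  "sample_law g f n =
     (\<Pi>\<^sub>M j\<in>{1..n}. convolution (density lborel (\<lambda>x. ennreal (f x))) (density lborel (\<lambda>x. ennreal (g x))))"

definition tests :: "nat \<Rightarrow> ((nat \<Rightarrow> real) \<Rightarrow> nat) set" where
  "tests n = measurable (\<Pi>\<^sub>M j\<in>{1..n}. (borel :: real measure)) (count_space {0, 1})"

definition test_prob ::
    "(real \<Rightarrow> real) \<Rightarrow> (real \<Rightarrow> real) \<Rightarrow> nat \<Rightarrow> ((nat \<Rightarrow> real) \<Rightarrow> nat) \<Rightarrow> nat \<Rightarrow> ennreal" where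
  "test_prob g f n \<Delta> d = emeasure (sample_law g f n) {y \<in> space (sample_law g f n). \<Delta> y = d}"

text \<open>
  Sum of the two error probabilities. The supremum is taken in $[0,\infty]$, so that it is $0$
  over an empty set of alternatives.
\<close>

definition total_error ::
    "(real \<Rightarrow> real) \<Rightarrow> (real \<Rightarrow> real) \<Rightarrow> (real \<Rightarrow> real) set \<Rightarrow> nat \<Rightarrow> ((nat \<Rightarrow> real) \<Rightarrow> nat) \<Rightarrow> ennreal" where
  "total_error g f0 H1 n \<Delta> = test_prob g f0 n \<Delta> 1 + (SUP f\<in>H1. test_prob g f n \<Delta> 0)"


section \<open>The test statistic\<close>

text \<open>
  The kernel is in general not integrable; its Fourier transform is bounded with compact support,
  and the kernel is obtained from it by Fourier inversion.
\<close>

definition kernel_fourier :: "(real \<Rightarrow> real) \<Rightarrow> real \<Rightarrow> real \<Rightarrow> complex" where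
  "kernel_fourier g h u = inverse (fourier g u) * indicator {u. \<bar>u\<bar> \<le> 1 / h} u"

definition deconv_kernel :: "(real \<Rightarrow> real) \<Rightarrow> real \<Rightarrow> real \<Rightarrow> complex" where
  "deconv_kernel g h = inverse_fourier (kernel_fourier g h)"

definition test_stat ::
    "(real \<Rightarrow> real) \<Rightarrow> (real \<Rightarrow> real) \<Rightarrow> nat \<Rightarrow> real \<Rightarrow> (nat \<Rightarrow> real) \<Rightarrow> complex" where
  "test_stat g f0 n h Y = complex_of_real (2 / (real n * (real n - 1))) *
     (\<Sum>(k, j) \<in> {(k, j). 1 \<le> k \<and> k < j \<and> j \<le> n}.
        L2_inner (\<lambda>x. deconv_kernel g h (x - Y k) - complex_of_real (f0 x))
                 (\<lambda>x. deconv_kernel g h (x - Y j) - complex_of_real (f0 x)))"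


section \<open>The adaptive test and its rate\<close>

definition eff_n :: "nat \<Rightarrow> real" where
  "eff_n n = real n / sqrt (ln (ln (real n)))"

definition grid_size :: "nat \<Rightarrow> nat" where
  "grid_size n = nat \<lceil>ln (real n)\<rceil>"

definition grid_beta :: "real \<Rightarrow> real \<Rightarrow> nat \<Rightarrow> nat \<Rightarrow> real" where
  "grid_beta \<beta>lo \<beta>hi n i = \<beta>lo + (real i - 1) * (\<beta>hi - \<beta>lo) / (real (grid_size n) - 1)"

definition bandwidth :: "real \<Rightarrow> real \<Rightarrow> real \<Rightarrow> nat \<Rightarrow> nat \<Rightarrow> real" where
  "bandwidth \<sigma> \<beta>lo \<beta>hi n i =
     (if i = grid_size n + 1 then real n powr (- 2 / (4 * \<beta>hi + 4 * \<sigma> + 1))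
      else eff_n n powr (- 2 / (4 * grid_beta \<beta>lo \<beta>hi n i + 4 * \<sigma> + 1)))"

text \<open>The squared thresholds $t_{n,i}^2$.\<close>

definition threshold_sq :: "real \<Rightarrow> real \<Rightarrow> real \<Rightarrow> nat \<Rightarrow> nat \<Rightarrow> real" where
  "threshold_sq \<sigma> \<beta>lo \<beta>hi n i =
     (if i = grid_size n + 1 then real n powr (- 4 * \<beta>hi / (4 * \<beta>hi + 4 * \<sigma> + 1))
      else eff_n n powr
        (- 4 * grid_beta \<beta>lo \<beta>hi n i / (4 * grid_beta \<beta>lo \<beta>hi n i + 4 * \<sigma> + 1)))"

definition adaptive_test ::
    "(real \<Rightarrow> real) \<Rightarrow> (real \<Rightarrow> real) \<Rightarrow> real \<Rightarrow> real \<Rightarrow> real \<Rightarrow> real \<Rightarrow> nat \<Rightarrow> (nat \<Rightarrow> real) \<Rightarrow> nat" where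
  "adaptive_test g f0 \<sigma> \<beta>lo \<beta>hi Cstar n Y =
     (if (MAX i\<in>{1..grid_size n + 1}.
            cmod (test_stat g f0 n (bandwidth \<sigma> \<beta>lo \<beta>hi n i) Y) / threshold_sq \<sigma> \<beta>lo \<beta>hi n i) > Cstar
      then 1 else 0)"

definition rate :: "real \<Rightarrow> real \<Rightarrow> nat \<Rightarrow> real \<times> real \<times> real \<Rightarrow> real" where
  "rate \<sigma> \<beta>hi n = (\<lambda>(\<alpha>, r, \<beta>).
     eff_n n powr (- 2 * \<beta> / (4 * \<beta> + 4 * \<sigma> + 1)) * of_bool (r = 0) +
     real n powr (- 2 * \<beta>hi / (4 * \<beta>hi + 4 * \<sigma> + 1)) * of_bool (r > 0))"

definition alternatives ::
    "(real \<times> real \<times> real) set \<Rightarrow> real \<Rightarrow> (real \<Rightarrow> real) \<Rightarrow> real \<Rightarrow>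
     (real \<times> real \<times> real \<Rightarrow> real) \<Rightarrow> (real \<Rightarrow> real) set" where
  "alternatives \<T> L f0 C \<psi> =
     (\<Union>\<tau>\<in>\<T>. {f \<in> smoothness_class \<tau> L. (L2_norm (\<lambda>x. f x - f0 x))\<^sup>2 / (\<psi> \<tau>)\<^sup>2 \<ge> C})"


section \<open>Additional assumptions for the lower bound\<close>

definition assumption_T :: "(real \<Rightarrow> real) \<Rightarrow> bool" where
  "assumption_T f0 \<longleftrightarrow> (\<exists>c0>0. \<forall>x. f0 x \<ge> c0 / (1 + \<bar>x\<bar>\<^sup>2))"

text \<open>Here \<open>D1\<close>, \<open>D2\<close>, \<open>D3\<close> are the first three derivatives of the Fourier transform of \<open>g\<close>.\<close>

definition assumption_P :: "(real \<Rightarrow> real) \<Rightarrow> real \<Rightarrow> bool" where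
  "assumption_P g \<sigma> \<longleftrightarrow>
     (\<exists>D1 D2 D3 :: real \<Rightarrow> complex.
        (\<forall>u. (fourier g has_vector_derivative D1 u) (at u)) \<and>
        (\<forall>u. (D1 has_vector_derivative D2 u) (at u)) \<and>
        (\<forall>u. (D2 has_vector_derivative D3 u) (at u)) \<and>
        continuous_on UNIV D3 \<and>
        (\<exists>A1 A2 :: real.
           (\<forall>\<^sub>F u in at_infinity. cmod (D1 u) \<le> A1 * \<bar>u\<bar> powr (- \<sigma> - 1)) \<and>
           (\<forall>\<^sub>F u in at_infinity. cmod (D2 u) \<le> A2 * \<bar>u\<bar> powr (- \<sigma> - 2))))"

end

theory Submission
  imports Defs "HOL-Real_Asymp.Real_Asymp"
begin

text \<open>
  Upper bound. On the frequency side \<open>T\<^sub>n\<^sub>,\<^sub>h\<close> is a bias term plus a linear and a degenerate quadratic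
  \<open>U\<close>-statistic. Since $|\Phi^g|$ is integrable, Schur's test bounds the relevant second moments by
  multiples of $h^{-4\sigma-1}$, and Freedman's inequality, applied to the martingale of partial sums of
  the quadratic statistic under \<open>f0\<close>, gives tails small enough for a union bound over the $\log n$
  bandwidths, at the price of the factor $\sqrt{\log\log n}$. Under an alternative, Chebyshev's inequality
  at a single bandwidth adapted to the true smoothness suffices.

  Lower bound. For $m = 4^i$ perturb \<open>f0\<close> by random signs times $m$ wave packets with disjoint
  frequency supports near $[2m, 4m]$, the smoothness index being chosen such that all scales are
  equally hard. The signs are conditioned on the trigonometric sum being uniformly small, so that the
  perturbed functions stay nonnegative. There are about $\log n$ scales, perturbations at different
  scales are orthogonal, and for small \<open>C\<close> the chi-square distance between the uniform mixture and
  the null law is of order $\sqrt{\log n} / \log n$, so the two are asymptotically indistinguishable.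
\<close>

section \<open>Fourier transforms\<close>

text \<open>At bandwidth \<open>h\<close> two scales govern the degenerate part: the kernel
  \<open>HH\<close> is bounded by \<open>Dc\<close>, of order
  \<open>h powr (- 2 * \<sigma> - 1)\<close>, but its variance against a fixed band-limited function
  has only the factor \<open>Bc\<close>, of order \<open>h powr (- 2 * \<sigma>)\<close>. The
  product bounds the variance of a single pair; the ratio \<open>Bc / Dc\<close> is of order
  \<open>h\<close>. The error terms of the tail bound that are not exponential are multiples of
  \<open>Bc / Dc\<close> and \<open>Dc / (n * Bc)\<close>, up to powers of \<open>ln (ln n)\<close>,
  hence polynomially small on the grid of bandwidths, and the exponential one is of order
  \<open>1 / (ln n)\<^sup>2\<close>. The extra bandwidth \<open>N + 1\<close> has no iterated
  logarithm in its threshold; being a single one, it is handled by Chebyshev and a large threshold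
  constant.

  In the lower bound the obstacle is the weight \<open>1 / p0\<close>, which spoils the
  orthogonality of the packets. Assumption (T) survives convolution with the noise and bounds this
  weight by a multiple of \<open>1 + x\<^sup>2\<close>. In frequency such a weight costs one
  derivative, which preserves disjoint supports and is controlled by assumption (P).\<close>

definition cft :: "(real \<Rightarrow> complex) \<Rightarrow> real \<Rightarrow> complex" where
  "cft F u = (LBINT x. iexp (u * x) * F x)"

lemma integrable_iexp_mult:
  assumes "integrable lborel F"
  shows "integrable lborel (\<lambda>x. iexp (u * x) * F x)"
proof (rule Bochner_Integration.integrable_bound[OF assms])
  show "(\<lambda>x. iexp (u * x) * F x) \<in> borel_measurable lborel"
    using borel_measurable_integrable[OF assms] by measurable
qed (simp add: norm_mult)

lemma norm_cft_le:
  assumes "integrable lborel F"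
  shows "cmod (cft F u) \<le> (LBINT x. cmod (F x))"
  unfolding cft_def
  by (rule order_trans[OF integral_norm_bound]) (simp add: norm_mult)

lemma isCont_cft:
  assumes F: "integrable lborel F"
  shows "isCont (cft F) u"
proof (rule continuous_at_sequentiallyI)
  fix v :: "nat \<Rightarrow> real" assume v: "v \<longlonglongrightarrow> u"
  note [measurable] = borel_measurable_integrable[OF F]
  show "(\<lambda>n. cft F (v n)) \<longlonglongrightarrow> cft F u"
    unfolding cft_def
  proof (rule integral_dominated_convergence[where w="\<lambda>x. cmod (F x)"])
    show "AE x in lborel. (\<lambda>n. iexp (v n * x) * F x) \<longlonglongrightarrow> iexp (u * x) * F x"
      by (intro AE_I2 tendsto_intros v)
  qed (use F in \<open>auto simp: norm_mult\<close>)
qed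

lemma continuous_on_cft: "integrable lborel F \<Longrightarrow> continuous_on A (cft F)"
  by (simp add: continuous_at_imp_continuous_on isCont_cft)

lemma borel_measurable_cft: "integrable lborel F \<Longrightarrow> cft F \<in> borel_measurable borel"
  by (rule borel_measurable_continuous_onI[OF continuous_on_cft])

lemma fourier_eq_cft: "fourier f = cft (\<lambda>x. complex_of_real (f x))"
  by (simp add: fun_eq_iff fourier_def cft_def)

text \<open>The characteristic function of the standard normal law after the substitution
  \<open>v = s * u\<close>.\<close>

lemma gauss_fourier:
  fixes s w :: real
  assumes s: "s > 0"
  shows "(LBINT u. iexp (u * w) * complex_of_real (std_normal_density (s * u)))
    = complex_of_real (exp (- (w / s)\<^sup>2 / 2) / s)"
proof -
  have "complex_of_real (exp (- (w / s)\<^sup>2 / 2)) = (\<integral>v. iexp (w / s * v) \<partial>std_normal_distribution)"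
    using fun_cong[OF char_std_normal_distribution, of "w / s"] unfolding char_def by simp
  also have "\<dots> = (LBINT v. std_normal_density v *\<^sub>R iexp (w / s * v))"
    by (subst integral_density) auto
  also have "\<dots> = s *\<^sub>R (LBINT u. std_normal_density (s * u) *\<^sub>R iexp (w / s * (s * u)))"
    using s by (subst lborel_integral_real_affine[where c=s and t=0]) auto
  also have "(\<lambda>u. std_normal_density (s * u) *\<^sub>R iexp (w / s * (s * u)))
      = (\<lambda>u. iexp (u * w) * complex_of_real (std_normal_density (s * u)))"
    using s by (auto simp: scaleR_conv_of_real mult.commute fun_eq_iff)
  finally show ?thesis using s by (simp add: scaleR_conv_of_real field_simps)
qed

lemma integrable_gauss:
  assumes "s > 0"
  shows "integrable lborel (\<lambda>u. std_normal_density (s * u))"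
  using lborel_integrable_real_affine[where f=std_normal_density and c=s and t=0] assms
  by (simp add: integrable_normal_density)

lemma integrable_lborel_pair_mult:
  fixes F G :: "real \<Rightarrow> complex"
  assumes F: "integrable lborel F" and G: "integrable lborel G"
  shows "integrable (lborel \<Otimes>\<^sub>M lborel) (\<lambda>(x, y). F x * G y)"
proof -
  note [measurable] = borel_measurable_integrable[OF F] borel_measurable_integrable[OF G]
  show ?thesis
  proof (rule lborel_pair.Fubini_integrable)
    show "integrable lborel (\<lambda>x. LINT y|lborel. norm (case (x, y) of (x, y) \<Rightarrow> F x * G y))"
      using F by (simp add: norm_mult)
    show "AE x in lborel. integrable lborel (\<lambda>y. case (x, y) of (x, y) \<Rightarrow> F x * G y)"
      using G by simp
  qed measurable
qed

lemma integrable_lborel_pair_iexp: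
  fixes F G :: "real \<Rightarrow> complex"
  assumes F: "integrable lborel F" and G: "integrable lborel G"
  shows "integrable (lborel \<Otimes>\<^sub>M lborel) (\<lambda>(x, y). iexp (c * (x * y)) * (F x * G y))"
proof (rule Bochner_Integration.integrable_bound[OF integrable_lborel_pair_mult[OF F G]])
  note [measurable] = borel_measurable_integrable[OF F] borel_measurable_integrable[OF G]
  show "(\<lambda>(x, y). iexp (c * (x * y)) * (F x * G y)) \<in> borel_measurable (lborel \<Otimes>\<^sub>M lborel)"
    by measurable
qed (auto simp: norm_mult)

text \<open>The multiplication formula: Fubini for the symmetric kernel \<open>iexp (x * y)\<close>.
  It works at the level of integrable functions and so can be applied to pairings with a density
  such as the noise.\<close>

lemma cft_mult_swap:
  fixes F G :: "real \<Rightarrow> complex"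
  assumes F: "integrable lborel F" and G: "integrable lborel G"
  shows "(LBINT x. cft F x * G x) = (LBINT y. F y * cft G y)"
proof -
  have "(LBINT x. cft F x * G x) = (\<integral>x. (LBINT y. iexp (1 * (x * y)) * (G x * F y)) \<partial>lborel)"
    unfolding cft_def
    by (intro Bochner_Integration.integral_cong refl, subst integral_mult_left_zero[symmetric])
       (simp add: ac_simps)
  also have "\<dots> = (\<integral>y. (LBINT x. iexp (1 * (x * y)) * (G x * F y)) \<partial>lborel)"
    using lborel_pair.Fubini_integral[OF integrable_lborel_pair_iexp[OF G F, of 1]] by simp
  also have "\<dots> = (LBINT y. F y * cft G y)"
    unfolding cft_def
    by (intro Bochner_Integration.integral_cong refl, subst integral_mult_right_zero[symmetric])
       (simp add: ac_simps)
  finally show ?thesis .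
qed

text \<open>A Gaussian damping makes the inversion integral converge for every integrable
  \<open>F\<close>. The multiplication formula moves the transform onto the Gaussian, where it
  becomes an average of \<open>F\<close> around \<open>x\<close> at scale \<open>s\<close>.\<close>

lemma gauss_regularised_inversion:
  assumes F: "integrable lborel F" and s: "s > 0"
  shows "(LBINT u. cft F u * (iexp (- (u * x)) * complex_of_real (std_normal_density (s * u))))
    = (LBINT z. F (x + s * z) * complex_of_real (exp (- z\<^sup>2 / 2)))"
proof -
  let ?G = "\<lambda>u. iexp (- (u * x)) * complex_of_real (std_normal_density (s * u))"
  have G: "integrable lborel ?G"
    using integrable_iexp_mult[of "\<lambda>u. complex_of_real (std_normal_density (s * u))" "- x"]
      integrable_gauss[OF s] by (simp add: mult.commute)
  have cG: "cft ?G y = complex_of_real (exp (- ((y - x) / s)\<^sup>2 / 2) / s)" for y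
  proof -
    have "cft ?G y = (LBINT u. iexp (u * (y - x)) * complex_of_real (std_normal_density (s * u)))"
      unfolding cft_def
    proof (rule Bochner_Integration.integral_cong[OF refl])
      fix u :: real
      have "iexp (y * u) * iexp (- (u * x)) = iexp (u * (y - x))"
        by (simp add: exp_add[symmetric] algebra_simps)
      then show "iexp (y * u) * ?G u = iexp (u * (y - x)) * complex_of_real (std_normal_density (s * u))"
        by (simp only: mult.assoc[symmetric])
    qed
    then show ?thesis unfolding gauss_fourier[OF s] .
  qed
  have "(LBINT u. cft F u * ?G u) = (LBINT y. F y * complex_of_real (exp (- ((y - x) / s)\<^sup>2 / 2) / s))"
    unfolding cft_mult_swap[OF F G] cG ..
  also have "\<dots> = s *\<^sub>R (LBINT z. F (x + s * z) * complex_of_real (exp (- z\<^sup>2 / 2) / s))"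
    using s by (subst lborel_integral_real_affine[where c=s and t=x]) auto
  also have "\<dots> = (LBINT z. F (x + s * z) * complex_of_real (exp (- z\<^sup>2 / 2)))"
    using s by (subst integral_scaleR_right[symmetric]) (simp add: scaleR_conv_of_real)
  finally show ?thesis .
qed

lemma integral_gauss: "(LBINT z. exp (- z\<^sup>2 / 2)) = sqrt (2 * pi)"
  and integrable_gauss_exp: "integrable lborel (\<lambda>z::real. exp (- z\<^sup>2 / 2))"
proof -
  have eq: "(\<lambda>z::real. exp (- z\<^sup>2 / 2)) = (\<lambda>z. sqrt (2 * pi) * std_normal_density z)"
    by (simp add: fun_eq_iff std_normal_density_def)
  show "(LBINT z. exp (- z\<^sup>2 / 2)) = sqrt (2 * pi)"
    unfolding eq by simp
  show "integrable lborel (\<lambda>z::real. exp (- z\<^sup>2 / 2))"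
    unfolding eq by (intro integrable_mult_right integrable_normal_density) simp
qed

text \<open>The averages concentrate at \<open>x\<close>, and the bound on \<open>F\<close> supplies
  a dominating Gaussian. Continuity is asked at the single point \<open>x\<close>, because the
  autocorrelation used for Plancherel is shown continuous at \<open>0\<close> only.\<close>

lemma gauss_approx_limit:
  fixes F :: "real \<Rightarrow> complex"
  assumes [measurable]: "F \<in> borel_measurable borel" and bd: "\<And>x. cmod (F x) \<le> b"
    and cont: "isCont F x"
  shows "(\<lambda>n. \<integral>z. F (x + inverse (real (Suc n)) * z) * complex_of_real (exp (- z\<^sup>2 / 2)) \<partial>lborel)
    \<longlonglongrightarrow> complex_of_real (sqrt (2 * pi)) * F x"
proof -
  have "(\<lambda>n. \<integral>z. F (x + inverse (real (Suc n)) * z) * complex_of_real (exp (- z\<^sup>2 / 2)) \<partial>lborel)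
    \<longlonglongrightarrow> (LBINT z. F x * complex_of_real (exp (- z\<^sup>2 / 2)))"
  proof (rule integral_dominated_convergence[where w="\<lambda>z. b * exp (- z\<^sup>2 / 2)"])
    show "AE z in lborel. (\<lambda>n. F (x + inverse (real (Suc n)) * z) * complex_of_real (exp (- z\<^sup>2 / 2)))
        \<longlonglongrightarrow> F x * complex_of_real (exp (- z\<^sup>2 / 2))"
    proof (intro AE_I2 tendsto_mult tendsto_const)
      fix z
      have "(\<lambda>n. x + inverse (real (Suc n)) * z) \<longlonglongrightarrow> x + 0 * z"
        by (intro tendsto_intros LIMSEQ_inverse_real_of_nat)
      then show "(\<lambda>n. F (x + inverse (real (Suc n)) * z)) \<longlonglongrightarrow> F x"
        using isCont_tendsto_compose[OF cont] by simp
    qed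
    show "AE z in lborel. cmod (F (x + inverse (real (Suc n)) * z) * complex_of_real (exp (- z\<^sup>2 / 2)))
        \<le> b * exp (- z\<^sup>2 / 2)" for n
      using bd by (auto simp: norm_mult intro!: mult_right_mono)
  qed (use integrable_gauss_exp in auto)
  also have "(LBINT z. F x * complex_of_real (exp (- z\<^sup>2 / 2))) = complex_of_real (sqrt (2 * pi)) * F x"
    by (simp only: integral_mult_right_zero integral_of_real[OF integrable_gauss_exp] integral_gauss mult.commute)
  finally show ?thesis .
qed

text \<open>The damped inversion integral has two limits as the damping disappears: a multiple of
  \<open>F x\<close>, by concentration of the averages, and the undamped integral, by dominated
  convergence. Comparing the constants \<open>sqrt (2 * pi)\<close> and
  \<open>1 / sqrt (2 * pi)\<close> gives the factor \<open>1 / (2 * pi)\<close>.\<close>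

theorem fourier_inversion:
  assumes F: "integrable lborel F" and bd: "\<And>x. cmod (F x) \<le> b" and cont: "isCont F x"
    and cF: "integrable lborel (cft F)"
  shows "F x = complex_of_real (1 / (2 * pi)) * (LBINT u. iexp (- (u * x)) * cft F u)"
proof -
  have Fm: "F \<in> borel_measurable borel" using borel_measurable_integrable[OF F] by simp
  note [measurable] = Fm borel_measurable_integrable[OF cF]
  let ?s = "\<lambda>n. inverse (real (Suc n))"
  let ?I = "\<lambda>n. \<integral>u. cft F u * (iexp (- (u * x)) * complex_of_real (std_normal_density (?s n * u))) \<partial>lborel"
  have 1: "?I \<longlonglongrightarrow> complex_of_real (sqrt (2 * pi)) * F x"
    using gauss_approx_limit[OF Fm bd cont] by (subst gauss_regularised_inversion[OF F]) auto
  have 2: "?I \<longlonglongrightarrow> (LBINT u. cft F u * (iexp (- (u * x)) * complex_of_real (std_normal_density 0)))"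
  proof (rule integral_dominated_convergence[where w="\<lambda>u. cmod (cft F u)"])
    have "isCont std_normal_density 0"
      unfolding normal_density_def by (intro continuous_intros) auto
    moreover have "(\<lambda>n. ?s n * u) \<longlonglongrightarrow> 0 * u" for u
      by (intro tendsto_intros LIMSEQ_inverse_real_of_nat)
    ultimately have "(\<lambda>n. std_normal_density (?s n * u)) \<longlonglongrightarrow> std_normal_density 0" for u
      using isCont_tendsto_compose by fastforce
    then show "AE u in lborel. (\<lambda>n. cft F u * (iexp (- (u * x)) * complex_of_real (std_normal_density (?s n * u))))
      \<longlonglongrightarrow> cft F u * (iexp (- (u * x)) * complex_of_real (std_normal_density 0))"
      by (intro AE_I2 tendsto_intros)
    have le1: "std_normal_density z \<le> 1" for z
    proof -
      have "1 \<le> sqrt (2 * pi)" using pi_gt3 by simp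
      then have "std_normal_density z \<le> 1 * 1"
        unfolding std_normal_density_def by (intro mult_mono) (auto simp: divide_simps)
      then show ?thesis by simp
    qed
    show "AE u in lborel. cmod (cft F u * (iexp (- (u * x)) * complex_of_real (std_normal_density (?s n * u)))) \<le> cmod (cft F u)" for n
      using le1 by (auto simp: norm_mult intro!: AE_I2 mult_left_le)
  qed (use cF in auto)
  have "complex_of_real (sqrt (2 * pi)) * F x = (LBINT u. cft F u * (iexp (- (u * x)) * complex_of_real (std_normal_density 0)))"
    by (rule LIMSEQ_unique[OF 1 2])
  also have "\<dots> = complex_of_real (std_normal_density 0) * (LBINT u. iexp (- (u * x)) * cft F u)"
    by (subst integral_mult_right_zero[symmetric]) (simp add: ac_simps)
  finally have "complex_of_real (sqrt (2 * pi)) * F x = complex_of_real (1 / sqrt (2 * pi)) * (LBINT u. iexp (- (u * x)) * cft F u)"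
    by (simp add: std_normal_density_def)
  then have "complex_of_real (1 / sqrt (2 * pi)) * (complex_of_real (sqrt (2 * pi)) * F x)
     = complex_of_real (1 / sqrt (2 * pi)) * (complex_of_real (1 / sqrt (2 * pi)) * (LBINT u. iexp (- (u * x)) * cft F u))"
    by simp
  then show ?thesis
    unfolding mult.assoc[symmetric] of_real_mult[symmetric] by simp
qed

section \<open>Continuity of translations in mean\<close>

lemma LIMSEQ_zero_approx:
  fixes a :: "nat \<Rightarrow> real"
  assumes nn: "\<And>n. 0 \<le> a n"
    and ap: "\<And>e. e > 0 \<Longrightarrow> \<exists>b. b \<longlonglongrightarrow> 0 \<and> (\<forall>n. a n \<le> b n + e)"
  shows "a \<longlonglongrightarrow> 0"
proof (rule LIMSEQ_I)
  fix r :: real assume r: "0 < r"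
  then obtain b where b: "b \<longlonglongrightarrow> 0" "\<And>n. a n \<le> b n + r / 2"
    using ap[of "r / 2"] by auto
  obtain N where N: "\<And>n. n \<ge> N \<Longrightarrow> norm (b n - 0) < r / 2"
    using LIMSEQ_D[OF b(1), of "r / 2"] r by auto
  have "norm (a n - 0) < r" if "n \<ge> N" for n
    using N[OF that] b(2)[of n] nn[of n] by auto
  then show "\<exists>N. \<forall>n\<ge>N. norm (a n - 0) < r" by blast
qed

lemma integral_translate:
  fixes F :: "real \<Rightarrow> 'b::{banach, second_countable_topology}"
  shows "(LBINT x. F (x + z)) = (LBINT x. F x)"
  using lborel_integral_real_affine[of 1 F z] by (simp add: add.commute)

lemma integrable_translate:
  fixes F :: "real \<Rightarrow> 'b::{banach, second_countable_topology}"
  assumes "integrable lborel F"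
  shows "integrable lborel (\<lambda>x. F (x + z))"
  using lborel_integrable_real_affine[OF assms, of 1 z] by (simp add: add.commute)

text \<open>A point of an open set stays in it under small shifts, so the overlap of
  \<open>U\<close> with its translate converges to the full measure. The mass of the symmetric
  difference is twice the measure minus twice the overlap, by translation invariance.\<close>

lemma translation_continuous_open:
  fixes U :: "real set"
  assumes U: "open U" and fin: "emeasure lborel U < \<infinity>" and z: "z \<longlonglongrightarrow> 0"
  shows "(\<lambda>n. \<integral>x. \<bar>indicator U (x + z n) - indicator U x\<bar> \<partial>lborel) \<longlonglongrightarrow> (0::real)"
proof -
  have [measurable]: "U \<in> sets borel" using U by simp
  let ?i = "indicator U :: real \<Rightarrow> real"
  have iU: "integrable lborel ?i" using fin by simp
  have iUz: "integrable lborel (\<lambda>x. ?i (x + z n))" for n by (rule integrable_translate[OF iU])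
  have iP: "integrable lborel (\<lambda>x. ?i (x + z n) * ?i x)" for n
    by (rule Bochner_Integration.integrable_bound[OF iU]) (auto split: split_indicator)
  have "(\<lambda>n. \<integral>x. ?i (x + z n) * ?i x \<partial>lborel) \<longlonglongrightarrow> (LBINT x. ?i x)"
  proof (rule integral_dominated_convergence[where w="?i"])
    show "AE x in lborel. (\<lambda>n. ?i (x + z n) * ?i x) \<longlonglongrightarrow> ?i x"
    proof (rule AE_I2)
      fix x
      show "(\<lambda>n. ?i (x + z n) * ?i x) \<longlonglongrightarrow> ?i x"
      proof (cases "x \<in> U")
        case True
        have "(\<lambda>n. x + z n) \<longlonglongrightarrow> x + 0" by (intro tendsto_intros z)
        then have "\<forall>\<^sub>F n in sequentially. x + z n \<in> U"
          using topological_tendstoD[of "\<lambda>n. x + z n" x sequentially U] U True by simp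
        then have "\<forall>\<^sub>F n in sequentially. ?i (x + z n) * ?i x = ?i x"
          by eventually_elim (use True in simp)
        then show ?thesis by (rule tendsto_eventually)
      qed simp
    qed
    show "AE x in lborel. norm (?i (x + z n) * ?i x) \<le> ?i x" for n
      by (auto split: split_indicator)
  qed (use iU in measurable)
  then have lim: "(\<lambda>n. 2 * (LBINT x. ?i x) - 2 * (LBINT x. ?i (x + z n) * ?i x)) \<longlonglongrightarrow> 0"
    by (auto intro!: tendsto_eq_intros)
  have "(LBINT x. \<bar>?i (x + z n) - ?i x\<bar>) = 2 * (LBINT x. ?i x) - 2 * (LBINT x. ?i (x + z n) * ?i x)" for n
  proof -
    have "(LBINT x. \<bar>?i (x + z n) - ?i x\<bar>) = (LBINT x. (?i (x + z n) + ?i x) - 2 * (?i (x + z n) * ?i x))"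
      by (intro Bochner_Integration.integral_cong) (auto split: split_indicator)
    also have "\<dots> = (LBINT x. ?i (x + z n)) + (LBINT x. ?i x) - 2 * (LBINT x. ?i (x + z n) * ?i x)"
      using iU iUz iP by simp
    also have "(LBINT x. ?i (x + z n)) = (LBINT x. ?i x)"
      by (rule integral_translate)
    finally show ?thesis by simp
  qed
  with lim show ?thesis by simp
qed

text \<open>Outer regularity replaces \<open>A\<close> by an open superset; the excess set of
  measure below \<open>e / 2\<close> enters twice, once at \<open>x\<close> and once at the shifted
  point.\<close>

lemma translation_continuous_set:
  fixes A :: "real set"
  assumes A[measurable]: "A \<in> sets borel" and fin: "emeasure lborel A < \<infinity>" and z: "z \<longlonglongrightarrow> 0"
  shows "(\<lambda>n. \<integral>x. \<bar>indicator A (x + z n) - indicator A x\<bar> \<partial>lborel) \<longlonglongrightarrow> (0::real)"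
proof (rule LIMSEQ_zero_approx)
  show "0 \<le> (\<integral>x. \<bar>indicator A (x + z n) - indicator A x\<bar> \<partial>lborel :: real)" for n
    by simp
  fix e :: real assume e: "e > 0"
  obtain U where U: "open U" "A \<subseteq> U" "emeasure lborel (U - A) < ennreal (e / 2)"
    using outer_regular_lborel[OF A, of "e / 2"] e by auto
  have [measurable]: "U \<in> sets borel" using U by simp
  have "emeasure lborel U = emeasure lborel A + emeasure lborel (U - A)"
    using U by (subst plus_emeasure) (auto simp: Un_absorb1)
  also have "\<dots> < \<infinity>"
    using fin U(3) by (auto simp: less_top intro: order.strict_trans)
  finally have finU: "emeasure lborel U < \<infinity>" .
  have finD: "emeasure lborel (U - A) < \<infinity>" using U(3) by (auto intro: order.strict_trans)
  let ?b = "\<lambda>n. \<integral>x. \<bar>indicator U (x + z n) - indicator U x\<bar> \<partial>lborel :: real"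
  let ?d = "indicator (U - A) :: real \<Rightarrow> real"
  have iD: "integrable lborel ?d" using finD by simp
  have iDz: "integrable lborel (\<lambda>x. ?d (x + z n))" for n by (rule integrable_translate[OF iD])
  have iU: "integrable lborel (indicator U :: real \<Rightarrow> real)" using finU by simp
  have iUU: "integrable lborel (\<lambda>x. \<bar>indicator U (x + z n) - indicator U x\<bar> :: real)" for n
    by (intro integrable_abs Bochner_Integration.integrable_diff integrable_translate iU)
  have mD: "(LBINT x. ?d x) \<le> e / 2"
    proof -
    have "measure lborel (U - A) \<le> e / 2"
      unfolding measure_def using U(3) e by (intro enn2real_leI) auto
    then show ?thesis by simp
  qed
  have "(LBINT x. \<bar>indicator A (x + z n) - indicator A x\<bar>) \<le> ?b n + e" for n
  proof -
    have "(LBINT x. \<bar>indicator A (x + z n) - indicator A x\<bar>)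
      \<le> (LBINT x. \<bar>indicator U (x + z n) - indicator U x\<bar> + (?d (x + z n) + ?d x))"
      using U(2) iUU iD iDz by (intro integral_mono') (auto split: split_indicator)
    also have "\<dots> = ?b n + ((LBINT x. ?d (x + z n)) + (LBINT x. ?d x))"
      using iUU[of n] iD iDz[of n] by simp
    also have "(LBINT x. ?d (x + z n)) = (LBINT x. ?d x)" by (rule integral_translate)
    finally show ?thesis using mD by simp
  qed
  then show "\<exists>b. b \<longlonglongrightarrow> 0 \<and> (\<forall>n. (LBINT x. \<bar>indicator A (x + z n) - indicator A x\<bar>) \<le> b n + e)"
    using translation_continuous_open[OF U(1) finU z] by (intro exI[of _ ?b]) auto
qed

text \<open>Induction over integrable functions, starting from indicators. In the limit case an
  approximation \<open>s i\<close> of \<open>f\<close> is compared with \<open>f\<close> both at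
  \<open>x\<close> and at the shifted point, and translation invariance makes the two errors
  equal.\<close>

lemma translation_continuous_L1:
  fixes F :: "real \<Rightarrow> complex"
  assumes F: "integrable lborel F" and z: "z \<longlonglongrightarrow> 0"
  shows "(\<lambda>n. \<integral>x. cmod (F (x + z n) - F x) \<partial>lborel) \<longlonglongrightarrow> 0"
  using F
proof (induction F)
  case (base A c)
  have "(\<lambda>n. cmod c * (LBINT x. \<bar>indicator A (x + z n) - indicator A x\<bar>)) \<longlonglongrightarrow> cmod c * 0"
    using base by (intro tendsto_mult tendsto_const translation_continuous_set z) auto
  moreover have "cmod c * (LBINT x. \<bar>indicator A (x + z n) - indicator A x\<bar>)
      = (LBINT x. cmod (indicator A (x + z n) *\<^sub>R c - indicator A x *\<^sub>R c))" for n
    unfolding integral_mult_right_zero[symmetric] scaleR_left_diff_distrib[symmetric] norm_scaleR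
    by (simp only: mult.commute)
  ultimately show ?case by simp
next
  case (add f g)
  let ?b = "\<lambda>n. (LBINT x. cmod (f (x + z n) - f x)) + (LBINT x. cmod (g (x + z n) - g x))"
  have "?b \<longlonglongrightarrow> 0 + 0" by (intro tendsto_add add)
  moreover have "(LBINT x. cmod (f (x + z n) + g (x + z n) - (f x + g x))) \<le> ?b n" for n
  proof -
    have i: "integrable lborel (\<lambda>x. cmod (f (x + z n) - f x))" "integrable lborel (\<lambda>x. cmod (g (x + z n) - g x))"
      by (intro integrable_norm Bochner_Integration.integrable_diff integrable_translate add)+
    have "(LBINT x. cmod (f (x + z n) + g (x + z n) - (f x + g x)))
      \<le> (LBINT x. cmod (f (x + z n) - f x) + cmod (g (x + z n) - g x))"
      using i by (intro integral_mono') (auto intro!: norm_diff_triangle_ineq)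
    then show ?thesis using i by simp
  qed
  ultimately show ?case
    using tendsto_sandwich[of "\<lambda>_. 0" "\<lambda>n. \<integral>x. cmod (f (x + z n) + g (x + z n) - (f x + g x)) \<partial>lborel" sequentially ?b 0]
    by simp
next
  case (lim f s)
  show ?case
  proof (rule LIMSEQ_zero_approx)
    fix e :: real assume e: "e > 0"
    note [measurable] = borel_measurable_integrable[OF lim.hyps(1)] borel_measurable_integrable[OF lim.hyps(4)]
    have "(\<lambda>i. \<integral>x. cmod (s i x - f x) \<partial>lborel) \<longlonglongrightarrow> (\<integral>x. 0 \<partial>(lborel :: real measure))"
    proof (rule integral_dominated_convergence[where w="\<lambda>x. 3 * cmod (f x)"])
      show "AE x in lborel. (\<lambda>i. cmod (s i x - f x)) \<longlonglongrightarrow> 0"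
        using lim.hyps(2) by (auto simp: tendsto_norm_zero_iff LIM_zero)
      show "AE x in lborel. norm (cmod (s i x - f x)) \<le> 3 * cmod (f x)" for i
      proof (rule AE_I2)
        fix x
        have "cmod (s i x - f x) \<le> cmod (s i x) + cmod (f x)" by (rule norm_triangle_ineq4)
        then show "norm (cmod (s i x - f x)) \<le> 3 * cmod (f x)" using lim.hyps(3)[of x i] by simp
      qed
      show "integrable lborel (\<lambda>x. 3 * cmod (f x))" using lim.hyps(4) by simp
    qed measurable
    then have "(\<lambda>i. \<integral>x. cmod (s i x - f x) \<partial>lborel) \<longlonglongrightarrow> 0" by simp
    then have "\<forall>\<^sub>F i in sequentially. (LBINT x. cmod (s i x - f x)) < e / 2"
      using e by (intro order_tendstoD) auto
    then obtain i where i: "(LBINT x. cmod (s i x - f x)) < e / 2"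
      by (auto simp: eventually_sequentially)
    let ?b = "\<lambda>n. \<integral>x. cmod (s i (x + z n) - s i x) \<partial>lborel"
    have "(LBINT x. cmod (f (x + z n) - f x)) \<le> ?b n + e" for n
    proof -
      have i1: "integrable lborel (\<lambda>x. cmod (s i x - f x))"
        by (intro integrable_norm Bochner_Integration.integrable_diff lim.hyps)
      have i2: "integrable lborel (\<lambda>x. cmod (s i (x + z n) - f (x + z n)))"
        by (rule integrable_translate[OF i1])
      have i3: "integrable lborel (\<lambda>x. cmod (s i (x + z n) - s i x))"
        by (intro integrable_norm Bochner_Integration.integrable_diff integrable_translate lim.hyps)
      have "(LBINT x. cmod (f (x + z n) - f x))
        \<le> (LBINT x. cmod (s i (x + z n) - s i x) + (cmod (s i (x + z n) - f (x + z n)) + cmod (s i x - f x)))"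
      proof (intro integral_mono')
        show "cmod (f (x + z n) - f x) \<le> cmod (s i (x + z n) - s i x) + (cmod (s i (x + z n) - f (x + z n)) + cmod (s i x - f x))" for x
        proof -
          have "f (x + z n) - f x = (s i (x + z n) - s i x) - (s i (x + z n) - f (x + z n)) + (s i x - f x)" by simp
          also have "cmod \<dots> \<le> cmod ((s i (x + z n) - s i x) - (s i (x + z n) - f (x + z n))) + cmod (s i x - f x)"
            by (rule norm_triangle_ineq)
          also have "\<dots> \<le> cmod (s i (x + z n) - s i x) + cmod (s i (x + z n) - f (x + z n)) + cmod (s i x - f x)"
            by (intro add_right_mono norm_triangle_ineq4)
          finally show ?thesis by simp
        qed
      qed (use i1 i2 i3 in auto)
      also have "\<dots> = ?b n + ((LBINT x. cmod (s i (x + z n) - f (x + z n))) + (LBINT x. cmod (s i x - f x)))"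
        using i1 i2 i3 by simp
      also have "(LBINT x. cmod (s i (x + z n) - f (x + z n))) = (LBINT x. cmod (s i x - f x))"
        by (rule integral_translate[of "\<lambda>x. cmod (s i x - f x)"])
      finally show ?thesis using i by simp
    qed
    then show "\<exists>b. b \<longlonglongrightarrow> 0 \<and> (\<forall>n. (LBINT x. cmod (f (x + z n) - f x)) \<le> b n + e)"
      using lim.IH[of i] by (intro exI[of _ ?b]) auto
  qed simp
qed

section \<open>Autocorrelation and the Plancherel identity\<close>

lemma borel_measurable_cnj [measurable (raw)]:
  "f \<in> borel_measurable M \<Longrightarrow> (\<lambda>x. cnj (f x)) \<in> borel_measurable M"
  by (rule measurable_compose[OF _ borel_measurable_continuous_onI[OF continuous_on_cnj[OF continuous_on_id]]])

text \<open>Its value at \<open>0\<close> is the squared norm of \<open>F\<close> and its transform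
  is the squared modulus of \<open>cft F\<close>, so Fourier inversion at \<open>0\<close> is
  Plancherel's identity.\<close>

definition autocorr :: "(real \<Rightarrow> complex) \<Rightarrow> real \<Rightarrow> complex" where
  "autocorr F z = (LBINT x. F (x + z) * cnj (F x))"

lemma integrable_mult_L2:
  fixes F G :: "'a \<Rightarrow> complex"
  assumes F: "F \<in> borel_measurable M" "integrable M (\<lambda>x. (cmod (F x))\<^sup>2)"
    and G: "G \<in> borel_measurable M" "integrable M (\<lambda>x. (cmod (G x))\<^sup>2)"
  shows "integrable M (\<lambda>x. F x * cnj (G x))"
proof (rule Bochner_Integration.integrable_bound)
  show "integrable M (\<lambda>x. (cmod (F x))\<^sup>2 + (cmod (G x))\<^sup>2)" using F G by simp
  show "AE x in M. norm (F x * cnj (G x)) \<le> norm ((cmod (F x))\<^sup>2 + (cmod (G x))\<^sup>2)"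
  proof (rule AE_I2)
    fix x
    have "2 * (cmod (F x) * cmod (G x)) \<le> (cmod (F x))\<^sup>2 + (cmod (G x))\<^sup>2"
      using sum_squares_bound[of "cmod (F x)" "cmod (G x)"] by simp
    moreover have "0 \<le> cmod (F x) * cmod (G x)" by simp
    moreover have "norm (F x * cnj (G x)) = cmod (F x) * cmod (G x)" by (simp add: norm_mult)
    moreover have "norm ((cmod (F x))\<^sup>2 + (cmod (G x))\<^sup>2) = (cmod (F x))\<^sup>2 + (cmod (G x))\<^sup>2" by simp
    ultimately show "norm (F x * cnj (G x)) \<le> norm ((cmod (F x))\<^sup>2 + (cmod (G x))\<^sup>2)"
      by linarith
  qed
qed (use F G in measurable)

text \<open>The integrand is split at height \<open>M\<close> of \<open>F x\<close>. Below
  \<open>M\<close>, continuity of translations in mean applies with the factor \<open>M\<close>;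
  above \<open>M\<close>, a weighted arithmetic-geometric inequality reduces to the truncated square
  integral, which is small for large \<open>M\<close>.\<close>

lemma autocorr_continuous_0:
  fixes F :: "real \<Rightarrow> complex"
  assumes F: "integrable lborel F" and F2: "integrable lborel (\<lambda>x. (cmod (F x))\<^sup>2)"
  shows "isCont (autocorr F) 0"
proof (rule continuous_at_sequentiallyI)
  fix z :: "nat \<Rightarrow> real" assume z: "z \<longlonglongrightarrow> 0"
  note Fm[measurable] = borel_measurable_integrable[OF F]
  have Fb[measurable]: "F \<in> borel_measurable borel" using Fm by simp
  have Ft[measurable]: "(\<lambda>x. F (x + z n)) \<in> borel_measurable lborel" for n by measurable
  have F2t: "integrable lborel (\<lambda>x. (cmod (F (x + z n)))\<^sup>2)" for n
    using integrable_translate[OF F2] .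
  have "(\<lambda>n. cmod (autocorr F (z n) - autocorr F 0)) \<longlonglongrightarrow> 0"
  proof (rule LIMSEQ_zero_approx)
    fix e :: real assume e: "e > 0"
    let ?S = "\<integral>x. (cmod (F x))\<^sup>2 \<partial>lborel"
    have S: "?S \<ge> 0" by simp
    \<comment> \<open>With this weight the full square integrals contribute at most
      \<open>e / 2\<close>; afterwards \<open>M\<close> is taken so large that the truncated one,
      multiplied by \<open>1 / k\<close>, stays below \<open>e / 4\<close>.\<close>
    define k where "k = e / (2 * (?S + 1))"
    have k: "k > 0" using e S by (simp add: k_def add_nonneg_pos)
    let ?T = "\<lambda>M x. (cmod (F x))\<^sup>2 * indicator {x. cmod (F x) > real M} x"
    have "(\<lambda>M. \<integral>x. ?T M x \<partial>lborel) \<longlonglongrightarrow> (\<integral>x. 0 \<partial>(lborel :: real measure))"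
    proof (rule integral_dominated_convergence[where w="\<lambda>x. (cmod (F x))\<^sup>2"])
      show "AE x in lborel. (\<lambda>M. ?T M x) \<longlonglongrightarrow> 0"
      proof (rule AE_I2)
        fix x
        have "\<forall>\<^sub>F M in sequentially. ?T M x = 0"
          using eventually_ge_at_top[of "nat \<lceil>cmod (F x)\<rceil>"]
          by eventually_elim (auto simp: indicator_def nat_ceiling_le_eq)
        then show "(\<lambda>M. ?T M x) \<longlonglongrightarrow> 0" by (rule tendsto_eventually)
      qed
    qed (use F2 in \<open>auto split: split_indicator\<close>)
    then have "\<forall>\<^sub>F M in sequentially. (LBINT x. ?T M x) < k * (e / 4)"
      using e k by (intro order_tendstoD) auto
    then obtain M where M: "(LBINT x. ?T M x) < k * (e / 4)"
      by (auto simp: eventually_sequentially)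
    have iT: "integrable lborel (?T M)"
      by (rule Bochner_Integration.integrable_bound[OF F2]) (auto split: split_indicator)
    let ?b = "\<lambda>n. real M * (LBINT x. cmod (F (x + z n) - F x))"
    have "cmod (autocorr F (z n) - autocorr F 0) \<le> ?b n + e" for n
    proof -
      have i1: "integrable lborel (\<lambda>x. F (x + z n) * cnj (F x))"
        by (rule integrable_mult_L2[OF Ft F2t Fm F2])
      have i2: "integrable lborel (\<lambda>x. F x * cnj (F x))"
        by (rule integrable_mult_L2[OF Fm F2 Fm F2])
      have i3: "integrable lborel (\<lambda>x. cmod (F (x + z n) - F x))"
        by (intro integrable_norm Bochner_Integration.integrable_diff integrable_translate F)
      have "autocorr F (z n) - autocorr F 0 = (LBINT x. (F (x + z n) - F x) * cnj (F x))"
        unfolding autocorr_def using i1 i2 by (simp add: left_diff_distrib)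
      also have "cmod \<dots> \<le> (LBINT x. cmod ((F (x + z n) - F x) * cnj (F x)))"
        by (rule integral_norm_bound)
      also have "\<dots> \<le> (LBINT x. real M * cmod (F (x + z n) - F x) + (k / 2 * ((cmod (F (x + z n)))\<^sup>2 + (cmod (F x))\<^sup>2) + (1 / k) * ?T M x))"
      proof (intro integral_mono')
        fix x
        show "cmod ((F (x + z n) - F x) * cnj (F x)) \<le> real M * cmod (F (x + z n) - F x) + (k / 2 * ((cmod (F (x + z n)))\<^sup>2 + (cmod (F x))\<^sup>2) + (1 / k) * ?T M x)"
        proof (cases "cmod (F x) > real M")
          case False
          then have "cmod (F (x + z n) - F x) * cmod (F x) \<le> cmod (F (x + z n) - F x) * real M"
            by (intro mult_left_mono) auto
          moreover have "0 \<le> k / 2 * ((cmod (F (x + z n)))\<^sup>2 + (cmod (F x))\<^sup>2)" using k by simp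
          ultimately show ?thesis using False by (simp add: norm_mult mult.commute)
        next
          case True
          have amgm: "a * c \<le> k / 2 * a\<^sup>2 + (1 / (2 * k)) * c\<^sup>2" for a c :: real
          proof -
            have "0 \<le> (k * a - c)\<^sup>2 / (2 * k)" using k by simp
            also have "\<dots> = k / 2 * a\<^sup>2 + (1 / (2 * k)) * c\<^sup>2 - a * c"
              using k by (simp add: power2_eq_square field_simps)
            finally show ?thesis by simp
          qed
          have "cmod (F (x + z n) - F x) * cmod (F x) \<le> (cmod (F (x + z n)) + cmod (F x)) * cmod (F x)"
            by (intro mult_right_mono norm_triangle_ineq4) simp
          also have "\<dots> \<le> k / 2 * ((cmod (F (x + z n)))\<^sup>2 + (cmod (F x))\<^sup>2) + (1 / k) * (cmod (F x))\<^sup>2"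
            using amgm[of "cmod (F (x + z n))" "cmod (F x)"] amgm[of "cmod (F x)" "cmod (F x)"]
            by (simp add: algebra_simps)
          finally show ?thesis using True by (simp add: norm_mult add_increasing)
        qed
      qed (use i3 F2 F2t iT k in auto)
      also have "\<dots> = ?b n + (k / 2 * ((LBINT x. (cmod (F (x + z n)))\<^sup>2) + ?S) + (1 / k) * (LBINT x. ?T M x))"
        using i3 F2 F2t[of n] iT by simp
      also have "(LBINT x. (cmod (F (x + z n)))\<^sup>2) = ?S"
        by (rule integral_translate)
      also have "k / 2 * (?S + ?S) + (1 / k) * (LBINT x. ?T M x) \<le> e"
      proof -
        have "k * ?S \<le> k * (?S + 1)" using k by simp
        also have "\<dots> = e / 2" using S by (simp add: k_def field_simps add_nonneg_eq_0_iff)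
        finally have "k * ?S \<le> e / 2" .
        moreover have "(1 / k) * (LBINT x. ?T M x) \<le> (1 / k) * (k * (e / 4))"
          using M k by (intro mult_left_mono) auto
        moreover have "(1 / k) * (k * (e / 4)) = e / 4" using k by simp
        moreover have "k / 2 * (?S + ?S) = k * ?S" by simp
        ultimately have "k / 2 * (?S + ?S) + (1 / k) * (LBINT x. ?T M x) \<le> e / 2 + e / 4"
          by (intro add_mono) simp_all
        then show ?thesis using e by linarith
      qed
      finally show ?thesis by simp
    qed
    moreover have "?b \<longlonglongrightarrow> 0"
      using tendsto_mult_right_zero[OF translation_continuous_L1[OF F z]] by simp
    ultimately show "\<exists>b. b \<longlonglongrightarrow> 0 \<and> (\<forall>n. cmod (autocorr F (z n) - autocorr F 0) \<le> b n + e)"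
      by (intro exI[of _ ?b]) auto
  qed simp
  then show "(\<lambda>n. autocorr F (z n)) \<longlonglongrightarrow> autocorr F 0"
    by (simp add: tendsto_norm_zero_iff LIM_zero_iff)
qed

lemma norm_autocorr_le:
  fixes F :: "real \<Rightarrow> complex"
  assumes F: "F \<in> borel_measurable lborel" and F2: "integrable lborel (\<lambda>x. (cmod (F x))\<^sup>2)"
  shows "cmod (autocorr F z) \<le> (LBINT x. (cmod (F x))\<^sup>2)"
proof -
  have i: "integrable lborel (\<lambda>x. (cmod (F (x + z)))\<^sup>2)"
    using integrable_translate[OF F2] .
  have "cmod (autocorr F z) \<le> (LBINT x. cmod (F (x + z) * cnj (F x)))"
    unfolding autocorr_def by (rule integral_norm_bound)
  also have "\<dots> \<le> (LBINT x. (cmod (F (x + z)))\<^sup>2 / 2 + (cmod (F x))\<^sup>2 / 2)"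
  proof (intro integral_mono')
    show "cmod (F (x + z) * cnj (F x)) \<le> (cmod (F (x + z)))\<^sup>2 / 2 + (cmod (F x))\<^sup>2 / 2" for x
      using sum_squares_bound[of "cmod (F (x + z))" "cmod (F x)"] by (simp add: norm_mult)
  qed (use i F2 in auto)
  also have "\<dots> = (LBINT x. (cmod (F x))\<^sup>2)"
    using i F2 integral_translate[of "\<lambda>x. (cmod (F x))\<^sup>2" z] by simp
  finally show ?thesis .
qed

lemma integrable_autocorr_pair:
  fixes F :: "real \<Rightarrow> complex"
  assumes F: "integrable lborel F"
  shows "integrable (lborel \<Otimes>\<^sub>M lborel) (\<lambda>(x, z). F (x + z) * cnj (F x))"
proof -
  have [measurable]: "F \<in> borel_measurable borel" using borel_measurable_integrable[OF F] by simp
  have tr: "(LBINT z. cmod (F (x + z))) = (LBINT z. cmod (F z))" for x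
    using integral_translate[of "\<lambda>z. cmod (F z)" x] by (simp add: add.commute)
  show ?thesis
  proof (rule lborel_pair.Fubini_integrable)
    show "integrable lborel (\<lambda>x. LINT z|lborel. norm (case (x, z) of (x, z) \<Rightarrow> F (x + z) * cnj (F x)))"
      using F tr by (simp add: norm_mult)
    show "AE x in lborel. integrable lborel (\<lambda>z. case (x, z) of (x, z) \<Rightarrow> F (x + z) * cnj (F x))"
      using integrable_translate[OF F] by (auto simp: add.commute)
  qed measurable
qed

lemma integrable_autocorr:
  assumes F: "integrable lborel F"
  shows "integrable lborel (autocorr F)"
  unfolding autocorr_def
  using lborel_pair.integrable_snd[OF integrable_autocorr_pair[OF F]] by simp

text \<open>After Fubini, writing \<open>iexp (u * z)\<close> as \<open>iexp (u * (z + x))\<close>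
  times the conjugate of \<open>iexp (u * x)\<close> makes the double integral a product.\<close>

lemma cft_autocorr:
  assumes F: "integrable lborel F"
  shows "cft (autocorr F) u = complex_of_real ((cmod (cft F u))\<^sup>2)"
proof -
  have [measurable]: "F \<in> borel_measurable borel" using borel_measurable_integrable[OF F] by simp
  have i: "integrable (lborel \<Otimes>\<^sub>M lborel) (\<lambda>(x, z). iexp (u * z) * (F (x + z) * cnj (F x)))"
    by (rule Bochner_Integration.integrable_bound[OF integrable_autocorr_pair[OF F]])
       (auto simp: norm_mult)
  have "cft (autocorr F) u = (\<integral>z. (LBINT x. iexp (u * z) * (F (x + z) * cnj (F x))) \<partial>lborel)"
    unfolding cft_def autocorr_def by simp
  also have "\<dots> = (\<integral>x. (LBINT z. iexp (u * z) * (F (x + z) * cnj (F x))) \<partial>lborel)"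
    using lborel_pair.Fubini_integral[OF i] by simp
  also have "\<dots> = (LBINT x. cft F u * cnj (iexp (u * x) * F x))"
  proof (rule Bochner_Integration.integral_cong[OF refl])
    fix x :: real
    have "(LBINT z. iexp (u * z) * (F (x + z) * cnj (F x)))
      = (LBINT z. (iexp (u * (z + x)) * F (z + x)) * cnj (iexp (u * x) * F x))"
    proof (rule Bochner_Integration.integral_cong[OF refl])
      fix z :: real
      have "iexp (u * (z + x)) * cnj (iexp (u * x)) = iexp (u * z)"
        by (simp add: exp_cnj exp_add[symmetric] algebra_simps)
      then show "iexp (u * z) * (F (x + z) * cnj (F x)) = (iexp (u * (z + x)) * F (z + x)) * cnj (iexp (u * x) * F x)"
        by (simp only: complex_cnj_mult ac_simps)
    qed
    also have "\<dots> = (LBINT z. (iexp (u * (z + x)) * F (z + x))) * cnj (iexp (u * x) * F x)"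
      by (rule integral_mult_left_zero)
    also have "(LBINT z. (iexp (u * (z + x)) * F (z + x))) = cft F u"
      unfolding cft_def by (rule integral_translate)
    finally show "(LBINT z. iexp (u * z) * (F (x + z) * cnj (F x))) = cft F u * cnj (iexp (u * x) * F x)" .
  qed
  also have "\<dots> = cft F u * cnj (cft F u)"
    unfolding cft_def by (simp only: integral_mult_right_zero Bochner_Integration.integral_cnj)
  finally show ?thesis by (simp only: complex_norm_square)
qed

text \<open>Damped inversion is applied to the autocorrelation at \<open>0\<close>. Since its
  transform is nonnegative, the damped integrals increase as the damping weakens, and monotone
  convergence yields the integrability of the squared transform together with the value.\<close>

theorem plancherel:
  assumes F: "integrable lborel F" and F2: "integrable lborel (\<lambda>x. (cmod (F x))\<^sup>2)"
  shows "integrable lborel (\<lambda>u. (cmod (cft F u))\<^sup>2)"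
    and "(LBINT u. (cmod (cft F u))\<^sup>2) = 2 * pi * (LBINT x. (cmod (F x))\<^sup>2)"
proof -
  have [measurable]: "cft F \<in> borel_measurable borel" by (rule borel_measurable_cft[OF F])
  let ?A = "autocorr F"
  have iA: "integrable lborel ?A" by (rule integrable_autocorr[OF F])
  have Am: "?A \<in> borel_measurable borel" using borel_measurable_integrable[OF iA] by simp
  let ?s = "\<lambda>n. inverse (real (Suc n))"
  let ?f = "\<lambda>n u. (cmod (cft F u))\<^sup>2 * std_normal_density (?s n * u)"
  let ?b = "\<integral>x. (cmod (F x))\<^sup>2 \<partial>lborel"
  have le: "(cmod (cft F u))\<^sup>2 \<le> (LBINT x. cmod (F x))\<^sup>2" for u
    by (intro power_mono norm_cft_le[OF F]) simp
  have if_: "integrable lborel (?f n)" for n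
  proof (rule Bochner_Integration.integrable_bound)
    show "integrable lborel (\<lambda>u. (LBINT x. cmod (F x))\<^sup>2 * std_normal_density (?s n * u))"
      by (intro integrable_mult_right integrable_gauss) simp
    show "AE u in lborel. norm (?f n u) \<le> norm ((LBINT x. cmod (F x))\<^sup>2 * std_normal_density (?s n * u))"
      using le by (auto simp: abs_mult intro!: mult_right_mono)
  qed measurable
  have eq: "complex_of_real (LBINT u. ?f n u)
      = (LBINT z. ?A (0 + ?s n * z) * complex_of_real (exp (- z\<^sup>2 / 2)))" for n
  proof -
    have "(LBINT z. ?A (0 + ?s n * z) * complex_of_real (exp (- z\<^sup>2 / 2)))
      = (LBINT u. cft ?A u * (iexp (- (u * 0)) * complex_of_real (std_normal_density (?s n * u))))"
      by (rule gauss_regularised_inversion[OF iA, symmetric]) simp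
    also have "\<dots> = (LBINT u. complex_of_real (?f n u))"
      unfolding cft_autocorr[OF F] by (simp del: of_nat_Suc)
    finally show ?thesis by (simp only: integral_of_real[OF if_])
  qed
  have "(\<lambda>n. complex_of_real (LBINT u. ?f n u)) \<longlonglongrightarrow> complex_of_real (sqrt (2 * pi)) * ?A 0"
    unfolding eq
    by (rule gauss_approx_limit[OF Am norm_autocorr_le autocorr_continuous_0[OF F F2]])
       (use F F2 in auto)
  also have "?A 0 = complex_of_real ?b"
  proof -
    have "?A 0 = (LBINT x. complex_of_real ((cmod (F x))\<^sup>2))"
      unfolding autocorr_def
      by (intro Bochner_Integration.integral_cong refl) (simp add: complex_norm_square del: of_real_power)
    then show ?thesis by (simp only: integral_of_real[OF F2])
  qed
  finally have "(\<lambda>n. complex_of_real (LBINT u. ?f n u)) \<longlonglongrightarrow> complex_of_real (sqrt (2 * pi) * ?b)"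
    by simp
  then have lim: "(\<lambda>n. \<integral>u. ?f n u \<partial>lborel) \<longlonglongrightarrow> sqrt (2 * pi) * ?b"
    by (simp only: tendsto_of_real_iff)
  have mono: "AE u in lborel. mono (\<lambda>n. ?f n u)"
  proof (intro AE_I2 monoI mult_left_mono)
    fix u :: real and m n :: nat assume "m \<le> n"
    then have "(?s n * u)\<^sup>2 \<le> (?s m * u)\<^sup>2"
      unfolding power_mult_distrib by (intro mult_right_mono power_mono) (auto simp: field_simps)
    then show "std_normal_density (?s m * u) \<le> std_normal_density (?s n * u)"
      unfolding std_normal_density_def by (intro mult_left_mono) auto
  qed simp
  have plim: "AE u in lborel. (\<lambda>n. ?f n u) \<longlonglongrightarrow> (cmod (cft F u))\<^sup>2 * std_normal_density 0"
  proof (intro AE_I2 tendsto_mult tendsto_const)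
    fix u :: real
    have "isCont std_normal_density 0"
      unfolding normal_density_def by (intro continuous_intros) auto
    moreover have "(\<lambda>n. ?s n * u) \<longlonglongrightarrow> 0 * u"
      by (intro tendsto_intros LIMSEQ_inverse_real_of_nat)
    ultimately show "(\<lambda>n. std_normal_density (?s n * u)) \<longlonglongrightarrow> std_normal_density 0"
      using isCont_tendsto_compose by fastforce
  qed
  note mc = if_ mono plim lim
  have c: "std_normal_density 0 = 1 / sqrt (2 * pi)" by (simp add: std_normal_density_def)
  have lm: "(\<lambda>u. (cmod (cft F u))\<^sup>2 * std_normal_density 0) \<in> borel_measurable lborel"
    by measurable
  have 1: "integrable lborel (\<lambda>u. (cmod (cft F u))\<^sup>2 * std_normal_density 0)"
    by (rule integrable_monotone_convergence[OF mc lm])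
  have 2: "(LBINT u. (cmod (cft F u))\<^sup>2 * std_normal_density 0) = sqrt (2 * pi) * ?b"
    by (rule integral_monotone_convergence[OF mc lm])
  show "integrable lborel (\<lambda>u. (cmod (cft F u))\<^sup>2)"
    using integrable_mult_right[OF 1, of "sqrt (2 * pi)"] by (simp add: c)
  have "(LBINT u. (cmod (cft F u))\<^sup>2) * (1 / sqrt (2 * pi)) = sqrt (2 * pi) * ?b"
    using 2 unfolding c by (simp only: integral_mult_left_zero)
  then show "(LBINT u. (cmod (cft F u))\<^sup>2) = 2 * pi * ?b"
    by (simp add: field_simps)
qed

section \<open>Polarisation and Parseval's identity\<close>

lemma cft_add: "integrable lborel F \<Longrightarrow> integrable lborel G \<Longrightarrow> cft (\<lambda>x. F x + G x) u = cft F u + cft G u"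
  unfolding cft_def using integrable_iexp_mult by (simp add: distrib_left)

lemma cft_diff: "integrable lborel F \<Longrightarrow> integrable lborel G \<Longrightarrow> cft (\<lambda>x. F x - G x) u = cft F u - cft G u"
  unfolding cft_def using integrable_iexp_mult by (simp add: right_diff_distrib)

lemma cft_cmult: "cft (\<lambda>x. c * F x) u = c * cft F u"
  unfolding cft_def by (simp only: mult.left_commute[of _ c] integral_mult_right_zero)

lemma norm_add_square_polar:
  "F * cnj G = complex_of_real (((cmod (F + G))\<^sup>2 - (cmod (F - G))\<^sup>2) / 4)
     + \<i> * complex_of_real (((cmod (F + \<i> * G))\<^sup>2 - (cmod (F - \<i> * G))\<^sup>2) / 4)"
  by (rule complex_eqI) (simp_all add: cmod_power2, simp_all add: power2_eq_square algebra_simps)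

lemma integrable_norm_square_add:
  fixes F G :: "'a \<Rightarrow> complex"
  assumes F: "F \<in> borel_measurable M" "integrable M (\<lambda>x. (cmod (F x))\<^sup>2)"
    and G: "G \<in> borel_measurable M" "integrable M (\<lambda>x. (cmod (G x))\<^sup>2)"
  shows "integrable M (\<lambda>x. (cmod (F x + c * G x))\<^sup>2)"
proof (rule Bochner_Integration.integrable_bound)
  show "integrable M (\<lambda>x. 2 * (cmod (F x))\<^sup>2 + 2 * (cmod c)\<^sup>2 * (cmod (G x))\<^sup>2)" using F G by simp
  show "AE x in M. norm ((cmod (F x + c * G x))\<^sup>2) \<le> norm (2 * (cmod (F x))\<^sup>2 + 2 * (cmod c)\<^sup>2 * (cmod (G x))\<^sup>2)"
  proof (rule AE_I2)
    fix x
    have "(cmod (F x + c * G x))\<^sup>2 \<le> (cmod (F x) + cmod c * cmod (G x))\<^sup>2"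
      using norm_triangle_ineq[of "F x" "c * G x"] by (intro power_mono) (auto simp: norm_mult)
    also have "\<dots> \<le> 2 * (cmod (F x))\<^sup>2 + 2 * (cmod c * cmod (G x))\<^sup>2"
      using sum_squares_bound[of "cmod (F x)" "cmod c * cmod (G x)"] by (simp add: power2_sum)
    finally show "norm ((cmod (F x + c * G x))\<^sup>2) \<le> norm (2 * (cmod (F x))\<^sup>2 + 2 * (cmod c)\<^sup>2 * (cmod (G x))\<^sup>2)"
      by (simp add: power_mult_distrib)
  qed
qed (use F G in measurable)

text \<open>Both inner products are the same combination of four squared norms, with coefficients
  \<open>1\<close>, \<open>- 1\<close>, \<open>\<i>\<close> and \<open>- \<i>\<close> in front of
  \<open>G\<close>; Plancherel is applied to each of the four.\<close>

theorem parseval: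
  assumes F: "integrable lborel F" "integrable lborel (\<lambda>x. (cmod (F x))\<^sup>2)"
    and G: "integrable lborel G" "integrable lborel (\<lambda>x. (cmod (G x))\<^sup>2)"
  shows "(LBINT u. cft F u * cnj (cft G u)) = complex_of_real (2 * pi) * (LBINT x. F x * cnj (G x))"
proof -
  note Fm = borel_measurable_integrable[OF F(1)] and Gm = borel_measurable_integrable[OF G(1)]
  let ?h = "\<lambda>c x. F x + c * G x"
  let ?N = "\<lambda>c. \<integral>x. (cmod (?h c x))\<^sup>2 \<partial>lborel" and ?M = "\<lambda>c. \<integral>u. (cmod (cft F u + c * cft G u))\<^sup>2 \<partial>lborel"
  have h1: "integrable lborel (?h c)" for c using F G by simp
  have h2: "integrable lborel (\<lambda>x. (cmod (?h c x))\<^sup>2)" for c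
    by (rule integrable_norm_square_add[OF Fm F(2) Gm G(2)])
  have ch: "cft (?h c) u = cft F u + c * cft G u" for c u
    using F G by (subst cft_add) (auto simp: cft_cmult)
  have NM: "?M c = 2 * pi * ?N c" and iM: "integrable lborel (\<lambda>u. (cmod (cft F u + c * cft G u))\<^sup>2)" for c
    using plancherel[OF h1 h2] unfolding ch by auto
  have pol: "(LBINT x. X x * cnj (Y x)) =
      complex_of_real (((LBINT x. (cmod (X x + 1 * Y x))\<^sup>2) - (LBINT x. (cmod (X x + (-1) * Y x))\<^sup>2)) / 4)
     + \<i> * complex_of_real (((LBINT x. (cmod (X x + \<i> * Y x))\<^sup>2) - (LBINT x. (cmod (X x + (-\<i>) * Y x))\<^sup>2)) / 4)"
    if i: "\<And>c. integrable lborel (\<lambda>x. (cmod (X x + c * Y x))\<^sup>2)" for X Y :: "real \<Rightarrow> complex"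
  proof -
    have "(LBINT x. X x * cnj (Y x)) =
      (LBINT x. complex_of_real (((cmod (X x + 1 * Y x))\<^sup>2 - (cmod (X x + (-1) * Y x))\<^sup>2) / 4)
     + \<i> * complex_of_real (((cmod (X x + \<i> * Y x))\<^sup>2 - (cmod (X x + (-\<i>) * Y x))\<^sup>2) / 4))"
      by (subst norm_add_square_polar) simp
    also have "\<dots> = (LBINT x. complex_of_real (((cmod (X x + 1 * Y x))\<^sup>2 - (cmod (X x + (-1) * Y x))\<^sup>2) / 4))
      + (LBINT x. \<i> * complex_of_real (((cmod (X x + \<i> * Y x))\<^sup>2 - (cmod (X x + (-\<i>) * Y x))\<^sup>2) / 4))"
      by (intro Bochner_Integration.integral_add integrable_mult_right integrable_of_real
          integrable_divide_zero Bochner_Integration.integrable_diff i)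
    also have "\<dots> = complex_of_real (LBINT x. ((cmod (X x + 1 * Y x))\<^sup>2 - (cmod (X x + (-1) * Y x))\<^sup>2) / 4)
      + \<i> * complex_of_real (LBINT x. ((cmod (X x + \<i> * Y x))\<^sup>2 - (cmod (X x + (-\<i>) * Y x))\<^sup>2) / 4)"
      by (subst integral_of_real, intro integrable_divide_zero Bochner_Integration.integrable_diff i,
          subst integral_mult_right_zero,
          subst integral_of_real, intro integrable_divide_zero Bochner_Integration.integrable_diff i) (rule refl)
    finally show ?thesis
      by (simp only: integral_divide_zero Bochner_Integration.integral_diff[OF i i])
  qed
  show ?thesis
    unfolding pol[OF iM] pol[OF h2] NM by (simp add: algebra_simps)
qed

section \<open>Degenerate U-statistics\<close>

declare One_nat_def [simp del]

text \<open>The linear term is kept exactly, so that it disappears when a centred variable is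
  averaged. For \<open>x = - t\<close> below zero the claim follows from the lower Taylor bound for
  \<open>exp t\<close>, because \<open>1 - t + t\<^sup>2\<close> times
  \<open>1 + t + t\<^sup>2 / 2\<close> is at least \<open>1\<close>.\<close>

lemma exp_le_quadratic:
  fixes x :: real
  assumes "\<bar>x\<bar> \<le> 1"
  shows "exp x \<le> 1 + x + x\<^sup>2"
proof (cases "x \<ge> 0")
  case True
  then show ?thesis using assms exp_bound[of x] by simp
next
  case False
  define t where "t = - x"
  have t: "0 \<le> t" using False by (simp add: t_def)
  have "1 \<le> 1 + t\<^sup>2 / 2 + t ^ 3 / 2 + t ^ 4 / 2" using t by simp
  also have "\<dots> = (1 - t + t\<^sup>2) * (1 + t + t\<^sup>2 / 2)"
    by (simp add: power2_eq_square power3_eq_cube power4_eq_xxxx field_simps)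
  also have "\<dots> \<le> (1 - t + t\<^sup>2) * exp t"
  proof (rule mult_left_mono[OF exp_lower_Taylor_quadratic[OF t]])
    have "0 \<le> (t - 1 / 2)\<^sup>2 + 3 / 4" by simp
    also have "\<dots> = 1 - t + t\<^sup>2" by (simp add: power2_eq_square algebra_simps)
    finally show "0 \<le> 1 - t + t\<^sup>2" .
  qed
  finally have "exp (- t) \<le> 1 - t + t\<^sup>2"
    by (simp add: exp_minus field_simps)
  then show ?thesis by (simp add: t_def)
qed

lemma (in prob_space) markov_measure:
  assumes u: "integrable M u" and nn: "\<And>x. x \<in> space M \<Longrightarrow> 0 \<le> u x" and c: "(0::real) < c"
  shows "measure M {x \<in> space M. c \<le> u x} \<le> (\<integral>x. u x \<partial>M) / c"
  by (rule integral_Markov_inequality_measure[OF u sets.top]) (use nn c in auto)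

lemma (in prob_space) integrable_bounded:
  fixes u :: "'a \<Rightarrow> real"
  assumes "u \<in> borel_measurable M" "\<And>x. x \<in> space M \<Longrightarrow> \<bar>u x\<bar> \<le> c"
  shows "integrable M u"
  using assms by (intro integrable_const_bound[where B=c]) auto

section \<open>Resampling one coordinate of an independent sample\<close>

context prob_space
begin

abbreviation sample :: "nat \<Rightarrow> (nat \<Rightarrow> 'a) measure" where
  "sample n \<equiv> (\<Pi>\<^sub>M j\<in>{1..n}. M)"

lemma prob_space_sample: "prob_space (sample n)"
  by (rule prob_space_PiM) (rule prob_space_axioms)

lemma sample_update_measurable:
  assumes F: "F \<in> borel_measurable (sample n)" and i: "i \<in> {1..n}"
  shows "(\<lambda>(y, z). F (y(i := z)) :: real) \<in> borel_measurable (sample n \<Otimes>\<^sub>M M)"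
proof -
  have "(\<lambda>(y, z). y(i := z)) \<in> measurable (sample n \<Otimes>\<^sub>M M) (sample n)"
    using measurable_add_dim[of i "{1..n}" "\<lambda>_. M"] unfolding insert_absorb[OF i] .
  from measurable_compose[OF this F] show ?thesis by (simp add: case_prod_beta')
qed

text \<open>The only form of conditioning in the proof: conditional expectation given all other
  coordinates is the integral over a fresh value \<open>z\<close> put in place of coordinate
  \<open>i\<close>.\<close>

lemma sample_resample:
  fixes F :: "(nat \<Rightarrow> 'a) \<Rightarrow> real"
  assumes F: "F \<in> borel_measurable (sample n)" and bd: "\<And>y. y \<in> space (sample n) \<Longrightarrow> \<bar>F y\<bar> \<le> c"
    and i: "i \<in> {1..n}"
  shows "(\<integral>y. F y \<partial>sample n) = (\<integral>y. (\<integral>z. F (y(i := z)) \<partial>M) \<partial>sample n)"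
    and "(\<lambda>y. \<integral>z. F (y(i := z)) \<partial>M) \<in> borel_measurable (sample n)"
proof -
  interpret product_sigma_finite "\<lambda>_::nat. M" by standard
  interpret S: prob_space "sample n" by (rule prob_space_sample)
  \<comment> \<open>Both sides are brought to the product over the remaining coordinates. On the
    right the inner integral has forgotten coordinate \<open>i\<close>, so integrating over that
    coordinate once more leaves it unchanged.\<close>
  let ?J = "{1..n} - {i}"
  have ins: "insert i ?J = {1..n}" using i by auto
  let ?G = "\<lambda>y. \<integral>z. F (y(i := z)) \<partial>M"
  show Gm: "?G \<in> borel_measurable (sample n)"
    using borel_measurable_lebesgue_integral[OF sample_update_measurable[OF F i]] by simp
  have upd': "y(i := z) \<in> space (sample n)" if "y \<in> space (sample n)" "z \<in> space M" for y z
    using that i by (auto simp: space_PiM PiE_iff extensional_def)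
  have Gb: "\<bar>?G y\<bar> \<le> c" if "y \<in> space (sample n)" for y
  proof -
    have "(\<lambda>z. F (y(i := z))) \<in> borel_measurable M"
      using measurable_Pair2[OF sample_update_measurable[OF F i] that] by simp
    then have "integrable M (\<lambda>z. F (y(i := z)))"
      using bd upd'[OF that] by (intro integrable_bounded) auto
    moreover have "\<bar>F (y(i := z))\<bar> \<le> c" if "z \<in> space M" for z using bd upd'[OF \<open>y \<in> space (sample n)\<close> that] .
    ultimately have "?G y \<le> c" "?G y \<ge> - c"
      by (intro integral_le_const integral_ge_const AE_I2; force simp: abs_le_iff)+
    then show ?thesis by simp
  qed
  have "(\<integral>y. F y \<partial>sample n) = (\<integral>y. (\<integral>z. F (y(i := z)) \<partial>M) \<partial>PiM ?J (\<lambda>_. M))"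
    using product_integral_insert[of ?J i F] S.integrable_bounded[OF F bd] unfolding ins by auto
  moreover have "(\<integral>y. ?G y \<partial>sample n) = (\<integral>y. (\<integral>w. ?G (y(i := w)) \<partial>M) \<partial>PiM ?J (\<lambda>_. M))"
    using product_integral_insert[of ?J i ?G] S.integrable_bounded[OF Gm Gb] unfolding ins by auto
  ultimately show "(\<integral>y. F y \<partial>sample n) = (\<integral>y. ?G y \<partial>sample n)"
    by (simp add: prob_space)
qed

text \<open>Resampling the newest coordinate removes the cross term, since \<open>l\<close> is
  centred. The sample size \<open>n\<close> is fixed and the length \<open>j\<close> of the partial
  sum varies, which permits induction within one product space.\<close>

lemma second_moment_sum:
  fixes l :: "'a \<Rightarrow> real"
  assumes [measurable]: "l \<in> borel_measurable M" and bd: "\<And>z. \<bar>l z\<bar> \<le> c"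
    and z: "(\<integral>z. l z \<partial>M) = 0" and v: "(\<integral>z. (l z)\<^sup>2 \<partial>M) \<le> v" and j: "j \<le> n"
  shows "(\<integral>y. (\<Sum>k=1..j. l (y k))\<^sup>2 \<partial>sample n) \<le> real j * v"
  using j
proof (induction j)
  case (Suc j)
  interpret S: prob_space "sample n" by (rule prob_space_sample)
  let ?S = "\<lambda>j y. \<Sum>k=1..j. l (y k)"
  have m: "?S i \<in> borel_measurable (sample n)" if "i \<le> n" for i
    using that
    by (intro borel_measurable_sum measurable_compose[OF measurable_component_singleton[of _ "{1..n}" "\<lambda>_. M"] assms(1)]) auto
  have Sb: "\<bar>?S i y\<bar> \<le> real i * c" for i y
  proof -
    have "\<bar>?S i y\<bar> \<le> (\<Sum>k=1..i. \<bar>l (y k)\<bar>)" by (rule sum_abs)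
    also have "\<dots> \<le> real (card {1..i}) * c" by (rule sum_bounded_above) (rule bd)
    finally show ?thesis by simp
  qed
  have sq: "\<bar>(?S i y)\<^sup>2\<bar> \<le> (real i * c)\<^sup>2" for i y
    using Sb[of y i] by (metis abs_power2 abs_ge_zero power2_abs power_mono)
  have c: "c \<ge> 0" using bd order_trans abs_ge_zero by blast
  have il: "integrable M l" by (rule integrable_bounded[of _ c]) (use bd in auto)
  have il2: "integrable M (\<lambda>z. (l z)\<^sup>2)"
    by (rule integrable_bounded[of _ "c\<^sup>2"]) (use bd c in \<open>auto simp: power2_le_iff_abs_le\<close>)
  have m1: "?S (Suc j) \<in> borel_measurable (sample n)" and m2: "?S j \<in> borel_measurable (sample n)"
    using m Suc.prems by auto
  have mm: "(\<lambda>y. (?S (Suc j) y)\<^sup>2) \<in> borel_measurable (sample n)" using m1 by measurable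
  have "(\<integral>y. (?S (Suc j) y)\<^sup>2 \<partial>sample n) = (\<integral>y. (\<integral>z. (?S (Suc j) (y(Suc j := z)))\<^sup>2 \<partial>M) \<partial>sample n)"
    by (rule sample_resample(1)[OF mm sq]) (use Suc.prems in auto)
  also have "\<dots> = (\<integral>y. (?S j y)\<^sup>2 + (\<integral>z. (l z)\<^sup>2 \<partial>M) \<partial>sample n)"
  proof (rule Bochner_Integration.integral_cong[OF refl])
    fix y
    have "?S (Suc j) (y(Suc j := z)) = ?S j y + l z" for z by simp
    then have "(\<integral>z. (?S (Suc j) (y(Suc j := z)))\<^sup>2 \<partial>M) = (\<integral>z. (?S j y)\<^sup>2 + (2 * ?S j y) * l z + (l z)\<^sup>2 \<partial>M)"
      by (simp add: power2_sum ac_simps)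
    also have "\<dots> = (?S j y)\<^sup>2 + (2 * ?S j y) * (\<integral>z. l z \<partial>M) + (\<integral>z. (l z)\<^sup>2 \<partial>M)"
      using il il2 by (simp add: prob_space)
    finally show "(\<integral>z. (?S (Suc j) (y(Suc j := z)))\<^sup>2 \<partial>M) = (?S j y)\<^sup>2 + (\<integral>z. (l z)\<^sup>2 \<partial>M)" using z by simp
  qed
  also have "\<dots> = (\<integral>y. (?S j y)\<^sup>2 \<partial>sample n) + (\<integral>z. (l z)\<^sup>2 \<partial>M)"
  proof -
    have "integrable (sample n) (\<lambda>y. (?S j y)\<^sup>2)"
      by (rule S.integrable_bounded[OF _ sq]) (use m2 in measurable)
    then show ?thesis by (simp add: S.prob_space)
  qed
  also have "\<dots> \<le> real j * v + v" using Suc v by simp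
  finally show ?case by (simp add: algebra_simps)
qed simp

end

text \<open>Both \<open>H_sup\<close> and \<open>H_var\<close> bound the martingale increments by the nonnegative form
  \<open>quad\<close>, which itself is controlled by the statistic; this lets Freedman's inequality bootstrap.\<close>

locale degenerate_kernel = prob_space P for P :: "'a measure" +
  fixes H :: "'a \<Rightarrow> 'a \<Rightarrow> real" and B D :: real
  assumes H_meas: "(\<lambda>(x, y). H x y) \<in> borel_measurable (P \<Otimes>\<^sub>M P)"
    and H_sym: "H x y = H y x"
    and H_bound: "\<bar>H x y\<bar> \<le> D"
    and H_degenerate: "(\<integral>z. H x z \<partial>P) = 0"
    and H_sup: "\<And>(y :: nat \<Rightarrow> 'a) z j. (\<Sum>k=1..j. H (y k) z)\<^sup>2 \<le> D * (\<Sum>k=1..j. \<Sum>l=1..j. H (y k) (y l))"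
    and H_var: "\<And>(y :: nat \<Rightarrow> 'a) j. (\<integral>z. (\<Sum>k=1..j. H (y k) z)\<^sup>2 \<partial>P) \<le> B * (\<Sum>k=1..j. \<Sum>l=1..j. H (y k) (y l))"
    and B_pos: "0 < B" and D_pos: "0 < D"
begin

definition incr :: "nat \<Rightarrow> (nat \<Rightarrow> 'a) \<Rightarrow> 'a \<Rightarrow> real" where
  "incr j y z = (\<Sum>k=1..j. H (y k) z)"

definition ustat :: "nat \<Rightarrow> (nat \<Rightarrow> 'a) \<Rightarrow> real" where
  "ustat j y = (\<Sum>l=1..j. \<Sum>k=1..<l. H (y k) (y l))"

text \<open>In the application this is the squared norm of the sum of the first \<open>j\<close>
  centred kernel functions.\<close>

definition quad :: "nat \<Rightarrow> (nat \<Rightarrow> 'a) \<Rightarrow> real" where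
  "quad j y = (\<Sum>k=1..j. \<Sum>l=1..j. H (y k) (y l))"

lemma ustat_Suc: "ustat (Suc j) y = ustat j y + incr j y (y (Suc j))"
  by (simp add: ustat_def incr_def atLeastLessThanSuc_atLeastAtMost)

lemma quad_eq: "quad j y = (\<Sum>k=1..j. H (y k) (y k)) + 2 * ustat j y"
proof (induction j)
  case 0
  show ?case by (simp add: quad_def ustat_def)
next
  case (Suc j)
  have "quad (Suc j) y = quad j y + (\<Sum>k=1..j. H (y k) (y (Suc j))) + (\<Sum>k=1..j. H (y (Suc j)) (y k)) + H (y (Suc j)) (y (Suc j))"
    by (simp add: quad_def sum.distrib)
  also have "(\<Sum>k=1..j. H (y (Suc j)) (y k)) = (\<Sum>k=1..j. H (y k) (y (Suc j)))"
    by (intro sum.cong refl H_sym)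
  finally show ?case by (simp add: Suc ustat_Suc incr_def)
qed

text \<open>Read off from \<open>H_sup\<close> at an arbitrary point \<open>z\<close>: a square is
  at most \<open>D\<close> times the quadratic form.\<close>

lemma quad_nonneg: "0 \<le> quad j y"
proof -
  fix z :: 'a
  have "0 \<le> D * quad j y"
    using H_sup[of y z j] unfolding quad_def by (meson order_trans zero_le_power2)
  then show ?thesis using D_pos by (simp add: zero_le_mult_iff)
qed

lemma quad_le: "quad j y \<le> real j * D + 2 * ustat j y"
proof -
  have "(\<Sum>k=1..j. H (y k) (y k)) \<le> real (card {1..j}) * D"
    by (rule sum_bounded_above) (use H_bound abs_le_iff in blast)
  then show ?thesis by (simp add: quad_eq)
qed

lemma incr_bound: "\<bar>incr j y z\<bar> \<le> real j * D"
proof -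
  have "\<bar>incr j y z\<bar> \<le> (\<Sum>k=1..j. \<bar>H (y k) z\<bar>)" unfolding incr_def by (rule sum_abs)
  also have "\<dots> \<le> real (card {1..j}) * D" by (rule sum_bounded_above) (rule H_bound)
  finally show ?thesis by simp
qed

lemma ustat_bound: "\<bar>ustat j y\<bar> \<le> (real j)\<^sup>2 * D"
proof (induction j)
  case (Suc j)
  have "\<bar>ustat (Suc j) y\<bar> \<le> \<bar>ustat j y\<bar> + \<bar>incr j y (y (Suc j))\<bar>"
    unfolding ustat_Suc by (rule abs_triangle_ineq)
  also have "\<dots> \<le> (real j)\<^sup>2 * D + real j * D" using Suc incr_bound by (intro add_mono) auto
  also have "\<dots> \<le> (real (Suc j))\<^sup>2 * D" using D_pos by (simp add: power2_eq_square algebra_simps)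
  finally show ?case .
qed (simp add: ustat_def)

text \<open>Adaptedness: quantities at time \<open>j\<close> do not see observation
  \<open>Suc j\<close>, so resampling that coordinate acts as conditioning on the past. The same
  holds for the next two lemmas.\<close>

lemma ustat_update: "ustat j (y(Suc j := z)) = ustat j y"
  unfolding ustat_def by (intro sum.cong refl) auto

lemma incr_update: "incr j (y(Suc j := z)) w = incr j y w"
  unfolding incr_def by (intro sum.cong refl) auto

lemma quad_update: "i \<le> j \<Longrightarrow> quad i (y(Suc j := z)) = quad i y"
  unfolding quad_def by (intro sum.cong refl) auto

lemma H_measurable_section: "(\<lambda>z. H x z) \<in> borel_measurable P" if "x \<in> space P"
  using measurable_Pair2[OF H_meas that] by simp

lemma H_measurable_sample:
  assumes "k \<in> {1..n}" "l \<in> {1..n}"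
  shows "(\<lambda>y. H (y k) (y l)) \<in> borel_measurable (sample n)"
proof -
  have "(\<lambda>y. (y k, y l)) \<in> measurable (sample n) (P \<Otimes>\<^sub>M P)"
    using assms by (intro measurable_Pair measurable_component_singleton)
  from measurable_compose[OF this H_meas] show ?thesis by simp
qed

lemma ustat_measurable: "j \<le> n \<Longrightarrow> ustat j \<in> borel_measurable (sample n)"
  unfolding ustat_def by (intro borel_measurable_sum H_measurable_sample) auto

lemma quad_measurable: "j \<le> n \<Longrightarrow> quad j \<in> borel_measurable (sample n)"
  unfolding quad_def by (intro borel_measurable_sum H_measurable_sample) auto

lemma sample_space_component: "y \<in> space (sample n) \<Longrightarrow> k \<in> {1..n} \<Longrightarrow> y k \<in> space P"
  by (auto simp: space_PiM)

lemma incr_measurable: "y \<in> space (sample n) \<Longrightarrow> j \<le> n \<Longrightarrow> incr j y \<in> borel_measurable P"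
  unfolding incr_def using sample_space_component
  by (intro borel_measurable_sum H_measurable_section) auto

lemma incr_integral:
  assumes "y \<in> space (sample n)" "j \<le> n"
  shows "integrable P (incr j y)" "(\<integral>z. incr j y z \<partial>P) = 0"
    "integrable P (\<lambda>z. (incr j y z)\<^sup>2)" "(\<integral>z. (incr j y z)\<^sup>2 \<partial>P) \<le> B * quad j y"
proof -
  note m = incr_measurable[OF assms]
  show i: "integrable P (incr j y)"
    by (rule integrable_bounded[OF m incr_bound])
  have "integrable P (\<lambda>z. H (y k) z)" if "k \<in> {1..j}" for k
    by (rule integrable_bounded[OF H_measurable_section H_bound])
       (use sample_space_component[OF assms(1)] that assms(2) in auto)
  then show "(\<integral>z. incr j y z \<partial>P) = 0"
    unfolding incr_def by (subst Bochner_Integration.integral_sum) (auto simp: H_degenerate)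
  show "integrable P (\<lambda>z. (incr j y z)\<^sup>2)"
  proof (rule integrable_bounded)
    show "\<bar>(incr j y z)\<^sup>2\<bar> \<le> (real j * D)\<^sup>2" for z
      using incr_bound[of j y z] by (metis abs_power2 abs_ge_zero power2_abs power_mono)
  qed (use m in measurable)
  show "(\<integral>z. (incr j y z)\<^sup>2 \<partial>P) \<le> B * quad j y"
    using H_var unfolding incr_def quad_def .
qed

lemma integrable_ustat:
  assumes "j \<le> n"
  shows "integrable (sample n) (ustat j)" "integrable (sample n) (\<lambda>y. (ustat j y)\<^sup>2)"
    "integrable (sample n) (quad j)"
proof -
  interpret S: prob_space "sample n" by (rule prob_space_sample)
  show 1: "integrable (sample n) (ustat j)"
    by (rule S.integrable_bounded[OF ustat_measurable[OF assms] ustat_bound])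
  show "integrable (sample n) (\<lambda>y. (ustat j y)\<^sup>2)"
  proof (rule S.integrable_bounded)
    show "\<bar>(ustat j y)\<^sup>2\<bar> \<le> ((real j)\<^sup>2 * D)\<^sup>2" for y
      using ustat_bound[of j y] by (metis abs_power2 abs_ge_zero power2_abs power_mono)
  qed (use ustat_measurable[OF assms] in measurable)
  show "integrable (sample n) (quad j)"
  proof (rule S.integrable_bounded[OF quad_measurable[OF assms]])
    show "\<bar>quad j y\<bar> \<le> real j * D + 2 * ((real j)\<^sup>2 * D)" for y
      using quad_le[of j y] quad_nonneg[of j y] ustat_bound[of j y] by (simp add: abs_le_iff)
  qed
qed

lemma mean_ustat: "j \<le> n \<Longrightarrow> (\<integral>y. ustat j y \<partial>sample n) = 0"
proof (induction j)
  case (Suc j)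
  interpret S: prob_space "sample n" by (rule prob_space_sample)
  have "(\<integral>y. ustat (Suc j) y \<partial>sample n) = (\<integral>y. (\<integral>z. ustat (Suc j) (y(Suc j := z)) \<partial>P) \<partial>sample n)"
    by (rule sample_resample(1)[OF ustat_measurable ustat_bound]) (use Suc in auto)
  also have "\<dots> = (\<integral>y. ustat j y \<partial>sample n)"
  proof (rule Bochner_Integration.integral_cong[OF refl])
    fix y assume y: "y \<in> space (sample n)"
    show "(\<integral>z. ustat (Suc j) (y(Suc j := z)) \<partial>P) = ustat j y"
      using incr_integral[OF y, of j] Suc.prems
      by (simp add: ustat_Suc ustat_update incr_update prob_space)
  qed
  finally show ?case using Suc by simp
qed (simp add: ustat_def[abs_def])

text \<open>The increments are orthogonal. The conditional variance of increment
  \<open>Suc j\<close> is at most \<open>B * quad j\<close>, and \<open>quad j\<close> has mean at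
  most \<open>j * D\<close> because the off-diagonal part is centred. Summation over
  \<open>j\<close> gives half of the square.\<close>

lemma second_moment_ustat:
  "j \<le> n \<Longrightarrow> (\<integral>y. (ustat j y)\<^sup>2 \<partial>sample n) \<le> B * D * (real j)\<^sup>2 / 2"
proof (induction j)
  case (Suc j)
  interpret S: prob_space "sample n" by (rule prob_space_sample)
  note j = Suc_leD[OF Suc.prems]
  have sq: "\<bar>(ustat i y)\<^sup>2\<bar> \<le> ((real i)\<^sup>2 * D)\<^sup>2" for i y
    using ustat_bound[of i y] by (metis abs_power2 abs_ge_zero power2_abs power_mono)
  have m: "(\<lambda>y. (ustat (Suc j) y)\<^sup>2) \<in> borel_measurable (sample n)"
    using ustat_measurable[OF Suc.prems] by measurable
  have "(\<integral>y. (ustat (Suc j) y)\<^sup>2 \<partial>sample n) = (\<integral>y. (\<integral>z. (ustat (Suc j) (y(Suc j := z)))\<^sup>2 \<partial>P) \<partial>sample n)"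
    by (rule sample_resample(1)[OF m sq]) (use Suc in auto)
  also have "\<dots> \<le> (\<integral>y. (ustat j y)\<^sup>2 + B * quad j y \<partial>sample n)"
  proof (rule integral_mono')
    show "integrable (sample n) (\<lambda>y. (ustat j y)\<^sup>2 + B * quad j y)"
      using integrable_ustat[OF j] by simp
    fix y assume y: "y \<in> space (sample n)"
    note ii = incr_integral[OF y j]
    have "(\<integral>z. (ustat (Suc j) (y(Suc j := z)))\<^sup>2 \<partial>P)
      = (\<integral>z. (ustat j y)\<^sup>2 + (2 * ustat j y) * incr j y z + (incr j y z)\<^sup>2 \<partial>P)"
      by (simp add: ustat_Suc ustat_update incr_update power2_sum ac_simps)
    also have "\<dots> = (ustat j y)\<^sup>2 + (2 * ustat j y) * (\<integral>z. incr j y z \<partial>P) + (\<integral>z. (incr j y z)\<^sup>2 \<partial>P)"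
      using ii(1,3) by (simp add: prob_space)
    finally show "(\<integral>z. (ustat (Suc j) (y(Suc j := z)))\<^sup>2 \<partial>P) \<le> (ustat j y)\<^sup>2 + B * quad j y"
      using ii(2,4) by simp
    show "0 \<le> (ustat j y)\<^sup>2 + B * quad j y" using B_pos quad_nonneg by simp
  qed
  also have "\<dots> = (\<integral>y. (ustat j y)\<^sup>2 \<partial>sample n) + B * (\<integral>y. quad j y \<partial>sample n)"
    using integrable_ustat[OF j] by simp
  also have "\<dots> \<le> B * D * (real j)\<^sup>2 / 2 + B * (real j * D)"
  proof (intro add_mono mult_left_mono Suc.IH j)
    have "(\<integral>y. quad j y \<partial>sample n) \<le> (\<integral>y. real j * D + 2 * ustat j y \<partial>sample n)"
      using integrable_ustat[OF j] quad_le by (intro integral_mono) auto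
    also have "\<dots> = real j * D"
      using integrable_ustat[OF j] mean_ustat[OF j] by (simp add: S.prob_space)
    finally show "(\<integral>y. quad j y \<partial>sample n) \<le> real j * D" .
  qed (use B_pos in simp)
  also have "\<dots> \<le> B * D * (real (Suc j))\<^sup>2 / 2"
    using B_pos D_pos by (simp add: power2_eq_square algebra_simps)
  finally show ?case .
qed (simp add: ustat_def)

text \<open>Freedman's exponential supermartingale, stopped when the predictable quadratic form becomes large.\<close>

definition expmart :: "real \<Rightarrow> nat \<Rightarrow> (nat \<Rightarrow> 'a) \<Rightarrow> real" where
  "expmart \<theta> j y = (if \<forall>i<j. \<theta>\<^sup>2 * D * quad i y \<le> 1
     then exp (\<theta> * ustat j y - \<theta>\<^sup>2 * B * (\<Sum>i<j. quad i y)) else 0)"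

lemma expmart_nonneg: "0 \<le> expmart \<theta> j y"
  by (simp add: expmart_def)

lemma expmart_bound: "\<bar>expmart \<theta> j y\<bar> \<le> exp (\<bar>\<theta>\<bar> * ((real j)\<^sup>2 * D))"
proof -
  have "\<theta> * ustat j y \<le> \<bar>\<theta>\<bar> * \<bar>ustat j y\<bar>" by (metis abs_ge_self abs_mult)
  also have "\<dots> \<le> \<bar>\<theta>\<bar> * ((real j)\<^sup>2 * D)" by (intro mult_left_mono ustat_bound) simp
  finally have "\<theta> * ustat j y \<le> \<bar>\<theta>\<bar> * ((real j)\<^sup>2 * D)" .
  moreover have "0 \<le> \<theta>\<^sup>2 * B * (\<Sum>i<j. quad i y)"
    using B_pos quad_nonneg by (intro mult_nonneg_nonneg sum_nonneg) auto
  ultimately show ?thesis by (simp add: expmart_def)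
qed

lemma expmart_measurable: "j \<le> n \<Longrightarrow> expmart \<theta> j \<in> borel_measurable (sample n)"
proof -
  assume j: "j \<le> n"
  have q[measurable]: "quad i \<in> borel_measurable (sample n)" if "i < j" for i
    using quad_measurable that j by simp
  have [measurable]: "ustat j \<in> borel_measurable (sample n)" by (rule ustat_measurable[OF j])
  have s: "(\<lambda>y. \<Sum>i<j. quad i y) \<in> borel_measurable (sample n)"
    by (intro borel_measurable_sum q) simp
  have p: "Measurable.pred (sample n) (\<lambda>y. \<forall>i\<in>{..<j}. \<theta>\<^sup>2 * D * quad i y \<le> 1)"
  proof (intro pred_intros_finite)
    fix i assume "i \<in> {..<j}"
    then have [measurable]: "quad i \<in> borel_measurable (sample n)" using q by simp
    show "Measurable.pred (sample n) (\<lambda>y. \<theta>\<^sup>2 * D * quad i y \<le> 1)" by measurable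
  qed simp
  show ?thesis
    unfolding expmart_def using s p by (intro measurable_If) (auto simp: Ball_def)
qed

text \<open>As long as the process is not stopped, \<open>H_sup\<close> keeps the exponent
  \<open>\<theta> * incr\<close> in \<open>[-1, 1]\<close>, where \<open>exp\<close> is below its
  quadratic bound. The linear term averages to zero and the quadratic one to at most the compensator
  newly subtracted in this step.\<close>

lemma expmart_le_1: "j \<le> n \<Longrightarrow> (\<integral>y. expmart \<theta> j y \<partial>sample n) \<le> 1"
proof (induction j)
  case 0
  interpret S: prob_space "sample n" by (rule prob_space_sample)
  show ?case by (simp add: expmart_def ustat_def S.prob_space)
next
  case (Suc j)
  interpret S: prob_space "sample n" by (rule prob_space_sample)
  note j = Suc_leD[OF Suc.prems]
  have "(\<integral>y. expmart \<theta> (Suc j) y \<partial>sample n) = (\<integral>y. (\<integral>z. expmart \<theta> (Suc j) (y(Suc j := z)) \<partial>P) \<partial>sample n)"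
    by (rule sample_resample(1)[OF expmart_measurable expmart_bound]) (use Suc in auto)
  also have "\<dots> \<le> (\<integral>y. expmart \<theta> j y \<partial>sample n)"
  proof (rule integral_mono')
    show "integrable (sample n) (expmart \<theta> j)"
      by (rule S.integrable_bounded[OF expmart_measurable[OF j] expmart_bound])
    fix y assume y: "y \<in> space (sample n)"
    note ii = incr_integral[OF y j]
    show "(\<integral>z. expmart \<theta> (Suc j) (y(Suc j := z)) \<partial>P) \<le> expmart \<theta> j y"
    \<comment> \<open>Whether the process is stopped at time \<open>Suc j\<close> depends on
      \<open>quad i\<close> with \<open>i \<le> j\<close> only, hence is decided before observation
      \<open>Suc j\<close>. Once stopped, the left side is zero.\<close>
    proof (cases "\<forall>i<Suc j. \<theta>\<^sup>2 * D * quad i y \<le> 1")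
      case False
      then have "expmart \<theta> (Suc j) (y(Suc j := z)) = 0" for z
        by (auto simp: expmart_def quad_update)
      then show ?thesis by (simp add: expmart_nonneg)
    next
      case True
      then have qj: "\<theta>\<^sup>2 * D * quad j y \<le> 1" by simp
      have step: "expmart \<theta> (Suc j) (y(Suc j := z)) = expmart \<theta> j y * exp (- (\<theta>\<^sup>2 * B * quad j y)) * exp (\<theta> * incr j y z)" for z
        using True by (simp add: expmart_def quad_update ustat_Suc ustat_update incr_update
            exp_add[symmetric] algebra_simps)
      have e: "exp (\<theta> * incr j y z) \<le> 1 + \<theta> * incr j y z + \<theta>\<^sup>2 * (incr j y z)\<^sup>2" for z
      proof -
        have "(\<theta> * incr j y z)\<^sup>2 \<le> \<theta>\<^sup>2 * (D * quad j y)"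
          unfolding power_mult_distrib incr_def quad_def by (intro mult_left_mono H_sup) simp
        also have "\<dots> \<le> 1\<^sup>2" using qj by (simp add: ac_simps)
        finally have "\<bar>\<theta> * incr j y z\<bar> \<le> 1" by (simp add: abs_square_le_1)
        from exp_le_quadratic[OF this] show ?thesis by (simp add: power_mult_distrib)
      qed
      have "(\<integral>z. exp (\<theta> * incr j y z) \<partial>P) \<le> (\<integral>z. 1 + \<theta> * incr j y z + \<theta>\<^sup>2 * (incr j y z)\<^sup>2 \<partial>P)"
        using ii e by (intro integral_mono') (auto intro: order_trans[OF exp_ge_zero])
      also have "\<dots> = 1 + \<theta>\<^sup>2 * (\<integral>z. (incr j y z)\<^sup>2 \<partial>P)"
        using ii by (simp add: prob_space)
      also have "\<dots> \<le> 1 + \<theta>\<^sup>2 * (B * quad j y)" using ii(4) by (simp add: mult_left_mono)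
      also have "\<dots> \<le> exp (\<theta>\<^sup>2 * B * quad j y)"
        using exp_ge_add_one_self[of "\<theta>\<^sup>2 * B * quad j y"] by (simp add: ac_simps)
      finally have "(\<integral>z. exp (\<theta> * incr j y z) \<partial>P) \<le> exp (\<theta>\<^sup>2 * B * quad j y)" .
      then have "expmart \<theta> j y * exp (- (\<theta>\<^sup>2 * B * quad j y)) * (\<integral>z. exp (\<theta> * incr j y z) \<partial>P)
        \<le> expmart \<theta> j y * exp (- (\<theta>\<^sup>2 * B * quad j y)) * exp (\<theta>\<^sup>2 * B * quad j y)"
        using expmart_nonneg by (intro mult_left_mono) auto
      also have "\<dots> = expmart \<theta> j y" by (simp add: mult.assoc exp_add[symmetric])
      finally show ?thesis unfolding step by simp
    qed
    show "0 \<le> expmart \<theta> j y" by (rule expmart_nonneg)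
  qed
  also have "\<dots> \<le> 1" by (rule Suc.IH[OF j])
  finally show ?case .
qed

text \<open>Outside this event the process is never stopped and the compensator has its typical
  size: the mean of the sum is at most \<open>D * n\<^sup>2 / 2\<close>, a quarter of the
  threshold.\<close>

definition bad_quad :: "nat \<Rightarrow> real \<Rightarrow> (nat \<Rightarrow> 'a) set" where
  "bad_quad n \<theta> = {y \<in> space (sample n). (\<Sum>i<n. quad i y) > 2 * D * (real n)\<^sup>2 \<or> (\<exists>i<n. \<theta>\<^sup>2 * D * quad i y > 1)}"

text \<open>The form \<open>quad i\<close> exceeds its diagonal part, at most \<open>n * D\<close>,
  only through \<open>2 * ustat i\<close>. Both ways to be bad therefore force a large
  \<open>ustat\<close>, which is rare by the second moment: Cauchy-Schwarz over \<open>i\<close>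
  handles the sum and gives the first term, a union bound over \<open>i\<close> gives the
  second.\<close>

lemma prob_bad_quad:
  assumes n: "n \<ge> 1" and \<theta>: "\<theta> \<noteq> 0" "2 * \<theta>\<^sup>2 * D\<^sup>2 * real n \<le> 1"
  shows "bad_quad n \<theta> \<in> sets (sample n)"
    and "measure (sample n) (bad_quad n \<theta>) \<le> 2 * B / D + 8 * \<theta> ^ 4 * (real n) ^ 3 * B * D ^ 3"
proof -
  interpret S: prob_space "sample n" by (rule prob_space_sample)
  have q: "quad i \<in> borel_measurable (sample n)" if "i < n" for i using quad_measurable that by simp
  have uu: "ustat i \<in> borel_measurable (sample n)" if "i < n" for i using ustat_measurable that by simp
  have s[measurable]: "(\<lambda>y. \<Sum>i<n. quad i y) \<in> borel_measurable (sample n)"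
    by (intro borel_measurable_sum q) simp
  have su[measurable]: "(\<lambda>y. \<Sum>i<n. ustat i y) \<in> borel_measurable (sample n)"
    by (intro borel_measurable_sum uu) simp
  define A where "A = {y \<in> space (sample n). (\<Sum>i<n. quad i y) > 2 * D * (real n)\<^sup>2}"
  define E where "E i = {y \<in> space (sample n). \<theta>\<^sup>2 * D * quad i y > 1}" for i
  have A: "A \<in> sets (sample n)" unfolding A_def by measurable
  have C: "E i \<in> sets (sample n)" if "i < n" for i
    unfolding E_def using q[OF that] by measurable
  have EU: "(\<Union>i\<in>{..<n}. E i) \<in> sets (sample n)"
    by (rule sets.finite_UN) (simp_all add: C)
  have eq: "bad_quad n \<theta> = A \<union> (\<Union>i\<in>{..<n}. E i)" by (auto simp: bad_quad_def A_def E_def)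
  show "bad_quad n \<theta> \<in> sets (sample n)" unfolding eq using A EU by (rule sets.Un)
  have nD: "0 < D * (real n)\<^sup>2" using n D_pos by simp
  have PA: "measure (sample n) A \<le> 2 * B / D"
  proof -
    let ?u = "\<lambda>y. (\<Sum>i<n. ustat i y)\<^sup>2"
    have ui: "integrable (sample n) ?u"
    proof (rule S.integrable_bounded)
      show "\<bar>?u y\<bar> \<le> (\<Sum>i<n. (real i)\<^sup>2 * D)\<^sup>2" for y
      proof -
        have "\<bar>\<Sum>i<n. ustat i y\<bar> \<le> (\<Sum>i<n. (real i)\<^sup>2 * D)"
          by (rule order_trans[OF sum_abs sum_mono[OF ustat_bound]])
        then show ?thesis by (metis abs_power2 abs_ge_zero power2_abs power_mono)
      qed
    qed measurable
    \<comment> \<open>The diagonal parts use up at most \<open>D * n\<^sup>2\<close> of the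
      threshold \<open>2 * D * n\<^sup>2\<close>; the rest must come from twice the sum of the
      \<open>ustat i\<close>.\<close>
    have "measure (sample n) A \<le> measure (sample n) {y \<in> space (sample n). (D * (real n)\<^sup>2 / 2)\<^sup>2 \<le> ?u y}"
    proof (rule S.finite_measure_mono)
      show "A \<subseteq> {y \<in> space (sample n). (D * (real n)\<^sup>2 / 2)\<^sup>2 \<le> ?u y}"
        unfolding A_def
      proof safe
        fix y assume a: "2 * D * (real n)\<^sup>2 < (\<Sum>i<n. quad i y)"
        have "(\<Sum>i<n. quad i y) \<le> (\<Sum>i<n. real n * D + 2 * ustat i y)"
        proof (rule sum_mono)
          fix i assume "i \<in> {..<n}"
          then have "real i * D \<le> real n * D" using D_pos by simp
          then show "quad i y \<le> real n * D + 2 * ustat i y" using quad_le[of i y] by linarith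
        qed
        also have "\<dots> = D * (real n)\<^sup>2 + 2 * (\<Sum>i<n. ustat i y)"
          by (simp add: sum.distrib sum_distrib_left[symmetric] power2_eq_square)
        finally have "D * (real n)\<^sup>2 / 2 \<le> (\<Sum>i<n. ustat i y)" using a by simp
        then show "(D * (real n)\<^sup>2 / 2)\<^sup>2 \<le> ?u y" using nD by (intro power_mono) auto
      qed
    qed measurable
    also have "\<dots> \<le> (\<integral>y. ?u y \<partial>sample n) / (D * (real n)\<^sup>2 / 2)\<^sup>2"
      by (rule S.markov_measure[OF ui]) (use n D_pos in auto)
    also have "(\<integral>y. ?u y \<partial>sample n) \<le> (\<integral>y. real n * (\<Sum>i<n. (ustat i y)\<^sup>2) \<partial>sample n)"
    proof (rule integral_mono')
      show "?u y \<le> real n * (\<Sum>i<n. (ustat i y)\<^sup>2)" for y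
        using Cauchy_Schwarz_ineq_sum[of "\<lambda>_. 1" "\<lambda>i. ustat i y" "{..<n}"] by simp
    qed (use integrable_ustat in \<open>auto intro!: integrable_mult_right Bochner_Integration.integrable_sum sum_nonneg mult_nonneg_nonneg\<close>)
    also have "\<dots> = real n * (\<Sum>i<n. \<integral>y. (ustat i y)\<^sup>2 \<partial>sample n)"
      using integrable_ustat by (simp add: Bochner_Integration.integral_sum)
    also have "\<dots> \<le> real n * (\<Sum>i<n. B * D * (real n)\<^sup>2 / 2)"
    proof (intro mult_left_mono sum_mono)
      fix i assume i: "i \<in> {..<n}"
      have "(\<integral>y. (ustat i y)\<^sup>2 \<partial>sample n) \<le> B * D * (real i)\<^sup>2 / 2"
        by (rule second_moment_ustat) (use i in auto)
      also have "\<dots> \<le> B * D * (real n)\<^sup>2 / 2"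
        using i B_pos D_pos by (intro divide_right_mono mult_left_mono power_mono) auto
      finally show "(\<integral>y. (ustat i y)\<^sup>2 \<partial>sample n) \<le> B * D * (real n)\<^sup>2 / 2" .
    qed simp
    also have "real n * (\<Sum>i<n. B * D * (real n)\<^sup>2 / 2) / (D * (real n)\<^sup>2 / 2)\<^sup>2 = 2 * B / D"
      using n D_pos by (simp add: power2_eq_square field_simps)
    finally show ?thesis using nD by (simp add: divide_right_mono)
  qed
  have PC: "measure (sample n) (E i) \<le> 8 * \<theta> ^ 4 * (real n)\<^sup>2 * B * D ^ 3" if i: "i < n" for i
  proof -
    have c: "0 < 1 / (4 * \<theta>\<^sup>2 * D)" using \<theta> D_pos by simp
    have "measure (sample n) (E i) \<le> measure (sample n) {y \<in> space (sample n). (1 / (4 * \<theta>\<^sup>2 * D))\<^sup>2 \<le> (ustat i y)\<^sup>2}"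
    proof (rule S.finite_measure_mono)
      show "E i \<subseteq> {y \<in> space (sample n). (1 / (4 * \<theta>\<^sup>2 * D))\<^sup>2 \<le> (ustat i y)\<^sup>2}"
        unfolding E_def
      proof safe
        fix y assume a: "1 < \<theta>\<^sup>2 * D * quad i y"
        have l: "0 < \<theta>\<^sup>2 * D" using \<theta> D_pos by simp
        have "\<theta>\<^sup>2 * D * quad i y \<le> \<theta>\<^sup>2 * D * (real n * D + 2 * ustat i y)"
        proof (rule mult_left_mono)
          have "real i * D \<le> real n * D" using i D_pos by simp
          then show "quad i y \<le> real n * D + 2 * ustat i y" using quad_le[of i y] by linarith
        qed (use l in simp)
        also have "\<dots> = \<theta>\<^sup>2 * D\<^sup>2 * real n + 2 * (\<theta>\<^sup>2 * D * ustat i y)"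
          by (simp add: power2_eq_square algebra_simps)
        \<comment> \<open>The second condition on \<open>\<theta>\<close> makes the diagonal part at
          most \<open>1 / 2\<close>, so the term with \<open>ustat i\<close> accounts for at least
          the other half.\<close>
        finally have "1 < \<theta>\<^sup>2 * D\<^sup>2 * real n + 2 * (\<theta>\<^sup>2 * D * ustat i y)" using a by linarith
        then have "1 / 4 \<le> \<theta>\<^sup>2 * D * ustat i y" using \<theta>(2) by linarith
        then have "1 / (4 * \<theta>\<^sup>2 * D) \<le> ustat i y"
          using l by (simp add: pos_divide_le_eq mult.assoc) (simp add: mult_ac)
        then show "(1 / (4 * \<theta>\<^sup>2 * D))\<^sup>2 \<le> (ustat i y)\<^sup>2" using c by (intro power_mono) auto
      qed
    qed (use uu[OF i] in measurable)
    also have "\<dots> \<le> (\<integral>y. (ustat i y)\<^sup>2 \<partial>sample n) / (1 / (4 * \<theta>\<^sup>2 * D))\<^sup>2"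
      by (rule S.markov_measure[OF integrable_ustat(2)]) (use i \<theta> D_pos in auto)
    also have "\<dots> \<le> (B * D * (real n)\<^sup>2 / 2) / (1 / (4 * \<theta>\<^sup>2 * D))\<^sup>2"
    proof (rule divide_right_mono)
      have "(\<integral>y. (ustat i y)\<^sup>2 \<partial>sample n) \<le> B * D * (real i)\<^sup>2 / 2"
        by (rule second_moment_ustat) (use i in auto)
      also have "\<dots> \<le> B * D * (real n)\<^sup>2 / 2"
        using i B_pos D_pos by (intro divide_right_mono mult_left_mono power_mono) auto
      finally show "(\<integral>y. (ustat i y)\<^sup>2 \<partial>sample n) \<le> B * D * (real n)\<^sup>2 / 2" .
    qed simp
    also have "\<dots> = 8 * \<theta> ^ 4 * (real n)\<^sup>2 * B * D ^ 3"
      using \<theta> D_pos by (simp add: power2_eq_square power3_eq_cube power4_eq_xxxx field_simps)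
    finally show ?thesis .
  qed
  have "measure (sample n) (bad_quad n \<theta>) \<le> measure (sample n) A + measure (sample n) (\<Union>i\<in>{..<n}. E i)"
    unfolding eq using A EU by (rule measure_Un_le)
  also have "measure (sample n) (\<Union>i\<in>{..<n}. E i) \<le> (\<Sum>i<n. measure (sample n) (E i))"
    using C by (intro S.finite_measure_subadditive_finite) auto
  also have "\<dots> \<le> (\<Sum>i<n. 8 * \<theta> ^ 4 * (real n)\<^sup>2 * B * D ^ 3)"
    by (intro sum_mono PC) simp
  also have "\<dots> = 8 * \<theta> ^ 4 * (real n) ^ 3 * B * D ^ 3"
    by (simp add: power2_eq_square power3_eq_cube)
  finally show "measure (sample n) (bad_quad n \<theta>) \<le> 2 * B / D + 8 * \<theta> ^ 4 * (real n) ^ 3 * B * D ^ 3"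
    using PA by simp
qed

text \<open>Off the bad event \<open>expmart\<close> is the plain exponential with a compensator of
  at most \<open>2 * \<theta>\<^sup>2 * B * D * n\<^sup>2\<close>, so Markov's inequality for a
  variable of mean at most \<open>1\<close> applies.\<close>

lemma ustat_tail_good:
  "measure (sample n) {y \<in> space (sample n). x \<le> \<theta> * ustat n y \<and> y \<notin> bad_quad n \<theta>}
     \<le> exp (- x + 2 * \<theta>\<^sup>2 * B * D * (real n)\<^sup>2)"
proof -
  interpret S: prob_space "sample n" by (rule prob_space_sample)
  have m[measurable]: "expmart \<theta> n \<in> borel_measurable (sample n)" by (rule expmart_measurable) simp
  have i: "integrable (sample n) (expmart \<theta> n)"
    by (rule S.integrable_bounded[OF m expmart_bound])
  let ?c = "exp (x - 2 * \<theta>\<^sup>2 * B * D * (real n)\<^sup>2)"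
  have "measure (sample n) {y \<in> space (sample n). x \<le> \<theta> * ustat n y \<and> y \<notin> bad_quad n \<theta>}
    \<le> measure (sample n) {y \<in> space (sample n). ?c \<le> expmart \<theta> n y}"
  proof (rule S.finite_measure_mono)
    show "{y \<in> space (sample n). x \<le> \<theta> * ustat n y \<and> y \<notin> bad_quad n \<theta>}
      \<subseteq> {y \<in> space (sample n). ?c \<le> expmart \<theta> n y}"
    proof safe
      fix y assume y: "y \<in> space (sample n)" and a: "x \<le> \<theta> * ustat n y" and b: "y \<notin> bad_quad n \<theta>"
      have s: "(\<Sum>i<n. quad i y) \<le> 2 * D * (real n)\<^sup>2" and q: "\<forall>i<n. \<theta>\<^sup>2 * D * quad i y \<le> 1"
        using b y unfolding bad_quad_def by (blast intro: leI)+
      have "\<theta>\<^sup>2 * B * (\<Sum>i<n. quad i y) \<le> \<theta>\<^sup>2 * B * (2 * D * (real n)\<^sup>2)"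
        using s B_pos by (intro mult_left_mono) auto
      then show "?c \<le> expmart \<theta> n y" using q a by (simp add: expmart_def algebra_simps)
    qed
  qed measurable
  also have "\<dots> \<le> (\<integral>y. expmart \<theta> n y \<partial>sample n) / ?c"
    by (rule S.markov_measure[OF i]) (auto simp: expmart_nonneg)
  also have "\<dots> \<le> 1 / ?c" by (intro divide_right_mono expmart_le_1) auto
  also have "\<dots> = exp (- x + 2 * \<theta>\<^sup>2 * B * D * (real n)\<^sup>2)"
    by (simp add: exp_minus[symmetric] inverse_eq_divide[symmetric])
  finally show ?thesis .
qed

text \<open>Deviations are measured in units of \<open>n * sqrt (B * D)\<close>, the size of the
  standard deviation. The first term is the Gaussian-type tail of both signs, the other two are the
  probability of the bad event. The theorem is applied with \<open>c = 4\<close> and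
  \<open>\<kappa>\<close> the square root of \<open>ln (ln n)\<close>.\<close>

theorem ustat_tail:
  assumes n: "n \<ge> 1" and k: "0 < \<kappa>" "2 * \<kappa>\<^sup>2 * D \<le> real n * B"
  shows "measure (sample n) {y \<in> space (sample n). \<bar>ustat n y\<bar> \<ge> c * \<kappa> * (real n * sqrt (B * D))}
     \<le> 2 * exp (- (c - 2) * \<kappa>\<^sup>2) + 2 * B / D + 8 * \<kappa> ^ 4 * D / (real n * B)"
proof -
  interpret S: prob_space "sample n" by (rule prob_space_sample)
  \<comment> \<open>With this choice the compensator bound equals
    \<open>2 * \<kappa>\<^sup>2\<close>, which is the origin of \<open>c - 2\<close> in the
    exponent.\<close>
  define \<theta> where "\<theta> = \<kappa> / (real n * sqrt (B * D))"
  have r: "0 < sqrt (B * D)" using B_pos D_pos by simp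
  have \<theta>: "0 < \<theta>" using k n r by (simp add: \<theta>_def)
  have \<theta>2: "\<theta>\<^sup>2 = \<kappa>\<^sup>2 / ((real n)\<^sup>2 * (B * D))"
    using B_pos D_pos by (simp add: \<theta>_def power_divide power_mult_distrib)
  have \<theta>4: "\<theta> ^ 4 = \<kappa> ^ 4 / ((real n) ^ 4 * (B * D)\<^sup>2)"
  proof -
    have "\<theta> ^ 4 = (\<theta>\<^sup>2)\<^sup>2" by (simp add: power_mult[symmetric])
    also have "\<dots> = \<kappa> ^ 4 / ((real n) ^ 4 * (B * D)\<^sup>2)"
      unfolding \<theta>2 by (simp add: power_divide power_mult_distrib power_mult[symmetric])
    finally show ?thesis .
  qed
  have cond: "2 * \<theta>\<^sup>2 * D\<^sup>2 * real n \<le> 1"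
    unfolding \<theta>2 using k(2) n B_pos D_pos by (simp add: power2_eq_square field_simps)
  \<comment> \<open>The bad event depends on \<open>\<theta>\<close> through its square, so one
    event serves the upper and the lower tail.\<close>
  have bad_eq: "bad_quad n (- \<theta>) = bad_quad n \<theta>" by (simp add: bad_quad_def)
  define E where "E s = {y \<in> space (sample n). c * \<kappa>\<^sup>2 \<le> s * ustat n y \<and> y \<notin> bad_quad n s}" for s
  have [measurable]: "ustat n \<in> borel_measurable (sample n)" by (rule ustat_measurable) simp
  have bm[measurable]: "bad_quad n \<theta> \<in> sets (sample n)" using prob_bad_quad(1)[OF n _ cond] \<theta> by simp
  have Em: "E s \<in> sets (sample n)" if "s = \<theta> \<or> s = - \<theta>" for s
  proof -
    have "bad_quad n s = bad_quad n \<theta>" using that bad_eq by auto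
    then show ?thesis unfolding E_def by simp
  qed
  have E1: "E \<theta> \<in> sets (sample n)" and E2: "E (- \<theta>) \<in> sets (sample n)"
    by (rule Em, simp)+
  have E12: "E \<theta> \<union> E (- \<theta>) \<in> sets (sample n)" and E12b: "E \<theta> \<union> E (- \<theta>) \<union> bad_quad n \<theta> \<in> sets (sample n)"
    using sets.Un[OF E1 E2] sets.Un[OF sets.Un[OF E1 E2] bm] by simp_all
  have tail: "measure (sample n) (E s) \<le> exp (- (c - 2) * \<kappa>\<^sup>2)" if "s = \<theta> \<or> s = - \<theta>" for s
  proof -
    have s2: "s\<^sup>2 = \<theta>\<^sup>2" using that by auto
    have "2 * s\<^sup>2 * B * D * (real n)\<^sup>2 = 2 * \<kappa>\<^sup>2"
      unfolding s2 \<theta>2 using n B_pos D_pos by (simp add: field_simps)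
    then have "- (c * \<kappa>\<^sup>2) + 2 * s\<^sup>2 * B * D * (real n)\<^sup>2 = - (c - 2) * \<kappa>\<^sup>2"
      by (simp only: left_diff_distrib mult_minus_left minus_diff_eq)
    then show ?thesis
      using ustat_tail_good[of n "c * \<kappa>\<^sup>2" s] unfolding E_def by (simp only:)
  qed
  have "measure (sample n) {y \<in> space (sample n). \<bar>ustat n y\<bar> \<ge> c * \<kappa> * (real n * sqrt (B * D))}
     \<le> measure (sample n) ((E \<theta> \<union> E (- \<theta>)) \<union> bad_quad n \<theta>)"
  proof (rule S.finite_measure_mono)
    show "{y \<in> space (sample n). \<bar>ustat n y\<bar> \<ge> c * \<kappa> * (real n * sqrt (B * D))} \<subseteq> (E \<theta> \<union> E (- \<theta>)) \<union> bad_quad n \<theta>"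
    proof
      fix y assume "y \<in> {y \<in> space (sample n). \<bar>ustat n y\<bar> \<ge> c * \<kappa> * (real n * sqrt (B * D))}"
      then have y: "y \<in> space (sample n)" and a: "c * \<kappa> * (real n * sqrt (B * D)) \<le> \<bar>ustat n y\<bar>" by auto
      have "\<theta> * (c * \<kappa> * (real n * sqrt (B * D))) \<le> \<theta> * \<bar>ustat n y\<bar>"
        using a \<theta> by (intro mult_left_mono) auto
      moreover have "\<theta> * (c * \<kappa> * (real n * sqrt (B * D))) = c * \<kappa>\<^sup>2"
        using n B_pos D_pos by (simp add: \<theta>_def power2_eq_square)
      ultimately have "c * \<kappa>\<^sup>2 \<le> \<theta> * ustat n y \<or> c * \<kappa>\<^sup>2 \<le> - \<theta> * ustat n y"
        by (auto simp: abs_if split: if_splits)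
      then show "y \<in> (E \<theta> \<union> E (- \<theta>)) \<union> bad_quad n \<theta>" using y bad_eq by (auto simp: E_def)
    qed
  qed (rule E12b)
  also have "\<dots> \<le> measure (sample n) (E \<theta>) + measure (sample n) (E (- \<theta>)) + measure (sample n) (bad_quad n \<theta>)"
    by (rule order_trans[OF measure_Un_le[OF E12 bm] add_right_mono[OF measure_Un_le[OF E1 E2]]])
  also have "\<dots> \<le> exp (- (c - 2) * \<kappa>\<^sup>2) + exp (- (c - 2) * \<kappa>\<^sup>2) + (2 * B / D + 8 * \<theta> ^ 4 * (real n) ^ 3 * B * D ^ 3)"
    using \<theta> by (intro add_mono tail prob_bad_quad(2)[OF n _ cond]) auto
  also have "8 * \<theta> ^ 4 * (real n) ^ 3 * B * D ^ 3 = 8 * \<kappa> ^ 4 * D / (real n * B)"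
    unfolding \<theta>4 using n B_pos D_pos by (simp add: power2_eq_square power3_eq_cube power4_eq_xxxx field_simps)
  finally show ?thesis by simp
qed

end

section \<open>Observations and band-limited functions\<close>

lemma is_densityD:
  assumes "is_density f"
  shows "f \<in> borel_measurable borel" "0 \<le> f x" "integrable lborel f" "integral\<^sup>L lborel f = 1"
    "integrable lborel (\<lambda>x. complex_of_real (f x))"
  using assms by (auto simp: is_density_def)

lemma norm_fourier_le_1: "is_density f \<Longrightarrow> cmod (fourier f u) \<le> 1"
  using norm_cft_le[of "\<lambda>x. complex_of_real (f x)" u] is_densityD[of f]
  by (simp add: fourier_eq_cft)

lemma isCont_fourier: "is_density f \<Longrightarrow> isCont (fourier f) u"
  unfolding fourier_eq_cft by (rule isCont_cft) (rule is_densityD)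

lemma borel_measurable_fourier: "is_density f \<Longrightarrow> fourier f \<in> borel_measurable borel"
  unfolding fourier_eq_cft by (rule borel_measurable_cft) (rule is_densityD)

lemma fourier_uminus: "fourier f (- u) = cnj (fourier f u)"
proof -
  have "cnj (fourier f u) = (LBINT x. cnj (iexp (u * x) * complex_of_real (f x)))"
    unfolding fourier_def by (rule Bochner_Integration.integral_cnj[symmetric])
  also have "\<dots> = fourier f (- u)"
    unfolding fourier_def by (simp add: exp_cnj)
  finally show ?thesis ..
qed

abbreviation obs_law :: "(real \<Rightarrow> real) \<Rightarrow> (real \<Rightarrow> real) \<Rightarrow> real measure" where
  "obs_law g f \<equiv> convolution (density lborel (\<lambda>x. ennreal (f x))) (density lborel (\<lambda>x. ennreal (g x)))"

lemma prob_space_density_lborel: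
  assumes "is_density f"
  shows "prob_space (density lborel (\<lambda>x. ennreal (f x)))"
proof
  note d = is_densityD[OF assms]
  have "(\<integral>\<^sup>+x. ennreal (f x) \<partial>lborel) = 1"
    using d by (subst nn_integral_eq_integral) auto
  then show "emeasure (density lborel (\<lambda>x. ennreal (f x))) (space (density lborel (\<lambda>x. ennreal (f x)))) = 1"
    using d(1) by (simp add: emeasure_density)
qed

lemma prob_space_obs_law:
  assumes "is_density f" "is_density g"
  shows "prob_space (obs_law g f)"
proof -
  interpret F: prob_space "density lborel (\<lambda>x. ennreal (f x))" by (rule prob_space_density_lborel) fact
  interpret G: prob_space "density lborel (\<lambda>x. ennreal (g x))" by (rule prob_space_density_lborel) fact
  interpret FG: pair_prob_space "density lborel (\<lambda>x. ennreal (f x))" "density lborel (\<lambda>x. ennreal (g x))" ..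
  show ?thesis unfolding convolution_def by (rule FG.prob_space_distr) measurable
qed

lemma sets_obs_law [measurable_cong, simp]: "sets (obs_law g f) = sets borel"
  and space_obs_law [simp]: "space (obs_law g f) = UNIV"
  by (simp_all add: convolution_def)

lemma char_obs_law:
  assumes f: "is_density f" and g: "is_density g"
  shows "(\<integral>y. iexp (u * y) \<partial>obs_law g f) = fourier f u * fourier g u"
proof -
  let ?F = "density lborel (\<lambda>x. ennreal (f x))" and ?G = "density lborel (\<lambda>x. ennreal (g x))"
  interpret F: prob_space ?F by (rule prob_space_density_lborel) fact
  interpret G: prob_space ?G by (rule prob_space_density_lborel) fact
  interpret FG: pair_prob_space ?F ?G ..
  have F': "(\<integral>x. iexp (u * x) \<partial>density lborel (\<lambda>x. ennreal (f x))) = fourier f u" if "is_density f" for f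
    unfolding fourier_def using is_densityD[OF that]
    by (subst integral_density) (auto simp: scaleR_conv_of_real mult.commute)
  have m[measurable]: "(\<lambda>x. iexp (u * x)) \<in> borel_measurable borel" by measurable
  have "(\<integral>y. iexp (u * y) \<partial>obs_law g f) = (\<integral>z. iexp (u * (fst z + snd z)) \<partial>(?F \<Otimes>\<^sub>M ?G))"
    unfolding convolution_def by (subst integral_distr) (auto simp: case_prod_beta')
  also have "\<dots> = (\<integral>z. (\<lambda>(x, y). iexp (u * x) * iexp (u * y)) z \<partial>(?F \<Otimes>\<^sub>M ?G))"
    by (intro Bochner_Integration.integral_cong refl)
       (auto simp: exp_add[symmetric] algebra_simps)
  also have "\<dots> = (\<integral>x. (\<integral>y. iexp (u * x) * iexp (u * y) \<partial>?G) \<partial>?F)"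
  proof (subst FG.integral_fst'[symmetric])
    show "integrable (?F \<Otimes>\<^sub>M ?G) (\<lambda>(x, y). iexp (u * x) * iexp (u * y))"
      by (rule FG.integrable_const_bound[where B=1]) (auto simp: norm_mult)
  qed simp
  also have "\<dots> = fourier f u * fourier g u"
    by (simp only: integral_mult_right_zero integral_mult_left_zero F'[OF f] F'[OF g])
  finally show ?thesis .
qed

lemma norm_integral_le_nn_integral:
  fixes F :: "'a \<Rightarrow> complex"
  shows "ennreal (cmod (\<integral>x. F x \<partial>M)) \<le> (\<integral>\<^sup>+x. ennreal (cmod (F x)) \<partial>M)"
proof (cases "integrable M F")
  case True
  then show ?thesis by (rule integral_norm_bound_ennreal)
qed (simp add: not_integrable_integral_eq)

text \<open>Expanding the square and integrating first over \<open>P\<close> leaves a quadratic form with kernel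
  \<open>char P (u - v)\<close>, which Schur's test bounds by the integral of \<open>\<bar>char P\<bar>\<close>.\<close>

lemma transform_second_moment:
  fixes A :: "real \<Rightarrow> complex"
  assumes P: "prob_space P" and sP[measurable_cong]: "sets P = sets borel"
    and A: "integrable lborel A" and A2: "integrable lborel (\<lambda>u. (cmod (A u))\<^sup>2)"
    and k: "\<And>u. cmod (\<integral>y. iexp (u * y) \<partial>P) \<le> k u" and ki: "integrable lborel k"
  shows "(\<integral>y. (cmod (cft A y))\<^sup>2 \<partial>P) \<le> (LBINT u. k u) * (LBINT u. (cmod (A u))\<^sup>2)"
proof -
  interpret P: prob_space P by fact
  interpret pair_sigma_finite P "lborel :: real measure" ..
  have Am[measurable]: "A \<in> borel_measurable borel" using borel_measurable_integrable[OF A] by simp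
  have km[measurable]: "k \<in> borel_measurable borel" using borel_measurable_integrable[OF ki] by simp
  have cm[measurable]: "cft A \<in> borel_measurable borel" by (rule borel_measurable_cft[OF A])
  have k0: "0 \<le> k u" for u using k order_trans norm_ge_zero by blast
  let ?b = "\<integral>x. cmod (A x) \<partial>lborel"
  have cb: "cmod (cft A y) \<le> ?b" for y by (rule norm_cft_le[OF A])
  \<comment> \<open>One exchange of integrals for both uses: \<open>c = - 1\<close> and
    \<open>d = u\<close> for the inner transform, \<open>c = 1\<close> and \<open>d = 0\<close> for
    the outer one.\<close>
  have fub: "(\<integral>y. (LBINT u. iexp (y * (c * u + d)) * B u * w y) \<partial>P)
     = (\<integral>u. (\<integral>y. iexp (y * (c * u + d)) * B u * w y \<partial>P) \<partial>lborel)"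
    if B: "integrable lborel B" and [measurable]: "w \<in> borel_measurable borel"
      and wb: "\<And>y. cmod (w y) \<le> b" for c d b and B w :: "real \<Rightarrow> complex"
  proof -
    have [measurable]: "B \<in> borel_measurable borel" using borel_measurable_integrable[OF B] by simp
    have b: "0 \<le> b" using wb order_trans norm_ge_zero by blast
    have "integrable (P \<Otimes>\<^sub>M lborel) (\<lambda>(y, u). iexp (y * (c * u + d)) * B u * w y)"
    proof (rule Bochner_Integration.integrable_bound)
      show "integrable (P \<Otimes>\<^sub>M lborel) (\<lambda>(y, u). complex_of_real b * B u)"
      proof (rule Fubini_integrable)
        show "AE y in P. integrable lborel (\<lambda>u. case (y, u) of (y, u) \<Rightarrow> complex_of_real b * B u)"
          using B by simp
        show "integrable P (\<lambda>y. LBINT u. norm (case (y, u) of (y, u) \<Rightarrow> complex_of_real b * B u))"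
          by simp
      qed measurable
      show "AE x in P \<Otimes>\<^sub>M lborel. norm (case x of (y, u) \<Rightarrow> iexp (y * (c * u + d)) * B u * w y)
          \<le> norm (case x of (y, u) \<Rightarrow> complex_of_real b * B u)"
      proof (rule AE_I2, clarify)
        fix y u
        have "norm (iexp (y * (c * u + d)) * B u * w y) = cmod (B u) * cmod (w y)"
          by (simp add: norm_mult norm_exp_i_times del: of_real_mult of_real_add)
        also have "\<dots> \<le> cmod (B u) * b" by (intro mult_left_mono wb) simp
        finally show "norm (iexp (y * (c * u + d)) * B u * w y) \<le> norm (complex_of_real b * B u)"
          using b by (simp add: norm_mult mult.commute)
      qed
    qed measurable
    then show ?thesis by (rule Fubini_integral[symmetric])
  qed
  let ?\<chi> = "\<lambda>u. \<integral>y. iexp (u * y) \<partial>P"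
  have cA: "integrable lborel (\<lambda>v. cnj (A v))" using A by simp
  have inner: "(\<integral>y. iexp (y * u) * cnj (cft A y) \<partial>P) = (LBINT v. cnj (A v) * ?\<chi> (u - v))" for u
  proof -
    have "(\<integral>y. iexp (y * u) * cnj (cft A y) \<partial>P) = (\<integral>y. (LBINT v. iexp (y * ((-1) * v + u)) * cnj (A v) * 1) \<partial>P)"
    proof (rule Bochner_Integration.integral_cong[OF refl])
      fix y
      have "iexp (y * u) * cnj (cft A y) = (LBINT v. iexp (y * u) * cnj (iexp (y * v) * A v))"
        unfolding cft_def by (simp only: integral_mult_right_zero Bochner_Integration.integral_cnj)
      also have "\<dots> = (LBINT v. iexp (y * ((-1) * v + u)) * cnj (A v) * 1)"
      proof (rule Bochner_Integration.integral_cong[OF refl])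
        fix v
        have "iexp (y * u) * cnj (iexp (y * v)) = iexp (y * ((-1) * v + u))"
          by (simp add: exp_cnj exp_add[symmetric] algebra_simps)
        then show "iexp (y * u) * cnj (iexp (y * v) * A v) = iexp (y * ((-1) * v + u)) * cnj (A v) * 1"
          by (simp only: complex_cnj_mult mult.assoc[symmetric] mult_1_right)
      qed
      finally show "iexp (y * u) * cnj (cft A y) = (LBINT v. iexp (y * ((-1) * v + u)) * cnj (A v) * 1)" .
    qed
    also have "\<dots> = (\<integral>v. (\<integral>y. iexp (y * ((-1) * v + u)) * cnj (A v) * 1 \<partial>P) \<partial>lborel)"
    proof (rule fub[OF cA])
      show "cmod ((1 :: complex)) \<le> 1" by simp
    qed simp
    also have "\<dots> = (LBINT v. cnj (A v) * ?\<chi> (u - v))"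
    proof (rule Bochner_Integration.integral_cong[OF refl])
      fix v
      have e: "y * ((-1) * v + u) = (u - v) * y" for y by (simp add: algebra_simps)
      show "(\<integral>y. iexp (y * ((-1) * v + u)) * cnj (A v) * 1 \<partial>P) = cnj (A v) * ?\<chi> (u - v)"
        unfolding e mult_1_right by (rule trans[OF integral_mult_left_zero mult.commute])
    qed
    finally show ?thesis .
  qed
  have "complex_of_real (\<integral>y. (cmod (cft A y))\<^sup>2 \<partial>P) = (\<integral>y. cft A y * cnj (cft A y) \<partial>P)"
  proof -
    have "integrable P (\<lambda>y. (cmod (cft A y))\<^sup>2)"
      by (rule P.integrable_bounded[where c="?b\<^sup>2"]) (use cb in \<open>auto intro!: power_mono\<close>)
    then have "complex_of_real (\<integral>y. (cmod (cft A y))\<^sup>2 \<partial>P) = (\<integral>y. complex_of_real ((cmod (cft A y))\<^sup>2) \<partial>P)"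
      by (simp only: integral_of_real)
    then show ?thesis by (simp only: complex_norm_square)
  qed
  also have "\<dots> = (\<integral>y. (LBINT u. iexp (y * (1 * u + 0)) * A u * cnj (cft A y)) \<partial>P)"
    unfolding cft_def by (subst integral_mult_left_zero[symmetric]) simp
  also have "\<dots> = (\<integral>u. (\<integral>y. iexp (y * (1 * u + 0)) * A u * cnj (cft A y) \<partial>P) \<partial>lborel)"
  proof (rule fub[OF A])
    show "cmod (cnj (cft A y)) \<le> ?b" for y using cb by simp
  qed measurable
  also have "\<dots> = (\<integral>u. A u * (\<integral>y. iexp (y * u) * cnj (cft A y) \<partial>P) \<partial>lborel)"
    by (subst integral_mult_right_zero[symmetric]) (simp add: ac_simps)
  also have "\<dots> = (\<integral>u. A u * (LBINT v. cnj (A v) * ?\<chi> (u - v)) \<partial>lborel)"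
    unfolding inner ..
  finally have eq: "complex_of_real (\<integral>y. (cmod (cft A y))\<^sup>2 \<partial>P) = (\<integral>u. A u * (LBINT v. cnj (A v) * ?\<chi> (u - v)) \<partial>lborel)" .
  let ?s = "\<integral>u. (cmod (A u))\<^sup>2 \<partial>lborel" and ?K = "\<integral>u. k u \<partial>lborel"
  have nk: "(\<integral>\<^sup>+v. ennreal (k (u - v)) \<partial>lborel) = ennreal ?K" for u
    using nn_integral_real_affine[of "\<lambda>v. ennreal (k v)" "-1" u] k0 ki
    by (simp add: nn_integral_eq_integral)
  have nk': "(\<integral>\<^sup>+u. ennreal (k (u - v)) \<partial>lborel) = ennreal ?K" for v
    using nn_integral_real_affine[of "\<lambda>v. ennreal (k v)" 1 "-v"] k0 ki
    by (simp add: nn_integral_eq_integral)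
  have nA: "(\<integral>\<^sup>+u. ennreal ((cmod (A u))\<^sup>2) \<partial>lborel) = ennreal ?s"
    using A2 by (simp add: nn_integral_eq_integral)
  have K0: "0 \<le> ?K" using k0 by simp
  have "ennreal (cmod (\<integral>u. A u * (LBINT v. cnj (A v) * ?\<chi> (u - v)) \<partial>lborel))
    \<le> (\<integral>\<^sup>+u. ennreal (cmod (A u * (LBINT v. cnj (A v) * ?\<chi> (u - v)))) \<partial>lborel)"
    by (rule norm_integral_le_nn_integral) 
  \<comment> \<open>The product \<open>cmod (A u) * cmod (A v)\<close> is replaced by half the sum
    of the squares. In each half one variable occurs in \<open>k (u - v)\<close> alone and
    integrates to the total mass of \<open>k\<close>.\<close>
  also have "\<dots> \<le> (\<integral>\<^sup>+u. (\<integral>\<^sup>+v. ennreal ((cmod (A u))\<^sup>2 / 2 * k (u - v)) + ennreal ((cmod (A v))\<^sup>2 / 2 * k (u - v)) \<partial>lborel) \<partial>lborel)"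
  proof (rule nn_integral_mono)
    fix u
    have "ennreal (cmod (A u * (LBINT v. cnj (A v) * ?\<chi> (u - v))))
      = ennreal (cmod (LBINT v. A u * (cnj (A v) * ?\<chi> (u - v))))"
      by (simp only: integral_mult_right_zero)
    also have "\<dots> \<le> (\<integral>\<^sup>+v. ennreal (cmod (A u * (cnj (A v) * ?\<chi> (u - v)))) \<partial>lborel)"
      by (rule norm_integral_le_nn_integral)
    also have "\<dots> \<le> (\<integral>\<^sup>+v. ennreal ((cmod (A u))\<^sup>2 / 2 * k (u - v)) + ennreal ((cmod (A v))\<^sup>2 / 2 * k (u - v)) \<partial>lborel)"
    proof (rule nn_integral_mono)
      fix v
      have "cmod (A u * (cnj (A v) * ?\<chi> (u - v))) = (cmod (A u) * cmod (A v)) * cmod (?\<chi> (u - v))"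
        by (simp add: norm_mult)
      also have "\<dots> \<le> (cmod (A u) * cmod (A v)) * k (u - v)" by (intro mult_left_mono k) simp
      also have "\<dots> \<le> ((cmod (A u))\<^sup>2 / 2 + (cmod (A v))\<^sup>2 / 2) * k (u - v)"
        using sum_squares_bound[of "cmod (A u)" "cmod (A v)"] k0 by (intro mult_right_mono) auto
      finally have "ennreal (cmod (A u * (cnj (A v) * ?\<chi> (u - v))))
          \<le> ennreal ((cmod (A u))\<^sup>2 / 2 * k (u - v) + (cmod (A v))\<^sup>2 / 2 * k (u - v))"
        unfolding distrib_right by (rule ennreal_leI)
      also have "\<dots> = ennreal ((cmod (A u))\<^sup>2 / 2 * k (u - v)) + ennreal ((cmod (A v))\<^sup>2 / 2 * k (u - v))"
        by (rule ennreal_plus) (use k0 in auto)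
      finally show "ennreal (cmod (A u * (cnj (A v) * ?\<chi> (u - v))))
          \<le> ennreal ((cmod (A u))\<^sup>2 / 2 * k (u - v)) + ennreal ((cmod (A v))\<^sup>2 / 2 * k (u - v))" .
    qed
    finally show "ennreal (cmod (A u * (LBINT v. cnj (A v) * ?\<chi> (u - v))))
      \<le> (\<integral>\<^sup>+v. ennreal ((cmod (A u))\<^sup>2 / 2 * k (u - v)) + ennreal ((cmod (A v))\<^sup>2 / 2 * k (u - v)) \<partial>lborel)" .
  qed
  also have "\<dots> = (\<integral>\<^sup>+u. (\<integral>\<^sup>+v. ennreal ((cmod (A u))\<^sup>2 / 2 * k (u - v)) \<partial>lborel) \<partial>lborel)
      + (\<integral>\<^sup>+u. (\<integral>\<^sup>+v. ennreal ((cmod (A v))\<^sup>2 / 2 * k (u - v)) \<partial>lborel) \<partial>lborel)"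
    by (simp add: nn_integral_add)
  also have "(\<integral>\<^sup>+u. (\<integral>\<^sup>+v. ennreal ((cmod (A v))\<^sup>2 / 2 * k (u - v)) \<partial>lborel) \<partial>lborel)
      = (\<integral>\<^sup>+v. (\<integral>\<^sup>+u. ennreal ((cmod (A v))\<^sup>2 / 2 * k (u - v)) \<partial>lborel) \<partial>lborel)"
    by (rule lborel_pair.Fubini') measurable
  also have "(\<integral>\<^sup>+u. (\<integral>\<^sup>+v. ennreal ((cmod (A u))\<^sup>2 / 2 * k (u - v)) \<partial>lborel) \<partial>lborel)
      + (\<integral>\<^sup>+v. (\<integral>\<^sup>+u. ennreal ((cmod (A v))\<^sup>2 / 2 * k (u - v)) \<partial>lborel) \<partial>lborel)
      = (\<integral>\<^sup>+u. ennreal ((cmod (A u))\<^sup>2) * ennreal (?K / 2) \<partial>lborel) + (\<integral>\<^sup>+u. ennreal ((cmod (A u))\<^sup>2) * ennreal (?K / 2) \<partial>lborel)"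
  proof -
    have e: "ennreal ((cmod (A u))\<^sup>2 / 2) * ennreal ?K = ennreal ((cmod (A u))\<^sup>2) * ennreal (?K / 2)" for u
      using K0 by (simp add: ennreal_mult''[symmetric])
    have 1: "(\<integral>\<^sup>+v. ennreal ((cmod (A u))\<^sup>2 / 2 * k (u - v)) \<partial>lborel) = ennreal ((cmod (A u))\<^sup>2) * ennreal (?K / 2)" for u
    proof -
      have "(\<integral>\<^sup>+v. ennreal ((cmod (A u))\<^sup>2 / 2 * k (u - v)) \<partial>lborel) = (\<integral>\<^sup>+v. ennreal ((cmod (A u))\<^sup>2 / 2) * ennreal (k (u - v)) \<partial>lborel)"
        by (intro nn_integral_cong ennreal_mult') simp
      also have "\<dots> = ennreal ((cmod (A u))\<^sup>2 / 2) * ennreal ?K"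
        by (subst nn_integral_cmult) (auto simp: nk)
      finally show ?thesis using e by simp
    qed
    have 2: "(\<integral>\<^sup>+u. ennreal ((cmod (A v))\<^sup>2 / 2 * k (u - v)) \<partial>lborel) = ennreal ((cmod (A v))\<^sup>2) * ennreal (?K / 2)" for v
    proof -
      have "(\<integral>\<^sup>+u. ennreal ((cmod (A v))\<^sup>2 / 2 * k (u - v)) \<partial>lborel) = (\<integral>\<^sup>+u. ennreal ((cmod (A v))\<^sup>2 / 2) * ennreal (k (u - v)) \<partial>lborel)"
        by (intro nn_integral_cong ennreal_mult') simp
      also have "\<dots> = ennreal ((cmod (A v))\<^sup>2 / 2) * ennreal ?K"
        by (subst nn_integral_cmult) (auto simp: nk')
      finally show ?thesis using e by simp
    qed
    show ?thesis unfolding 1 2 ..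
  qed
  also have "\<dots> = ennreal (?K * ?s)"
  proof -
    have "(\<integral>\<^sup>+u. ennreal ((cmod (A u))\<^sup>2) * ennreal (?K / 2) \<partial>lborel) = ennreal ?s * ennreal (?K / 2)"
      by (subst nn_integral_multc) (auto simp: nA)
    then show ?thesis
      using K0 by (simp add: ennreal_mult''[symmetric] ennreal_plus[symmetric] mult.commute del: ennreal_plus)
  qed
  finally have "cmod (\<integral>u. A u * (LBINT v. cnj (A v) * ?\<chi> (u - v)) \<partial>lborel) \<le> ?K * ?s"
    using K0 by (simp add: ennreal_le_iff)
  then show ?thesis
    unfolding eq[symmetric] by simp
qed

text \<open>These frequency-side functions are closed under sums, products and conjugation and are
  always integrable and square integrable, so the bilinear algebra below carries no further
  integrability conditions.\<close>

definition bandlim :: "real \<Rightarrow> (real \<Rightarrow> complex) \<Rightarrow> bool" where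
  "bandlim R A \<longleftrightarrow> A \<in> borel_measurable borel \<and> (\<exists>b. \<forall>u. cmod (A u) \<le> b) \<and> (\<forall>u. R < \<bar>u\<bar> \<longrightarrow> A u = 0)"

lemma bandlimD:
  assumes "bandlim R A"
  shows "A \<in> borel_measurable borel" "R < \<bar>u\<bar> \<Longrightarrow> A u = 0"
  using assms by (auto simp: bandlim_def)

lemma bandlim_integrable: 
  assumes "bandlim R A"
  shows "integrable lborel A"
proof -
  obtain b where b: "\<And>u. cmod (A u) \<le> b" using assms by (auto simp: bandlim_def)
  have b0: "0 \<le> b" using b order_trans norm_ge_zero by blast
  show ?thesis
  proof (rule Bochner_Integration.integrable_bound)
    show "integrable lborel (\<lambda>u. indicator {- R..R} u * b :: real)"
      by (intro integrable_mult_left integrable_real_indicator) (simp_all add: emeasure_lborel_Icc_eq)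
    show "AE u in lborel. norm (A u) \<le> norm (indicator {- R..R} u * b)"
      using b b0 bandlimD(2)[OF assms] by (intro AE_I2) (auto simp: indicator_def abs_le_iff not_le)
  qed (use bandlimD(1)[OF assms] in simp)
qed

lemma bandlim_mult_bounded:
  assumes A: "bandlim R A" and [measurable]: "w \<in> borel_measurable borel" and w: "\<And>u. cmod (w u) \<le> c"
  shows "bandlim R (\<lambda>u. A u * w u)"
proof -
  obtain b where b: "\<And>u. cmod (A u) \<le> b" using A by (auto simp: bandlim_def)
  have "cmod (A u * w u) \<le> b * c" for u
    unfolding norm_mult using b[of u] w[of u] by (intro mult_mono) (auto intro: order_trans[OF norm_ge_zero])
  moreover have "(\<lambda>u. A u * w u) \<in> borel_measurable borel" using bandlimD(1)[OF A] by measurable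
  ultimately show ?thesis using bandlimD(2)[OF A] unfolding bandlim_def by auto
qed

lemma bandlim_cnj: "bandlim R A \<Longrightarrow> bandlim R (\<lambda>u. cnj (A u))"
  by (auto simp: bandlim_def intro: borel_measurable_cnj)

lemma bandlim_mult: "bandlim R A \<Longrightarrow> bandlim R B \<Longrightarrow> bandlim R (\<lambda>u. A u * B u)"
  using bandlim_mult_bounded by (metis bandlim_def)

lemma bandlim_add: "bandlim R A \<Longrightarrow> bandlim R B \<Longrightarrow> bandlim R (\<lambda>u. A u + B u)"
proof -
  assume A: "bandlim R A" and B: "bandlim R B"
  obtain b c where b: "\<And>u. cmod (A u) \<le> b" and c: "\<And>u. cmod (B u) \<le> c" using A B by (auto simp: bandlim_def)
  have "cmod (A u + B u) \<le> b + c" for u using norm_triangle_mono[OF b c] .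
  moreover have "(\<lambda>u. A u + B u) \<in> borel_measurable borel" using bandlimD(1)[OF A] bandlimD(1)[OF B] by measurable
  ultimately show "bandlim R (\<lambda>u. A u + B u)" using A B unfolding bandlim_def by auto
qed

lemma bandlim_cmult: "bandlim R A \<Longrightarrow> bandlim R (\<lambda>u. c * A u)"
  using bandlim_mult_bounded[of R A "\<lambda>_. c" "cmod c"] by (simp add: mult.commute)

lemma bandlim_diff: "bandlim R A \<Longrightarrow> bandlim R B \<Longrightarrow> bandlim R (\<lambda>u. A u - B u)"
  using bandlim_add[OF _ bandlim_cmult[of R B "-1"], of A] by simp

lemma bandlim_sum: "(\<And>k. k \<in> I \<Longrightarrow> bandlim R (A k)) \<Longrightarrow> bandlim R (\<lambda>u. \<Sum>k\<in>I. A k u)"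
proof (induction I rule: infinite_finite_induct)
  case (insert k I)
  then show ?case by (simp add: bandlim_add)
qed (auto simp: bandlim_def)

lemma bandlim_norm_square: "bandlim R A \<Longrightarrow> integrable lborel (\<lambda>u. (cmod (A u))\<^sup>2)"
  using integrable_norm[OF bandlim_integrable[OF bandlim_mult[of R A A]]]
  by (simp add: norm_mult power2_eq_square)

lemma bandlim_pair: "bandlim R A \<Longrightarrow> bandlim R B \<Longrightarrow> integrable lborel (\<lambda>u. A u * cnj (B u))"
  by (intro bandlim_integrable[of R] bandlim_mult bandlim_cnj)

text \<open>The real part of the inner product of the functions whose transforms are
  \<open>A\<close> and \<open>B\<close>, by Parseval. Taking the real part makes it symmetric and
  bilinear over the reals; the inner products needed for the test statistic are real anyway by
  Hermitian symmetry.\<close>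

definition pr :: "(real \<Rightarrow> complex) \<Rightarrow> (real \<Rightarrow> complex) \<Rightarrow> real" where
  "pr A B = Re (LBINT u. A u * cnj (B u)) / (2 * pi)"

lemma pr_sym: "pr A B = pr B A"
proof -
  have "(LBINT u. B u * cnj (A u)) = (LBINT u. cnj (A u * cnj (B u)))" by (simp add: mult.commute)
  also have "\<dots> = cnj (LBINT u. A u * cnj (B u))" by (rule Bochner_Integration.integral_cnj)
  finally show ?thesis by (simp add: pr_def)
qed

lemma pr_add_left:
  assumes "bandlim R A" "bandlim R B" "bandlim R C"
  shows "pr (\<lambda>u. A u + B u) C = pr A C + pr B C"
  using bandlim_pair[OF assms(1,3)] bandlim_pair[OF assms(2,3)]
  by (simp add: pr_def distrib_right add_divide_distrib)

lemma pr_add_right: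
  assumes "bandlim R A" "bandlim R B" "bandlim R C"
  shows "pr C (\<lambda>u. A u + B u) = pr C A + pr C B"
  using pr_add_left[OF assms] by (simp add: pr_sym)

lemma pr_sum_left:
  assumes "\<And>k. k \<in> I \<Longrightarrow> bandlim R (A k)" "bandlim R C"
  shows "pr (\<lambda>u. \<Sum>k\<in>I. A k u) C = (\<Sum>k\<in>I. pr (A k) C)"
  using assms(1)
proof (induction I rule: infinite_finite_induct)
  case (insert k I)
  then show ?case
    using pr_add_left[OF _ bandlim_sum assms(2), of "A k" I A] by simp
qed (auto simp: pr_def)

lemma pr_scale_left: "pr (\<lambda>u. complex_of_real c * A u) B = c * pr A B"
proof -
  have "(LBINT u. complex_of_real c * A u * cnj (B u)) = complex_of_real c * (LBINT u. A u * cnj (B u))"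
    by (simp only: mult.assoc integral_mult_right_zero)
  then show ?thesis by (simp add: pr_def)
qed

lemma pr_self:
  assumes "bandlim R A"
  shows "pr A A = (LBINT u. (cmod (A u))\<^sup>2) / (2 * pi)"
proof -
  have "(LBINT u. A u * cnj (A u)) = (LBINT u. complex_of_real ((cmod (A u))\<^sup>2))"
    by (simp only: complex_norm_square)
  also have "\<dots> = complex_of_real (LBINT u. (cmod (A u))\<^sup>2)"
    by (rule integral_of_real[OF bandlim_norm_square[OF assms]])
  finally show ?thesis by (simp add: pr_def)
qed

lemma pr_self_nonneg: "bandlim R A \<Longrightarrow> 0 \<le> pr A A"
  by (subst pr_self) auto

text \<open>The squared norm of \<open>A + t * B\<close> is a nonnegative quadratic polynomial in
  \<open>t\<close>; it is evaluated at its minimiser, the degenerate case \<open>pr B B = 0\<close>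
  being separate.\<close>

lemma pr_cauchy_schwarz:
  assumes A: "bandlim R A" and B: "bandlim R B"
  shows "(pr A B)\<^sup>2 \<le> pr A A * pr B B"
proof -
  have nn: "0 \<le> pr A A + 2 * t * pr A B + t\<^sup>2 * pr B B" for t
  proof -
    have tB: "bandlim R (\<lambda>u. complex_of_real t * B u)" by (rule bandlim_cmult[OF B])
    have "0 \<le> pr (\<lambda>u. A u + complex_of_real t * B u) (\<lambda>u. A u + complex_of_real t * B u)"
      by (rule pr_self_nonneg[OF bandlim_add[OF A tB]])
    also have "\<dots> = (pr A A + pr (\<lambda>u. complex_of_real t * B u) A) + (pr A (\<lambda>u. complex_of_real t * B u)
        + pr (\<lambda>u. complex_of_real t * B u) (\<lambda>u. complex_of_real t * B u))"
      unfolding pr_add_left[OF A tB bandlim_add[OF A tB]] pr_add_right[OF A tB A] pr_add_right[OF A tB tB]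
      by (simp only: add.assoc add.left_commute)
    also have "pr A (\<lambda>u. complex_of_real t * B u) = t * pr A B"
      by (subst pr_sym) (simp only: pr_scale_left pr_sym)
    also have "pr (\<lambda>u. complex_of_real t * B u) (\<lambda>u. complex_of_real t * B u) = t * (t * pr B B)"
      unfolding pr_scale_left by (subst pr_sym) (simp only: pr_scale_left)
    also have "pr (\<lambda>u. complex_of_real t * B u) A = t * pr A B"
      unfolding pr_scale_left by (subst pr_sym) simp
    also have "(pr A A + t * pr A B) + (t * pr A B + t * (t * pr B B)) = pr A A + 2 * t * pr A B + t\<^sup>2 * pr B B"
      by (simp add: power2_eq_square algebra_simps)
    finally show ?thesis .
  qed
  show ?thesis
  proof (cases "pr B B = 0")
    case True
    have "pr A B = 0"
    proof (rule ccontr)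
      assume n: "pr A B \<noteq> 0"
      \<comment> \<open>Here the polynomial is affine in \<open>t\<close>, and at this point it
        would take the value \<open>- 1\<close>.\<close>
      define s where "s = - (pr A A + 1) / (2 * pr A B)"
      have "2 * s * pr A B = - (pr A A + 1)" using n by (simp add: s_def)
      then show False using nn[of s] True by simp
    qed
    then show ?thesis using True by simp
  next
    case False
    then have p: "pr B B > 0" using pr_self_nonneg[OF B] by simp
    have "0 \<le> pr A A + 2 * (- pr A B / pr B B) * pr A B + (- pr A B / pr B B)\<^sup>2 * pr B B" by (rule nn)
    also have "\<dots> = pr A A - (pr A B)\<^sup>2 / pr B B" using p by (simp add: power2_eq_square field_simps)
    finally show ?thesis using p by (simp add: field_simps)
  qed
qed

lemma integral_hermitian_real:
  fixes F :: "real \<Rightarrow> complex"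
  assumes "\<And>u. F (- u) = cnj (F u)"
  shows "(LBINT u. F u) = complex_of_real (Re (LBINT u. F u))"
proof -
  have "(LBINT u. F u) = (LBINT u. F (- u))"
    using lborel_integral_real_affine[of "-1" F 0] by simp
  also have "\<dots> = cnj (LBINT u. F u)"
    unfolding assms by (rule Bochner_Integration.integral_cnj)
  finally have "Im (LBINT u. F u) = - Im (LBINT u. F u)"
    by (metis cnj.simps(2))
  then show ?thesis by (intro complex_eqI) auto
qed

section \<open>The deconvolution statistic\<close>

lemma noise_bounds:
  fixes g :: "real \<Rightarrow> real"
  assumes g: "is_density g" and nz: "\<And>u. fourier g u \<noteq> 0" and cg: "0 < cg" and \<sigma>: "1 < \<sigma>"
    and as: "(\<lambda>u. cmod (fourier g u)) \<sim>[at_infinity] (\<lambda>u. cg * \<bar>u\<bar> powr (- \<sigma>))"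
  obtains U where "1 \<le> U"
    "\<And>u. U \<le> \<bar>u\<bar> \<Longrightarrow> cg / 2 * \<bar>u\<bar> powr (- \<sigma>) \<le> cmod (fourier g u)"
    "\<And>u. U \<le> \<bar>u\<bar> \<Longrightarrow> cmod (fourier g u) \<le> 2 * cg * \<bar>u\<bar> powr (- \<sigma>)"
proof -
  from as have "((\<lambda>u. if cmod (fourier g u) = 0 \<and> cg * \<bar>u\<bar> powr (- \<sigma>) = 0 then 1
      else cmod (fourier g u) / (cg * \<bar>u\<bar> powr (- \<sigma>))) \<longlongrightarrow> 1) at_infinity"
    by (simp add: asymp_equiv_def)
  \<comment> \<open>Asymptotic equivalence reads the quotient \<open>0 / 0\<close> as
    \<open>1\<close>; this case is void because the noise transform has no zeros.\<close>
  moreover have "(\<lambda>u. if cmod (fourier g u) = 0 \<and> cg * \<bar>u\<bar> powr (- \<sigma>) = 0 then 1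
      else cmod (fourier g u) / (cg * \<bar>u\<bar> powr (- \<sigma>))) = (\<lambda>u. cmod (fourier g u) / (cg * \<bar>u\<bar> powr (- \<sigma>)))"
    using nz by auto
  ultimately have lim: "((\<lambda>u. cmod (fourier g u) / (cg * \<bar>u\<bar> powr (- \<sigma>))) \<longlongrightarrow> 1) at_infinity" by simp
  have "\<forall>\<^sub>F u in at_infinity. 1 / 2 < cmod (fourier g u) / (cg * \<bar>u\<bar> powr (- \<sigma>))"
    by (rule order_tendstoD(1)[OF lim]) simp
  moreover have "\<forall>\<^sub>F u in at_infinity. cmod (fourier g u) / (cg * \<bar>u\<bar> powr (- \<sigma>)) < 2"
    by (rule order_tendstoD(2)[OF lim]) simp
  ultimately have "\<forall>\<^sub>F u in at_infinity. 1 / 2 < cmod (fourier g u) / (cg * \<bar>u\<bar> powr (- \<sigma>))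
      \<and> cmod (fourier g u) / (cg * \<bar>u\<bar> powr (- \<sigma>)) < 2"
    by (rule eventually_conj)
  then obtain b where b: "\<And>u. b \<le> \<bar>u\<bar> \<Longrightarrow> 1 / 2 < cmod (fourier g u) / (cg * \<bar>u\<bar> powr (- \<sigma>))
      \<and> cmod (fourier g u) / (cg * \<bar>u\<bar> powr (- \<sigma>)) < 2"
    unfolding eventually_at_infinity by auto
  show ?thesis
  proof (rule that[of "max 1 b"])
    fix u :: real assume u: "max 1 b \<le> \<bar>u\<bar>"
    then have p: "0 < cg * \<bar>u\<bar> powr (- \<sigma>)" using cg by auto
    from b[of u] u have "1 / 2 < cmod (fourier g u) / (cg * \<bar>u\<bar> powr (- \<sigma>))"
      "cmod (fourier g u) / (cg * \<bar>u\<bar> powr (- \<sigma>)) < 2" by auto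
    then have "1 / 2 * (cg * \<bar>u\<bar> powr (- \<sigma>)) < cmod (fourier g u)"
      "cmod (fourier g u) < 2 * (cg * \<bar>u\<bar> powr (- \<sigma>))"
      using p by (simp_all only: pos_less_divide_eq pos_divide_less_eq)
    then show "cg / 2 * \<bar>u\<bar> powr (- \<sigma>) \<le> cmod (fourier g u)"
      and "cmod (fourier g u) \<le> 2 * cg * \<bar>u\<bar> powr (- \<sigma>)" by simp_all
  qed simp
qed

text \<open>The properties of the noise behind the upper bound: polynomial growth of the inverse
  transform on the band \<open>\<bar>u\<bar> \<le> 1 / h\<close>, and an integrable transform. The
  latter rests on \<open>1 < \<sigma>\<close>.\<close>

locale deconv =
  fixes g :: "real \<Rightarrow> real" and \<sigma> G Ig :: real
  assumes g: "is_density g" and nz: "\<And>u. fourier g u \<noteq> 0" and \<sigma>: "1 < \<sigma>" and G: "1 \<le> G"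
    and inv: "\<And>h u. 0 < h \<Longrightarrow> h \<le> 1 \<Longrightarrow> \<bar>u\<bar> \<le> 1 / h \<Longrightarrow> cmod (inverse (fourier g u)) \<le> G * h powr (- \<sigma>)"
    and int_g: "integrable lborel (\<lambda>u. cmod (fourier g u))"
    and Ig: "(LBINT u. cmod (fourier g u)) \<le> Ig" and Ig_pos: "0 < Ig"

lemma integrable_power_tail:
  fixes \<sigma> U :: real
  assumes "1 < \<sigma>" "0 < U"
  shows "integrable lborel (\<lambda>u. indicator {u. U \<le> \<bar>u\<bar>} u * \<bar>u\<bar> powr (- \<sigma>) :: real)"
proof -
  have "set_integrable lborel (einterval U \<infinity>) (\<lambda>x. x powr (- \<sigma>))"
  proof (rule interval_integral_FTC_nonneg(1)[where F="\<lambda>x. x powr (1 - \<sigma>) / (1 - \<sigma>)" and A="U powr (1 - \<sigma>) / (1 - \<sigma>)" and B=0])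
    show "((\<lambda>x. x powr (1 - \<sigma>) / (1 - \<sigma>)) has_real_derivative x powr - \<sigma>) (at x)"
      if "ereal U < ereal x" "ereal x < \<infinity>" for x
      using that assms by (auto intro!: derivative_eq_intros simp: divide_simps) 
    show "isCont (\<lambda>x. x powr - \<sigma>) x" if "ereal U < ereal x" "ereal x < \<infinity>" for x
      using that assms by (auto intro!: continuous_intros)
    show "(((\<lambda>x. x powr (1 - \<sigma>) / (1 - \<sigma>)) \<circ> real_of_ereal) \<longlongrightarrow> U powr (1 - \<sigma>) / (1 - \<sigma>)) (at_right (ereal U))"
      using assms by (simp add: ereal_tendsto_simps) (auto intro!: tendsto_eq_intros)
    show "(((\<lambda>x. x powr (1 - \<sigma>) / (1 - \<sigma>)) \<circ> real_of_ereal) \<longlongrightarrow> 0) (at_left \<infinity>)"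
      using assms unfolding ereal_tendsto_simps by real_asymp
  qed auto
  then have 1: "integrable lborel (\<lambda>x. indicator {U<..} x * x powr (- \<sigma>) :: real)"
    by (simp add: set_integrable_def)
  have 2: "integrable lborel (\<lambda>x. indicator {U<..} (- x) * (- x) powr (- \<sigma>) :: real)"
    using lborel_integrable_real_affine[OF 1, of "-1" 0] by simp
  have "integrable lborel (\<lambda>x. indicator {U<..} x * x powr (- \<sigma>) + indicator {U<..} (- x) * (- x) powr (- \<sigma>) :: real)"
    using 1 2 by (rule Bochner_Integration.integrable_add)
  then show ?thesis
  proof (rule integrable_cong_AE_imp)
    have "AE x in lborel. x \<noteq> U \<and> x \<noteq> - U"
      using AE_lborel_singleton[of U] AE_lborel_singleton[of "- U"] by eventually_elim auto
    then show "AE u in lborel. indicator {U<..} u * u powr (- \<sigma>) + indicator {U<..} (- u) * (- u) powr (- \<sigma>)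
       = (indicator {u. U \<le> \<bar>u\<bar>} u * \<bar>u\<bar> powr (- \<sigma>) :: real)"
      by eventually_elim (use assms in \<open>auto simp: indicator_def abs_if\<close>)
  qed measurable
qed

lemma one_le_powr_uminus:
  fixes h \<sigma> :: real
  assumes "0 < h" "h \<le> 1" "0 \<le> \<sigma>"
  shows "1 \<le> h powr (- \<sigma>)"
  using powr_mono'[of "- \<sigma>" 0 h] assms by simp

lemma deconv_exists:
  fixes g :: "real \<Rightarrow> real"
  assumes g: "is_density g" and nz: "\<And>u. fourier g u \<noteq> 0" and cg: "0 < cg" and \<sigma>: "1 < \<sigma>"
    and as: "(\<lambda>u. cmod (fourier g u)) \<sim>[at_infinity] (\<lambda>u. cg * \<bar>u\<bar> powr (- \<sigma>))"
  obtains G Ig where "deconv g \<sigma> G Ig"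
proof -
  from noise_bounds[OF assms] obtain U where U: "1 \<le> U"
    and lo: "\<And>u. U \<le> \<bar>u\<bar> \<Longrightarrow> cg / 2 * \<bar>u\<bar> powr (- \<sigma>) \<le> cmod (fourier g u)"
    and hi: "\<And>u. U \<le> \<bar>u\<bar> \<Longrightarrow> cmod (fourier g u) \<le> 2 * cg * \<bar>u\<bar> powr (- \<sigma>)" by metis
  have "\<exists>x\<in>{- U..U}. \<forall>y\<in>{- U..U}. cmod (fourier g x) \<le> cmod (fourier g y)"
    using U by (intro continuous_attains_inf continuous_on_norm continuous_at_imp_continuous_on ballI isCont_fourier g) auto
  then obtain x where "\<forall>y\<in>{- U..U}. cmod (fourier g x) \<le> cmod (fourier g y)" by blast
  then have x: "\<And>y. \<bar>y\<bar> \<le> U \<Longrightarrow> cmod (fourier g x) \<le> cmod (fourier g y)"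
    by (auto simp: abs_le_iff)
  let ?m = "cmod (fourier g x)"
  have m: "0 < ?m" using nz by simp
  define G where "G = 1 + 1 / ?m + 2 / cg"
  have G1: "1 \<le> G" using m cg by (simp add: G_def)
  have inv: "cmod (inverse (fourier g u)) \<le> G * h powr (- \<sigma>)" if h: "0 < h" "h \<le> 1" "\<bar>u\<bar> \<le> 1 / h" for h u
  proof (cases "\<bar>u\<bar> \<le> U")
    case True
    have "cmod (inverse (fourier g u)) \<le> 1 / ?m"
      unfolding norm_inverse unfolding inverse_eq_divide
      using x[OF True] m by (intro divide_left_mono mult_pos_pos) auto
    also have "\<dots> \<le> G" using m cg by (simp add: G_def)
    also have "\<dots> \<le> G * h powr (- \<sigma>)"
      using mult_left_mono[OF one_le_powr_uminus[of h \<sigma>], of G] G1 h \<sigma> by simp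
    finally show ?thesis .
  next
    case False
    then have u: "U \<le> \<bar>u\<bar>" by simp
    have up: "0 < \<bar>u\<bar>" using u U by simp
    have "cmod (inverse (fourier g u)) = 1 / cmod (fourier g u)" unfolding norm_inverse unfolding inverse_eq_divide ..
    also have "\<dots> \<le> 1 / (cg / 2 * \<bar>u\<bar> powr (- \<sigma>))"
      using lo[OF u] cg up nz[of u] by (intro divide_left_mono mult_pos_pos) auto
    also have "\<dots> = 2 / cg * \<bar>u\<bar> powr \<sigma>" by (simp add: powr_minus field_simps)
    also have "\<dots> \<le> G * h powr (- \<sigma>)"
    proof (rule mult_mono)
      have "\<bar>u\<bar> powr \<sigma> \<le> (1 / h) powr \<sigma>" using h up \<sigma> by (intro powr_mono2) auto
      then show "\<bar>u\<bar> powr \<sigma> \<le> h powr (- \<sigma>)" using h by (simp add: powr_minus powr_divide inverse_eq_divide)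
      show "2 / cg \<le> G" using m by (simp add: G_def)
    qed (use G1 in auto)
    finally show ?thesis .
  qed
  have int: "integrable lborel (\<lambda>u. cmod (fourier g u))"
  proof (rule Bochner_Integration.integrable_bound)
    show "integrable lborel (\<lambda>u. indicator {- U..U} u + 2 * cg * (indicator {u. U \<le> \<bar>u\<bar>} u * \<bar>u\<bar> powr (- \<sigma>)) :: real)"
      using U \<sigma> by (intro Bochner_Integration.integrable_add integrable_mult_right integrable_power_tail integrable_real_indicator)
        (auto simp: emeasure_lborel_Icc_eq)
    show "AE u in lborel. norm (cmod (fourier g u)) \<le> norm (indicator {- U..U} u + 2 * cg * (indicator {u. U \<le> \<bar>u\<bar>} u * \<bar>u\<bar> powr (- \<sigma>)) :: real)"
    proof (rule AE_I2)
      fix u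
      have pos: "0 \<le> 2 * cg * \<bar>u\<bar> powr (- \<sigma>)" using cg by simp
      show "norm (cmod (fourier g u)) \<le> norm (indicator {- U..U} u + 2 * cg * (indicator {u. U \<le> \<bar>u\<bar>} u * \<bar>u\<bar> powr (- \<sigma>)) :: real)"
      proof (cases "U \<le> \<bar>u\<bar>")
        case True
        then show ?thesis using hi[OF True] pos by (simp add: indicator_def)
      next
        case False
        then have "u \<in> {- U..U}" by auto
        then show ?thesis using norm_fourier_le_1[OF g, of u] False by (simp add: indicator_def)
      qed
    qed
  qed (use borel_measurable_fourier[OF g] in measurable)
  have "deconv g \<sigma> G ((LBINT u. cmod (fourier g u)) + 1)"
    using g nz \<sigma> G1 inv int by unfold_locales (auto intro!: add_nonneg_pos)
  then show ?thesis by (rule that)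
qed

section \<open>Moments of the centred deconvolution kernel\<close>

locale deconv_model = deconv +
  fixes f :: "real \<Rightarrow> real" and h :: real
  assumes f: "is_density f" and h: "0 < h" "h \<le> 1"
begin

abbreviation "P \<equiv> obs_law g f"

definition band :: "real set" where "band = {u. \<bar>u\<bar> \<le> 1 / h}"

text \<open>The transform of the kernel placed at observation \<open>y\<close>, minus its
  expectation: averaging \<open>iexp (u * y)\<close> gives \<open>fourier f u * fourier g u\<close>,
  and the noise factor cancels against the kernel on the band.\<close>

definition af :: "real \<Rightarrow> real \<Rightarrow> complex" where
  "af y u = kernel_fourier g h u * iexp (u * y) - fourier f u * indicator band u"

definition HH :: "real \<Rightarrow> real \<Rightarrow> real" where "HH y z = pr (af y) (af z)"

text \<open>\<open>Dc\<close> comes from integrating the squared kernel transform, of size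
  \<open>h powr (- 2 * \<sigma>)\<close>, over a band of length \<open>2 / h\<close>. In
  \<open>Bc\<close> the finite integral of \<open>cmod (fourier g u)\<close> takes the place of the
  band length, which saves the factor \<open>1 / h\<close>.\<close>

definition Bc :: real where "Bc = Ig * G\<^sup>2 / (2 * pi) * h powr (- 2 * \<sigma>)"
definition Dc :: real where "Dc = 4 * G\<^sup>2 / pi * h powr (- 2 * \<sigma> - 1)"

lemma Bc_pos: "0 < Bc" and Dc_pos: "0 < Dc"
  using G Ig_pos h by (auto simp: Bc_def Dc_def intro!: mult_pos_pos divide_pos_pos)

lemma band_measurable [measurable]: "band \<in> sets borel"
  by (simp add: band_def)

lemma kernel_fourier_eq: "kernel_fourier g h u = inverse (fourier g u) * indicator band u"
  by (simp add: kernel_fourier_def band_def)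

lemma kernel_fourier_measurable [measurable]: "kernel_fourier g h \<in> borel_measurable borel"
  unfolding kernel_fourier_eq[abs_def] using borel_measurable_fourier[OF g] by measurable

lemma fourier_f_measurable [measurable]: "fourier f \<in> borel_measurable borel"
  by (rule borel_measurable_fourier[OF f])

lemma norm_kernel_fourier_le: "cmod (kernel_fourier g h u) \<le> G * h powr (- \<sigma>)"
  using inv[OF h, of u] G h by (auto simp: kernel_fourier_eq indicator_def band_def)

lemma bandlim_kernel: "bandlim (1 / h) (kernel_fourier g h)"
  unfolding bandlim_def
proof (intro conjI allI impI exI)
  show "cmod (kernel_fourier g h u) \<le> G * h powr (- \<sigma>)" for u by (rule norm_kernel_fourier_le)
qed (auto simp: kernel_fourier_eq indicator_def band_def)

lemma bandlim_indicator: "bandlim (1 / h) (indicator band)"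
  by (auto simp: bandlim_def indicator_def band_def intro!: exI[of _ 1])

lemma bandlim_fourier: 
  assumes "is_density d"
  shows "bandlim (1 / h) (\<lambda>u. fourier d u * indicator band u)"
  using bandlim_mult_bounded[OF bandlim_indicator borel_measurable_fourier[OF assms] norm_fourier_le_1[OF assms]]
  by (simp add: mult.commute)

lemma bandlim_af: "bandlim (1 / h) (af y)"
  unfolding af_def[abs_def]
  by (intro bandlim_diff bandlim_fourier f bandlim_mult_bounded[OF bandlim_kernel, where c=1]) auto

lemma powr_square: "(h powr (- \<sigma>))\<^sup>2 = h powr (- 2 * \<sigma>)"
  using h by (simp add: powr_power)

lemma norm_af_le: "cmod (af y u) \<le> 2 * G * h powr (- \<sigma>) * indicator band u"
proof (cases "u \<in> band")
  case True
  have one: "1 \<le> h powr (- \<sigma>)"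
    using h \<sigma> by (intro one_le_powr_uminus) auto
  have "cmod (af y u) \<le> cmod (kernel_fourier g h u * iexp (u * y)) + cmod (fourier f u * indicator band u)"
    unfolding af_def by (rule norm_triangle_ineq4)
  also have "\<dots> \<le> G * h powr (- \<sigma>) + 1"
    using norm_kernel_fourier_le[of u] norm_fourier_le_1[OF f, of u] True
    by (intro add_mono) (simp_all add: norm_mult)
  also have "1 \<le> G * h powr (- \<sigma>)" using mult_mono[OF G one] G by simp
  finally show ?thesis using True by simp
next
  case False
  then show ?thesis by (simp add: af_def kernel_fourier_eq)
qed

lemma pr_af_le: "pr (af y) (af y) \<le> Dc"
proof -
  have "(LBINT u. (cmod (af y u))\<^sup>2) \<le> (LBINT u. (2 * G * h powr (- \<sigma>))\<^sup>2 * indicator {- (1 / h)..1 / h} u)"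
  proof (rule integral_mono')
    show "integrable lborel (\<lambda>u. (2 * G * h powr (- \<sigma>))\<^sup>2 * indicator {- (1 / h)..1 / h} u :: real)"
      by (intro integrable_mult_right integrable_real_indicator) (auto simp: emeasure_lborel_Icc_eq)
    fix u
    have "(cmod (af y u))\<^sup>2 \<le> (2 * G * h powr (- \<sigma>) * indicator band u)\<^sup>2"
      by (rule power_mono[OF norm_af_le]) simp
    then show "(cmod (af y u))\<^sup>2 \<le> (2 * G * h powr (- \<sigma>))\<^sup>2 * indicator {- (1 / h)..1 / h} u"
      by (auto simp: indicator_def band_def abs_le_iff)
  qed simp
  also have "\<dots> = (2 * G * h powr (- \<sigma>))\<^sup>2 * (2 / h)"
    using h by simp
  also have "\<dots> = 8 * G\<^sup>2 * (h powr (- 2 * \<sigma>) / h)"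
    unfolding power_mult_distrib powr_square by simp
  also have "h powr (- 2 * \<sigma>) / h = h powr (- 2 * \<sigma> - 1)"
    using h by (simp add: powr_diff)
  finally have "(LBINT u. (cmod (af y u))\<^sup>2) \<le> 8 * G\<^sup>2 * h powr (- 2 * \<sigma> - 1)" .
  then have "pr (af y) (af y) \<le> 8 * G\<^sup>2 * h powr (- 2 * \<sigma> - 1) / (2 * pi)"
    unfolding pr_self[OF bandlim_af] by (intro divide_right_mono) auto
  then show ?thesis by (simp add: Dc_def)
qed

lemma prob_P: "prob_space P"
  by (rule prob_space_obs_law[OF f g])

lemma measure_P_UNIV [simp]: "measure P UNIV = 1"
  using prob_space.prob_space[OF prob_P] by simp

lemma af_measurable_pair: "(\<lambda>(z, u). af z u) \<in> borel_measurable (P \<Otimes>\<^sub>M lborel)"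
  unfolding af_def by measurable

lemma af_mean: "(\<integral>z. af z u \<partial>P) = 0"
proof -
  interpret P: prob_space P by (rule prob_P)
  have i: "integrable P (\<lambda>z. iexp (u * z))"
    by (rule P.integrable_const_bound[where B=1]) auto
  have "(\<integral>z. af z u \<partial>P) = kernel_fourier g h u * (\<integral>z. iexp (u * z) \<partial>P) - fourier f u * indicator band u"
    unfolding af_def using i by (simp add: P.prob_space)
  also have "\<dots> = 0"
    unfolding char_obs_law[OF f g] using nz[of u] by (simp add: kernel_fourier_eq)
  finally show ?thesis .
qed

lemma integrable_af_pair:
  assumes A: "bandlim (1 / h) A"
  shows "integrable (P \<Otimes>\<^sub>M lborel) (\<lambda>(z, u). A u * cnj (af z u))"
proof -
  interpret P: prob_space P by (rule prob_P)
  interpret pair_sigma_finite P "lborel :: real measure" ..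
  note [measurable] = bandlimD(1)[OF A] af_measurable_pair
  let ?c = "2 * G * h powr (- \<sigma>)"
  have c: "0 \<le> ?c" using G by simp
  have b: "cmod (af z u) \<le> ?c" for z u
  proof -
    have "?c * indicator band u \<le> ?c" using c by (intro mult_left_le) (auto simp: indicator_def)
    then show ?thesis by (rule order_trans[OF norm_af_le])
  qed
  show ?thesis
  proof (rule Bochner_Integration.integrable_bound)
    show "integrable (P \<Otimes>\<^sub>M lborel) (\<lambda>(z, u). A u * complex_of_real ?c)"
    proof (rule Fubini_integrable)
      show "integrable P (\<lambda>z. LBINT u. norm (case (z, u) of (z, u) \<Rightarrow> A u * complex_of_real ?c))" by simp
      show "AE z in P. integrable lborel (\<lambda>u. case (z, u) of (z, u) \<Rightarrow> A u * complex_of_real ?c)"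
        using bandlim_integrable[OF A] by simp
    qed measurable
    show "AE x in P \<Otimes>\<^sub>M lborel. norm (case x of (z, u) \<Rightarrow> A u * cnj (af z u)) \<le> norm (case x of (z, u) \<Rightarrow> A u * complex_of_real ?c)"
    proof (rule AE_I2, clarify)
      fix z u
      have "norm (A u * cnj (af z u)) = norm (A u) * cmod (af z u)" by (simp add: norm_mult)
      also have "\<dots> \<le> norm (A u) * ?c" by (intro mult_left_mono b) simp
      also have "\<dots> = norm (A u * complex_of_real ?c)"
        using c by (simp only: norm_mult norm_of_real abs_of_nonneg)
      finally show "norm (A u * cnj (af z u)) \<le> norm (A u * complex_of_real ?c)" .
    qed
  qed measurable
qed

text \<open>As a function of the observation, \<open>pr A (af z)\<close> is, up to
  \<open>2 * pi\<close>, the real part of a transform minus its mean. Dropping the mean only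
  increases the second moment, and \<open>transform_second_moment\<close> applies because the
  characteristic function of the observations is dominated by the noise transform.\<close>

lemma pr_af:
  assumes A: "bandlim (1 / h) A"
  shows "(\<lambda>z. pr A (af z)) \<in> borel_measurable P"
    and "\<bar>pr A (af z)\<bar> \<le> sqrt (pr A A * Dc)"
    and "(\<integral>z. pr A (af z) \<partial>P) = 0"
    and "(\<integral>z. (pr A (af z))\<^sup>2 \<partial>P) \<le> Bc * pr A A"
proof -
  interpret P: prob_space P by (rule prob_P)
  interpret pair_sigma_finite P "lborel :: real measure" ..
  note Am[measurable] = bandlimD(1)[OF A]
  note iA = integrable_af_pair[OF A]
  have im: "integrable P (\<lambda>z. \<integral>u. A u * cnj (af z u) \<partial>lborel)"
    using integrable_fst[OF iA] by simp
  show m[measurable]: "(\<lambda>z. pr A (af z)) \<in> borel_measurable P"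
    unfolding pr_def using borel_measurable_integrable[OF im] by measurable
  show bd: "\<bar>pr A (af z)\<bar> \<le> sqrt (pr A A * Dc)" for z
  proof -
    have "(pr A (af z))\<^sup>2 \<le> pr A A * pr (af z) (af z)" by (rule pr_cauchy_schwarz[OF A bandlim_af])
    also have "\<dots> \<le> pr A A * Dc" by (intro mult_left_mono pr_af_le pr_self_nonneg[OF A])
    finally show ?thesis by (metis real_sqrt_abs real_sqrt_le_iff)
  qed
  have "(\<integral>z. (LBINT u. A u * cnj (af z u)) \<partial>P) = (\<integral>u. (\<integral>z. A u * cnj (af z u) \<partial>P) \<partial>lborel)"
    by (rule Fubini_integral[OF iA, symmetric])
  also have "\<dots> = 0"
    by (simp only: integral_mult_right_zero Bochner_Integration.integral_cnj af_mean) simp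
  finally have z: "(\<integral>z. (LBINT u. A u * cnj (af z u)) \<partial>P) = 0" .
  show mean: "(\<integral>z. pr A (af z) \<partial>P) = 0"
    unfolding pr_def using im z by simp
  let ?\<phi> = "cft (\<lambda>u. cnj (A u) * kernel_fourier g h u)"
  have bl: "bandlim (1 / h) (\<lambda>u. cnj (A u) * kernel_fourier g h u)"
    by (intro bandlim_mult bandlim_cnj A bandlim_kernel)
  define c where "c = (LBINT u. A u * cnj (fourier f u * indicator band u))"
  have ps: "(LBINT u. A u * cnj (af z u)) = cnj (?\<phi> z) - c" for z
  proof -
    have b1: "bandlim (1 / h) (\<lambda>u. kernel_fourier g h u * iexp (u * z))"
      by (rule bandlim_mult_bounded[OF bandlim_kernel, where c=1]) auto
    have "(LBINT u. A u * cnj (af z u)) = (LBINT u. A u * cnj (kernel_fourier g h u * iexp (u * z))) - c"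
      unfolding c_def af_def complex_cnj_diff right_diff_distrib
      by (intro Bochner_Integration.integral_diff bandlim_pair[OF A] b1 bandlim_fourier f)
    also have "(LBINT u. A u * cnj (kernel_fourier g h u * iexp (u * z)))
      = (LBINT u. cnj (iexp (z * u) * (cnj (A u) * kernel_fourier g h u)))"
      by (intro Bochner_Integration.integral_cong refl) (simp add: ac_simps)
    also have "\<dots> = cnj (?\<phi> z)" unfolding cft_def by (rule Bochner_Integration.integral_cnj)
    finally show ?thesis .
  qed
  have \<phi>m[measurable]: "?\<phi> \<in> borel_measurable borel" by (rule borel_measurable_cft[OF bandlim_integrable[OF bl]])
  define b where "b = (LBINT u. cmod (cnj (A u) * kernel_fourier g h u))"
  have \<phi>b: "cmod (?\<phi> z) \<le> b" for z unfolding b_def by (rule norm_cft_le[OF bandlim_integrable[OF bl]])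
  have i\<phi>: "integrable P (\<lambda>z. Re (?\<phi> z))"
  proof (rule P.integrable_bounded[where c=b])
    show "\<bar>Re (?\<phi> z)\<bar> \<le> b" for z by (rule order_trans[OF abs_Re_le_cmod \<phi>b])
  qed measurable
  have i\<phi>2: "integrable P (\<lambda>z. (Re (?\<phi> z))\<^sup>2)"
  proof (rule P.integrable_bounded[where c="b\<^sup>2"])
    show "\<bar>(Re (?\<phi> z))\<^sup>2\<bar> \<le> b\<^sup>2" for z
      using order_trans[OF abs_Re_le_cmod \<phi>b, of z] by (metis abs_power2 abs_ge_zero power2_abs power_mono)
  qed measurable
  have i\<phi>3: "integrable P (\<lambda>z. (cmod (?\<phi> z))\<^sup>2)"
    by (rule P.integrable_bounded[where c="b\<^sup>2"]) (use \<phi>b in \<open>auto intro!: power_mono\<close>)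
  have pe: "pr A (af z) = (Re (?\<phi> z) - Re c) / (2 * pi)" for z
    unfolding pr_def ps by simp
  have "(\<integral>z. Re (?\<phi> z) \<partial>P) - Re c = 0"
    using mean i\<phi> unfolding pe by (simp add: P.prob_space)
  then have mc: "(\<integral>z. Re (?\<phi> z) \<partial>P) = Re c" by simp
  have "(\<integral>z. (pr A (af z))\<^sup>2 \<partial>P) = (\<integral>z. ((Re (?\<phi> z))\<^sup>2 - 2 * Re c * Re (?\<phi> z) + (Re c)\<^sup>2) / (2 * pi)\<^sup>2 \<partial>P)"
    unfolding pe by (simp add: power_divide power2_diff algebra_simps)
  also have "\<dots> = ((\<integral>z. (Re (?\<phi> z))\<^sup>2 \<partial>P) - 2 * Re c * Re c + (Re c)\<^sup>2) / (2 * pi)\<^sup>2"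
    using i\<phi> i\<phi>2 by (simp add: mc P.prob_space)
  also have "\<dots> \<le> (\<integral>z. (Re (?\<phi> z))\<^sup>2 \<partial>P) / (2 * pi)\<^sup>2"
    by (intro divide_right_mono) (auto simp: power2_eq_square)
  also have "\<dots> \<le> (\<integral>z. (cmod (?\<phi> z))\<^sup>2 \<partial>P) / (2 * pi)\<^sup>2"
  proof (intro divide_right_mono integral_mono[OF i\<phi>2 i\<phi>3])
    show "(Re (?\<phi> z))\<^sup>2 \<le> (cmod (?\<phi> z))\<^sup>2" for z by (simp add: cmod_power2)
  qed simp
  also have "\<dots> \<le> ((LBINT u. cmod (fourier g u)) * (LBINT u. (cmod (cnj (A u) * kernel_fourier g h u))\<^sup>2)) / (2 * pi)\<^sup>2"
  proof (intro divide_right_mono transform_second_moment prob_P int_g bandlim_integrable[OF bl] bandlim_norm_square[OF bl])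
    show "cmod (\<integral>y. iexp (u * y) \<partial>P) \<le> cmod (fourier g u)" for u
      unfolding char_obs_law[OF f g] norm_mult using norm_fourier_le_1[OF f, of u]
      by (simp add: mult_left_le_one_le)
  qed auto
  also have "\<dots> \<le> (Ig * ((G * h powr (- \<sigma>))\<^sup>2 * (LBINT u. (cmod (A u))\<^sup>2))) / (2 * pi)\<^sup>2"
  proof (intro divide_right_mono mult_mono Ig)
    have "(LBINT u. (cmod (cnj (A u) * kernel_fourier g h u))\<^sup>2) \<le> (LBINT u. (G * h powr (- \<sigma>))\<^sup>2 * (cmod (A u))\<^sup>2)"
    proof (rule integral_mono')
      show "integrable lborel (\<lambda>u. (G * h powr (- \<sigma>))\<^sup>2 * (cmod (A u))\<^sup>2)"
        by (intro integrable_mult_right bandlim_norm_square[OF A])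
      show "(cmod (cnj (A u) * kernel_fourier g h u))\<^sup>2 \<le> (G * h powr (- \<sigma>))\<^sup>2 * (cmod (A u))\<^sup>2" for u
        unfolding norm_mult complex_mod_cnj power_mult_distrib mult.commute[of "(cmod (A u))\<^sup>2"]
        using power_mono[OF norm_kernel_fourier_le[of u], of 2]
        by (intro mult_right_mono) (auto simp: power_mult_distrib)
    qed simp
    then show "(LBINT u. (cmod (cnj (A u) * kernel_fourier g h u))\<^sup>2) \<le> (G * h powr (- \<sigma>))\<^sup>2 * (LBINT u. (cmod (A u))\<^sup>2)"
      by simp
  qed (use Ig_pos in auto)
  also have "\<dots> = Bc * pr A A"
    unfolding pr_self[OF A] Bc_def power_mult_distrib powr_square by (simp add: power2_eq_square)
  finally show "(\<integral>z. (pr A (af z))\<^sup>2 \<partial>P) \<le> Bc * pr A A" .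
qed

lemma pr_sum_af:
  assumes A: "bandlim (1 / h) A"
  shows "(\<Sum>k=1..j. HH (y k) z) = pr (\<lambda>u. \<Sum>k=1..j. af (y k) u) (af z)"
    and "(\<Sum>k=1..(j::nat). \<Sum>l=1..j. HH (y k) (y l)) = pr (\<lambda>u. \<Sum>k=1..j. af (y k) u) (\<lambda>u. \<Sum>k=1..j. af (y k) u)"
proof -
  show 1: "(\<Sum>k=1..j. HH (y k) z) = pr (\<lambda>u. \<Sum>k=1..j. af (y k) u) (af z)" for z
    unfolding HH_def by (rule pr_sum_left[OF bandlim_af bandlim_af, symmetric])
  have "(\<Sum>k=1..j. \<Sum>l=1..j. HH (y k) (y l)) = (\<Sum>l=1..j. \<Sum>k=1..j. HH (y k) (y l))"
    by (rule sum.swap)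
  also have "\<dots> = (\<Sum>l=1..j. pr (af (y l)) (\<lambda>u. \<Sum>k=1..j. af (y k) u))"
    unfolding 1 by (simp only: pr_sym)
  also have "\<dots> = pr (\<lambda>u. \<Sum>k=1..j. af (y k) u) (\<lambda>u. \<Sum>k=1..j. af (y k) u)"
    by (rule pr_sum_left[OF bandlim_af bandlim_sum[OF bandlim_af], symmetric])
  finally show "(\<Sum>k=1..j. \<Sum>l=1..j. HH (y k) (y l)) = pr (\<lambda>u. \<Sum>k=1..j. af (y k) u) (\<lambda>u. \<Sum>k=1..j. af (y k) u)" .
qed

text \<open>Sums of \<open>HH\<close> over observations are values of \<open>pr\<close> at the
  single band-limited function obtained by summing \<open>af (y k)\<close>. Hence
  \<open>H_sup\<close> is Cauchy-Schwarz and \<open>H_var\<close> is the variance bound of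
  \<open>pr_af\<close> for that function.\<close>

sublocale U: degenerate_kernel P HH Bc Dc
proof (intro degenerate_kernel.intro prob_P degenerate_kernel_axioms.intro Bc_pos Dc_pos)
  interpret P: prob_space P by (rule prob_P)
  have [measurable]: "(\<lambda>p. af (fst p) (snd p)) \<in> borel_measurable (borel \<Otimes>\<^sub>M borel)"
    unfolding af_def by measurable
  show "(\<lambda>(x, y). HH x y) \<in> borel_measurable (P \<Otimes>\<^sub>M P)"
  proof -
    have "(\<lambda>p. \<integral>u. af (fst p) u * cnj (af (snd p) u) \<partial>lborel) \<in> borel_measurable (P \<Otimes>\<^sub>M P)"
      unfolding af_def by (rule lborel.borel_measurable_lebesgue_integral) measurable
    then show ?thesis unfolding HH_def pr_def case_prod_beta' by measurable
  qed
  show "HH x y = HH y x" for x y unfolding HH_def by (rule pr_sym)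
  show "\<bar>HH x y\<bar> \<le> Dc" for x y
  proof -
    have "\<bar>HH x y\<bar> \<le> sqrt (pr (af x) (af x) * Dc)" unfolding HH_def by (rule pr_af(2)[OF bandlim_af])
    also have "\<dots> \<le> sqrt (Dc * Dc)"
      using pr_af_le Dc_pos by (intro real_sqrt_le_mono mult_right_mono) auto
    finally show ?thesis using Dc_pos by simp
  qed
  show "(\<integral>z. HH x z \<partial>P) = 0" for x unfolding HH_def by (rule pr_af(3)[OF bandlim_af])
  note S = bandlim_sum[OF bandlim_af]
  show "(\<Sum>k=1..j. HH (y k) z)\<^sup>2 \<le> Dc * (\<Sum>k=1..j. \<Sum>l=1..j. HH (y k) (y l))" for y :: "nat \<Rightarrow> real" and z j
  proof -
    let ?A = "\<lambda>u. \<Sum>k=1..j. af (y k) u"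
    have "(pr ?A (af z))\<^sup>2 \<le> pr ?A ?A * pr (af z) (af z)"
      by (rule pr_cauchy_schwarz[OF S bandlim_af])
    also have "\<dots> \<le> pr ?A ?A * Dc" by (intro mult_left_mono pr_af_le pr_self_nonneg[OF S])
    finally show ?thesis unfolding pr_sum_af[OF bandlim_indicator] by (simp add: mult.commute)
  qed
  show "(\<integral>z. (\<Sum>k=1..j. HH (y k) z)\<^sup>2 \<partial>P) \<le> Bc * (\<Sum>k=1..j. \<Sum>l=1..j. HH (y k) (y l))" for y :: "nat \<Rightarrow> real" and j
    unfolding pr_sum_af[OF bandlim_indicator] by (rule pr_af(4)[OF S])
qed

end

text \<open>By Plancherel, the squared norm of the part removed by cutting frequencies at
  \<open>1 / h\<close>, that is, the bias.\<close>

definition tail_energy :: "(real \<Rightarrow> complex) \<Rightarrow> real \<Rightarrow> real" where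
  "tail_energy A h = (LBINT u. (cmod (A u))\<^sup>2 * indicator {u. 1 / h < \<bar>u\<bar>} u) / (2 * pi)"

lemma fourier_square_integrable:
  assumes d: "is_density d" and d2: "integrable lborel (\<lambda>x. (d x)\<^sup>2)"
  shows "integrable lborel (\<lambda>u. (cmod (fourier d u))\<^sup>2)"
  unfolding fourier_eq_cft
  by (rule plancherel(1)[OF is_densityD(5)[OF d]]) (use d2 in \<open>simp add: norm_of_real\<close>)

lemma cft_reflect: "cft (\<lambda>x. F (- x)) u = cft F (- u)"
  unfolding cft_def
  using lborel_integral_real_affine[of "-1" "\<lambda>x. iexp (u * x) * F (- x)" 0] by simp

lemma integral_reflect:
  fixes F :: "real \<Rightarrow> 'b::{banach, second_countable_topology}"
  shows "(LBINT x. F (- x)) = (LBINT x. F x)"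
  using lborel_integral_real_affine[of "-1" F 0] by simp

lemma integrable_reflect:
  fixes F :: "real \<Rightarrow> 'b::{banach, second_countable_topology}"
  shows "integrable lborel F \<Longrightarrow> integrable lborel (\<lambda>x. F (- x))"
  using lborel_integrable_real_affine[of F "-1" 0] by simp

section \<open>Bias, linear and quadratic part of the statistic\<close>

locale deconv_stat = deconv_model +
  fixes f0 :: "real \<Rightarrow> real"
  assumes f0: "is_density f0" and f0_L2: "integrable lborel (\<lambda>x. (f0 x)\<^sup>2)"
    and f_L2: "integrable lborel (\<lambda>x. (f x)\<^sup>2)"
begin

definition dif :: "real \<Rightarrow> complex" where
  "dif u = (fourier f u - fourier f0 u) * indicator band u"

lemma bandlim_dif: "bandlim (1 / h) dif"
  unfolding dif_def[abs_def] left_diff_distrib by (intro bandlim_diff bandlim_fourier f f0)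

lemma fourier_f0_measurable [measurable]: "fourier f0 \<in> borel_measurable borel"
  by (rule borel_measurable_fourier[OF f0])

lemma integrable_band_tail:
  assumes [measurable]: "A \<in> borel_measurable borel" and A: "integrable lborel (\<lambda>u. (cmod (A u))\<^sup>2)"
  shows "integrable lborel (\<lambda>u. (cmod (A u))\<^sup>2 * indicator band u)"
    "integrable lborel (\<lambda>u. (cmod (A u))\<^sup>2 * indicator {u. 1 / h < \<bar>u\<bar>} u)"
    "(LBINT u. (cmod (A u))\<^sup>2) = (LBINT u. (cmod (A u))\<^sup>2 * indicator band u) + 2 * pi * tail_energy A h"
proof -
  show 1: "integrable lborel (\<lambda>u. (cmod (A u))\<^sup>2 * indicator band u)"
    by (rule Bochner_Integration.integrable_bound[OF A]) (auto simp: indicator_def)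
  show 2: "integrable lborel (\<lambda>u. (cmod (A u))\<^sup>2 * indicator {u. 1 / h < \<bar>u\<bar>} u)"
    by (rule Bochner_Integration.integrable_bound[OF A]) (auto simp: indicator_def)
  have "(LBINT u. (cmod (A u))\<^sup>2) = (LBINT u. (cmod (A u))\<^sup>2 * indicator band u + (cmod (A u))\<^sup>2 * indicator {u. 1 / h < \<bar>u\<bar>} u)"
    by (intro Bochner_Integration.integral_cong refl) (auto simp: indicator_def band_def)
  then show "(LBINT u. (cmod (A u))\<^sup>2) = (LBINT u. (cmod (A u))\<^sup>2 * indicator band u) + 2 * pi * tail_energy A h"
    using 1 2 by (simp add: tail_energy_def)
qed

definition ga :: "real \<Rightarrow> real \<Rightarrow> complex" where
  "ga y u = kernel_fourier g h u * iexp (u * y)"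

lemma bandlim_ga: "bandlim (1 / h) (ga y)"
  unfolding ga_def[abs_def] by (rule bandlim_mult_bounded[OF bandlim_kernel, where c=1]) auto

lemma deconv_kernel_shift:
  "deconv_kernel g h (x - y) = complex_of_real (1 / (2 * pi)) * cft (ga y) (- x)"
proof -
  have "(LBINT u. iexp (- (u * (x - y))) * kernel_fourier g h u) = cft (ga y) (- x)"
    unfolding cft_def
  proof (rule Bochner_Integration.integral_cong[OF refl])
    fix u
    have "iexp (- x * u) * iexp (u * y) = iexp (- (u * (x - y)))"
      by (simp add: exp_add[symmetric] algebra_simps)
    then show "iexp (- (u * (x - y))) * kernel_fourier g h u = iexp (- x * u) * ga y u"
      by (simp only: ga_def mult.left_commute[of _ "kernel_fourier g h u"] mult.commute[of _ "kernel_fourier g h u"])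
  qed
  then show ?thesis by (simp add: deconv_kernel_def inverse_fourier_def)
qed

lemma kernel_L2:
  "(\<lambda>x. deconv_kernel g h (x - y)) \<in> borel_measurable lborel"
  "integrable lborel (\<lambda>x. (cmod (deconv_kernel g h (x - y)))\<^sup>2)"
proof -
  note i = bandlim_integrable[OF bandlim_ga] and i2 = bandlim_norm_square[OF bandlim_ga]
  have [measurable]: "cft (ga y) \<in> borel_measurable borel" by (rule borel_measurable_cft[OF i])
  show "(\<lambda>x. deconv_kernel g h (x - y)) \<in> borel_measurable lborel"
    unfolding deconv_kernel_shift by measurable
  have "integrable lborel (\<lambda>x. (cmod (cft (ga y) (- x)))\<^sup>2)"
    by (rule integrable_reflect[OF plancherel(1)[OF i i2]])
  then have "integrable lborel (\<lambda>x. (1 / (2 * pi))\<^sup>2 * (cmod (cft (ga y) (- x)))\<^sup>2)"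
    by (rule integrable_mult_right)
  then show "integrable lborel (\<lambda>x. (cmod (deconv_kernel g h (x - y)))\<^sup>2)"
    unfolding deconv_kernel_shift norm_mult power_mult_distrib by simp
qed

lemma inner_kernel_kernel:
  "(LBINT x. deconv_kernel g h (x - y) * cnj (deconv_kernel g h (x - z)))
    = complex_of_real (1 / (2 * pi)) * (LBINT u. ga y u * cnj (ga z u))"
proof -
  note i = bandlim_integrable[OF bandlim_ga] and i2 = bandlim_norm_square[OF bandlim_ga]
  have "(LBINT x. deconv_kernel g h (x - y) * cnj (deconv_kernel g h (x - z)))
    = (LBINT x. complex_of_real ((1 / (2 * pi))\<^sup>2) * (cft (ga y) (- x) * cnj (cft (ga z) (- x))))"
    unfolding deconv_kernel_shift by (simp add: power2_eq_square ac_simps)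
  also have "\<dots> = complex_of_real ((1 / (2 * pi))\<^sup>2) * (LBINT x. cft (ga y) (- x) * cnj (cft (ga z) (- x)))"
    by (rule integral_mult_right_zero)
  also have "(LBINT x. cft (ga y) (- x) * cnj (cft (ga z) (- x))) = (LBINT x. cft (ga y) x * cnj (cft (ga z) x))"
    by (rule integral_reflect)
  also have "\<dots> = complex_of_real (2 * pi) * (LBINT u. ga y u * cnj (ga z u))"
    by (rule parseval[OF i i2 i i2])
  also have "complex_of_real ((1 / (2 * pi))\<^sup>2) * (complex_of_real (2 * pi) * (LBINT u. ga y u * cnj (ga z u)))
    = complex_of_real (1 / (2 * pi)) * (LBINT u. ga y u * cnj (ga z u))"
    unfolding mult.assoc[symmetric] of_real_mult[symmetric] by (simp add: power2_eq_square)
  finally show ?thesis .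
qed

text \<open>The multiplication formula against the reflected density: reflection turns its transform
  into the complex conjugate of \<open>fourier f0\<close>.\<close>

lemma inner_kernel_density:
  "(LBINT x. deconv_kernel g h (x - y) * cnj (complex_of_real (f0 x)))
    = complex_of_real (1 / (2 * pi)) * (LBINT u. ga y u * cnj (fourier f0 u))"
proof -
  note i = bandlim_integrable[OF bandlim_ga]
  have r: "integrable lborel (\<lambda>x. complex_of_real (f0 (- x)))"
    by (rule integrable_reflect[OF is_densityD(5)[OF f0]])
  have "(LBINT x. deconv_kernel g h (x - y) * cnj (complex_of_real (f0 x)))
    = (LBINT x. complex_of_real (1 / (2 * pi)) * (cft (ga y) (- x) * complex_of_real (f0 (- (- x)))))"
    unfolding deconv_kernel_shift by (simp add: ac_simps)
  also have "\<dots> = complex_of_real (1 / (2 * pi)) * (LBINT x. cft (ga y) (- x) * complex_of_real (f0 (- (- x))))"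
    by (rule integral_mult_right_zero)
  also have "(LBINT x. cft (ga y) (- x) * complex_of_real (f0 (- (- x)))) = (LBINT x. cft (ga y) x * complex_of_real (f0 (- x)))"
    by (rule integral_reflect)
  also have "\<dots> = (LBINT u. ga y u * cft (\<lambda>x. complex_of_real (f0 (- x))) u)"
    by (rule cft_mult_swap[OF i r])
  also have "\<dots> = (LBINT u. ga y u * cnj (fourier f0 u))"
  proof -
    have "cft (\<lambda>x. complex_of_real (f0 (- x))) u = cnj (fourier f0 u)" for u
      using cft_reflect[of "\<lambda>x. complex_of_real (f0 x)" u] fourier_uminus[of f0 u] by (simp add: fourier_eq_cft)
    then show ?thesis by (simp only:)
  qed
  finally show ?thesis .
qed

lemma inner_density_density:
  "(LBINT x. complex_of_real (f0 x) * cnj (complex_of_real (f0 x)))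
    = complex_of_real ((LBINT u. (cmod (fourier f0 u))\<^sup>2) / (2 * pi))"
proof -
  have "(LBINT x. complex_of_real (f0 x) * cnj (complex_of_real (f0 x))) = complex_of_real (LBINT x. (f0 x)\<^sup>2)"
    unfolding integral_of_real[OF f0_L2, symmetric] by (simp add: power2_eq_square)
  also have "(LBINT x. (f0 x)\<^sup>2) = (LBINT u. (cmod (fourier f0 u))\<^sup>2) / (2 * pi)"
    unfolding fourier_eq_cft using plancherel(2)[OF is_densityD(5)[OF f0]] f0_L2 by simp
  finally show ?thesis .
qed

lemma af_uminus: "af y (- u) = cnj (af y u)"
proof -
  have "iexp (- u * y) = cnj (iexp (u * y))" by (simp add: exp_cnj)
  then show ?thesis
    unfolding af_def kernel_fourier_eq fourier_uminus by (simp add: indicator_def band_def)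
qed

lemma dif_uminus: "dif (- u) = cnj (dif u)"
  unfolding dif_def fourier_uminus by (simp add: indicator_def band_def)

text \<open>On the band the transform of the residual at \<open>y\<close> is
  \<open>af y + dif\<close>, noise plus signal; off the band it is \<open>- fourier f0\<close>, the
  same for all observations. Expanding the inner product gives a degenerate term, two linear terms
  and a constant with the tail energy.\<close>

lemma inner_residuals:
  "L2_inner (\<lambda>x. deconv_kernel g h (x - y) - complex_of_real (f0 x))
      (\<lambda>x. deconv_kernel g h (x - z) - complex_of_real (f0 x))
    = complex_of_real (HH y z + pr dif (af y) + pr dif (af z) + (pr dif dif + tail_energy (fourier f0) h))"
proof -
  let ?K = "\<lambda>y x. deconv_kernel g h (x - y)" and ?f = "\<lambda>x. complex_of_real (f0 x)"
  let ?c = "complex_of_real (1 / (2 * pi))"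
  have fm: "?f \<in> borel_measurable lborel" using is_densityD(1)[OF f0] by measurable
  have f2: "integrable lborel (\<lambda>x. (cmod (?f x))\<^sup>2)" using f0_L2 by simp
  note KK = integrable_mult_L2[OF kernel_L2 kernel_L2] and Kf = integrable_mult_L2[OF kernel_L2 fm f2]
    and fK = integrable_mult_L2[OF fm f2 kernel_L2] and ff = integrable_mult_L2[OF fm f2 fm f2]
  define b where "b y u = ga y u - fourier f0 u * indicator band u" for y u
  have blf: "bandlim (1 / h) (\<lambda>u. fourier f0 u * indicator band u)" by (rule bandlim_fourier[OF f0])
  have bb: "b y = (\<lambda>u. af y u + dif u)" for y
    unfolding b_def af_def dif_def ga_def by (auto simp: fun_eq_iff indicator_def)
  have gf: "(LBINT u. ga y u * cnj (fourier f0 u)) = (LBINT u. ga y u * cnj (fourier f0 u * indicator band u))" for y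
    by (intro Bochner_Integration.integral_cong refl) (auto simp: ga_def kernel_fourier_eq indicator_def)
  have fg: "(LBINT x. ?f x * cnj (?K z x)) = ?c * (LBINT u. fourier f0 u * indicator band u * cnj (ga z u))"
  proof -
    have "(LBINT x. ?f x * cnj (?K z x)) = (LBINT x. cnj (?K z x * cnj (?f x)))" by (simp add: mult.commute)
    also have "\<dots> = cnj (?c * (LBINT u. ga z u * cnj (fourier f0 u * indicator band u)))"
      unfolding gf[symmetric] inner_kernel_density[symmetric] by (rule Bochner_Integration.integral_cnj)
    also have "\<dots> = ?c * (LBINT u. cnj (ga z u * cnj (fourier f0 u * indicator band u)))"
      unfolding Bochner_Integration.integral_cnj complex_cnj_mult[of ?c] by simp
    also have "(\<lambda>u. cnj (ga z u * cnj (fourier f0 u * indicator band u))) = (\<lambda>u. fourier f0 u * indicator band u * cnj (ga z u))"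
      by (simp only: complex_cnj_mult complex_cnj_cnj mult.commute)
    finally show ?thesis .
  qed
  have "L2_inner (\<lambda>x. ?K y x - ?f x) (\<lambda>x. ?K z x - ?f x)
    = (LBINT x. (?K y x * cnj (?K z x) - ?K y x * cnj (?f x)) - (?f x * cnj (?K z x) - ?f x * cnj (?f x)))"
    unfolding L2_inner_def by (intro Bochner_Integration.integral_cong refl) (simp add: algebra_simps)
  also have "\<dots> = ((LBINT x. ?K y x * cnj (?K z x)) - (LBINT x. ?K y x * cnj (?f x)))
      - ((LBINT x. ?f x * cnj (?K z x)) - (LBINT x. ?f x * cnj (?f x)))"
    by (simp only: Bochner_Integration.integral_diff KK Kf fK ff Bochner_Integration.integrable_diff)
  also have "\<dots> = ?c * (((LBINT u. ga y u * cnj (ga z u)) - (LBINT u. ga y u * cnj (fourier f0 u * indicator band u)))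
      - (LBINT u. fourier f0 u * indicator band u * cnj (ga z u)) + complex_of_real (LBINT u. (cmod (fourier f0 u))\<^sup>2))"
    unfolding inner_kernel_kernel inner_kernel_density inner_density_density fg gf by (simp add: algebra_simps)
  also have "complex_of_real (LBINT u. (cmod (fourier f0 u))\<^sup>2)
      = (LBINT u. fourier f0 u * indicator band u * cnj (fourier f0 u * indicator band u)) + complex_of_real (2 * pi * tail_energy (fourier f0) h)"
  proof -
    note it = integrable_band_tail[OF fourier_f0_measurable fourier_square_integrable[OF f0 f0_L2]]
    have "(LBINT u. fourier f0 u * indicator band u * cnj (fourier f0 u * indicator band u))
      = (LBINT u. complex_of_real ((cmod (fourier f0 u))\<^sup>2 * indicator band u))"
      by (intro Bochner_Integration.integral_cong refl)
        (simp add: indicator_def complex_norm_square del: of_real_power)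
    also have "\<dots> = complex_of_real (LBINT u. (cmod (fourier f0 u))\<^sup>2 * indicator band u)"
      by (rule integral_of_real[OF it(1)])
    finally show ?thesis unfolding it(3) by simp
  qed
  also have "((LBINT u. ga y u * cnj (ga z u)) - (LBINT u. ga y u * cnj (fourier f0 u * indicator band u)))
      - (LBINT u. fourier f0 u * indicator band u * cnj (ga z u))
      + ((LBINT u. fourier f0 u * indicator band u * cnj (fourier f0 u * indicator band u)) + complex_of_real (2 * pi * tail_energy (fourier f0) h))
    = (LBINT u. b y u * cnj (b z u)) + complex_of_real (2 * pi * tail_energy (fourier f0) h)"
  proof -
    note i = bandlim_pair[OF bandlim_ga[of y] bandlim_ga[of z]] bandlim_pair[OF bandlim_ga[of y] blf] bandlim_pair[OF blf bandlim_ga[of z]] bandlim_pair[OF blf blf]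
    have "(LBINT u. b y u * cnj (b z u)) = (LBINT u. (ga y u * cnj (ga z u) - ga y u * cnj (fourier f0 u * indicator band u))
       - (fourier f0 u * indicator band u * cnj (ga z u) - fourier f0 u * indicator band u * cnj (fourier f0 u * indicator band u)))"
      unfolding b_def by (intro Bochner_Integration.integral_cong refl) (simp add: algebra_simps)
    also have "\<dots> = ((LBINT u. ga y u * cnj (ga z u)) - (LBINT u. ga y u * cnj (fourier f0 u * indicator band u)))
       - ((LBINT u. fourier f0 u * indicator band u * cnj (ga z u)) - (LBINT u. fourier f0 u * indicator band u * cnj (fourier f0 u * indicator band u)))"
      by (simp only: Bochner_Integration.integral_diff i Bochner_Integration.integrable_diff)
    finally show ?thesis by simp
  qed
  \<comment> \<open>The integrand takes conjugate values at \<open>u\<close> and \<open>- u\<close>,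
    so the integral is real and equals its real part in \<open>pr\<close>.\<close>
  also have "(LBINT u. b y u * cnj (b z u)) = complex_of_real (2 * pi * pr (b y) (b z))"
    unfolding pr_def
    by (subst integral_hermitian_real) (simp_all add: bb af_uminus dif_uminus)
  also have "?c * (complex_of_real (2 * pi * pr (b y) (b z)) + complex_of_real (2 * pi * tail_energy (fourier f0) h))
      = complex_of_real (pr (b y) (b z) + tail_energy (fourier f0) h)"
    unfolding of_real_add[symmetric] of_real_mult[symmetric] by (simp add: field_simps)
  also have "pr (b y) (b z) = HH y z + pr dif (af y) + pr dif (af z) + pr dif dif"
  proof -
    note ad = bandlim_add[OF bandlim_af bandlim_dif]
    have "pr (b y) (b z) = pr (af y) (\<lambda>u. af z u + dif u) + pr dif (\<lambda>u. af z u + dif u)"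
      unfolding bb by (rule pr_add_left[OF bandlim_af bandlim_dif ad])
    also have "\<dots> = (pr (af y) (af z) + pr (af y) dif) + (pr dif (af z) + pr dif dif)"
      unfolding pr_add_right[OF bandlim_af bandlim_dif bandlim_af] pr_add_right[OF bandlim_af bandlim_dif bandlim_dif] ..
    finally show ?thesis by (simp add: HH_def pr_sym[of "af y" dif])
  qed
  finally show ?thesis by (simp add: add.assoc)
qed

lemma sum_pairs_linear:
  fixes l :: "nat \<Rightarrow> real"
  shows "(\<Sum>j=1..n. \<Sum>k=1..<j. l k + l j) = (real n - 1) * (\<Sum>k=1..n. l k)"
proof (induction n)
  case (Suc n)
  have "(\<Sum>k=1..<Suc n. l k + l (Suc n)) = (\<Sum>k=1..n. l k) + real n * l (Suc n)"
    by (simp add: sum.distrib atLeastLessThanSuc_atLeastAtMost)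
  then show ?case using Suc by (simp add: algebra_simps)
qed simp

lemma sum_pairs_const: "(\<Sum>j=1..n. \<Sum>k=1..<j. c) = real n * (real n - 1) / 2 * (c::real)"
proof (induction n)
  case (Suc n)
  then show ?case by (simp add: algebra_simps)
qed simp

text \<open>The Hoeffding decomposition. Each observation belongs to \<open>n - 1\<close> of the
  \<open>n * (n - 1) / 2\<close> pairs, which determines the two normalisations.\<close>

lemma test_stat_eq:
  assumes n: "n \<ge> 2"
  shows "test_stat g f0 n h Y = complex_of_real
    (pr dif dif + tail_energy (fourier f0) h + 2 / real n * (\<Sum>k=1..n. pr dif (af (Y k)))
      + 2 / (real n * (real n - 1)) * U.ustat n Y)"
proof -
  let ?d = "pr dif dif + tail_energy (fourier f0) h" and ?l = "\<lambda>k. pr dif (af (Y k))"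
  have n0: "real n \<noteq> 0" "real n - 1 \<noteq> 0" using n by auto
  \<comment> \<open>The larger index becomes the outer one, as in \<open>ustat\<close>, where it is
    the time of the martingale increment.\<close>
  have set_eq: "{(k, j). 1 \<le> k \<and> k < j \<and> j \<le> n} = prod.swap ` (SIGMA j:{1..n}. {1..<j})"
    by force
  let ?L = "\<lambda>k j. L2_inner (\<lambda>x. deconv_kernel g h (x - Y k) - complex_of_real (f0 x))
                 (\<lambda>x. deconv_kernel g h (x - Y j) - complex_of_real (f0 x))"
  have "(\<Sum>(k, j) \<in> {(k, j). 1 \<le> k \<and> k < j \<and> j \<le> n}. ?L k j) = (\<Sum>(j, k) \<in> (SIGMA j:{1..n}. {1..<j}). ?L k j)"
    unfolding set_eq by (subst sum.reindex) (auto simp: prod.swap_def intro!: sum.cong inj_onI)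
  also have "\<dots> = (\<Sum>j=1..n. \<Sum>k=1..<j. ?L k j)"
    by (rule sum.Sigma[symmetric]) auto
  also have "\<dots> = complex_of_real (\<Sum>j=1..n. \<Sum>k=1..<j. HH (Y k) (Y j) + (?l k + ?l j) + ?d)"
    unfolding inner_residuals by (simp add: add.assoc)
  also have "(\<Sum>j=1..n. \<Sum>k=1..<j. HH (Y k) (Y j) + (?l k + ?l j) + ?d)
      = U.ustat n Y + (real n - 1) * (\<Sum>k=1..n. ?l k) + real n * (real n - 1) / 2 * ?d"
    unfolding U.ustat_def sum_pairs_linear[symmetric] sum_pairs_const[symmetric]
    by (simp only: sum.distrib)
  finally have "test_stat g f0 n h Y = complex_of_real (2 / (real n * (real n - 1)) *
      (U.ustat n Y + (real n - 1) * (\<Sum>k=1..n. ?l k) + real n * (real n - 1) / 2 * ?d))"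
    unfolding test_stat_def by (simp only: of_real_mult[symmetric])
  also have "2 / (real n * (real n - 1)) * (U.ustat n Y + (real n - 1) * (\<Sum>k=1..n. ?l k) + real n * (real n - 1) / 2 * ?d)
    = ?d + 2 / real n * (\<Sum>k=1..n. ?l k) + 2 / (real n * (real n - 1)) * U.ustat n Y"
    using n0 by (simp add: field_simps)
  finally show ?thesis .
qed

lemma L2_distance_eq:
  "(L2_norm (\<lambda>x. f x - f0 x))\<^sup>2 = pr dif dif + tail_energy (\<lambda>u. fourier f u - fourier f0 u) h"
proof -
  let ?F = "\<lambda>x. complex_of_real (f x) - complex_of_real (f0 x)"
  have F1: "integrable lborel ?F" using is_densityD(5)[OF f] is_densityD(5)[OF f0] by simp
  have i2: "integrable lborel (\<lambda>x. (cmod (complex_of_real (f x) + (-1) * complex_of_real (f0 x)))\<^sup>2)"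
    using f_L2 f0_L2 is_densityD(1)[OF f] is_densityD(1)[OF f0]
    by (intro integrable_norm_square_add) auto
  have F2: "integrable lborel (\<lambda>x. (cmod (?F x))\<^sup>2)" using i2 by simp
  have cF: "cft ?F u = fourier f u - fourier f0 u" for u
    unfolding fourier_eq_cft by (rule cft_diff[OF is_densityD(5)[OF f] is_densityD(5)[OF f0]])
  have "(L2_norm (\<lambda>x. f x - f0 x))\<^sup>2 = (LBINT x. (cmod (?F x))\<^sup>2)"
    unfolding L2_norm_def by (simp flip: of_real_diff)
  also have "\<dots> = (LBINT u. (cmod (fourier f u - fourier f0 u))\<^sup>2) / (2 * pi)"
    using plancherel(2)[OF F1 F2] unfolding cF by simp
  also have "(LBINT u. (cmod (fourier f u - fourier f0 u))\<^sup>2)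
      = (LBINT u. (cmod (fourier f u - fourier f0 u))\<^sup>2 * indicator band u) + 2 * pi * tail_energy (\<lambda>u. fourier f u - fourier f0 u) h"
    by (rule integrable_band_tail(3)) (use plancherel(1)[OF F1 F2] in \<open>simp_all add: cF\<close>)
  also have "(LBINT u. (cmod (fourier f u - fourier f0 u))\<^sup>2 * indicator band u) = 2 * pi * pr dif dif"
  proof -
    have "(cmod (dif u))\<^sup>2 = (cmod (fourier f u - fourier f0 u))\<^sup>2 * indicator band u" for u
      by (simp add: dif_def norm_mult indicator_def)
    then show ?thesis unfolding pr_self[OF bandlim_dif] by simp
  qed
  finally show ?thesis by (simp add: add_divide_distrib)
qed

lemma tail_energy_diff_le:
  "tail_energy (\<lambda>u. fourier f u - fourier f0 u) h \<le> 2 * tail_energy (fourier f) h + 2 * tail_energy (fourier f0) h"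
proof -
  note i1 = integrable_band_tail(2)[OF fourier_f_measurable fourier_square_integrable[OF f f_L2]]
  note i2 = integrable_band_tail(2)[OF fourier_f0_measurable fourier_square_integrable[OF f0 f0_L2]]
  let ?i = "\<lambda>u. indicator {u. 1 / h < \<bar>u\<bar>} u :: real"
  have "(LBINT u. (cmod (fourier f u - fourier f0 u))\<^sup>2 * ?i u)
    \<le> (LBINT u. 2 * ((cmod (fourier f u))\<^sup>2 * ?i u) + 2 * ((cmod (fourier f0 u))\<^sup>2 * ?i u))"
  proof (rule integral_mono')
    fix u
    have "(cmod (fourier f u - fourier f0 u))\<^sup>2 \<le> (cmod (fourier f u) + cmod (fourier f0 u))\<^sup>2"
      by (intro power_mono norm_triangle_ineq4) simp
    also have "\<dots> \<le> 2 * (cmod (fourier f u))\<^sup>2 + 2 * (cmod (fourier f0 u))\<^sup>2"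
      using sum_squares_bound[of "cmod (fourier f u)" "cmod (fourier f0 u)"] by (simp add: power2_sum)
    finally show "(cmod (fourier f u - fourier f0 u))\<^sup>2 * ?i u \<le> 2 * ((cmod (fourier f u))\<^sup>2 * ?i u) + 2 * ((cmod (fourier f0 u))\<^sup>2 * ?i u)"
      by (auto simp: indicator_def)
  qed (use i1 i2 in auto)
  also have "\<dots> = 2 * (LBINT u. (cmod (fourier f u))\<^sup>2 * ?i u) + 2 * (LBINT u. (cmod (fourier f0 u))\<^sup>2 * ?i u)"
    using i1 i2 by simp
  finally have "(LBINT u. (cmod (fourier f u - fourier f0 u))\<^sup>2 * ?i u)
    \<le> 2 * (LBINT u. (cmod (fourier f u))\<^sup>2 * ?i u) + 2 * (LBINT u. (cmod (fourier f0 u))\<^sup>2 * ?i u)" .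
  from divide_right_mono[OF this, of "2 * pi"] show ?thesis unfolding tail_energy_def
    by (simp add: add_divide_distrib)
qed

end

lemma tail_energy_nonneg: "0 \<le> tail_energy A h"
  unfolding tail_energy_def by (intro divide_nonneg_pos integral_nonneg) auto

lemma tail_energy_le_class:
  assumes f: "f \<in> smoothness_class (\<alpha>, r, \<beta>) L" and L: "0 < L" and W: "0 < W"
    and wt: "\<And>u. 1 / h < \<bar>u\<bar> \<Longrightarrow> W \<le> smoothness_weight \<alpha> r \<beta> u"
  shows "tail_energy (fourier f) h \<le> L / W"
proof -
  from f have d: "is_density f" and d2: "integrable lborel (\<lambda>x. (f x)\<^sup>2)"
    and n: "ennreal (1 / (2 * pi)) * (\<integral>\<^sup>+u. ennreal ((cmod (fourier f u))\<^sup>2 * smoothness_weight \<alpha> r \<beta> u) \<partial>lborel) \<le> ennreal L"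
    by (auto simp: smoothness_class_def)
  have [measurable]: "fourier f \<in> borel_measurable borel" by (rule borel_measurable_fourier[OF d])
  let ?A = "\<lambda>u. (cmod (fourier f u))\<^sup>2 * indicator {u. 1 / h < \<bar>u\<bar>} u"
  have i: "integrable lborel ?A"
    by (rule Bochner_Integration.integrable_bound[OF fourier_square_integrable[OF d d2]]) (auto simp: indicator_def)
  have "ennreal (1 / (2 * pi)) * (\<integral>\<^sup>+u. ennreal (W * ?A u) \<partial>lborel)
    \<le> ennreal (1 / (2 * pi)) * (\<integral>\<^sup>+u. ennreal ((cmod (fourier f u))\<^sup>2 * smoothness_weight \<alpha> r \<beta> u) \<partial>lborel)"
  proof (intro mult_left_mono nn_integral_mono ennreal_leI)
    fix u
    show "W * ?A u \<le> (cmod (fourier f u))\<^sup>2 * smoothness_weight \<alpha> r \<beta> u"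
    proof (cases "1 / h < \<bar>u\<bar>")
      case True
      then show ?thesis using mult_right_mono[OF wt[OF True], of "(cmod (fourier f u))\<^sup>2"] by (simp add: mult.commute)
    qed (simp add: smoothness_weight_def)
  qed simp
  also note n
  also have "(\<integral>\<^sup>+u. ennreal (W * ?A u) \<partial>lborel) = ennreal (W * (LBINT u. ?A u))"
    using i W by (subst nn_integral_eq_integral) auto
  finally have "1 / (2 * pi) * (W * (LBINT u. ?A u)) \<le> L"
    using L W by (simp add: ennreal_mult'[symmetric] ennreal_le_iff del: ennreal_1)
  then have "W * tail_energy (fourier f) h \<le> L" unfolding tail_energy_def by (simp add: field_simps)
  then show ?thesis using W by (simp add: field_simps)
qed

section \<open>Error probabilities at a single bandwidth\<close>

context deconv
begin

definition B0 :: real where "B0 = Ig * G\<^sup>2 / (2 * pi)"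
definition D0 :: real where "D0 = 4 * G\<^sup>2 / pi"

lemma B0_pos: "0 < B0" and D0_pos: "0 < D0"
  using G Ig_pos by (auto simp: B0_def D0_def)

end

context deconv_model
begin

lemma Bc_eq: "Bc = B0 * h powr (- 2 * \<sigma>)" and Dc_eq: "Dc = D0 * h powr (- 2 * \<sigma> - 1)"
  by (simp_all add: Bc_def B0_def Dc_def D0_def)

lemma Bc_Dc_eq: "Bc * Dc = B0 * D0 * (h powr (- 2 * \<sigma> - 1 / 2))\<^sup>2"
  unfolding Bc_eq Dc_eq using h by (simp add: powr_power powr_add[symmetric])

lemma Bc_div_Dc: "Bc / Dc = B0 / D0 * h"
  unfolding Bc_eq Dc_eq using h D0_pos by (simp add: powr_diff)

lemma Dc_div_Bc: "Dc / Bc = D0 / B0 / h"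
  unfolding Bc_eq Dc_eq using h B0_pos by (simp add: powr_diff)

end

context deconv_stat
begin

definition stat :: "nat \<Rightarrow> (nat \<Rightarrow> real) \<Rightarrow> real" where
  "stat n y = pr dif dif + tail_energy (fourier f0) h + 2 / real n * (\<Sum>k=1..n. pr dif (af (y k)))
      + 2 / (real n * (real n - 1)) * U.ustat n y"

lemma cmod_test_stat: "n \<ge> 2 \<Longrightarrow> cmod (test_stat g f0 n h y) = \<bar>stat n y\<bar>"
  by (simp only: test_stat_eq stat_def norm_of_real)

lemma linear_measurable: "(\<lambda>y. \<Sum>k=1..n. pr dif (af (y k))) \<in> borel_measurable (U.sample n)"
  by (intro borel_measurable_sum measurable_compose[OF measurable_component_singleton[of _ "{1..n}" "\<lambda>_. P"] pr_af(1)[OF bandlim_dif]])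

lemma stat_measurable: "stat n \<in> borel_measurable (U.sample n)"
  unfolding stat_def using linear_measurable U.ustat_measurable[of n n] by measurable

lemma sample_law_eq: "sample_law g f n = U.sample n"
  by (simp add: sample_law_def)

lemma ustat_chebyshev:
  assumes "0 < x"
  shows "measure (U.sample n) {y \<in> space (U.sample n). x \<le> \<bar>U.ustat n y\<bar>} \<le> Bc * Dc * (real n)\<^sup>2 / (2 * x\<^sup>2)"
proof -
  interpret S: prob_space "U.sample n" by (rule U.prob_space_sample)
  have "measure (U.sample n) {y \<in> space (U.sample n). x \<le> \<bar>U.ustat n y\<bar>}
      = measure (U.sample n) {y \<in> space (U.sample n). x\<^sup>2 \<le> (U.ustat n y)\<^sup>2}"
    using assms abs_le_square_iff[of x] by simp
  also have "\<dots> \<le> (\<integral>y. (U.ustat n y)\<^sup>2 \<partial>U.sample n) / x\<^sup>2"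
    by (rule S.markov_measure[OF U.integrable_ustat(2)[of n n]]) (use assms in auto)
  also have "\<dots> \<le> (Bc * Dc * (real n)\<^sup>2 / 2) / x\<^sup>2"
    by (intro divide_right_mono U.second_moment_ustat) auto
  finally show ?thesis by simp
qed

lemma linear_chebyshev:
  assumes "0 < x"
  shows "measure (U.sample n) {y \<in> space (U.sample n). x \<le> \<bar>\<Sum>k=1..n. pr dif (af (y k))\<bar>} \<le> real n * (Bc * pr dif dif) / x\<^sup>2"
proof -
  interpret S: prob_space "U.sample n" by (rule U.prob_space_sample)
  let ?l = "\<lambda>y. \<Sum>k=1..n. pr dif (af (y k))"
  let ?c = "real n * sqrt (pr dif dif * Dc)"
  have b: "\<bar>?l y\<bar> \<le> ?c" for y
  proof -
    have "\<bar>?l y\<bar> \<le> (\<Sum>k=1..n. \<bar>pr dif (af (y k))\<bar>)" by (rule sum_abs)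
    also have "\<dots> \<le> real (card {1..n}) * sqrt (pr dif dif * Dc)"
      by (rule sum_bounded_above) (rule pr_af(2)[OF bandlim_dif])
    finally show ?thesis by simp
  qed
  have i: "integrable (U.sample n) (\<lambda>y. (?l y)\<^sup>2)"
  proof (rule S.integrable_bounded[where c="?c\<^sup>2"])
    show "(\<lambda>y. (?l y)\<^sup>2) \<in> borel_measurable (U.sample n)" using linear_measurable by measurable
    show "\<bar>(?l y)\<^sup>2\<bar> \<le> ?c\<^sup>2" for y using b[of y] by (metis abs_power2 abs_ge_zero power2_abs power_mono)
  qed
  have "measure (U.sample n) {y \<in> space (U.sample n). x \<le> \<bar>?l y\<bar>}
      = measure (U.sample n) {y \<in> space (U.sample n). x\<^sup>2 \<le> (?l y)\<^sup>2}"
    using assms abs_le_square_iff[of x] by simp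
  also have "\<dots> \<le> (\<integral>y. (?l y)\<^sup>2 \<partial>U.sample n) / x\<^sup>2"
    by (rule S.markov_measure[OF i]) (use assms in auto)
  also have "\<dots> \<le> real n * (Bc * pr dif dif) / x\<^sup>2"
    by (intro divide_right_mono U.second_moment_sum[OF pr_af[OF bandlim_dif]]) auto
  finally show ?thesis .
qed

text \<open>The tails of \<open>f\<close> and \<open>f0\<close> account for at most
  \<open>4 * L' * t\<close> of the squared distance, so the signal \<open>pr dif dif\<close> on the
  band is at least \<open>C * t\<close>, which is at least twice the threshold. Acceptance then
  requires the linear or the quadratic noise to reach a quarter of the signal, and Chebyshev bounds
  both events.\<close>

lemma type_two_error:
  assumes n: "n \<ge> 2" and t: "0 < t" "h powr (- 2 * \<sigma> - 1 / 2) \<le> real n * t"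
    and tails: "tail_energy (fourier f) h \<le> L' * t" "tail_energy (fourier f0) h \<le> L' * t"
    and sep: "(C + 4 * L') * t \<le> (L2_norm (\<lambda>x. f x - f0 x))\<^sup>2" and Cs: "0 < Cs" "2 * Cs \<le> C"
  shows "emeasure (sample_law g f n) {y \<in> space (sample_law g f n). cmod (test_stat g f0 n h y) \<le> Cs * t}
    \<le> ennreal (64 * B0 / C + 128 * B0 * D0 / C\<^sup>2)"
proof -
  interpret S: prob_space "U.sample n" by (rule U.prob_space_sample)
  note [measurable] = stat_measurable linear_measurable U.ustat_measurable[of n n, simplified]
  let ?d = "pr dif dif" and ?l = "\<lambda>y. \<Sum>k=1..n. pr dif (af (y k))"
  have C: "0 < C" using Cs by simp
  have n0: "0 < real n" "0 < real n - 1" using n by auto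
  have d: "C * t \<le> ?d"
    using sep tails tail_energy_diff_le unfolding L2_distance_eq by (simp add: algebra_simps)
  have d0: "0 < ?d" using d C t by (meson less_le_trans mult_pos_pos)
  have hp: "0 < h powr (- 2 * \<sigma> - 1 / 2)" using h by simp
  \<comment> \<open>After the normalisations \<open>2 / n\<close> and
    \<open>2 / (n * (n - 1))\<close> each of these levels amounts to a quarter of the
    signal.\<close>
  let ?x1 = "real n * ?d / 8" and ?x2 = "real n * (real n - 1) * ?d / 8"
  let ?E1 = "{y \<in> space (U.sample n). ?x1 \<le> \<bar>?l y\<bar>}" and ?E2 = "{y \<in> space (U.sample n). ?x2 \<le> \<bar>U.ustat n y\<bar>}"
  have "measure (U.sample n) {y \<in> space (U.sample n). \<bar>stat n y\<bar> \<le> Cs * t} \<le> measure (U.sample n) (?E1 \<union> ?E2)"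
  proof (rule S.finite_measure_mono)
    show "{y \<in> space (U.sample n). \<bar>stat n y\<bar> \<le> Cs * t} \<subseteq> ?E1 \<union> ?E2"
    proof
      fix y assume "y \<in> {y \<in> space (U.sample n). \<bar>stat n y\<bar> \<le> Cs * t}"
      then have y: "y \<in> space (U.sample n)" and s: "stat n y \<le> Cs * t" by (auto simp: abs_le_iff)
      have "(2 * Cs) * t \<le> C * t" using Cs t by (intro mult_right_mono) auto
      then have "2 * (Cs * t) \<le> ?d" using d by (simp only: mult.assoc)
      then have 1: "?d + 2 / real n * ?l y + 2 / (real n * (real n - 1)) * U.ustat n y \<le> ?d / 2"
        using s tail_energy_nonneg[of "fourier f0" h] unfolding stat_def by simp
      show "y \<in> ?E1 \<union> ?E2"
      proof (rule ccontr)
        assume "y \<notin> ?E1 \<union> ?E2"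
        then have "\<bar>?l y\<bar> < ?x1" "\<bar>U.ustat n y\<bar> < ?x2" using y by auto
        then have "- ?l y < ?x1" "- U.ustat n y < ?x2" by auto
        then have "2 / real n * (- ?l y) < 2 / real n * ?x1"
          "2 / (real n * (real n - 1)) * (- U.ustat n y) < 2 / (real n * (real n - 1)) * ?x2"
          using n0 by (intro mult_strict_left_mono; simp)+
        moreover have "2 / real n * ?x1 = ?d / 4" "2 / (real n * (real n - 1)) * ?x2 = ?d / 4"
          using n0 by (simp_all add: field_simps)
        ultimately show False using 1 by simp
      qed
    qed
  qed measurable
  also have "\<dots> \<le> measure (U.sample n) ?E1 + measure (U.sample n) ?E2"
    by (rule measure_Un_le) measurable
  also have "measure (U.sample n) ?E1 \<le> real n * (Bc * ?d) / ?x1\<^sup>2"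
    by (rule linear_chebyshev) (use n0 d0 in simp)
  also have "real n * (Bc * ?d) / ?x1\<^sup>2 = 64 * (Bc / (real n * ?d))"
    using n0 d0 by (simp add: power2_eq_square field_simps)
  also have "Bc / (real n * ?d) \<le> B0 / C"
  proof -
    \<comment> \<open>Because \<open>h \<le> 1\<close>, the scale condition for the quadratic part
      also covers the variance of the linear part.\<close>
    have "h powr (- 2 * \<sigma>) \<le> h powr (- 2 * \<sigma> - 1 / 2)" using h by (intro powr_mono') auto
    also have "\<dots> \<le> real n * t" by (rule t)
    finally have "C * h powr (- 2 * \<sigma>) \<le> C * (real n * t)" using C by (intro mult_left_mono) auto
    also have "\<dots> \<le> real n * ?d" using d n0 by (simp add: mult_left_mono mult.left_commute)
    finally have "B0 * (C * h powr (- 2 * \<sigma>)) \<le> B0 * (real n * ?d)" using B0_pos by (intro mult_left_mono) auto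
    then show ?thesis unfolding Bc_eq using n0 d0 C by (simp add: field_simps)
  qed
  also have "measure (U.sample n) ?E2 \<le> Bc * Dc * (real n)\<^sup>2 / (2 * ?x2\<^sup>2)"
    by (rule ustat_chebyshev) (use n0 d0 in simp)
  also have "Bc * Dc * (real n)\<^sup>2 / (2 * ?x2\<^sup>2) = 32 * (Bc * Dc) / ((real n - 1) * ?d)\<^sup>2"
  proof -
    have "X * a\<^sup>2 / (2 * (a * b * d / 8)\<^sup>2) = 32 * X / (b * d)\<^sup>2" if "a \<noteq> 0" "b \<noteq> 0" "d \<noteq> 0" for a b d X :: real
      using that by (simp add: power2_eq_square field_simps)
    then show ?thesis using n0 d0 by simp
  qed
  also have "\<dots> \<le> 128 * B0 * D0 / C\<^sup>2"
  proof -
    have "C * h powr (- 2 * \<sigma> - 1 / 2) \<le> C * (real n * t)" using t C by (intro mult_left_mono) auto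
    also have "\<dots> \<le> real n * ?d" using d n0 by (simp add: mult_left_mono mult.left_commute)
    also have "\<dots> \<le> 2 * ((real n - 1) * ?d)" using n d0 by (simp add: algebra_simps)
    finally have "(C * h powr (- 2 * \<sigma> - 1 / 2))\<^sup>2 \<le> (2 * ((real n - 1) * ?d))\<^sup>2"
      using C hp by (intro power_mono) auto
    then have "32 * B0 * D0 * (C\<^sup>2 * (h powr (- 2 * \<sigma> - 1 / 2))\<^sup>2) \<le> 32 * B0 * D0 * (4 * ((real n - 1) * ?d)\<^sup>2)"
      using B0_pos D0_pos by (intro mult_left_mono) (auto simp: power_mult_distrib)
    then show ?thesis unfolding Bc_Dc_eq using n0 d0 C by (simp add: field_simps)
  qed
  finally have "measure (U.sample n) {y \<in> space (U.sample n). \<bar>stat n y\<bar> \<le> Cs * t} \<le> 64 * B0 / C + 128 * B0 * D0 / C\<^sup>2"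
    by simp
  then show ?thesis
    unfolding sample_law_eq cmod_test_stat[OF n] S.emeasure_eq_measure by (rule ennreal_leI)
qed

end

text \<open>True and hypothesised density coincide, so \<open>dif\<close> vanishes and only the
  deterministic tail energy and the degenerate part remain.\<close>

locale deconv_null = deconv_stat g \<sigma> G Ig f h f for g \<sigma> G Ig f h
begin

lemma stat_null: "stat n y = tail_energy (fourier f) h + 2 / (real n * (real n - 1)) * U.ustat n y"
proof -
  have "dif = (\<lambda>u. 0)" by (simp add: dif_def fun_eq_iff)
  then show ?thesis by (simp add: stat_def pr_def)
qed

lemma null_event_subset:
  assumes n: "n \<ge> 2" and t: "0 < t" and tails: "tail_energy (fourier f) h \<le> L' * t" and Cs: "L' < Cs"
    and s: "Cs * t < \<bar>stat n y\<bar>"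
  shows "(Cs - L') * t * (real n)\<^sup>2 / 4 \<le> \<bar>U.ustat n y\<bar>"
proof -
  have n0: "0 < real n" "0 < real n - 1" using n by auto
  have "\<bar>stat n y\<bar> \<le> tail_energy (fourier f) h + 2 / (real n * (real n - 1)) * \<bar>U.ustat n y\<bar>"
    unfolding stat_null using tail_energy_nonneg[of "fourier f" h] n0
    by (intro order_trans[OF abs_triangle_ineq]) (simp add: abs_mult)
  then have "(Cs - L') * t \<le> 2 / (real n * (real n - 1)) * \<bar>U.ustat n y\<bar>"
    using s tails by (simp add: algebra_simps)
  then have "(Cs - L') * t * (real n * (real n - 1) / 2) \<le> 2 / (real n * (real n - 1)) * \<bar>U.ustat n y\<bar> * (real n * (real n - 1) / 2)"
    using n0 by (intro mult_right_mono) auto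
  also have "\<dots> = \<bar>U.ustat n y\<bar>" using n0 by simp
  finally have 1: "(Cs - L') * t * (real n * (real n - 1) / 2) \<le> \<bar>U.ustat n y\<bar>" .
  \<comment> \<open>For \<open>n \<ge> 2\<close> at least half of the \<open>n\<^sup>2 / 2\<close>
    is left in \<open>n * (n - 1) / 2\<close>.\<close>
  have "(real n)\<^sup>2 / 4 \<le> real n * (real n - 1) / 2"
  proof -
    have "2 * real n \<le> real n * real n" using n by (intro mult_right_mono) auto
    then show ?thesis by (simp add: power2_eq_square algebra_simps)
  qed
  then have "(Cs - L') * t * ((real n)\<^sup>2 / 4) \<le> (Cs - L') * t * (real n * (real n - 1) / 2)"
    using Cs t by (intro mult_left_mono) auto
  from order_trans[OF this 1] show ?thesis by (simp only: times_divide_eq_right)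
qed

text \<open>For the last bandwidth, whose threshold lacks the iterated logarithm: the bound is small
  through the threshold constant \<open>Cs\<close>, uniformly in \<open>n\<close>, which is enough
  for a single event.\<close>

lemma type_one_error_chebyshev:
  assumes n: "n \<ge> 2" and t: "0 < t" "h powr (- 2 * \<sigma> - 1 / 2) \<le> real n * t"
    and tails: "tail_energy (fourier f) h \<le> L' * t" and Cs: "L' < Cs"
  shows "emeasure (sample_law g f n) {y \<in> space (sample_law g f n). cmod (test_stat g f n h y) > Cs * t}
    \<le> ennreal (8 * B0 * D0 / (Cs - L')\<^sup>2)"
proof -
  interpret S: prob_space "U.sample n" by (rule U.prob_space_sample)
  note [measurable] = stat_measurable U.ustat_measurable[of n n, simplified]
  let ?x = "(Cs - L') * t * (real n)\<^sup>2 / 4"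
  have n0: "0 < real n" using n by auto
  have hp: "0 < h powr (- 2 * \<sigma> - 1 / 2)" using h by simp
  have "measure (U.sample n) {y \<in> space (U.sample n). Cs * t < \<bar>stat n y\<bar>}
    \<le> measure (U.sample n) {y \<in> space (U.sample n). ?x \<le> \<bar>U.ustat n y\<bar>}"
    by (rule S.finite_measure_mono) (use null_event_subset[OF n t(1) tails Cs] in auto)
  also have "\<dots> \<le> Bc * Dc * (real n)\<^sup>2 / (2 * ?x\<^sup>2)"
    by (rule ustat_chebyshev) (use Cs t n0 in simp)
  also have "\<dots> = 8 * (Bc * Dc) / ((Cs - L')\<^sup>2 * (real n * t)\<^sup>2)"
  proof -
    have "X * a\<^sup>2 / (2 * (q * s * a\<^sup>2 / 4)\<^sup>2) = 8 * X / (q\<^sup>2 * (a * s)\<^sup>2)" if "a \<noteq> 0" "q \<noteq> 0" "s \<noteq> 0" for a q s X :: real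
      using that by (simp add: power2_eq_square field_simps)
    then show ?thesis using n0 t Cs by simp
  qed
  also have "\<dots> \<le> 8 * (B0 * D0 * (real n * t)\<^sup>2) / ((Cs - L')\<^sup>2 * (real n * t)\<^sup>2)"
    unfolding Bc_Dc_eq using t hp B0_pos D0_pos
    by (intro divide_right_mono mult_left_mono power_mono) auto
  also have "\<dots> = 8 * B0 * D0 / (Cs - L')\<^sup>2" using n0 t by simp
  finally show ?thesis
    unfolding sample_law_eq cmod_test_stat[OF n] S.emeasure_eq_measure by (rule ennreal_leI)
qed

text \<open>For the grid bandwidths, whose thresholds exceed the standard deviation by a factor
  \<open>\<kappa>\<close>. With \<open>\<kappa>\<^sup>2 = ln (ln n)\<close> the exponential term is
  \<open>2 / (ln n)\<^sup>2\<close>, which survives a union over about \<open>ln n\<close>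
  bandwidths.\<close>

lemma type_one_error_exponential:
  assumes n: "n \<ge> 2" and k: "0 < \<kappa>" "2 * \<kappa>\<^sup>2 * (D0 / B0) \<le> real n * h"
    and t: "0 < t" "\<kappa> * h powr (- 2 * \<sigma> - 1 / 2) \<le> real n * t"
    and tails: "tail_energy (fourier f) h \<le> L' * t" and Cs: "L' + 16 * sqrt (B0 * D0) \<le> Cs"
  shows "emeasure (sample_law g f n) {y \<in> space (sample_law g f n). cmod (test_stat g f n h y) > Cs * t}
    \<le> ennreal (2 * exp (- 2 * \<kappa>\<^sup>2) + 2 * (B0 / D0) * h + 8 * \<kappa> ^ 4 * (D0 / B0) / (real n * h))"
proof -
  interpret S: prob_space "U.sample n" by (rule U.prob_space_sample)
  note [measurable] = stat_measurable U.ustat_measurable[of n n, simplified]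
  have n0: "0 < real n" using n by auto
  have hp: "0 < h powr (- 2 * \<sigma> - 1 / 2)" using h by simp
  have r0: "0 < sqrt (B0 * D0)" using B0_pos D0_pos by simp
  have Cs': "L' < Cs" using Cs r0 by linarith
  have sq: "sqrt (Bc * Dc) = sqrt (B0 * D0) * h powr (- 2 * \<sigma> - 1 / 2)"
    unfolding Bc_Dc_eq using hp by (simp add: real_sqrt_mult)
  \<comment> \<open>The constant \<open>16\<close> is \<open>4 * 4\<close>: four units in the tail
    bound for \<open>ustat\<close>, and the \<open>1 / 4\<close> lost in
    \<open>null_event_subset\<close>.\<close>
  have le: "4 * \<kappa> * (real n * sqrt (Bc * Dc)) \<le> (Cs - L') * t * (real n)\<^sup>2 / 4"
  proof -
    have "16 * sqrt (B0 * D0) * (\<kappa> * h powr (- 2 * \<sigma> - 1 / 2)) \<le> (Cs - L') * (real n * t)"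
      by (rule mult_mono[OF _ t(2)]) (use Cs Cs' k hp in auto)
    then have "real n / 4 * (16 * sqrt (B0 * D0) * (\<kappa> * h powr (- 2 * \<sigma> - 1 / 2))) \<le> real n / 4 * ((Cs - L') * (real n * t))"
      using n0 by (intro mult_left_mono) auto
    then show ?thesis unfolding sq by (simp add: power2_eq_square ac_simps)
  qed
  have cond: "2 * \<kappa>\<^sup>2 * Dc \<le> real n * Bc"
  proof -
    have "2 * \<kappa>\<^sup>2 * (Dc / Bc) = 2 * \<kappa>\<^sup>2 * (D0 / B0) / h" unfolding Dc_div_Bc by simp
    also have "\<dots> \<le> real n" using k(2) h by (simp only: pos_divide_le_eq)
    finally show ?thesis using Bc_pos by (simp add: field_simps)
  qed
  have "measure (U.sample n) {y \<in> space (U.sample n). Cs * t < \<bar>stat n y\<bar>}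
    \<le> measure (U.sample n) {y \<in> space (U.sample n). 4 * \<kappa> * (real n * sqrt (Bc * Dc)) \<le> \<bar>U.ustat n y\<bar>}"
  proof (rule S.finite_measure_mono)
    show "{y \<in> space (U.sample n). Cs * t < \<bar>stat n y\<bar>} \<subseteq> {y \<in> space (U.sample n). 4 * \<kappa> * (real n * sqrt (Bc * Dc)) \<le> \<bar>U.ustat n y\<bar>}"
      using null_event_subset[OF n t(1) tails Cs'] order_trans[OF le] by auto
  qed measurable
  also have "\<dots> \<le> 2 * exp (- (4 - 2) * \<kappa>\<^sup>2) + 2 * Bc / Dc + 8 * \<kappa> ^ 4 * Dc / (real n * Bc)"
    by (rule U.ustat_tail) (use n k cond in auto)
  also have "\<dots> = 2 * exp (- 2 * \<kappa>\<^sup>2) + 2 * (Bc / Dc) + 8 * \<kappa> ^ 4 / real n * (Dc / Bc)" by simp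
  also have "\<dots> = 2 * exp (- 2 * \<kappa>\<^sup>2) + 2 * (B0 / D0) * h + 8 * \<kappa> ^ 4 * (D0 / B0) / (real n * h)"
    unfolding Bc_div_Dc Dc_div_Bc by (simp add: ac_simps)
  finally show ?thesis
    unfolding sample_law_eq cmod_test_stat[OF n] S.emeasure_eq_measure by (rule ennreal_leI)
qed

end

section \<open>Growth of the smoothness weights beyond the band\<close>

lemma weight_lower_regular:
  assumes "0 < h" "0 \<le> \<beta>" "0 \<le> \<alpha>" "1 / h < \<bar>u\<bar>"
  shows "h powr (- 2 * \<beta>) \<le> smoothness_weight \<alpha> 0 \<beta> u"
proof -
  have "h powr (- 2 * \<beta>) = (1 / h) powr (2 * \<beta>)" using assms by (simp add: powr_minus powr_divide inverse_eq_divide)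
  also have "\<dots> \<le> \<bar>u\<bar> powr (2 * \<beta>)" using assms by (intro powr_mono2) auto
  also have "\<dots> \<le> \<bar>u\<bar> powr (2 * \<beta>) * exp (2 * \<alpha>)"
    using assms mult_left_mono[of 1 "exp (2 * \<alpha>)" "\<bar>u\<bar> powr (2 * \<beta>)"] by simp
  finally show ?thesis by (simp add: smoothness_weight_def)
qed

text \<open>An exponential beats every power. With \<open>y = \<bar>u\<bar> powr rlo\<close>, the
  inequality \<open>ln x \<le> x - 1\<close> at \<open>x = 2 * \<alpha>lo * y / p\<close> yields the
  claim, and \<open>c\<close> is the minimum of
  \<open>exp (2 * \<alpha>lo * y) * y powr (- p)\<close>. It depends on the lower ends of the
  parameter ranges and on \<open>\<beta>hi\<close>, not on the individual parameters.\<close>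

lemma weight_lower_supersmooth:
  fixes \<alpha>lo rlo \<beta>hi :: real
  assumes a: "0 < \<alpha>lo" "0 < rlo" "0 < \<beta>hi"
  obtains c where "0 < c"
    "\<And>h \<alpha> r \<beta> u. 0 < h \<Longrightarrow> h \<le> 1 \<Longrightarrow> \<alpha>lo \<le> \<alpha> \<Longrightarrow> rlo \<le> r \<Longrightarrow> 0 \<le> \<beta> \<Longrightarrow> 1 / h < \<bar>u\<bar> \<Longrightarrow>
      c * h powr (- 2 * \<beta>hi) \<le> smoothness_weight \<alpha> r \<beta> u"
proof -
  define p where "p = 2 * \<beta>hi / rlo"
  have p: "0 < p" using a by (simp add: p_def)
  define c where "c = exp (p - p * ln (p / (2 * \<alpha>lo)))"
  show ?thesis
  proof (rule that[of c])
    fix h \<alpha> r \<beta> u :: real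
    assume h: "0 < h" "h \<le> 1" and as: "\<alpha>lo \<le> \<alpha>" "rlo \<le> r" "0 \<le> \<beta>" "1 / h < \<bar>u\<bar>"
    have "1 \<le> 1 / h" using h by simp
    then have u: "1 < \<bar>u\<bar>" using as by linarith
    define y where "y = \<bar>u\<bar> powr rlo"
    have y: "0 < y" using u by (simp add: y_def)
    have "ln (2 * \<alpha>lo * y / p) \<le> 2 * \<alpha>lo * y / p - 1" using a p y by (intro ln_le_minus_one) auto
    moreover have "ln (2 * \<alpha>lo * y / p) = ln y - ln (p / (2 * \<alpha>lo))" using a p y by (simp add: ln_div ln_mult)
    ultimately have "p * (ln y - ln (p / (2 * \<alpha>lo))) \<le> p * (2 * \<alpha>lo * y / p - 1)" using p by (intro mult_left_mono) auto
    then have "p - p * ln (p / (2 * \<alpha>lo)) + p * ln y \<le> 2 * \<alpha>lo * y" using p by (simp add: algebra_simps)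
    then have "exp (p - p * ln (p / (2 * \<alpha>lo)) + p * ln y) \<le> exp (2 * \<alpha>lo * y)" by simp
    moreover have "p * ln y = 2 * \<beta>hi * ln \<bar>u\<bar>" using u a by (simp add: y_def p_def ln_powr)
    then have "exp (p * ln y) = \<bar>u\<bar> powr (2 * \<beta>hi)" using u by (simp add: powr_def)
    ultimately have "c * \<bar>u\<bar> powr (2 * \<beta>hi) \<le> exp (2 * \<alpha>lo * y)" by (simp add: c_def exp_add)
    also have "\<dots> \<le> exp (2 * \<alpha> * \<bar>u\<bar> powr r)"
    proof -
      have "y \<le> \<bar>u\<bar> powr r" using u as unfolding y_def by (intro powr_mono) auto
      then have "\<alpha>lo * y \<le> \<alpha> * \<bar>u\<bar> powr r" using as a y by (intro mult_mono) auto
      then show ?thesis by simp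
    qed
    also have "\<dots> \<le> smoothness_weight \<alpha> r \<beta> u"
    proof -
      have "1 \<le> \<bar>u\<bar> powr (2 * \<beta>)" using u as by (intro ge_one_powr_ge_zero) auto
      then show ?thesis using as a mult_right_mono[of 1 "\<bar>u\<bar> powr (2 * \<beta>)" "exp (2 * \<alpha> * \<bar>u\<bar> powr r)"]
        by (simp add: smoothness_weight_def)
    qed
    finally have 1: "c * \<bar>u\<bar> powr (2 * \<beta>hi) \<le> smoothness_weight \<alpha> r \<beta> u" .
    have "h powr (- 2 * \<beta>hi) = (1 / h) powr (2 * \<beta>hi)" using h by (simp add: powr_minus powr_divide inverse_eq_divide)
    also have "\<dots> \<le> \<bar>u\<bar> powr (2 * \<beta>hi)" using as h a by (intro powr_mono2) auto
    finally have "c * h powr (- 2 * \<beta>hi) \<le> c * \<bar>u\<bar> powr (2 * \<beta>hi)"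
      by (intro mult_left_mono) (simp_all add: c_def)
    then show "c * h powr (- 2 * \<beta>hi) \<le> smoothness_weight \<alpha> r \<beta> u" using 1 by simp
  qed (simp add: c_def)
qed

section \<open>The adaptive test\<close>

text \<open>The bandwidth balances squared bias and standard deviation: the first equation is the
  bias at smoothness \<open>\<beta>\<close>, the second the scale of the quadratic part. The
  variable \<open>x\<close> stands for \<open>n\<close> or for \<open>eff_n n\<close>.\<close>

lemma bandwidth_powers:
  fixes x \<beta> \<sigma> :: real
  assumes x: "0 < x" and s: "0 < 4 * \<beta> + 4 * \<sigma> + 1"
  shows "(x powr (- 2 / (4 * \<beta> + 4 * \<sigma> + 1))) powr (2 * \<beta>) = x powr (- 4 * \<beta> / (4 * \<beta> + 4 * \<sigma> + 1))"
    and "(x powr (- 2 / (4 * \<beta> + 4 * \<sigma> + 1))) powr (- 2 * \<sigma> - 1 / 2) = x * x powr (- 4 * \<beta> / (4 * \<beta> + 4 * \<sigma> + 1))"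
proof -
  show "(x powr (- 2 / (4 * \<beta> + 4 * \<sigma> + 1))) powr (2 * \<beta>) = x powr (- 4 * \<beta> / (4 * \<beta> + 4 * \<sigma> + 1))"
    by (simp add: powr_powr)
  have "x * x powr (- 4 * \<beta> / (4 * \<beta> + 4 * \<sigma> + 1)) = x powr (1 + - 4 * \<beta> / (4 * \<beta> + 4 * \<sigma> + 1))"
    using x by (simp only: powr_add powr_one)
  also have "1 + - 4 * \<beta> / (4 * \<beta> + 4 * \<sigma> + 1) = - 2 / (4 * \<beta> + 4 * \<sigma> + 1) * (- 2 * \<sigma> - 1 / 2)"
    using s by (simp add: divide_simps) (simp add: algebra_simps)
  finally show "(x powr (- 2 / (4 * \<beta> + 4 * \<sigma> + 1))) powr (- 2 * \<sigma> - 1 / 2) = x * x powr (- 4 * \<beta> / (4 * \<beta> + 4 * \<sigma> + 1))"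
    by (simp only: powr_powr)
qed

definition large_n :: "nat \<Rightarrow> bool" where
  "large_n n \<longleftrightarrow> 3 \<le> n \<and> 2 \<le> ln (real n) \<and> 1 \<le> ln (ln (real n)) \<and> sqrt (real n) \<le> eff_n n \<and> eff_n n \<le> real n"

lemma eventually_large_n: "\<forall>\<^sub>F n in sequentially. large_n n"
proof -
  have "\<forall>\<^sub>F n in sequentially. 2 \<le> ln (real n)" by real_asymp
  moreover have "\<forall>\<^sub>F n in sequentially. 1 \<le> ln (ln (real n))" by real_asymp
  moreover have "\<forall>\<^sub>F n in sequentially. sqrt (real n) \<le> eff_n n" unfolding eff_n_def by real_asymp
  moreover have "\<forall>\<^sub>F n in sequentially. eff_n n \<le> real n" unfolding eff_n_def by real_asymp
  ultimately show ?thesis using eventually_ge_at_top[of 3]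
    unfolding large_n_def by eventually_elim auto
qed

lemma large_nD:
  assumes "large_n n"
  shows "3 \<le> n" "2 \<le> n" "2 \<le> ln (real n)" "1 \<le> ln (ln (real n))" "1 \<le> eff_n n" "sqrt (real n) \<le> eff_n n"
    "eff_n n \<le> real n" "eff_n n * sqrt (ln (ln (real n))) = real n"
    "ln (real n) \<le> real (grid_size n)" "real (grid_size n) \<le> ln (real n) + 1" "2 \<le> grid_size n"
proof -
  note a = assms[unfolded large_n_def]
  show "3 \<le> n" "2 \<le> ln (real n)" "1 \<le> ln (ln (real n))" "sqrt (real n) \<le> eff_n n" "eff_n n \<le> real n"
    using a by auto
  then show "2 \<le> n" by simp
  have "1 \<le> sqrt (real n)" using a by simp
  then show "1 \<le> eff_n n" using a by linarith
  have "0 < sqrt (ln (ln (real n)))" using a by simp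
  then show "eff_n n * sqrt (ln (ln (real n))) = real n" by (simp add: eff_n_def)
  show l: "ln (real n) \<le> real (grid_size n)" unfolding grid_size_def by linarith
  show "real (grid_size n) \<le> ln (real n) + 1" unfolding grid_size_def using a by linarith
  have "2 \<le> real (grid_size n)" using a l by linarith
  then show "2 \<le> grid_size n" by simp
qed

lemma grid_beta_bounds:
  assumes n: "large_n n" and i: "i \<in> {1..grid_size n}" and b: "\<beta>lo < \<beta>hi"
  shows "\<beta>lo \<le> grid_beta \<beta>lo \<beta>hi n i" "grid_beta \<beta>lo \<beta>hi n i \<le> \<beta>hi"
proof -
  have N: "0 < real (grid_size n) - 1" using large_nD[OF n] by simp
  have i': "0 \<le> real i - 1" "real i - 1 \<le> real (grid_size n) - 1" using i by auto
  show "\<beta>lo \<le> grid_beta \<beta>lo \<beta>hi n i" using i' N b by (simp add: grid_beta_def)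
  have "(real i - 1) * (\<beta>hi - \<beta>lo) \<le> (real (grid_size n) - 1) * (\<beta>hi - \<beta>lo)"
    using i' b by (intro mult_right_mono) auto
  then have "(real i - 1) * (\<beta>hi - \<beta>lo) / (real (grid_size n) - 1) \<le> \<beta>hi - \<beta>lo"
    using N by (simp add: pos_divide_le_eq mult.commute)
  then show "grid_beta \<beta>lo \<beta>hi n i \<le> \<beta>hi" by (simp add: grid_beta_def)
qed

lemma grid_bandwidth:
  assumes n: "large_n n" and i: "i \<in> {1..grid_size n}" and b: "0 \<le> \<beta>lo" "\<beta>lo < \<beta>hi" and \<sigma>: "1 < \<sigma>"
  defines "h \<equiv> bandwidth \<sigma> \<beta>lo \<beta>hi n i" and "t \<equiv> threshold_sq \<sigma> \<beta>lo \<beta>hi n i" and "\<beta> \<equiv> grid_beta \<beta>lo \<beta>hi n i"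
  shows "0 < h" "h \<le> 1" "0 < t" "h powr (2 * \<beta>) = t" "h powr (2 * \<beta>hi) \<le> t"
    "sqrt (ln (ln (real n))) * h powr (- 2 * \<sigma> - 1 / 2) = real n * t"
    "h powr (- 2 * \<sigma> - 1 / 2) \<le> real n * t"
    "h \<le> real n powr (- 1 / (4 * \<beta>hi + 4 * \<sigma> + 1))" "real n powr (3 / 5) \<le> real n * h"
proof -
  note nD = large_nD[OF n]
  note \<beta> = grid_beta_bounds[OF n i b(2), folded \<beta>_def]
  let ?s = "4 * \<beta> + 4 * \<sigma> + 1" and ?x = "eff_n n"
  have s: "5 \<le> ?s" "0 < ?s" using \<beta> b \<sigma> by auto
  have x: "1 \<le> ?x" "0 < ?x" using nD by auto
  have n0: "0 < real n" "1 \<le> real n" using nD by auto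
  have h: "h = ?x powr (- 2 / ?s)" and t: "t = ?x powr (- 4 * \<beta> / ?s)"
    using i by (auto simp: h_def t_def \<beta>_def bandwidth_def threshold_sq_def)
  note P = bandwidth_powers[OF x(2) s(2)]
  show h0: "0 < h" and t0: "0 < t" using x by (auto simp: h t)
  show ht: "h powr (2 * \<beta>) = t" unfolding h t by (rule P(1))
  have "?x powr (- 2 / ?s) \<le> ?x powr 0" using x s by (intro powr_mono) auto
  then show h1: "h \<le> 1" using x by (simp add: h)
  show "h powr (2 * \<beta>hi) \<le> t" unfolding ht[symmetric] using h0 h1 \<beta> by (intro powr_mono') auto
  have "sqrt (ln (ln (real n))) * h powr (- 2 * \<sigma> - 1 / 2) = (?x * sqrt (ln (ln (real n)))) * ?x powr (- 4 * \<beta> / ?s)"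
    unfolding h P(2) by simp
  then show e: "sqrt (ln (ln (real n))) * h powr (- 2 * \<sigma> - 1 / 2) = real n * t"
    unfolding nD(8) t .
  have "1 * h powr (- 2 * \<sigma> - 1 / 2) \<le> sqrt (ln (ln (real n))) * h powr (- 2 * \<sigma> - 1 / 2)"
    using nD(4) by (intro mult_right_mono) auto
  then show "h powr (- 2 * \<sigma> - 1 / 2) \<le> real n * t" using e by simp
  have "h \<le> ?x powr (- 2 / (4 * \<beta>hi + 4 * \<sigma> + 1))"
    unfolding h using x s \<beta> by (intro powr_mono) (auto simp: field_simps)
  also have "\<dots> \<le> (sqrt (real n)) powr (- 2 / (4 * \<beta>hi + 4 * \<sigma> + 1))"
    using nD n0 s \<beta> by (intro powr_mono2') (auto simp: divide_le_0_iff)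
  also have "\<dots> = real n powr (- 1 / (4 * \<beta>hi + 4 * \<sigma> + 1))"
    using n0 by (simp add: powr_half_sqrt[symmetric] powr_powr)
  finally show "h \<le> real n powr (- 1 / (4 * \<beta>hi + 4 * \<sigma> + 1))" .
  \<comment> \<open>Since \<open>\<sigma> > 1\<close>, the denominator of the exponent is at least
    \<open>5\<close>, so \<open>n * h\<close> grows at least like \<open>n\<close> to the power
    \<open>3 / 5\<close>.\<close>
  have "real n powr (- 2 / 5) \<le> ?x powr (- 2 / 5)" using nD n0 x by (intro powr_mono2') auto
  also have "\<dots> \<le> h" unfolding h using x s by (intro powr_mono) (auto simp: field_simps)
  finally have "real n * real n powr (- 2 / 5) \<le> real n * h" using n0 by (intro mult_left_mono) auto
  moreover have "real n * real n powr (- 2 / 5) = real n powr (1 + - 2 / 5)"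
    using n0 by (simp only: powr_add powr_one)
  ultimately show "real n powr (3 / 5) \<le> real n * h" by simp
qed

lemma last_bandwidth:
  assumes n: "large_n n" and i: "i = grid_size n + 1" and b: "0 \<le> \<beta>lo" "\<beta>lo < \<beta>hi" and \<sigma>: "1 < \<sigma>"
  defines "h \<equiv> bandwidth \<sigma> \<beta>lo \<beta>hi n i" and "t \<equiv> threshold_sq \<sigma> \<beta>lo \<beta>hi n i"
  shows "0 < h" "h \<le> 1" "0 < t" "h powr (2 * \<beta>hi) = t" "h powr (- 2 * \<sigma> - 1 / 2) \<le> real n * t"
    "t = (real n powr (- 2 * \<beta>hi / (4 * \<beta>hi + 4 * \<sigma> + 1)))\<^sup>2"
proof -
  note nD = large_nD[OF n]
  let ?s = "4 * \<beta>hi + 4 * \<sigma> + 1"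
  have s: "0 < ?s" using b \<sigma> by auto
  have n0: "0 < real n" "1 \<le> real n" using nD by auto
  have h: "h = real n powr (- 2 / ?s)" and t: "t = real n powr (- 4 * \<beta>hi / ?s)"
    using i by (auto simp: h_def t_def bandwidth_def threshold_sq_def)
  note P = bandwidth_powers[OF n0(1) s]
  show "0 < h" "0 < t" using n0 by (auto simp: h t)
  show "h powr (2 * \<beta>hi) = t" unfolding h t by (rule P(1))
  show "h powr (- 2 * \<sigma> - 1 / 2) \<le> real n * t" unfolding h t P(2) by simp
  have "real n powr (- 2 / ?s) \<le> real n powr 0" using n0 s by (intro powr_mono) auto
  then show "h \<le> 1" using n0 by (simp add: h)
  show "t = (real n powr (- 2 * \<beta>hi / ?s))\<^sup>2" unfolding t using n0 by (simp add: powr_power)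
qed

text \<open>The index is rounded down, so that the tail bound at \<open>\<beta>\<close> implies the
  one at the grid point. The price is a factor \<open>eff_n n powr d\<close> for grid spacing
  \<open>d\<close>; the spacing is of order \<open>1 / ln n\<close>, so this factor is
  bounded.\<close>

lemma grid_point_exists:
  assumes n: "large_n n" and b: "0 \<le> \<beta>lo" "\<beta>lo < \<beta>hi" and \<sigma>: "1 < \<sigma>" and \<beta>: "\<beta>lo \<le> \<beta>" "\<beta> \<le> \<beta>hi"
  obtains i where "i \<in> {1..grid_size n}" "grid_beta \<beta>lo \<beta>hi n i \<le> \<beta>"
    "threshold_sq \<sigma> \<beta>lo \<beta>hi n i \<le> exp (2 * (\<beta>hi - \<beta>lo)) * (eff_n n powr (- 2 * \<beta> / (4 * \<beta> + 4 * \<sigma> + 1)))\<^sup>2"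
proof -
  note nD = large_nD[OF n]
  let ?N = "real (grid_size n)"
  define d where "d = (\<beta>hi - \<beta>lo) / (?N - 1)"
  have N: "0 < ?N - 1" using nD by simp
  have d: "0 < d" using b N by (simp add: d_def)
  define k where "k = nat \<lfloor>(\<beta> - \<beta>lo) / d\<rfloor>"
  have q: "0 \<le> (\<beta> - \<beta>lo) / d" using \<beta> d by simp
  have k: "real k \<le> (\<beta> - \<beta>lo) / d" "(\<beta> - \<beta>lo) / d < real k + 1" using q unfolding k_def by linarith+
  have "(\<beta> - \<beta>lo) / d \<le> (\<beta>hi - \<beta>lo) / d" using \<beta> d by (intro divide_right_mono) auto
  also have "\<dots> = ?N - 1" using N b by (simp add: d_def)
  finally have kN: "real k \<le> ?N - 1" using k by linarith
  have gb: "grid_beta \<beta>lo \<beta>hi n (k + 1) = \<beta>lo + real k * d" by (simp add: grid_beta_def d_def)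
  have le: "\<beta>lo + real k * d \<le> \<beta>" using k(1) d by (simp add: field_simps)
  have ge: "\<beta> - (\<beta>lo + real k * d) \<le> d" using k(2) d by (simp add: field_simps)
  define \<gamma> where "\<gamma> = grid_beta \<beta>lo \<beta>hi n (k + 1)"
  have ki: "k + 1 \<in> {1..grid_size n}" using kN nD by auto
  have \<gamma>: "\<beta>lo \<le> \<gamma>" "\<gamma> \<le> \<beta>" "\<beta> - \<gamma> \<le> d" using le ge d by (auto simp: \<gamma>_def gb)
  let ?s = "4 * \<beta> + 4 * \<sigma> + 1" and ?r = "4 * \<gamma> + 4 * \<sigma> + 1" and ?x = "eff_n n"
  have sr: "5 \<le> ?s" "5 \<le> ?r" using \<gamma> b \<sigma> by auto
  have x: "1 \<le> ?x" "0 < ?x" using nD by auto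
  \<comment> \<open>The exponent \<open>4 * \<beta> / (4 * \<beta> + 4 * \<sigma> + 1)\<close> of
    the threshold is a Lipschitz function of \<open>\<beta>\<close> with constant at most
    \<open>1\<close>.\<close>
  have e: "4 * \<beta> / ?s - 4 * \<gamma> / ?r \<le> d"
  proof -
    have "4 * \<beta> / ?s - 4 * \<gamma> / ?r = 4 * (\<beta> - \<gamma>) * ((4 * \<sigma> + 1) / ?s) / ?r"
      using sr by (simp add: divide_simps) (simp add: algebra_simps)
    also have "\<dots> \<le> 4 * (\<beta> - \<gamma>) * 1 / 4"
      using sr \<gamma> b \<sigma> by (intro frac_le mult_left_mono mult_nonneg_nonneg) auto
    finally show ?thesis using \<gamma> by simp
  qed
  have "threshold_sq \<sigma> \<beta>lo \<beta>hi n (k + 1) = ?x powr (- 4 * \<gamma> / ?r)"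
    using ki by (auto simp: threshold_sq_def \<gamma>_def)
  also have "\<dots> = ?x powr (4 * \<beta> / ?s - 4 * \<gamma> / ?r) * (?x powr (- 2 * \<beta> / ?s))\<^sup>2"
    using x by (simp add: powr_power powr_add[symmetric])
  also have "\<dots> \<le> exp (2 * (\<beta>hi - \<beta>lo)) * (?x powr (- 2 * \<beta> / ?s))\<^sup>2"
  proof (rule mult_right_mono)
    have "?x powr (4 * \<beta> / ?s - 4 * \<gamma> / ?r) \<le> ?x powr d" using e x by (intro powr_mono) auto
    also have "\<dots> \<le> real n powr d" using nD x d by (intro powr_mono2) auto
    also have "\<dots> = exp (d * ln (real n))" using nD by (simp add: powr_def)
    also have "\<dots> \<le> exp (2 * (\<beta>hi - \<beta>lo))"
    proof -
      \<comment> \<open>Adding \<open>ln n \<le> N\<close> and \<open>2 \<le> N\<close> bounds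
        \<open>ln n\<close> by \<open>2 * (N - 1)\<close>, which absorbs the \<open>N - 1\<close> in
        the grid spacing.\<close>
      have "ln (real n) + 2 \<le> ?N + ?N" by (rule add_mono[OF nD(9) order_trans[OF nD(3,9)]])
      then have "ln (real n) \<le> 2 * (?N - 1)" by simp
      then have "d * ln (real n) \<le> d * (2 * (?N - 1))" using d by (intro mult_left_mono) auto
      also have "\<dots> = 2 * (d * (?N - 1))" by simp
      also have "d * (?N - 1) = \<beta>hi - \<beta>lo" using N by (simp add: d_def)
      finally show ?thesis by simp
    qed
    finally show "?x powr (4 * \<beta> / ?s - 4 * \<gamma> / ?r) \<le> exp (2 * (\<beta>hi - \<beta>lo))" .
  qed simp
  finally show ?thesis by (rule that[OF ki \<gamma>(2)[unfolded \<gamma>_def]])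
qed

lemma adaptive_test_event:
  fixes g f0 :: "real \<Rightarrow> real"
  assumes t: "\<And>i. i \<in> {1..grid_size n + 1} \<Longrightarrow> 0 < threshold_sq \<sigma> \<beta>lo \<beta>hi n i"
  shows "adaptive_test g f0 \<sigma> \<beta>lo \<beta>hi Cs n y = 1 \<longleftrightarrow>
      (\<exists>i\<in>{1..grid_size n + 1}. cmod (test_stat g f0 n (bandwidth \<sigma> \<beta>lo \<beta>hi n i) y) > Cs * threshold_sq \<sigma> \<beta>lo \<beta>hi n i)"
    and "adaptive_test g f0 \<sigma> \<beta>lo \<beta>hi Cs n y = 0 \<longleftrightarrow>
      (\<forall>i\<in>{1..grid_size n + 1}. cmod (test_stat g f0 n (bandwidth \<sigma> \<beta>lo \<beta>hi n i) y) \<le> Cs * threshold_sq \<sigma> \<beta>lo \<beta>hi n i)"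
proof -
  let ?a = "\<lambda>i. cmod (test_stat g f0 n (bandwidth \<sigma> \<beta>lo \<beta>hi n i) y) / threshold_sq \<sigma> \<beta>lo \<beta>hi n i"
  have "(MAX i\<in>{1..grid_size n + 1}. ?a i) > Cs \<longleftrightarrow> (\<exists>i\<in>{1..grid_size n + 1}. ?a i > Cs)"
    by (subst Max_gr_iff) auto
  also have "\<dots> \<longleftrightarrow> (\<exists>i\<in>{1..grid_size n + 1}. cmod (test_stat g f0 n (bandwidth \<sigma> \<beta>lo \<beta>hi n i) y) > Cs * threshold_sq \<sigma> \<beta>lo \<beta>hi n i)"
    using t by (intro bex_cong refl) (simp add: pos_less_divide_eq)
  finally have e: "(MAX i\<in>{1..grid_size n + 1}. ?a i) > Cs \<longleftrightarrow> (\<exists>i\<in>{1..grid_size n + 1}. cmod (test_stat g f0 n (bandwidth \<sigma> \<beta>lo \<beta>hi n i) y) > Cs * threshold_sq \<sigma> \<beta>lo \<beta>hi n i)" .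
  show "adaptive_test g f0 \<sigma> \<beta>lo \<beta>hi Cs n y = 1 \<longleftrightarrow>
      (\<exists>i\<in>{1..grid_size n + 1}. cmod (test_stat g f0 n (bandwidth \<sigma> \<beta>lo \<beta>hi n i) y) > Cs * threshold_sq \<sigma> \<beta>lo \<beta>hi n i)"
    unfolding adaptive_test_def e by simp
  show "adaptive_test g f0 \<sigma> \<beta>lo \<beta>hi Cs n y = 0 \<longleftrightarrow>
      (\<forall>i\<in>{1..grid_size n + 1}. cmod (test_stat g f0 n (bandwidth \<sigma> \<beta>lo \<beta>hi n i) y) \<le> Cs * threshold_sq \<sigma> \<beta>lo \<beta>hi n i)"
    unfolding adaptive_test_def e by (auto simp: not_le)
qed

context deconv
begin

lemma tail_energy_regular:
  assumes "f \<in> smoothness_class (\<alpha>, 0, \<beta>) L" "0 < L" "0 < h" "0 \<le> \<beta>" "0 \<le> \<alpha>"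
  shows "tail_energy (fourier f) h \<le> L * h powr (2 * \<beta>)"
proof -
  have "tail_energy (fourier f) h \<le> L / h powr (- 2 * \<beta>)"
    by (rule tail_energy_le_class[OF assms(1,2)]) (use assms weight_lower_regular in auto)
  then show ?thesis using assms by (simp add: powr_minus divide_inverse)
qed

theorem adaptive_upper_bound:
  assumes L: "0 < L" and ps: "parameter_set \<alpha>lo rlo rhi \<beta>lo \<beta>hi \<T>" and a0: "\<alpha>lo \<le> \<alpha>0"
    and f0: "f0 \<in> smoothness_class (\<alpha>0, 0, \<beta>hi) L" and \<epsilon>: "0 < \<epsilon>"
  shows "\<forall>\<^sub>F Cstar in at_top. \<exists>C0>0. \<forall>C>C0.
        limsup (\<lambda>n. total_error g f0 (alternatives \<T> L f0 C (rate \<sigma> \<beta>hi n)) n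
                      (adaptive_test g f0 \<sigma> \<beta>lo \<beta>hi Cstar n)) \<le> ennreal \<epsilon>"
proof -
  have b: "0 \<le> \<beta>lo" "\<beta>lo < \<beta>hi" and al: "0 < \<alpha>lo" using ps by (auto simp: parameter_set_def)
  have \<beta>hi: "0 < \<beta>hi" using b by simp
  have \<alpha>0: "0 \<le> \<alpha>0" using al a0 by simp
  have f0d: "is_density f0" and f02: "integrable lborel (\<lambda>x. (f0 x)\<^sup>2)"
    using f0 by (auto simp: smoothness_class_def)
  have BD: "0 < B0 * D0" using B0_pos D0_pos by simp
  \<comment> \<open>One constant serves for the tail energy in all classes: \<open>L\<close> itself
    when \<open>r = 0\<close>, and a larger value when the exponential weight has to be compared
    with the power \<open>2 * \<beta>hi\<close>.\<close>
  obtain L' where L': "L \<le> L'" and supersmooth: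
    "\<And>\<alpha> r \<beta> f h. 0 < rlo \<Longrightarrow> (\<alpha>, r, \<beta>) \<in> \<T> \<Longrightarrow> f \<in> smoothness_class (\<alpha>, r, \<beta>) L \<Longrightarrow> 0 < h \<Longrightarrow> h \<le> 1 \<Longrightarrow>
       tail_energy (fourier f) h \<le> L' * h powr (2 * \<beta>hi)"
  proof (cases "0 < rlo")
    case False
    then show ?thesis using that[of L] by simp
  next
    case True
    obtain c where c: "0 < c" "\<And>h \<alpha> r \<beta> u. 0 < h \<Longrightarrow> h \<le> 1 \<Longrightarrow> \<alpha>lo \<le> \<alpha> \<Longrightarrow> rlo \<le> r \<Longrightarrow> 0 \<le> \<beta> \<Longrightarrow> 1 / h < \<bar>u\<bar> \<Longrightarrow>
      c * h powr (- 2 * \<beta>hi) \<le> smoothness_weight \<alpha> r \<beta> u"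
      using weight_lower_supersmooth[OF al True \<beta>hi] by metis
    have "tail_energy (fourier f) h \<le> max L (L / c) * h powr (2 * \<beta>hi)"
      if T: "(\<alpha>, r, \<beta>) \<in> \<T>" and f: "f \<in> smoothness_class (\<alpha>, r, \<beta>) L" and h: "0 < h" "h \<le> 1" for \<alpha> r \<beta> f h
    proof -
      have "\<alpha>lo \<le> \<alpha>" "rlo \<le> r" "\<beta>lo \<le> \<beta>" using T ps True by (auto simp: parameter_set_def)
      then have "tail_energy (fourier f) h \<le> L / (c * h powr (- 2 * \<beta>hi))"
        using b h c by (intro tail_energy_le_class[OF f L]) auto
      also have "\<dots> = L / c * h powr (2 * \<beta>hi)" using h by (simp add: powr_minus divide_inverse)
      also have "\<dots> \<le> max L (L / c) * h powr (2 * \<beta>hi)" by (intro mult_right_mono) auto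
      finally show ?thesis .
    qed
    then show ?thesis by (intro that[of "max L (L / c)"]) auto
  qed
  have L'0: "0 < L'" using L L' by simp
  define R where "R = exp (2 * (\<beta>hi - \<beta>lo))"
  have R: "1 \<le> R" using b by (simp add: R_def)
  \<comment> \<open>The term with \<open>16\<close> is required by the exponential bound on the
    grid. The last term makes the Chebyshev bound at the final bandwidth at most
    \<open>\<epsilon> / 4\<close>; the summand \<open>1\<close> gives
    \<open>Cs - L' \<ge> 1\<close>, so that its square dominates it.\<close>
  define Cmin where "Cmin = L' + 16 * sqrt (B0 * D0) + 1 + 32 * B0 * D0 / \<epsilon>"
  show ?thesis
  proof (rule eventually_mono[OF eventually_ge_at_top[of Cmin]])
    fix Cs assume Cs: "Cmin \<le> Cs"
    have Cs1: "L' + 16 * sqrt (B0 * D0) \<le> Cs" "L' < Cs" "1 + 32 * B0 * D0 / \<epsilon> \<le> Cs - L'"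
    proof -
      have "0 \<le> sqrt (B0 * D0)" "0 \<le> 32 * B0 * D0 / \<epsilon>" using BD \<epsilon> by (auto simp: mult.assoc)
      then show "L' + 16 * sqrt (B0 * D0) \<le> Cs" "L' < Cs" "1 + 32 * B0 * D0 / \<epsilon> \<le> Cs - L'"
        using Cs unfolding Cmin_def by linarith+
    qed
    have Cs0: "0 < Cs" using Cs1 L'0 by linarith
    \<comment> \<open>The signal constant needed for detection: at least twice the threshold
      constant, and large enough for a type two error of at most
      \<open>\<epsilon> / 4\<close>.\<close>
    define K where "K = 1 + 2 * Cs + 4 * (64 * B0 + 128 * B0 * D0) / \<epsilon>"
    have K: "1 \<le> K" "2 * Cs \<le> K" "4 * (64 * B0 + 128 * B0 * D0) / \<epsilon> \<le> K"
      using Cs0 \<epsilon> B0_pos D0_pos by (auto simp: K_def)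
    have K2: "64 * B0 / K + 128 * B0 * D0 / K\<^sup>2 \<le> \<epsilon> / 4"
    proof -
      have "K * 1 \<le> K * K" using K by (intro mult_left_mono) auto
      then have "128 * B0 * D0 / K\<^sup>2 \<le> 128 * B0 * D0 / K"
        using K B0_pos D0_pos by (intro divide_left_mono) (auto simp: power2_eq_square)
      then have "64 * B0 / K + 128 * B0 * D0 / K\<^sup>2 \<le> (64 * B0 + 128 * B0 * D0) / K" by (simp add: add_divide_distrib)
      also have "\<dots> \<le> \<epsilon> / 4" using K(1,3) \<epsilon> by (simp add: field_simps)
      finally show ?thesis .
    qed
    have N2: "8 * B0 * D0 / (Cs - L')\<^sup>2 \<le> \<epsilon> / 4"
    proof -
      have q: "1 \<le> Cs - L'" 
      proof -
        have "0 \<le> 32 * B0 * D0 / \<epsilon>" using BD \<epsilon> by (auto simp: mult.assoc)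
        then show ?thesis using Cs1(3) by linarith
      qed
      have "32 * B0 * D0 / \<epsilon> \<le> Cs - L'" using Cs1(3) by simp
      also have "\<dots> \<le> (Cs - L')\<^sup>2" using q mult_left_mono[OF q, of "Cs - L'"] by (simp add: power2_eq_square)
      finally show ?thesis using \<epsilon> q by (simp add: field_simps)
    qed
    \<comment> \<open>\<open>4 * L'\<close> pays for the two tails in the squared distance, and
      \<open>R\<close> for rounding the smoothness to the grid.\<close>
    define C0 where "C0 = R * (K + 4 * L')"
    have "limsup (\<lambda>n. total_error g f0 (alternatives \<T> L f0 C (rate \<sigma> \<beta>hi n)) n
                      (adaptive_test g f0 \<sigma> \<beta>lo \<beta>hi Cs n)) \<le> ennreal \<epsilon>" if C: "C > C0" for C
    proof (rule Limsup_bounded)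
      let ?a = "1 / (4 * \<beta>hi + 4 * \<sigma> + 1)" and ?e = "B0 / D0" and ?e' = "D0 / B0"
      \<comment> \<open>The union bound over the grid: the prefactor dominates the number of
        bandwidths, and \<open>h\<close> and \<open>n * h\<close> have been replaced by their
        uniform polynomial bounds.\<close>
      define r where "r n = (ln (real n) + 1) * (2 * exp (- 2 * ln (ln (real n))) + 2 * ?e * real n powr (- ?a)
          + 8 * (ln (ln (real n)))\<^sup>2 * ?e' / real n powr (3 / 5))" for n :: nat
      have "r \<longlonglongrightarrow> 0"
      proof -
        define a where "a = ?a"
        define e where "e = ?e"
        define e' where "e' = ?e'"
        have pos: "0 < a" "0 < e" "0 < e'" using \<beta>hi \<sigma> B0_pos D0_pos by (auto simp: a_def e_def e'_def)
        have "(\<lambda>n. (ln (real n) + 1) * (2 * exp (- 2 * ln (ln (real n))) + 2 * e * real n powr (- a)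
          + 8 * (ln (ln (real n)))\<^sup>2 * e' / real n powr (3 / 5))) \<longlonglongrightarrow> 0"
          using pos by real_asymp
        then show ?thesis unfolding r_def a_def e_def e'_def .
      qed
      then have ev1: "\<forall>\<^sub>F n in sequentially. r n < \<epsilon> / 2" using \<epsilon> by (intro order_tendstoD) auto
      have ev2: "\<forall>\<^sub>F n in sequentially. 2 * ln (ln (real n)) * ?e' \<le> real n powr (3 / 5)"
      proof -
        define e' where "e' = ?e'"
        have "0 < e'" using B0_pos D0_pos by (simp add: e'_def)
        then have "\<forall>\<^sub>F n in sequentially. 2 * ln (ln (real n)) * e' \<le> real n powr (3 / 5)" by real_asymp
        then show ?thesis by (simp add: e'_def)
      qed
      show "\<forall>\<^sub>F n in sequentially. total_error g f0 (alternatives \<T> L f0 C (rate \<sigma> \<beta>hi n)) n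
                      (adaptive_test g f0 \<sigma> \<beta>lo \<beta>hi Cs n) \<le> ennreal \<epsilon>"
        using ev1 ev2 eventually_large_n
      proof eventually_elim
        case (elim n)
        note nD = large_nD[OF elim(3)]
        let ?N = "grid_size n" and ?h = "bandwidth \<sigma> \<beta>lo \<beta>hi n" and ?t = "threshold_sq \<sigma> \<beta>lo \<beta>hi n"
        note gb = grid_bandwidth[OF elim(3) _ b \<sigma>] and lb = last_bandwidth[OF elim(3) _ b \<sigma>]
        have cases: "i \<in> {1..?N} \<or> i = ?N + 1" if "i \<in> {1..?N + 1}" for i using that by auto
        have "0 < ?t i \<and> 0 < ?h i \<and> ?h i \<le> 1 \<and> ?h i powr (2 * \<beta>hi) \<le> ?t i
          \<and> ?h i powr (- 2 * \<sigma> - 1 / 2) \<le> real n * ?t i" if "i \<in> {1..?N + 1}" for i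
          using cases[OF that]
        proof
          assume i: "i \<in> {1..?N}"
          show ?thesis by (intro conjI gb(1,2,3,5,7)[OF i])
        next
          assume i: "i = ?N + 1"
          show ?thesis by (intro conjI lb(1,2,3,5)[OF i] eq_refl lb(4)[OF i])
        qed
        then have t0: "\<And>i. i \<in> {1..?N + 1} \<Longrightarrow> 0 < ?t i"
          and hb: "\<And>i. i \<in> {1..?N + 1} \<Longrightarrow> 0 < ?h i" "\<And>i. i \<in> {1..?N + 1} \<Longrightarrow> ?h i \<le> 1"
          and ht: "\<And>i. i \<in> {1..?N + 1} \<Longrightarrow> ?h i powr (2 * \<beta>hi) \<le> ?t i"
          and hn: "\<And>i. i \<in> {1..?N + 1} \<Longrightarrow> ?h i powr (- 2 * \<sigma> - 1 / 2) \<le> real n * ?t i"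
          by blast+
        have ev: "adaptive_test g f0 \<sigma> \<beta>lo \<beta>hi Cs n y = 1 \<longleftrightarrow> (\<exists>i\<in>{1..?N + 1}. cmod (test_stat g f0 n (?h i) y) > Cs * ?t i)"
          "adaptive_test g f0 \<sigma> \<beta>lo \<beta>hi Cs n y = 0 \<longleftrightarrow> (\<forall>i\<in>{1..?N + 1}. cmod (test_stat g f0 n (?h i) y) \<le> Cs * ?t i)" for y
          by (rule adaptive_test_event, rule t0, assumption)+
        have tail0: "tail_energy (fourier f0) (?h i) \<le> L' * ?t i" if i: "i \<in> {1..?N + 1}" for i
        proof -
          have "tail_energy (fourier f0) (?h i) \<le> L * ?h i powr (2 * \<beta>hi)"
            using \<beta>hi \<alpha>0 hb[OF i] by (intro tail_energy_regular[OF f0 L]) auto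
          also have "\<dots> \<le> L' * ?t i" using L L' ht[OF i] by (intro mult_mono) auto
          finally show ?thesis .
        qed
        have dn: "deconv_null g \<sigma> G Ig f0 (?h i)" if "i \<in> {1..?N + 1}" for i
          using f0d f02 hb[OF that] by unfold_locales auto
        let ?E = "\<lambda>i. {y \<in> space (sample_law g f0 n). cmod (test_stat g f0 n (?h i) y) > Cs * ?t i}"
        have Em: "?E i \<in> sets (sample_law g f0 n)" if i: "i \<in> {1..?N + 1}" for i
        proof -
          interpret Z: deconv_null g \<sigma> G Ig f0 "?h i" by (rule dn[OF i])
          have "{y \<in> space (Z.U.sample n). \<bar>Z.stat n y\<bar> > Cs * ?t i} \<in> sets (Z.U.sample n)"
            using Z.stat_measurable[of n] by measurable
          then show ?thesis unfolding Z.cmod_test_stat[OF nD(2)] Z.sample_law_eq .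
        qed
        let ?r = "2 * exp (- 2 * ln (ln (real n))) + 2 * ?e * real n powr (- ?a)
          + 8 * (ln (ln (real n)))\<^sup>2 * ?e' / real n powr (3 / 5)"
        have r0: "0 \<le> ?r" using B0_pos D0_pos by (intro add_nonneg_nonneg mult_nonneg_nonneg divide_nonneg_nonneg) auto
        have E1: "emeasure (sample_law g f0 n) (?E i) \<le> ennreal ?r" if i: "i \<in> {1..?N}" for i
        proof -
          let ?k = "sqrt (ln (ln (real n)))"
          have i': "i \<in> {1..?N + 1}" using i by auto
          note g = gb[OF i]
          have k: "0 < ?k" "?k\<^sup>2 = ln (ln (real n))" using nD(4) by auto
          have k4: "?k ^ 4 = (ln (ln (real n)))\<^sup>2"
          proof -
            have "?k ^ 4 = (?k\<^sup>2)\<^sup>2" by (simp add: power_mult[symmetric])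
            then show ?thesis unfolding k(2) .
          qed
          have np: "0 < real n powr (3 / 5)" using nD by simp
          have "emeasure (sample_law g f0 n) (?E i)
            \<le> ennreal (2 * exp (- 2 * ?k\<^sup>2) + 2 * ?e * ?h i + 8 * ?k ^ 4 * ?e' / (real n * ?h i))"
          proof (rule deconv_null.type_one_error_exponential[OF dn[OF i'] nD(2) k(1)])
            show "2 * ?k\<^sup>2 * ?e' \<le> real n * ?h i" unfolding k(2) using elim(2) g(9) by linarith
            show "0 < ?t i" by (rule g(3))
            show "?k * ?h i powr (- 2 * \<sigma> - 1 / 2) \<le> real n * ?t i" using g(6) by simp
            show "tail_energy (fourier f0) (?h i) \<le> L' * ?t i" by (rule tail0[OF i'])
            show "L' + 16 * sqrt (B0 * D0) \<le> Cs" by (rule Cs1)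
          qed
          also have "\<dots> \<le> ennreal ?r"
            unfolding k(2) k4 using g(1,8,9) B0_pos D0_pos np
            by (intro ennreal_leI add_mono mult_left_mono divide_left_mono mult_pos_pos mult_nonneg_nonneg order.refl)
               (auto intro: less_le_trans)
          finally show ?thesis .
        qed
        have E2: "emeasure (sample_law g f0 n) (?E (?N + 1)) \<le> ennreal (\<epsilon> / 4)"
        proof -
          have i: "?N + 1 \<in> {1..?N + 1}" by simp
          have "emeasure (sample_law g f0 n) (?E (?N + 1)) \<le> ennreal (8 * B0 * D0 / (Cs - L')\<^sup>2)"
            by (rule deconv_null.type_one_error_chebyshev[OF dn[OF i] nD(2) t0[OF i] hn[OF i] tail0[OF i] Cs1(2)])
          also have "\<dots> \<le> ennreal (\<epsilon> / 4)" by (rule ennreal_leI[OF N2])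
          finally show ?thesis .
        qed
        have "test_prob g f0 n (adaptive_test g f0 \<sigma> \<beta>lo \<beta>hi Cs n) 1 \<le> emeasure (sample_law g f0 n) (\<Union>i\<in>{1..?N + 1}. ?E i)"
          unfolding test_prob_def
        proof (rule emeasure_mono)
          show "{y \<in> space (sample_law g f0 n). adaptive_test g f0 \<sigma> \<beta>lo \<beta>hi Cs n y = 1} \<subseteq> (\<Union>i\<in>{1..?N + 1}. ?E i)"
          proof
            fix y assume "y \<in> {y \<in> space (sample_law g f0 n). adaptive_test g f0 \<sigma> \<beta>lo \<beta>hi Cs n y = 1}"
            then have y: "y \<in> space (sample_law g f0 n)" and a: "adaptive_test g f0 \<sigma> \<beta>lo \<beta>hi Cs n y = 1" by auto
            from a[unfolded ev(1)] obtain i where "i \<in> {1..?N + 1}" "Cs * ?t i < cmod (test_stat g f0 n (?h i) y)" ..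
            then show "y \<in> (\<Union>i\<in>{1..?N + 1}. ?E i)" using y by (intro UN_I[of i]) simp_all
          qed
          show "(\<Union>i\<in>{1..?N + 1}. ?E i) \<in> sets (sample_law g f0 n)" by (rule sets.finite_UN[OF finite_atLeastAtMost Em])
        qed
        also have "\<dots> \<le> (\<Sum>i\<in>{1..?N + 1}. emeasure (sample_law g f0 n) (?E i))"
          by (rule emeasure_subadditive_finite[OF finite_atLeastAtMost image_subsetI]) (rule Em)
        also have "\<dots> = (\<Sum>i\<in>{1..?N}. emeasure (sample_law g f0 n) (?E i)) + emeasure (sample_law g f0 n) (?E (?N + 1))"
        proof -
          have "1 \<le> Suc ?N" by simp
          from sum.nat_ivl_Suc'[OF this, of "\<lambda>i. emeasure (sample_law g f0 n) (?E i)"]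
          show ?thesis by (simp only: Suc_eq_plus1 add.commute)
        qed
        also have "\<dots> \<le> (\<Sum>i\<in>{1..?N}. ennreal ?r) + ennreal (\<epsilon> / 4)"
          by (intro add_mono sum_mono E1 E2)
        also have "(\<Sum>i\<in>{1..?N}. ennreal ?r) = ennreal (real ?N * ?r)"
          using r0 by (simp add: ennreal_mult'[symmetric] ennreal_of_nat_eq_real_of_nat)
        also have "\<dots> \<le> ennreal (\<epsilon> / 2)"
        proof (rule ennreal_leI)
          have "real ?N * ?r \<le> (ln (real n) + 1) * ?r" by (rule mult_right_mono[OF nD(10) r0])
          then show "real ?N * ?r \<le> \<epsilon> / 2" using elim(1) unfolding r_def by linarith
        qed
        finally have P1: "test_prob g f0 n (adaptive_test g f0 \<sigma> \<beta>lo \<beta>hi Cs n) 1 \<le> ennreal (\<epsilon> / 2) + ennreal (\<epsilon> / 4)"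
          by (simp add: add_right_mono)
        have P2: "test_prob g f n (adaptive_test g f0 \<sigma> \<beta>lo \<beta>hi Cs n) 0 \<le> ennreal (\<epsilon> / 4)"
          if f: "f \<in> alternatives \<T> L f0 C (rate \<sigma> \<beta>hi n)" for f
        proof -
          from f obtain \<alpha> r \<beta> where T: "(\<alpha>, r, \<beta>) \<in> \<T>" and fc: "f \<in> smoothness_class (\<alpha>, r, \<beta>) L"
            and sep: "(L2_norm (\<lambda>x. f x - f0 x))\<^sup>2 / (rate \<sigma> \<beta>hi n (\<alpha>, r, \<beta>))\<^sup>2 \<ge> C"
            by (auto simp: alternatives_def)
          have fd: "is_density f" and f2: "integrable lborel (\<lambda>x. (f x)\<^sup>2)"
            using fc by (auto simp: smoothness_class_def)
          \<comment> \<open>One bandwidth suffices for detection: the last one for supersmooth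
            classes, and a grid point just below the true index for \<open>r = 0\<close>.\<close>
          have "\<exists>i\<in>{1..?N + 1}. tail_energy (fourier f) (?h i) \<le> L' * ?t i \<and> ?t i \<le> R * (rate \<sigma> \<beta>hi n (\<alpha>, r, \<beta>))\<^sup>2
              \<and> 0 < rate \<sigma> \<beta>hi n (\<alpha>, r, \<beta>)"
          proof (cases "0 < rlo")
            case True
            then have r: "0 < r" using T ps by (auto simp: parameter_set_def)
            have i: "?N + 1 \<in> {1..?N + 1}" by simp
            note l = lb[OF refl]
            have "tail_energy (fourier f) (?h (?N + 1)) \<le> L' * ?t (?N + 1)"
              using supersmooth[OF True T fc l(1,2)] unfolding l(4) .
            moreover have rt: "rate \<sigma> \<beta>hi n (\<alpha>, r, \<beta>) = real n powr (- 2 * \<beta>hi / (4 * \<beta>hi + 4 * \<sigma> + 1))"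
              using r by (simp add: rate_def)
            then have "?t (?N + 1) \<le> R * (rate \<sigma> \<beta>hi n (\<alpha>, r, \<beta>))\<^sup>2"
              unfolding l(6) using R mult_right_mono[OF R, of "(real n powr (- 2 * \<beta>hi / (4 * \<beta>hi + 4 * \<sigma> + 1)))\<^sup>2"] by simp
            moreover have "0 < rate \<sigma> \<beta>hi n (\<alpha>, r, \<beta>)" using nD unfolding rt by simp
            ultimately show ?thesis using i by blast
          next
            case False
            then have r: "r = 0" and \<beta>: "\<beta>lo \<le> \<beta>" "\<beta> \<le> \<beta>hi" and \<alpha>: "\<alpha>lo \<le> \<alpha>" using T ps by (auto simp: parameter_set_def)
            obtain i where i: "i \<in> {1..?N}" "grid_beta \<beta>lo \<beta>hi n i \<le> \<beta>"
              "?t i \<le> R * (eff_n n powr (- 2 * \<beta> / (4 * \<beta> + 4 * \<sigma> + 1)))\<^sup>2"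
              using grid_point_exists[OF elim(3) b \<sigma> \<beta>] unfolding R_def by metis
            note g = gb[OF i(1)]
            have "tail_energy (fourier f) (?h i) \<le> L * ?h i powr (2 * \<beta>)"
              using \<alpha> al \<beta> b g(1) by (intro tail_energy_regular[OF fc[unfolded r] L]) auto
            also have "\<dots> \<le> L' * ?h i powr (2 * grid_beta \<beta>lo \<beta>hi n i)"
              using L L' g(1,2) i(2) grid_beta_bounds(1)[OF elim(3) i(1) b(2)] b by (intro mult_mono powr_mono') auto
            finally have "tail_energy (fourier f) (?h i) \<le> L' * ?t i" unfolding g(4) .
            moreover have rt: "rate \<sigma> \<beta>hi n (\<alpha>, r, \<beta>) = eff_n n powr (- 2 * \<beta> / (4 * \<beta> + 4 * \<sigma> + 1))"
              using r by (simp add: rate_def)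
            moreover have "0 < rate \<sigma> \<beta>hi n (\<alpha>, r, \<beta>)" using nD(5) unfolding rt by simp
            moreover have "i \<in> {1..?N + 1}" using i(1) by auto
            ultimately show ?thesis using i(3) by (intro bexI[of _ i]) simp_all
          qed
          then obtain i where i: "i \<in> {1..?N + 1}" and tl: "tail_energy (fourier f) (?h i) \<le> L' * ?t i"
            and ti: "?t i \<le> R * (rate \<sigma> \<beta>hi n (\<alpha>, r, \<beta>))\<^sup>2" and rp: "0 < rate \<sigma> \<beta>hi n (\<alpha>, r, \<beta>)" by blast
          have ds: "deconv_stat g \<sigma> G Ig f (?h i) f0"
            using fd f2 f0d f02 hb[OF i] by unfold_locales auto
          have "(K + 4 * L') * ?t i \<le> (K + 4 * L') * (R * (rate \<sigma> \<beta>hi n (\<alpha>, r, \<beta>))\<^sup>2)"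
            using ti K L'0 by (intro mult_left_mono) auto
          also have "\<dots> = C0 * (rate \<sigma> \<beta>hi n (\<alpha>, r, \<beta>))\<^sup>2" by (simp add: C0_def)
          also have "\<dots> \<le> C * (rate \<sigma> \<beta>hi n (\<alpha>, r, \<beta>))\<^sup>2" using C by (intro mult_right_mono) auto
          also have "\<dots> \<le> (L2_norm (\<lambda>x. f x - f0 x))\<^sup>2" using sep rp by (simp add: pos_le_divide_eq)
          finally have sep': "(K + 4 * L') * ?t i \<le> (L2_norm (\<lambda>x. f x - f0 x))\<^sup>2" .
          interpret Z: deconv_stat g \<sigma> G Ig f "?h i" f0 by (rule ds)
          have "test_prob g f n (adaptive_test g f0 \<sigma> \<beta>lo \<beta>hi Cs n) 0
            \<le> emeasure (sample_law g f n) {y \<in> space (sample_law g f n). cmod (test_stat g f0 n (?h i) y) \<le> Cs * ?t i}"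
            unfolding test_prob_def
          proof (rule emeasure_mono)
            show "{y \<in> space (sample_law g f n). adaptive_test g f0 \<sigma> \<beta>lo \<beta>hi Cs n y = 0}
              \<subseteq> {y \<in> space (sample_law g f n). cmod (test_stat g f0 n (?h i) y) \<le> Cs * ?t i}"
            proof safe
              fix y assume "adaptive_test g f0 \<sigma> \<beta>lo \<beta>hi Cs n y = 0"
              then show "cmod (test_stat g f0 n (?h i) y) \<le> Cs * ?t i" using ev(2) i by blast
            qed
            have "{y \<in> space (Z.U.sample n). \<bar>Z.stat n y\<bar> \<le> Cs * ?t i} \<in> sets (Z.U.sample n)"
              using Z.stat_measurable[of n] by measurable
            then show "{y \<in> space (sample_law g f n). cmod (test_stat g f0 n (?h i) y) \<le> Cs * ?t i} \<in> sets (sample_law g f n)"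
              unfolding Z.cmod_test_stat[OF nD(2)] Z.sample_law_eq .
          qed
          also have "\<dots> \<le> ennreal (64 * B0 / K + 128 * B0 * D0 / K\<^sup>2)"
            by (rule Z.type_two_error[OF nD(2) t0[OF i] hn[OF i] tl tail0[OF i] sep' Cs0 K(2)])
          also have "\<dots> \<le> ennreal (\<epsilon> / 4)" by (rule ennreal_leI[OF K2])
          finally show ?thesis .
        qed
        have "total_error g f0 (alternatives \<T> L f0 C (rate \<sigma> \<beta>hi n)) n (adaptive_test g f0 \<sigma> \<beta>lo \<beta>hi Cs n)
            \<le> (ennreal (\<epsilon> / 2) + ennreal (\<epsilon> / 4)) + ennreal (\<epsilon> / 4)"
          unfolding total_error_def by (intro add_mono P1 SUP_least P2)
        also have "\<dots> = ennreal \<epsilon>" using \<epsilon> by (simp add: ennreal_plus[symmetric] del: ennreal_plus)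
        finally show ?case .
      qed
    qed
    moreover have "0 < C0" using R K L'0 by (simp add: C0_def)
    ultimately show "\<exists>C0>0. \<forall>C>C0. limsup (\<lambda>n. total_error g f0 (alternatives \<T> L f0 C (rate \<sigma> \<beta>hi n)) n
                      (adaptive_test g f0 \<sigma> \<beta>lo \<beta>hi Cs n)) \<le> ennreal \<epsilon>" by blast
  qed
qed

end

section \<open>Chi-square bounds for mixtures\<close>

text \<open>Entrywise powers of Gram matrices are monotone in the weight (Schur product theorem). This replaces
  the awkward weight \<open>1 / p\<^sub>0\<close> by a polynomial one, for which Parseval gives exact orthogonality.\<close>

lemma gram_power:
  fixes D :: "'i \<Rightarrow> 'a \<Rightarrow> real" and v w :: "'a \<Rightarrow> real" and c :: "'i \<Rightarrow> real"
  assumes fin: "finite \<Theta>" and v: "\<And>x. 0 \<le> v x" "\<And>x. v x \<le> w x" "v \<in> borel_measurable M"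
    and D: "\<And>i. i \<in> \<Theta> \<Longrightarrow> D i \<in> borel_measurable M"
    and int: "\<And>i j. i \<in> \<Theta> \<Longrightarrow> j \<in> \<Theta> \<Longrightarrow> integrable M (\<lambda>x. D i x * D j x * w x)"
  shows "0 \<le> (\<Sum>i\<in>\<Theta>. \<Sum>j\<in>\<Theta>. c i * c j * (1 + (\<integral>x. D i x * D j x * w x \<partial>M)) ^ n)"
    and "(\<Sum>i\<in>\<Theta>. \<Sum>j\<in>\<Theta>. c i * c j * (1 + (\<integral>x. D i x * D j x * v x \<partial>M)) ^ n)
      \<le> (\<Sum>i\<in>\<Theta>. \<Sum>j\<in>\<Theta>. c i * c j * (1 + (\<integral>x. D i x * D j x * w x \<partial>M)) ^ n)"
proof -
  define Gv where "Gv i j = (\<integral>x. D i x * D j x * v x \<partial>M)" for i j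
  define Gw where "Gw i j = (\<integral>x. D i x * D j x * w x \<partial>M)" for i j
  have intv: "integrable M (\<lambda>x. D i x * D j x * v x)" if "i \<in> \<Theta>" "j \<in> \<Theta>" for i j
  proof (rule Bochner_Integration.integrable_bound[OF int[OF that]])
    show "(\<lambda>x. D i x * D j x * v x) \<in> borel_measurable M" using D that v by measurable
    show "AE x in M. norm (D i x * D j x * v x) \<le> norm (D i x * D j x * w x)"
    proof (rule AE_I2)
      fix x
      have "0 \<le> w x" using v(1)[of x] v(2)[of x] by linarith
      then show "norm (D i x * D j x * v x) \<le> norm (D i x * D j x * w x)"
        using v(1,2)[of x] by (auto simp: abs_mult intro!: mult_left_mono)
    qed
  qed
  \<comment> \<open>One factor \<open>1 + G i j\<close> is split off. The entry \<open>G i j\<close>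
    is an integral over \<open>x\<close>, so its contribution is an average over \<open>x\<close> of
    forms of the same kind with coefficients \<open>c i * D i x\<close>. This is why the inductions
    below run over arbitrary coefficients.\<close>
  have step: "(\<Sum>i\<in>\<Theta>. \<Sum>j\<in>\<Theta>. c i * c j * (1 + (\<integral>x. D i x * D j x * s x \<partial>M)) ^ Suc n)
     = (\<Sum>i\<in>\<Theta>. \<Sum>j\<in>\<Theta>. c i * c j * (1 + (\<integral>x. D i x * D j x * s x \<partial>M)) ^ n)
       + (\<integral>x. s x * (\<Sum>i\<in>\<Theta>. \<Sum>j\<in>\<Theta>. (c i * D i x) * (c j * D j x) * (1 + (\<integral>x. D i x * D j x * s x \<partial>M)) ^ n) \<partial>M)"
    and istep: "integrable M (\<lambda>x. s x * (\<Sum>i\<in>\<Theta>. \<Sum>j\<in>\<Theta>. (c i * D i x) * (c j * D j x) * k i j))"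
    if s: "\<And>i j. i \<in> \<Theta> \<Longrightarrow> j \<in> \<Theta> \<Longrightarrow> integrable M (\<lambda>x. D i x * D j x * s x)" for s c n k
  proof -
    have e: "(\<lambda>x. s x * (\<Sum>i\<in>\<Theta>. \<Sum>j\<in>\<Theta>. (c i * D i x) * (c j * D j x) * k i j))
      = (\<lambda>x. \<Sum>i\<in>\<Theta>. \<Sum>j\<in>\<Theta>. (c i * c j * k i j) * (D i x * D j x * s x))" for k
      by (simp add: fun_eq_iff sum_distrib_left ac_simps)
    show "integrable M (\<lambda>x. s x * (\<Sum>i\<in>\<Theta>. \<Sum>j\<in>\<Theta>. (c i * D i x) * (c j * D j x) * k i j))"
      unfolding e by (intro Bochner_Integration.integrable_sum integrable_mult_right s)
    have eq: "(\<integral>x. s x * (\<Sum>i\<in>\<Theta>. \<Sum>j\<in>\<Theta>. (c i * D i x) * (c j * D j x) * k i j) \<partial>M)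
      = (\<Sum>i\<in>\<Theta>. \<Sum>j\<in>\<Theta>. (c i * c j * k i j) * (\<integral>x. D i x * D j x * s x \<partial>M))" for k
      unfolding e using s by (simp add: Bochner_Integration.integral_sum)
    show "(\<Sum>i\<in>\<Theta>. \<Sum>j\<in>\<Theta>. c i * c j * (1 + (\<integral>x. D i x * D j x * s x \<partial>M)) ^ Suc n)
     = (\<Sum>i\<in>\<Theta>. \<Sum>j\<in>\<Theta>. c i * c j * (1 + (\<integral>x. D i x * D j x * s x \<partial>M)) ^ n)
       + (\<integral>x. s x * (\<Sum>i\<in>\<Theta>. \<Sum>j\<in>\<Theta>. (c i * D i x) * (c j * D j x) * (1 + (\<integral>x. D i x * D j x * s x \<partial>M)) ^ n) \<partial>M)"
      unfolding eq sum.distrib[symmetric] by (intro sum.cong refl) (simp add: algebra_simps)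
  qed
  have stepw: "(\<Sum>i\<in>\<Theta>. \<Sum>j\<in>\<Theta>. c i * c j * (1 + Gw i j) ^ Suc n) = (\<Sum>i\<in>\<Theta>. \<Sum>j\<in>\<Theta>. c i * c j * (1 + Gw i j) ^ n)
       + (\<integral>x. w x * (\<Sum>i\<in>\<Theta>. \<Sum>j\<in>\<Theta>. (c i * D i x) * (c j * D j x) * (1 + Gw i j) ^ n) \<partial>M)" for c n
    unfolding Gw_def by (rule step, rule int)
  have stepv: "(\<Sum>i\<in>\<Theta>. \<Sum>j\<in>\<Theta>. c i * c j * (1 + Gv i j) ^ Suc n) = (\<Sum>i\<in>\<Theta>. \<Sum>j\<in>\<Theta>. c i * c j * (1 + Gv i j) ^ n)
       + (\<integral>x. v x * (\<Sum>i\<in>\<Theta>. \<Sum>j\<in>\<Theta>. (c i * D i x) * (c j * D j x) * (1 + Gv i j) ^ n) \<partial>M)" for c n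
    unfolding Gv_def by (rule step, rule intv)
  have w0: "0 \<le> w x" for x using v(1)[of x] v(2)[of x] by linarith
  have base: "(\<Sum>i\<in>\<Theta>. \<Sum>j\<in>\<Theta>. c i * c j) = (\<Sum>i\<in>\<Theta>. c i)\<^sup>2" for c :: "'i \<Rightarrow> real"
    by (simp add: power2_eq_square sum_product)
  have psd: "0 \<le> (\<Sum>i\<in>\<Theta>. \<Sum>j\<in>\<Theta>. c i * c j * (1 + Gw i j) ^ n)" for c :: "'i \<Rightarrow> real" and n
  proof (induction n arbitrary: c)
    case 0
    show ?case by (simp add: base)
  next
    case (Suc n)
    show ?case
      unfolding stepw
      by (intro add_nonneg_nonneg Bochner_Integration.integral_nonneg mult_nonneg_nonneg w0 Suc.IH)
  qed
  have le: "(\<Sum>i\<in>\<Theta>. \<Sum>j\<in>\<Theta>. c i * c j * (1 + Gv i j) ^ n) \<le> (\<Sum>i\<in>\<Theta>. \<Sum>j\<in>\<Theta>. c i * c j * (1 + Gw i j) ^ n)" for c :: "'i \<Rightarrow> real" and n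
  proof (induction n arbitrary: c)
    case (Suc n)
    show ?case
      unfolding stepw stepv
    proof (rule add_mono[OF Suc.IH integral_mono])
      fix x
      let ?Q = "\<lambda>g. \<Sum>i\<in>\<Theta>. \<Sum>j\<in>\<Theta>. (c i * D i x) * (c j * D j x) * (1 + g i j) ^ n"
      \<comment> \<open>First the Gram entries are enlarged by the induction hypothesis, then the
        weight, which is legitimate because the form with \<open>Gw\<close> is nonnegative.\<close>
      have "v x * ?Q Gv \<le> v x * ?Q Gw"
        by (intro mult_left_mono v Suc.IH)
      also have "\<dots> \<le> w x * ?Q Gw"
        by (intro mult_right_mono v psd)
      finally show "v x * ?Q Gv \<le> w x * ?Q Gw" .
    qed (rule istep, erule (1) int intv)+
  qed simp
  show "0 \<le> (\<Sum>i\<in>\<Theta>. \<Sum>j\<in>\<Theta>. c i * c j * (1 + (\<integral>x. D i x * D j x * w x \<partial>M)) ^ n)"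
    using psd[of c n] unfolding Gw_def .
  show "(\<Sum>i\<in>\<Theta>. \<Sum>j\<in>\<Theta>. c i * c j * (1 + (\<integral>x. D i x * D j x * v x \<partial>M)) ^ n)
      \<le> (\<Sum>i\<in>\<Theta>. \<Sum>j\<in>\<Theta>. c i * c j * (1 + (\<integral>x. D i x * D j x * w x \<partial>M)) ^ n)"
    using le[of c n] unfolding Gv_def Gw_def .
qed

lemma PiM_density_prob:
  fixes r :: "'a \<Rightarrow> real"
  assumes M: "prob_space M" and [measurable]: "r \<in> borel_measurable M" and r: "\<And>x. 0 \<le> r x"
    and N: "prob_space (density M (\<lambda>x. ennreal (r x)))" and I: "finite I"
  shows "PiM I (\<lambda>_. density M (\<lambda>x. ennreal (r x))) = density (PiM I (\<lambda>_. M)) (\<lambda>y. ennreal (\<Prod>i\<in>I. r (y i)))"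
proof (rule sym)
  interpret M: prob_space M by fact
  interpret N: prob_space "density M (\<lambda>x. ennreal (r x))" by fact
  interpret PM: product_sigma_finite "\<lambda>_. M" by standard
  interpret PN: product_sigma_finite "\<lambda>_. density M (\<lambda>x. ennreal (r x))" by standard
  show "density (PiM I (\<lambda>_. M)) (\<lambda>y. ennreal (\<Prod>i\<in>I. r (y i))) = PiM I (\<lambda>_. density M (\<lambda>x. ennreal (r x)))"
  proof (rule PN.PiM_eqI[OF I])
    show "sets (density (PiM I (\<lambda>_. M)) (\<lambda>y. ennreal (\<Prod>i\<in>I. r (y i)))) = sets (PiM I (\<lambda>_. density M (\<lambda>x. ennreal (r x))))"
      by (simp cong: sets_PiM_cong)
    fix A assume A: "\<And>i. i \<in> I \<Longrightarrow> A i \<in> sets (density M (\<lambda>x. ennreal (r x)))"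
    have Am: "A i \<in> sets M" if "i \<in> I" for i using A[OF that] by simp
    have box: "Pi\<^sub>E I A \<in> sets (PiM I (\<lambda>_. M))" using I Am by (intro sets_PiM_I_finite) auto
    have "emeasure (density (PiM I (\<lambda>_. M)) (\<lambda>y. ennreal (\<Prod>i\<in>I. r (y i)))) (Pi\<^sub>E I A)
      = (\<integral>\<^sup>+y. ennreal (\<Prod>i\<in>I. r (y i)) * indicator (Pi\<^sub>E I A) y \<partial>PiM I (\<lambda>_. M))"
    proof (rule emeasure_density[OF _ box])
      show "(\<lambda>y. ennreal (\<Prod>i\<in>I. r (y i))) \<in> borel_measurable (PiM I (\<lambda>_. M))"
        by (intro measurable_compose[OF _ measurable_ennreal] borel_measurable_prod) measurable
    qed
    also have "\<dots> = (\<integral>\<^sup>+y. (\<Prod>i\<in>I. ennreal (r (y i)) * indicator (A i) (y i)) \<partial>PiM I (\<lambda>_. M))"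
    proof (rule nn_integral_cong)
      fix y assume y: "y \<in> space (PiM I (\<lambda>_. M))"
      have "indicator (Pi\<^sub>E I A) y = (\<Prod>i\<in>I. indicator (A i) (y i) :: ennreal)"
      proof (cases "\<forall>i\<in>I. y i \<in> A i")
        case True
        then have "y \<in> Pi\<^sub>E I A" using y by (auto simp: space_PiM PiE_iff)
        moreover have "(\<Prod>i\<in>I. indicator (A i) (y i) :: ennreal) = 1" using True by (intro prod.neutral) auto
        ultimately show ?thesis by simp
      next
        case False
        then obtain i where i: "i \<in> I" "y i \<notin> A i" by blast
        then have "y \<notin> Pi\<^sub>E I A" by auto
        moreover have "(\<Prod>i\<in>I. indicator (A i) (y i) :: ennreal) = 0" using I i by (intro prod_zero bexI[of _ i]) auto
        ultimately show ?thesis by simp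
      qed
      then show "ennreal (\<Prod>i\<in>I. r (y i)) * indicator (Pi\<^sub>E I A) y = (\<Prod>i\<in>I. ennreal (r (y i)) * indicator (A i) (y i))"
        using r by (simp add: prod.distrib prod_ennreal)
    qed
    also have "\<dots> = (\<Prod>i\<in>I. \<integral>\<^sup>+x. ennreal (r x) * indicator (A i) x \<partial>M)"
      by (rule PM.product_nn_integral_prod[OF I]) (use Am in \<open>auto intro!: borel_measurable_times borel_measurable_indicator measurable_compose[OF _ measurable_ennreal]\<close>)
    also have "\<dots> = (\<Prod>i\<in>I. emeasure (density M (\<lambda>x. ennreal (r x))) (A i))"
      using Am by (intro prod.cong refl) (simp add: emeasure_density)
    finally show "emeasure (density (PiM I (\<lambda>_. M)) (\<lambda>y. ennreal (\<Prod>i\<in>I. r (y i)))) (Pi\<^sub>E I A)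
       = (\<Prod>i\<in>I. emeasure (density M (\<lambda>x. ennreal (r x))) (A i))" .
  qed
qed

text \<open>For the mixture likelihood ratio \<open>L\<close> the error sum is at least
  \<open>1\<close> minus the mean of \<open>\<bar>L - 1\<bar>\<close>, which is at most the root of
  the chi-square distance. The second moment of \<open>L\<close> is a double sum of
  \<open>n\<close>-th powers because each likelihood ratio is a product over the sample.\<close>

lemma mixture_testing_bound:
  fixes r :: "'i \<Rightarrow> 'a \<Rightarrow> real" and K :: "'i \<Rightarrow> 'i \<Rightarrow> real"
  assumes M: "prob_space M" and fin: "finite \<Theta>"
    and rm: "\<And>i. i \<in> \<Theta> \<Longrightarrow> r i \<in> borel_measurable M" and r0: "\<And>i x. 0 \<le> r i x"
    and r1: "\<And>i. i \<in> \<Theta> \<Longrightarrow> integrable M (r i)" "\<And>i. i \<in> \<Theta> \<Longrightarrow> (\<integral>x. r i x \<partial>M) = 1"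
    and r2: "\<And>i j. i \<in> \<Theta> \<Longrightarrow> j \<in> \<Theta> \<Longrightarrow> integrable M (\<lambda>x. r i x * r j x)"
      "\<And>i j. i \<in> \<Theta> \<Longrightarrow> j \<in> \<Theta> \<Longrightarrow> (\<integral>x. r i x * r j x \<partial>M) = 1 + K i j"
    and c: "\<And>i. i \<in> \<Theta> \<Longrightarrow> 0 \<le> c i" "(\<Sum>i\<in>\<Theta>. c i) = (1::real)"
    and chi: "(\<Sum>i\<in>\<Theta>. \<Sum>j\<in>\<Theta>. c i * c j * (1 + K i j) ^ n) \<le> 1 + \<xi>"
    and A: "A \<in> sets (\<Pi>\<^sub>M j\<in>{1..n}. M)"
    and s: "\<And>i. i \<in> \<Theta> \<Longrightarrow> measure (density (\<Pi>\<^sub>M j\<in>{1..n}. M) (\<lambda>y. ennreal (\<Prod>k\<in>{1..n}. r i (y k)))) A \<le> s"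
  shows "1 - sqrt \<xi> \<le> measure (\<Pi>\<^sub>M j\<in>{1..n}. M) (space (\<Pi>\<^sub>M j\<in>{1..n}. M) - A) + s"
proof -
  let ?S = "\<Pi>\<^sub>M j\<in>{1..n}. M"
  interpret M: prob_space M by fact
  interpret S: prob_space ?S by (rule prob_space_PiM) (rule M)
  interpret PM: product_sigma_finite "\<lambda>_::nat. M" by standard
  define l where "l i y = (\<Prod>k\<in>{1..n}. r i (y k))" for i and y :: "nat \<Rightarrow> 'a"
  define L where "L y = (\<Sum>i\<in>\<Theta>. c i * l i y)" for y
  have li: "integrable ?S (l i)" "(\<integral>y. l i y \<partial>?S) = 1" if "i \<in> \<Theta>" for i
    unfolding l_def using PM.product_integrable_prod[of "{1..n}" "\<lambda>_. r i"] PM.product_integral_prod[of "{1..n}" "\<lambda>_. r i"] r1[OF that]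
    by auto
  have ll: "integrable ?S (\<lambda>y. l i y * l j y)" "(\<integral>y. l i y * l j y \<partial>?S) = (1 + K i j) ^ n" if "i \<in> \<Theta>" "j \<in> \<Theta>" for i j
    unfolding l_def prod.distrib[symmetric]
    using PM.product_integrable_prod[of "{1..n}" "\<lambda>_ x. r i x * r j x"] PM.product_integral_prod[of "{1..n}" "\<lambda>_ x. r i x * r j x"] r2[OF that]
    by auto
  have iL: "integrable ?S L" unfolding L_def using li by (intro Bochner_Integration.integrable_sum integrable_mult_right) auto
  have EL: "(\<integral>y. L y \<partial>?S) = 1"
    unfolding L_def using li c by (simp add: Bochner_Integration.integral_sum)
  have L2eq: "(L y)\<^sup>2 = (\<Sum>i\<in>\<Theta>. \<Sum>j\<in>\<Theta>. c i * c j * (l i y * l j y))" for y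
    unfolding L_def power2_eq_square sum_product by (intro sum.cong refl) simp
  have iL2: "integrable ?S (\<lambda>y. (L y)\<^sup>2)"
    unfolding L2eq using ll by (intro Bochner_Integration.integrable_sum integrable_mult_right) auto
  have EL2: "(\<integral>y. (L y)\<^sup>2 \<partial>?S) \<le> 1 + \<xi>"
    unfolding L2eq using ll chi by (simp add: Bochner_Integration.integral_sum)
  have i1: "integrable ?S (\<lambda>y. L y - 1)" using iL by simp
  have e2: "(L y - 1)\<^sup>2 = (L y)\<^sup>2 - 2 * L y + 1" for y by (simp add: power2_eq_square algebra_simps)
  have i2: "integrable ?S (\<lambda>y. (L y - 1)\<^sup>2)" unfolding e2 using iL iL2 by simp
  have "(\<integral>y. (L y - 1)\<^sup>2 \<partial>?S) = (\<integral>y. (L y)\<^sup>2 \<partial>?S) - 2 * (\<integral>y. L y \<partial>?S) + 1"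
    unfolding e2 using iL iL2 by (simp add: S.prob_space)
  then have V: "(\<integral>y. (L y - 1)\<^sup>2 \<partial>?S) \<le> \<xi>" using EL EL2 by simp
  \<comment> \<open>Cauchy-Schwarz in the form that a variance is nonnegative.\<close>
  have "(\<integral>y. \<bar>L y - 1\<bar> \<partial>?S)\<^sup>2 \<le> (\<integral>y. \<bar>L y - 1\<bar>\<^sup>2 \<partial>?S)"
  proof -
    have "0 \<le> (\<integral>y. (\<bar>L y - 1\<bar> - (\<integral>y. \<bar>L y - 1\<bar> \<partial>?S))\<^sup>2 \<partial>?S)" by simp
    also have "\<dots> = (\<integral>y. \<bar>L y - 1\<bar>\<^sup>2 \<partial>?S) - (\<integral>y. \<bar>L y - 1\<bar> \<partial>?S)\<^sup>2"
      using i1 i2 by (intro S.variance_eq) auto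
    finally show ?thesis by simp
  qed
  then have "(\<integral>y. \<bar>L y - 1\<bar> \<partial>?S)\<^sup>2 \<le> \<xi>" using V by simp
  then have abs: "(\<integral>y. \<bar>L y - 1\<bar> \<partial>?S) \<le> sqrt \<xi>" by (rule real_le_rsqrt)
  have iA: "integrable ?S (\<lambda>y. indicator A y * F y)" if "integrable ?S F" for F :: "_ \<Rightarrow> real"
    using integrable_mult_indicator[OF A that] by simp
  have mA: "measure (density ?S (\<lambda>y. ennreal (l i y))) A = (\<integral>y. indicator A y * l i y \<partial>?S)" if i: "i \<in> \<Theta>" for i
  proof -
    have l0: "0 \<le> l i y" for y unfolding l_def by (intro prod_nonneg) (simp add: r0)
    have "emeasure (density ?S (\<lambda>y. ennreal (l i y))) A = (\<integral>\<^sup>+y. ennreal (l i y) * indicator A y \<partial>?S)"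
      using borel_measurable_integrable[OF li(1)[OF i]] by (intro emeasure_density A) measurable
    also have "\<dots> = (\<integral>\<^sup>+y. ennreal (indicator A y * l i y) \<partial>?S)"
      by (intro nn_integral_cong) (auto simp: indicator_def)
    also have "\<dots> = ennreal (\<integral>y. indicator A y * l i y \<partial>?S)"
      using iA[OF li(1)[OF i]] l0 by (intro nn_integral_eq_integral) auto
    finally show ?thesis using l0 by (simp add: measure_def)
  qed
  have "(\<integral>y. indicator A y * L y \<partial>?S) = (\<Sum>i\<in>\<Theta>. c i * (\<integral>y. indicator A y * l i y \<partial>?S))"
  proof -
    have "(\<lambda>y. indicator A y * L y) = (\<lambda>y. \<Sum>i\<in>\<Theta>. c i * (indicator A y * l i y))"
      by (simp add: L_def sum_distrib_left ac_simps fun_eq_iff)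
    then show ?thesis using iA[OF li(1)] by (simp add: Bochner_Integration.integral_sum)
  qed
  also have "\<dots> \<le> (\<Sum>i\<in>\<Theta>. c i * s)"
    using s mA c by (intro sum_mono mult_left_mono) (auto simp: l_def)
  also have "\<dots> = s" using c by (simp add: sum_distrib_right[symmetric])
  finally have sA: "(\<integral>y. indicator A y * L y \<partial>?S) \<le> s" .
  have "- (\<integral>y. \<bar>L y - 1\<bar> \<partial>?S) \<le> (\<integral>y. indicator A y * (L y - 1) \<partial>?S)"
  proof -
    have "(\<integral>y. - \<bar>L y - 1\<bar> \<partial>?S) \<le> (\<integral>y. indicator A y * (L y - 1) \<partial>?S)"
      using i1 iA[OF i1] by (intro integral_mono) (auto simp: indicator_def)
    then show ?thesis by simp
  qed
  also have "(\<integral>y. indicator A y * (L y - 1) \<partial>?S) = (\<integral>y. indicator A y * L y \<partial>?S) - measure ?S A"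
  proof -
    have "integrable ?S (indicator A :: _ \<Rightarrow> real)"
      using A by (intro integrable_real_indicator) (auto simp: S.emeasure_eq_measure)
    then have "(\<integral>y. indicator A y * L y - indicator A y \<partial>?S) = (\<integral>y. indicator A y * L y \<partial>?S) - (\<integral>y. indicator A y \<partial>?S)"
      using iA[OF iL] by (intro Bochner_Integration.integral_diff)
    moreover have "(\<integral>y. indicator A y \<partial>?S) = measure ?S A"
      using A sets.sets_into_space[OF A] by (simp add: Int_absorb2)
    ultimately show ?thesis by (simp add: right_diff_distrib)
  qed
  finally have "- sqrt \<xi> \<le> s - measure ?S A" using abs sA by linarith
  moreover have "measure ?S (space ?S - A) = 1 - measure ?S A" by (rule S.prob_compl[OF A])
  ultimately show ?thesis by simp
qed

section \<open>Wave packets\<close>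

text \<open>The exponent is at least two, so the kink of \<open>max 0 x\<close> at the origin is
  flattened and the one-sided derivatives agree there.\<close>

lemma DERIV_pos_part_power:
  "((\<lambda>x. (max 0 x) ^ Suc (Suc n)) has_real_derivative real (Suc (Suc n)) * (max 0 x) ^ Suc n) (at (x::real))"
proof -
  consider "x > 0" | "x < 0" | "x = 0" by linarith
  then show ?thesis
  proof cases
    case 1
    have "((\<lambda>x. x ^ Suc (Suc n)) has_real_derivative real (Suc (Suc n)) * x ^ Suc n) (at x)"
      using DERIV_pow[of "Suc (Suc n)" x UNIV] by simp
    then have "((\<lambda>x. (max 0 x) ^ Suc (Suc n)) has_real_derivative real (Suc (Suc n)) * x ^ Suc n) (at x)"
      by (rule has_field_derivative_transform_within_open[where S="{0<..}"]) (use 1 in auto)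
    then show ?thesis using 1 by simp
  next
    case 2
    have "((\<lambda>x. 0) has_real_derivative 0) (at x)" by simp
    then have "((\<lambda>x. (max 0 x) ^ Suc (Suc n)) has_real_derivative 0) (at x)"
      by (rule has_field_derivative_transform_within_open[where S="{..<0}"]) (use 2 in auto)
    then show ?thesis using 2 by simp
  next
    case 3
    have "((\<lambda>h. (max 0 h :: real) ^ Suc (Suc n) / h) \<longlongrightarrow> 0) (at 0)"
    proof (rule Lim_null_comparison)
      show "\<forall>\<^sub>F h in at 0. norm ((max 0 h :: real) ^ Suc (Suc n) / h) \<le> norm h ^ Suc n"
      proof (intro always_eventually allI)
        fix h :: real
        show "norm ((max 0 h) ^ Suc (Suc n) / h) \<le> norm h ^ Suc n"
        proof (cases "h > 0")
          case True
          then show ?thesis by simp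
        next
          case False
          then have "max 0 h = 0" by simp
          then show ?thesis unfolding real_norm_def by (metis abs_ge_zero abs_zero div_0 power_0_Suc zero_le_power)
        qed
      qed
      show "((\<lambda>h::real. norm h ^ Suc n) \<longlongrightarrow> 0) (at 0)"
        by (auto intro!: tendsto_eq_intros)
    qed
    then show ?thesis using 3 by (simp add: DERIV_def)
  qed
qed

text \<open>The cube makes the second derivative continuous across the ends of the support. Two
  derivatives give a transform of order \<open>1 / (1 + x\<^sup>2)\<close>, the decay of the lower
  bound in assumption (T).\<close>

definition bump :: "real \<Rightarrow> real" where "bump u = (max 0 (1 - u\<^sup>2)) ^ 3"
definition dbump :: "real \<Rightarrow> real" where "dbump u = - 6 * u * (max 0 (1 - u\<^sup>2)) ^ 2"
definition ddbump :: "real \<Rightarrow> real" where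
  "ddbump u = - 6 * (max 0 (1 - u\<^sup>2)) ^ 2 + 24 * u\<^sup>2 * max 0 (1 - u\<^sup>2)"

lemma DERIV_bump: "(bump has_real_derivative dbump u) (at u)"
proof -
  have i: "((\<lambda>u::real. 1 - u\<^sup>2) has_real_derivative - 2 * u) (at u)"
    by (auto intro!: derivative_eq_intros)
  have "((\<lambda>u. (max 0 (1 - u\<^sup>2)) ^ Suc (Suc 1)) has_real_derivative (real (Suc (Suc 1)) * (max 0 (1 - u\<^sup>2)) ^ Suc 1) * (- 2 * u)) (at u)"
    by (rule DERIV_chain2[OF DERIV_pos_part_power i])
  then show ?thesis by (simp add: bump_def[abs_def] dbump_def numeral_3_eq_3 numeral_2_eq_2 algebra_simps One_nat_def)
qed

lemma DERIV_dbump: "(dbump has_real_derivative ddbump u) (at u)"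
proof -
  have i: "((\<lambda>u::real. 1 - u\<^sup>2) has_real_derivative - 2 * u) (at u)"
    by (auto intro!: derivative_eq_intros)
  have "((\<lambda>u. (max 0 (1 - u\<^sup>2)) ^ Suc (Suc 0)) has_real_derivative (real (Suc (Suc 0)) * (max 0 (1 - u\<^sup>2)) ^ Suc 0) * (- 2 * u)) (at u)"
    by (rule DERIV_chain2[OF DERIV_pos_part_power i])
  then have d: "((\<lambda>u. (max 0 (1 - u\<^sup>2))\<^sup>2) has_real_derivative - 4 * u * max 0 (1 - u\<^sup>2)) (at u)"
    by (simp add: numeral_2_eq_2 algebra_simps)
  have "((\<lambda>u. - 6 * u * (max 0 (1 - u\<^sup>2))\<^sup>2) has_real_derivative ddbump u) (at u)"
    by (rule derivative_eq_intros d refl)+ (simp add: ddbump_def power2_eq_square algebra_simps)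
  then show ?thesis by (simp add: dbump_def[abs_def])
qed

lemma continuous_ddbump: "continuous_on UNIV ddbump"
  unfolding ddbump_def[abs_def] by (intro continuous_intros)

lemma continuous_bump: "continuous_on UNIV bump" and continuous_dbump: "continuous_on UNIV dbump"
  unfolding bump_def[abs_def] dbump_def[abs_def] by (intro continuous_intros)+

lemma bump_outside: "1 \<le> \<bar>u\<bar> \<Longrightarrow> bump u = 0" and dbump_outside: "1 \<le> \<bar>u\<bar> \<Longrightarrow> dbump u = 0"
  using abs_le_square_iff[of 1 u] by (auto simp: bump_def dbump_def max_def)

lemma bump_uminus [simp]: "bump (- u) = bump u"
  by (simp add: bump_def)

lemma bump_nonneg: "0 \<le> bump u" and bump_le_1: "bump u \<le> 1"
  by (auto simp: bump_def max_def intro!: power_le_one)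

lemma abs_dbump_le: "\<bar>dbump u\<bar> \<le> 6"
proof (cases "1 \<le> \<bar>u\<bar>")
  case False
  have "(max 0 (1 - u\<^sup>2)) ^ 2 \<le> 1" by (auto simp: max_def intro!: power_le_one)
  then have "\<bar>u\<bar> * (max 0 (1 - u\<^sup>2)) ^ 2 \<le> 1 * 1" using False by (intro mult_mono) auto
  then show ?thesis by (simp add: dbump_def abs_mult)
qed (simp add: dbump_outside)

lemma bandlim_continuous:
  assumes c: "continuous_on UNIV F" and z: "\<And>u. R < \<bar>u\<bar> \<Longrightarrow> F u = 0"
  shows "bandlim R F"
proof -
  have "compact (F ` {- R..R})"
    by (intro compact_continuous_image continuous_on_subset[OF c]) auto
  then obtain b where b: "\<And>u. u \<in> {- R..R} \<Longrightarrow> cmod (F u) \<le> b"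
    using compact_imp_bounded[of "F ` {- R..R}"] unfolding bounded_iff by blast
  have "cmod (F u) \<le> max 0 b" for u
  proof (cases "R < \<bar>u\<bar>")
    case False
    then have "u \<in> {- R..R}" by auto
    then show ?thesis using b[of u] by simp
  qed (simp add: z)
  moreover have "F \<in> borel_measurable borel" by (rule borel_measurable_continuous_onI[OF c])
  ultimately show ?thesis using z unfolding bandlim_def by blast
qed

text \<open>Integration by parts: the derivative of \<open>iexp (x * u) * F u\<close> integrates to
  zero over an interval containing the support of \<open>F\<close>.\<close>

lemma cft_derivative:
  assumes d: "\<And>u. (F has_vector_derivative F' u) (at u)" and c: "continuous_on UNIV F'"
    and z: "\<And>u. R < \<bar>u\<bar> \<Longrightarrow> F u = 0"
  shows "bandlim R F" "bandlim R F'" "cft F' x = - \<i> * complex_of_real x * cft F x"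
proof -
  have cF: "continuous_on UNIV F"
    using d by (intro continuous_at_imp_continuous_on) (auto intro: has_vector_derivative_continuous)
  show b: "bandlim R F" by (rule bandlim_continuous[OF cF z])
  have z': "F' u = 0" if u: "R < \<bar>u\<bar>" for u
  proof -
    have o: "open {u::real. R < \<bar>u\<bar>}" by (intro open_Collect_less continuous_intros)
    have "(F has_vector_derivative 0) (at u)"
      by (rule has_vector_derivative_transform_within_open[OF has_vector_derivative_const[of 0] o]) (use u z in auto)
    then show ?thesis using vector_derivative_unique_at[OF d[of u]] by blast
  qed
  show b': "bandlim R F'" by (rule bandlim_continuous[OF c z'])
  let ?G = "\<lambda>u. iexp (x * u) * F u" and ?g = "\<lambda>u. iexp (x * u) * (\<i> * complex_of_real x * F u + F' u)"
  \<comment> \<open>A point strictly beyond the support, so that both boundary terms vanish.\<close>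
  define S where "S = \<bar>R\<bar> + 1"
  have "(LBINT u. indicator {- S..S} u *\<^sub>R ?g u) = ?G S - ?G (- S)"
  proof (rule integral_FTC_Icc)
    show "- S \<le> S" by (simp add: S_def)
    show "continuous_on {- S..S} ?g"
      by (intro continuous_intros continuous_on_subset[OF c] continuous_on_subset[OF cF]) auto
    fix u
    have "((\<lambda>u. iexp (x * u)) has_vector_derivative \<i> * complex_of_real x * iexp (x * u)) (at u)"
    proof -
      have "((\<lambda>u. exp (\<i> * complex_of_real x * u)) has_field_derivative (\<i> * complex_of_real x) * exp (\<i> * complex_of_real x * complex_of_real u)) (at (complex_of_real u))"
        by (auto intro!: derivative_eq_intros)
      from has_vector_derivative_real_field[OF this] show ?thesis by (simp add: mult.assoc)
    qed
    from has_vector_derivative_mult[OF this d[of u]]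
    have "(?G has_vector_derivative iexp (x * u) * F' u + \<i> * complex_of_real x * iexp (x * u) * F u) (at u)" .
    moreover have "E * b + a * E * c = E * (a * c + b)" for E a b c :: complex
      by (simp add: algebra_simps)
    ultimately have "(?G has_vector_derivative ?g u) (at u)" by (simp only:)
    then show "(?G has_vector_derivative ?g u) (at u within {- S..S})"
      by (rule has_vector_derivative_at_within)
  qed
  also have "?G S - ?G (- S) = 0" using z[of S] z[of "- S"] by (simp add: S_def)
  also have "(LBINT u. indicator {- S..S} u *\<^sub>R ?g u) = (LBINT u. ?g u)"
    by (intro Bochner_Integration.integral_cong refl) (auto simp: indicator_def S_def z z')
  also have "\<dots> = (LBINT u. \<i> * complex_of_real x * (iexp (x * u) * F u) + iexp (x * u) * F' u)"
    by (simp add: algebra_simps)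
  also have "\<dots> = \<i> * complex_of_real x * cft F x + cft F' x"
    unfolding cft_def
    using integrable_iexp_mult[OF bandlim_integrable[OF b]] integrable_iexp_mult[OF bandlim_integrable[OF b']]
    by (subst Bochner_Integration.integral_add) (simp_all only: integrable_mult_right integral_mult_right_zero)
  finally show "cft F' x = - \<i> * complex_of_real x * cft F x" by (simp add: add_eq_0_iff2)
qed

lemma has_vector_derivative_of_real:
  "(f has_real_derivative f') (at u) \<Longrightarrow> ((\<lambda>u. complex_of_real (f u)) has_vector_derivative complex_of_real f') (at u)"
  using bounded_linear.has_vector_derivative[OF bounded_linear_of_real, of f f' "at u"]
  by (simp add: has_real_derivative_iff_has_vector_derivative)

text \<open>The inverse transform of \<open>bump\<close>. It is real because \<open>bump\<close> is
  even, so taking the real part loses nothing.\<close>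

definition bhat :: "real \<Rightarrow> real" where
  "bhat x = Re (cft (\<lambda>u. complex_of_real (bump u)) x) / (2 * pi)"

lemma bandlim_bump: "bandlim 1 (\<lambda>u. complex_of_real (bump u))"
  by (rule bandlim_continuous) (auto intro!: continuous_intros continuous_on_subset[OF continuous_bump] simp: bump_outside)

lemma cft_bump: "cft (\<lambda>u. complex_of_real (bump u)) x = complex_of_real (2 * pi * bhat x)"
proof -
  have "cft (\<lambda>u. complex_of_real (bump u)) x = complex_of_real (Re (cft (\<lambda>u. complex_of_real (bump u)) x))"
    unfolding cft_def by (rule integral_hermitian_real) (simp add: exp_cnj)
  then show ?thesis by (simp add: bhat_def)
qed

text \<open>Multiplying the transform by \<open>x\<^sup>2\<close> gives, up to sign, the transform
  of the second derivative of \<open>bump\<close>, which is bounded.\<close>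

lemma bhat_decay: obtains Cb where "0 < Cb" "\<And>x. \<bar>bhat x\<bar> \<le> Cb / (1 + x\<^sup>2)"
proof -
  let ?b = "\<lambda>u. complex_of_real (bump u)" and ?d = "\<lambda>u. complex_of_real (dbump u)" and ?dd = "\<lambda>u. complex_of_real (ddbump u)"
  note 1 = cft_derivative[of ?b ?d 1, OF has_vector_derivative_of_real[OF DERIV_bump]]
  note 2 = cft_derivative[of ?d ?dd 1, OF has_vector_derivative_of_real[OF DERIV_dbump]]
  have cd: "continuous_on UNIV ?d" "continuous_on UNIV ?dd"
    by (intro continuous_intros continuous_dbump continuous_ddbump)+
  have e: "cft ?dd x = - complex_of_real (x\<^sup>2) * cft ?b x" for x
  proof -
    have "cft ?dd x = - \<i> * complex_of_real x * (- \<i> * complex_of_real x * cft ?b x)"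
      using 1(3)[OF cd(1)] 2(3)[OF cd(2)] by (simp add: bump_outside dbump_outside)
    then show ?thesis by (simp add: power2_eq_square algebra_simps)
  qed
  have bdd: "bandlim 1 ?dd" by (rule 2(2)[OF cd(2)]) (simp add: dbump_outside)
  define A where "A = (LBINT u. cmod (?b u)) + (LBINT u. cmod (?dd u))"
  have "\<bar>bhat x\<bar> * (1 + x\<^sup>2) \<le> A" for x
  proof -
    have "\<bar>bhat x\<bar> = cmod (cft ?b x) / (2 * pi)" unfolding cft_bump norm_of_real by (simp add: abs_mult)
    also have "\<dots> \<le> cmod (cft ?b x) / 1" using pi_gt3 by (intro divide_left_mono) auto
    finally have "\<bar>bhat x\<bar> * (1 + x\<^sup>2) \<le> cmod (cft ?b x) * (1 + x\<^sup>2)" by (intro mult_right_mono) auto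
    also have "\<dots> = cmod (cft ?b x) + cmod (cft ?dd x)" unfolding e norm_mult norm_minus_cancel norm_of_real by (simp add: algebra_simps)
    also have "\<dots> \<le> A" unfolding A_def
      by (intro add_mono norm_cft_le bandlim_integrable[OF bandlim_bump] bandlim_integrable[OF bdd])
    finally show ?thesis .
  qed
  then have "\<bar>bhat x\<bar> \<le> A / (1 + x\<^sup>2)" for x by (simp add: pos_le_divide_eq add_pos_nonneg)
  moreover have "A / (1 + x\<^sup>2) \<le> (\<bar>A\<bar> + 1) / (1 + x\<^sup>2)" for x :: real by (intro divide_right_mono) auto
  ultimately show ?thesis by (intro that[of "\<bar>A\<bar> + 1"]) (auto intro: order_trans)
qed

lemma cft_translate: "cft (\<lambda>u. F (u - a)) x = iexp (x * a) * cft F x"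
proof -
  have "cft (\<lambda>u. F (u - a)) x = (LBINT u. iexp (x * (u + a)) * F (u + a - a))"
    unfolding cft_def by (rule integral_translate[symmetric])
  also have "\<dots> = (LBINT u. iexp (x * a) * (iexp (x * u) * F u))"
  proof (rule Bochner_Integration.integral_cong[OF refl])
    fix u
    have "iexp (x * (u + a)) = iexp (x * a) * iexp (x * u)" by (simp add: exp_add[symmetric] algebra_simps)
    then show "iexp (x * (u + a)) * F (u + a - a) = iexp (x * a) * (iexp (x * u) * F u)" by simp
  qed
  finally show ?thesis unfolding cft_def by (simp only: integral_mult_right_zero)
qed

text \<open>Two bumps placed symmetrically make the inverse transform real: it is
  \<open>bhat\<close> modulated by a cosine. Centres at even integers and radius one make the
  supports for different \<open>k\<close> meet at most in endpoints, where the bumps vanish.\<close>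

definition beta :: "nat \<Rightarrow> real \<Rightarrow> real" where
  "beta k u = (bump (u - 2 * real k) + bump (u + 2 * real k)) / 2"

definition dbeta :: "nat \<Rightarrow> real \<Rightarrow> real" where
  "dbeta k u = (dbump (u - 2 * real k) + dbump (u + 2 * real k)) / 2"

definition bk :: "nat \<Rightarrow> real \<Rightarrow> real" where
  "bk k x = bhat x * cos (2 * real k * x)"

lemma DERIV_beta: "(beta k has_real_derivative dbeta k u) (at u)"
proof -
  have "((\<lambda>u. bump (u - 2 * real k)) has_real_derivative dbump (u - 2 * real k) * 1) (at u)"
    by (rule DERIV_chain2[OF DERIV_bump]) (auto intro!: derivative_eq_intros)
  moreover have "((\<lambda>u. bump (u + 2 * real k)) has_real_derivative dbump (u + 2 * real k) * 1) (at u)"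
    by (rule DERIV_chain2[OF DERIV_bump]) (auto intro!: derivative_eq_intros)
  ultimately show ?thesis unfolding beta_def[abs_def] dbeta_def
    by (auto intro!: derivative_eq_intros)
qed

lemma continuous_dbeta: "continuous_on UNIV (dbeta k)" and continuous_beta: "continuous_on UNIV (beta k)"
  unfolding dbeta_def[abs_def] beta_def[abs_def]
  by (auto intro!: continuous_intros continuous_on_compose2[OF continuous_dbump] continuous_on_compose2[OF continuous_bump])

lemma beta_outside: "1 \<le> \<bar>\<bar>u\<bar> - 2 * real k\<bar> \<Longrightarrow> beta k u = 0"
  and dbeta_outside: "1 \<le> \<bar>\<bar>u\<bar> - 2 * real k\<bar> \<Longrightarrow> dbeta k u = 0"
proof -
  assume a: "1 \<le> \<bar>\<bar>u\<bar> - 2 * real k\<bar>"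
  then have "1 \<le> \<bar>u - 2 * real k\<bar>" "1 \<le> \<bar>u + 2 * real k\<bar>" by (auto simp: abs_if split: if_splits)
  then show "beta k u = 0" "dbeta k u = 0"
    by (simp_all add: beta_def dbeta_def bump_outside dbump_outside)
qed

lemma beta_disjoint:
  assumes "k \<noteq> l"
  shows "beta k u = 0 \<and> dbeta k u = 0 \<or> beta l u = 0 \<and> dbeta l u = 0"
proof (rule ccontr)
  assume "\<not> ?thesis"
  then have "\<bar>\<bar>u\<bar> - 2 * real k\<bar> < 1" "\<bar>\<bar>u\<bar> - 2 * real l\<bar> < 1"
    using beta_outside dbeta_outside by (meson not_le)+
  then have "\<bar>real k - real l\<bar> < 1" by linarith
  then show False using assms by linarith
qed

lemma beta_uminus [simp]: "beta k (- u) = beta k u"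
  using bump_uminus[of "u + 2 * real k"] bump_uminus[of "u - 2 * real k"]
  by (simp add: beta_def algebra_simps)

lemma beta_nonneg: "0 \<le> beta k u" and beta_le_1: "beta k u \<le> 1" and abs_dbeta_le: "\<bar>dbeta k u\<bar> \<le> 6"
  using bump_nonneg[of "u - 2 * real k"] bump_nonneg[of "u + 2 * real k"] bump_le_1[of "u - 2 * real k"] bump_le_1[of "u + 2 * real k"]
    abs_dbump_le[of "u - 2 * real k"] abs_dbump_le[of "u + 2 * real k"]
  by (auto simp: beta_def dbeta_def)

lemma bandlim_beta: "bandlim (2 * real k + 1) (\<lambda>u. complex_of_real (beta k u))"
  by (rule bandlim_continuous) (auto intro!: continuous_intros continuous_on_subset[OF continuous_beta] beta_outside)

lemma cft_beta: "cft (\<lambda>u. complex_of_real (beta k u)) x = complex_of_real (2 * pi * bk k x)"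
proof -
  let ?b = "\<lambda>u. complex_of_real (bump u)" and ?a = "2 * real k"
  have i: "integrable lborel ?b" by (rule bandlim_integrable[OF bandlim_bump])
  have i1: "integrable lborel (\<lambda>u. ?b (u - ?a))" using integrable_translate[OF i, of "- ?a"] by simp
  have i2: "integrable lborel (\<lambda>u. ?b (u - (- ?a)))" using integrable_translate[OF i, of ?a] by simp
  have "cft (\<lambda>u. complex_of_real (beta k u)) x = cft (\<lambda>u. (1 / 2) * (?b (u - ?a) + ?b (u - (- ?a)))) x"
    by (simp add: beta_def[abs_def] add_divide_distrib algebra_simps)
  also have "\<dots> = 1 / 2 * (iexp (x * ?a) * cft ?b x + iexp (x * (- ?a)) * cft ?b x)"
    unfolding cft_cmult cft_add[OF i1 i2] cft_translate[of ?b ?a x] cft_translate[of ?b "- ?a" x] ..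
  also have "\<dots> = complex_of_real (cos (2 * real k * x)) * cft ?b x"
  proof -
    have "iexp (x * ?a) + iexp (x * (- ?a)) = 2 * complex_of_real (cos (2 * real k * x))"
      unfolding cis_conv_exp[symmetric] by (rule complex_eqI) (simp_all add: mult.commute)
    then show ?thesis by (simp only: distrib_right[symmetric]) simp
  qed
  finally show ?thesis unfolding cft_bump bk_def by (simp add: ac_simps)
qed

lemma bk_continuous: "continuous_on UNIV (bk k)"
proof -
  have "continuous_on UNIV bhat"
    unfolding bhat_def[abs_def] by (intro continuous_intros continuous_on_cft bandlim_integrable[OF bandlim_bump]) auto
  then show ?thesis unfolding bk_def[abs_def] by (intro continuous_intros)
qed

lemma bk_measurable [measurable]: "bk k \<in> borel_measurable borel"
  by (rule borel_measurable_continuous_onI[OF bk_continuous])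

lemma integrable_cauchy_weight: "integrable lborel (\<lambda>x::real. c / (1 + x\<^sup>2))"
proof -
  have "set_integrable lborel (einterval (-\<infinity>) \<infinity>) (\<lambda>x. inverse (1 + x\<^sup>2))"
  proof (rule interval_integral_FTC_nonneg(1)[where F=arctan and A="- (pi / 2)" and B="pi / 2"])
    show "((arctan \<circ> real_of_ereal) \<longlongrightarrow> - (pi / 2)) (at_right (- \<infinity>))"
      unfolding ereal_tendsto_simps by (rule tendsto_arctan_at_bot)
    show "((arctan \<circ> real_of_ereal) \<longlongrightarrow> pi / 2) (at_left \<infinity>)"
      unfolding ereal_tendsto_simps by (rule tendsto_arctan_at_top)
  qed (auto intro!: continuous_intros DERIV_arctan simp: add_nonneg_eq_0_iff)
  then have "integrable lborel (\<lambda>x::real. c * inverse (1 + x\<^sup>2))"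
    by (intro integrable_mult_right) (simp add: set_integrable_def einterval_def)
  then show ?thesis by (simp add: divide_inverse)
qed

lemma bk_integrable: "integrable lborel (bk k)" "integrable lborel (\<lambda>x. (bk k x)\<^sup>2)"
proof -
  obtain Cb where Cb: "0 < Cb" "\<And>x. \<bar>bhat x\<bar> \<le> Cb / (1 + x\<^sup>2)" using bhat_decay by blast
  have b: "\<bar>bk k x\<bar> \<le> Cb / (1 + x\<^sup>2)" for x
  proof -
    have "\<bar>bk k x\<bar> \<le> \<bar>bhat x\<bar> * 1" unfolding bk_def abs_mult by (intro mult_left_mono) auto
    then show ?thesis using Cb(2)[of x] by linarith
  qed
  show i: "integrable lborel (bk k)"
  proof (rule Bochner_Integration.integrable_bound[OF integrable_cauchy_weight[of Cb]])
    show "AE x in lborel. norm (bk k x) \<le> norm (Cb / (1 + x\<^sup>2))"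
      unfolding real_norm_def by (intro AE_I2 order_trans[OF b abs_ge_self])
  qed simp
  have bC: "\<bar>bk k x\<bar> \<le> Cb" for x
  proof -
    have "Cb / (1 + x\<^sup>2) \<le> Cb / 1" using Cb(1) by (intro divide_left_mono) (auto intro: add_pos_nonneg)
    then show ?thesis using b[of x] by simp
  qed
  have "\<bar>(bk k x)\<^sup>2\<bar> \<le> \<bar>Cb * bk k x\<bar>" for x
  proof -
    have "\<bar>(bk k x)\<^sup>2\<bar> = \<bar>bk k x\<bar> * \<bar>bk k x\<bar>" by (simp add: power2_eq_square abs_mult)
    also have "\<dots> \<le> Cb * \<bar>bk k x\<bar>" by (rule mult_right_mono) (simp_all add: bC)
    also have "\<dots> = \<bar>Cb * bk k x\<bar>" using Cb(1) by (simp add: abs_mult)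
    finally show ?thesis .
  qed
  then show "integrable lborel (\<lambda>x. (bk k x)\<^sup>2)"
    by (intro Bochner_Integration.integrable_bound[OF integrable_mult_right[OF i, of Cb]]) auto
qed

text \<open>Inversion is applied to \<open>beta k\<close>, whose transform is already known to be
  \<open>2 * pi * bk k\<close>. Evaluating at \<open>- u\<close> turns the inverse transform into
  the forward transform of \<open>bk k\<close>.\<close>

lemma fourier_bk: "fourier (bk k) u = complex_of_real (beta k u)"
proof -
  let ?F = "\<lambda>u. complex_of_real (beta k u)"
  have "?F (- u) = complex_of_real (1 / (2 * pi)) * (LBINT x. iexp (- (x * (- u))) * cft ?F x)"
  proof (rule fourier_inversion[where b=1])
    show "integrable lborel ?F" by (rule bandlim_integrable[OF bandlim_beta])
    show "cmod (?F x) \<le> 1" for x using beta_nonneg[of k x] beta_le_1[of k x] by simp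
    show "isCont ?F (- u)"
      using continuous_beta by (intro continuous_intros) (simp add: continuous_on_eq_continuous_at)
    show "integrable lborel (cft ?F)" unfolding cft_beta[abs_def] using bk_integrable by simp
  qed
  also have "\<dots> = complex_of_real (1 / (2 * pi)) * (LBINT x. complex_of_real (2 * pi) * (iexp (u * x) * complex_of_real (bk k x)))"
    unfolding cft_beta by (simp add: ac_simps)
  also have "\<dots> = complex_of_real (1 / (2 * pi)) * (complex_of_real (2 * pi) * fourier (bk k) u)"
    unfolding fourier_def by (simp only: integral_mult_right_zero)
  also have "\<dots> = fourier (bk k) u" unfolding mult.assoc[symmetric] of_real_mult[symmetric] by simp
  finally show ?thesis by simp
qed

text \<open>Decay of the noise transform and of its derivative at the common rate
  \<open>\<bar>u\<bar> powr (- \<sigma>)\<close>. The derivative serves to control perturbations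
  under the weight \<open>1 + y\<^sup>2\<close>.\<close>

locale smooth_noise =
  fixes g :: "real \<Rightarrow> real" and \<sigma> :: real and D1 :: "real \<Rightarrow> complex" and kP cP :: real
  assumes g: "is_density g" and \<sigma>: "0 < \<sigma>"
    and D1: "\<And>u. (fourier g has_vector_derivative D1 u) (at u)" and D1_cont: "continuous_on UNIV D1"
    and kP: "1 \<le> kP" and cP: "0 < cP"
    and g_le: "\<And>u. kP \<le> \<bar>u\<bar> \<Longrightarrow> cmod (fourier g u) \<le> cP * \<bar>u\<bar> powr (- \<sigma>)"
    and D1_le: "\<And>u. kP \<le> \<bar>u\<bar> \<Longrightarrow> cmod (D1 u) \<le> cP * \<bar>u\<bar> powr (- \<sigma>)"
begin

definition Ek :: "nat \<Rightarrow> real \<Rightarrow> real" where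
  "Ek k y = (LBINT e. bk k (y - e) * g e)"

text \<open>\<open>De\<close> is the Fourier transform of \<open>Ek\<close> and \<open>De'\<close> its derivative, that is, up to a
  unimodular factor the transform of \<open>y * Ek y\<close>.\<close>

definition De :: "nat \<Rightarrow> real \<Rightarrow> complex" where
  "De k u = complex_of_real (beta k u) * fourier g u"

definition De' :: "nat \<Rightarrow> real \<Rightarrow> complex" where
  "De' k u = complex_of_real (dbeta k u) * fourier g u + complex_of_real (beta k u) * D1 u"

lemma De_facts:
  "bandlim (2 * real k + 1) (De k)" "bandlim (2 * real k + 1) (De' k)"
  "cft (De' k) x = - \<i> * complex_of_real x * cft (De k) x"
proof -
  have cg: "continuous_on UNIV (fourier g)"
    by (intro continuous_at_imp_continuous_on ballI isCont_fourier g)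
  have d: "(De k has_vector_derivative De' k u) (at u)" for u
  proof -
    from has_vector_derivative_mult[OF has_vector_derivative_of_real[OF DERIV_beta[of k u]] D1[of u]]
    show ?thesis unfolding De_def[abs_def] De'_def by (simp add: add.commute)
  qed
  have c: "continuous_on UNIV (De' k)"
    unfolding De'_def[abs_def] by (intro continuous_intros cg D1_cont continuous_dbeta continuous_beta)
  have z: "De k u = 0" if "2 * real k + 1 < \<bar>u\<bar>" for u
    using that by (simp add: De_def beta_outside)
  show "bandlim (2 * real k + 1) (De k)" "bandlim (2 * real k + 1) (De' k)"
    "cft (De' k) x = - \<i> * complex_of_real x * cft (De k) x"
    by (rule cft_derivative[OF d c z]; assumption)+
qed

text \<open>The modulated function \<open>?H\<close> has the packet seen from \<open>y\<close> as
  its transform at \<open>- e\<close>. The multiplication formula against the reflected noise then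
  turns the convolution into a product of transforms.\<close>

lemma Ek_eq: "complex_of_real (2 * pi * Ek k y) = cft (De k) (- y)"
proof -
  let ?H = "\<lambda>u. iexp (y * u) * complex_of_real (beta k u)"
  note bi = bandlim_integrable[OF bandlim_beta[of k]]
  have Hi: "integrable lborel ?H" by (rule integrable_iexp_mult[OF bi])
  have gi: "integrable lborel (\<lambda>e. complex_of_real (g (- e)))"
    by (rule integrable_reflect[OF is_densityD(5)[OF g]])
  have cH: "cft ?H (- e) = complex_of_real (2 * pi * bk k (y - e))" for e
  proof -
    have "cft ?H (- e) = cft (\<lambda>u. complex_of_real (beta k u)) (y - e)"
      unfolding cft_def
    proof (rule Bochner_Integration.integral_cong[OF refl])
      fix u
      have "iexp (- e * u) * iexp (y * u) = iexp ((y - e) * u)" by (simp add: exp_add[symmetric] algebra_simps)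
      then show "iexp (- e * u) * ?H u = iexp ((y - e) * u) * complex_of_real (beta k u)"
        by (simp only: mult.assoc[symmetric])
    qed
    then show ?thesis by (simp only: cft_beta)
  qed
  have "complex_of_real (2 * pi * Ek k y) = complex_of_real (LBINT e. 2 * pi * bk k (y - e) * g e)"
    unfolding Ek_def by (simp add: mult.assoc)
  also have "\<dots> = (LBINT e. complex_of_real (2 * pi * bk k (y - e) * g e))"
  proof (rule integral_of_real[symmetric])
    obtain Cb where Cb: "0 < Cb" "\<And>x. \<bar>bhat x\<bar> \<le> Cb / (1 + x\<^sup>2)" using bhat_decay by blast
    have b: "\<bar>bk k x\<bar> \<le> Cb" for x
    proof -
      have "\<bar>bk k x\<bar> \<le> \<bar>bhat x\<bar> * 1" unfolding bk_def abs_mult by (intro mult_left_mono) auto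
      also have "Cb / (1 + x\<^sup>2) \<le> Cb / 1" using Cb(1) by (intro divide_left_mono) (auto intro: add_pos_nonneg)
      then have "\<bar>bhat x\<bar> * 1 \<le> Cb" using Cb(2)[of x] by simp
      finally show ?thesis .
    qed
    show "integrable lborel (\<lambda>e. 2 * pi * bk k (y - e) * g e)"
    proof (rule Bochner_Integration.integrable_bound[OF integrable_mult_right[OF is_densityD(3)[OF g], of "2 * pi * Cb"]])
      show "(\<lambda>e. 2 * pi * bk k (y - e) * g e) \<in> borel_measurable lborel"
        using is_densityD(1)[OF g] by measurable
      show "AE e in lborel. norm (2 * pi * bk k (y - e) * g e) \<le> norm (2 * pi * Cb * g e)"
        using b Cb(1) by (intro AE_I2) (auto simp: abs_mult intro!: mult_right_mono)
    qed
  qed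
  also have "\<dots> = (LBINT e. cft ?H (- e) * complex_of_real (g (- (- e))))"
    unfolding cH by simp
  also have "\<dots> = (LBINT e. cft ?H e * complex_of_real (g (- e)))"
    by (rule integral_reflect)
  also have "\<dots> = (LBINT u. ?H u * cft (\<lambda>e. complex_of_real (g (- e))) u)"
    by (rule cft_mult_swap[OF Hi gi])
  also have "\<dots> = (LBINT u. ?H (- u) * cft (\<lambda>e. complex_of_real (g (- e))) (- u))"
    by (rule integral_reflect[symmetric])
  also have "\<dots> = cft (De k) (- y)"
  proof -
    have "cft (\<lambda>e. complex_of_real (g (- e))) (- u) = fourier g u" for u
      using cft_reflect[of "\<lambda>x. complex_of_real (g x)" "- u"] by (simp add: fourier_eq_cft)
    then show ?thesis unfolding cft_def[of "De k"] De_def by (simp add: mult.assoc)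
  qed
  finally show ?thesis .
qed

lemma Ek_weight_eq: "complex_of_real (2 * pi * (y * Ek k y)) = - \<i> * cft (De' k) (- y)"
  unfolding De_facts(3) Ek_eq[symmetric] by (simp add: algebra_simps)

lemma Ek_measurable [measurable]: "Ek k \<in> borel_measurable borel"
proof -
  have [measurable]: "cft (De k) \<in> borel_measurable borel"
    by (rule borel_measurable_cft[OF bandlim_integrable[OF De_facts(1)]])
  have "Ek k = (\<lambda>y. Re (cft (De k) (- y)) / (2 * pi))"
    unfolding Ek_eq[symmetric] by (simp add: fun_eq_iff)
  then show ?thesis by simp
qed

text \<open>Multiplication by \<open>y\<close> is differentiation in frequency up to a unimodular
  factor, so the weight \<open>1 + y\<^sup>2\<close> splits into two applications of Parseval, one
  for \<open>De\<close> and one for \<open>De'\<close>.\<close>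

lemma Ek_weighted:
  "integrable lborel (\<lambda>y. Ek k y * Ek l y * (1 + y\<^sup>2))"
  "(LBINT y. Ek k y * Ek l y * (1 + y\<^sup>2)) = pr (De k) (De l) + pr (De' k) (De' l)"
proof -
  note i = bandlim_integrable[OF De_facts(1)] bandlim_norm_square[OF De_facts(1)]
  note i' = bandlim_integrable[OF De_facts(2)] bandlim_norm_square[OF De_facts(2)]
  let ?A = "\<lambda>y. cft (De k) y * cnj (cft (De l) y)" and ?B = "\<lambda>y. cft (De' k) y * cnj (cft (De' l) y)"
  have m: "cft (De k) \<in> borel_measurable lborel" "cft (De' k) \<in> borel_measurable lborel" for k
    using borel_measurable_cft[OF i(1)[of k]] borel_measurable_cft[OF i'(1)[of k]] by simp_all
  have A: "integrable lborel ?A" by (intro integrable_mult_L2 m plancherel i)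
  have B: "integrable lborel ?B" by (intro integrable_mult_L2 m plancherel i')
  have e: "Ek k y * Ek l y * (1 + y\<^sup>2) = Re (?A (- y) + ?B (- y)) / (2 * pi)\<^sup>2" for y
  proof -
    have "a * cnj b = (- \<i> * a) * cnj (- \<i> * b)" for a b :: complex
      by (rule complex_eqI) (simp_all add: algebra_simps)
    then have "?B (- y) = (- \<i> * cft (De' k) (- y)) * cnj (- \<i> * cft (De' l) (- y))" .
    also have "\<dots> = complex_of_real (2 * pi * (y * Ek k y) * (2 * pi * (y * Ek l y)))"
      unfolding Ek_weight_eq[symmetric] by simp
    finally have 1: "?B (- y) = complex_of_real (2 * pi * (y * Ek k y) * (2 * pi * (y * Ek l y)))" .
    have 2: "?A (- y) = complex_of_real (2 * pi * Ek k y * (2 * pi * Ek l y))"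
      unfolding Ek_eq[symmetric] by simp
    show ?thesis unfolding 1 2 by (simp add: power2_eq_square field_simps)
  qed
  have AB: "integrable lborel (\<lambda>y. Re (?A y + ?B y) / (2 * pi)\<^sup>2)"
    by (intro integrable_divide_zero integrable_Re Bochner_Integration.integrable_add A B)
  show "integrable lborel (\<lambda>y. Ek k y * Ek l y * (1 + y\<^sup>2))"
    unfolding e by (rule integrable_reflect[OF AB])
  have "(LBINT y. Ek k y * Ek l y * (1 + y\<^sup>2)) = (LBINT y. Re (?A y + ?B y) / (2 * pi)\<^sup>2)"
    unfolding e by (rule integral_reflect)
  also have "\<dots> = Re ((LBINT y. ?A y) + (LBINT y. ?B y)) / (2 * pi)\<^sup>2"
    by (simp only: integral_divide_zero integral_Re[OF Bochner_Integration.integrable_add[OF A B]]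
        Bochner_Integration.integral_add[OF A B])
  also have "\<dots> = pr (De k) (De l) + pr (De' k) (De' l)"
    unfolding parseval[OF i i] parseval[OF i' i'] pr_def by (simp add: power2_eq_square field_simps)
  finally show "(LBINT y. Ek k y * Ek l y * (1 + y\<^sup>2)) = pr (De k) (De l) + pr (De' k) (De' l)" .
qed

definition ak :: "nat \<Rightarrow> real" where "ak k = pr (De k) (De k) + pr (De' k) (De' k)"

text \<open>Neither convolution nor differentiation enlarges the frequency support, so packets with
  different indices stay exactly orthogonal under this weight.\<close>

lemma Ek_orthogonal: "(LBINT y. Ek k y * Ek l y * (1 + y\<^sup>2)) = (if k = l then ak k else 0)"
proof (cases "k = l")
  case False
  have "(\<lambda>u. De k u * cnj (De l u)) = (\<lambda>u. 0)" "(\<lambda>u. De' k u * cnj (De' l u)) = (\<lambda>u. 0)"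
  proof -
    have "De k u * cnj (De l u) = 0 \<and> De' k u * cnj (De' l u) = 0" for u
      using beta_disjoint[OF False, of u] by (auto simp: De_def De'_def)
    then show "(\<lambda>u. De k u * cnj (De l u)) = (\<lambda>u. 0)" "(\<lambda>u. De' k u * cnj (De' l u)) = (\<lambda>u. 0)"
      by (intro ext; blast)+
  qed
  then have "pr (De k) (De l) = 0" "pr (De' k) (De' l) = 0" by (simp_all only: pr_def) simp_all
  then show ?thesis unfolding Ek_weighted using False by simp
qed (simp add: Ek_weighted ak_def)

lemma ak_nonneg: "0 \<le> ak k"
  unfolding ak_def by (intro add_nonneg_nonneg pr_self_nonneg[OF De_facts(1)] pr_self_nonneg[OF De_facts(2)])

text \<open>On the support of \<open>beta k\<close> one has \<open>\<bar>u\<bar> \<ge> k\<close>, so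
  both \<open>fourier g\<close> and \<open>D1\<close> are at most \<open>?q\<close>. Then
  \<open>De\<close> is at most \<open>?q\<close>, and \<open>De'\<close> at most
  \<open>7 * ?q\<close> because the slope of \<open>beta k\<close> is at most
  \<open>6\<close>.\<close>

lemma ak_le:
  assumes k: "kP \<le> real k"
  shows "ak k \<le> 67 * cP\<^sup>2 * real k powr (- 2 * \<sigma>)"
proof -
  have k1: "1 \<le> real k" using k kP by simp
  let ?I = "\<lambda>u. indicator {2 * real k - 1..2 * real k + 1} u + indicator {- 2 * real k - 1..- 2 * real k + 1} u :: real"
  let ?q = "cP * real k powr (- \<sigma>)"
  have q: "0 < ?q" using cP k1 by simp
  have iI: "integrable lborel ?I" and I4: "(LBINT u. ?I u) = 4"
  proof -
    have i: "integrable lborel (indicator {a..b} :: real \<Rightarrow> real)" for a b :: real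
      by (rule integrable_real_indicator) (simp_all add: emeasure_lborel_Icc_eq)
    show "integrable lborel ?I" using i by (rule Bochner_Integration.integrable_add) (rule i)
    show "(LBINT u. ?I u) = 4" using i by simp
  qed
  have sup: "cmod (De k u) \<le> ?q * ?I u \<and> cmod (De' k u) \<le> 7 * ?q * ?I u" for u
  proof (cases "1 \<le> \<bar>\<bar>u\<bar> - 2 * real k\<bar>")
    case True
    then show ?thesis using q by (simp add: De_def De'_def beta_outside dbeta_outside)
  next
    case False
    then have u: "real k \<le> \<bar>u\<bar>" using k1 by linarith
    have "1 \<le> ?I u" using False by (auto simp: indicator_def abs_if split: if_splits)
    have "\<bar>u\<bar> powr (- \<sigma>) \<le> real k powr (- \<sigma>)" using u k1 \<sigma> by (intro powr_mono2') auto
    then have "cP * \<bar>u\<bar> powr (- \<sigma>) \<le> ?q" using cP by (intro mult_left_mono) auto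
    then have 1: "cmod (fourier g u) \<le> ?q" "cmod (D1 u) \<le> ?q"
      using g_le[of u] D1_le[of u] u k by linarith+
    have b: "\<bar>beta k u\<bar> \<le> 1" using beta_nonneg[of k u] beta_le_1[of k u] by simp
    have "cmod (De k u) \<le> 1 * ?q" unfolding De_def norm_mult norm_of_real by (intro mult_mono b 1) auto
    moreover have "cmod (De' k u) \<le> 6 * ?q + 1 * ?q"
      unfolding De'_def by (rule order_trans[OF norm_triangle_ineq])
        (simp only: norm_mult norm_of_real, intro add_mono mult_mono b 1 abs_dbeta_le, auto)
    moreover have "?q * 1 \<le> ?q * ?I u" using \<open>1 \<le> ?I u\<close> q by (intro mult_left_mono) auto
    ultimately show ?thesis by linarith
  qed
  have pb: "pr A A \<le> M\<^sup>2 * 8 / (2 * pi)" if A: "bandlim R A" and M: "\<And>u. cmod (A u) \<le> M * ?I u" for A R M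
  proof -
    have "(LBINT u. (cmod (A u))\<^sup>2) \<le> (LBINT u. M\<^sup>2 * 2 * ?I u)"
    proof (rule integral_mono')
      show "integrable lborel (\<lambda>u. M\<^sup>2 * 2 * ?I u)" by (rule integrable_mult_right[OF iI])
      fix u
      have "(cmod (A u))\<^sup>2 \<le> (M * ?I u)\<^sup>2" by (rule power_mono[OF M]) simp
      also have "\<dots> = M\<^sup>2 * (?I u)\<^sup>2" by (rule power_mult_distrib)
      \<comment> \<open>The sum \<open>?I\<close> of two indicators takes the values
        \<open>0\<close>, \<open>1\<close> and \<open>2\<close>, so its square is at most twice
        itself; its integral \<open>4\<close> produces the factor \<open>8\<close>.\<close>
      also have "\<dots> \<le> M\<^sup>2 * (2 * ?I u)" by (intro mult_left_mono) (auto simp: indicator_def power2_eq_square)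
      finally show "(cmod (A u))\<^sup>2 \<le> M\<^sup>2 * 2 * ?I u" by (simp only: mult.assoc)
      show "0 \<le> M\<^sup>2 * 2 * ?I u" by simp
    qed
    also have "\<dots> = M\<^sup>2 * 8" using I4 by (simp only: integral_mult_right_zero)
    finally show ?thesis unfolding pr_self[OF A] by (intro divide_right_mono) auto
  qed
  have "ak k \<le> ?q\<^sup>2 * 8 / (2 * pi) + (7 * ?q)\<^sup>2 * 8 / (2 * pi)"
    unfolding ak_def using sup by (intro add_mono pb[OF De_facts(1)] pb[OF De_facts(2)]) auto
  \<comment> \<open>The constants \<open>1\<close> and \<open>7\<close> squared add up to
    \<open>50\<close>, and \<open>50 * 8 / (2 * pi)\<close> is \<open>200 / pi\<close>.\<close>
  also have "\<dots> = 200 * ?q\<^sup>2 / pi" by (simp add: power2_eq_square field_simps)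
  also have "\<dots> \<le> 200 * ?q\<^sup>2 / 3" using pi_gt3 by (intro divide_left_mono) auto
  also have "\<dots> \<le> 67 * ?q\<^sup>2" by simp
  finally have "ak k \<le> 67 * ?q\<^sup>2" .
  then show ?thesis using k1 by (simp add: power_mult_distrib powr_power)
qed

end

section \<open>Rademacher sums\<close>

definition signs :: "nat \<Rightarrow> (nat \<Rightarrow> real) set" where
  "signs m = PiE {m + 1..2 * m} (\<lambda>_. {- 1, 1})"

text \<open>A perturbation with equal amplitudes and signs \<open>\<theta>\<close> factors as
  amplitude times \<open>bhat x\<close> times this sum. A uniform bound on it is therefore what
  positivity of the perturbed density calls for.\<close>

definition trig :: "nat \<Rightarrow> (nat \<Rightarrow> real) \<Rightarrow> real \<Rightarrow> real" where
  "trig m \<theta> x = (\<Sum>k\<in>{m + 1..2 * m}. \<theta> k * cos (2 * real k * x))"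

lemma finite_signs [simp]: "finite (signs m)" and card_signs: "card (signs m) = 2 ^ m"
  by (simp_all add: signs_def finite_PiE card_PiE card_insert_if numeral_2_eq_2)

lemma signs_pm: "\<theta> \<in> signs m \<Longrightarrow> k \<in> {m + 1..2 * m} \<Longrightarrow> \<theta> k = 1 \<or> \<theta> k = - 1"
  by (auto simp: signs_def PiE_iff)

lemma exp_sum_le_exp_square: "exp x + exp (- x) \<le> 2 * exp (x\<^sup>2)" for x :: real
proof (cases "\<bar>x\<bar> \<le> 1")
  case True
  have "1 + x\<^sup>2 \<le> exp (x\<^sup>2)" by (rule exp_ge_add_one_self)
  moreover have "exp (- x) \<le> 1 - x + x\<^sup>2" using exp_le_quadratic[of "- x"] True by simp
  ultimately show ?thesis using exp_le_quadratic[OF True] by linarith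
next
  case False
  have "\<bar>x\<bar> * 1 \<le> \<bar>x\<bar> * \<bar>x\<bar>" using False by (intro mult_left_mono) auto
  then have "\<bar>x\<bar> \<le> x\<^sup>2" by (simp add: power2_eq_square)
  then have "exp x \<le> exp (x\<^sup>2)" "exp (- x) \<le> exp (x\<^sup>2)" by auto
  then show ?thesis by linarith
qed

lemma rademacher_mgf:
  "(\<Sum>\<theta>\<in>signs m. exp (\<Sum>k\<in>{m + 1..2 * m}. \<theta> k * s k)) \<le> 2 ^ m * exp (\<Sum>k\<in>{m + 1..2 * m}. (s k)\<^sup>2)"
proof -
  have "(\<Sum>\<theta>\<in>signs m. exp (\<Sum>k\<in>{m + 1..2 * m}. \<theta> k * s k)) = (\<Sum>\<theta>\<in>signs m. \<Prod>k\<in>{m + 1..2 * m}. exp (\<theta> k * s k))"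
    by (simp add: exp_sum)
  also have "\<dots> = (\<Prod>k\<in>{m + 1..2 * m}. \<Sum>t\<in>{- 1, 1}. exp (t * s k))"
    unfolding signs_def by (rule prod_sum_PiE[symmetric]) auto
  also have "\<dots> \<le> (\<Prod>k\<in>{m + 1..2 * m}. 2 * exp ((s k)\<^sup>2))"
    using exp_sum_le_exp_square[of "s _"] by (intro prod_mono) (auto simp: add.commute intro!: add_nonneg_nonneg)
  also have "\<dots> = 2 ^ m * exp (\<Sum>k\<in>{m + 1..2 * m}. (s k)\<^sup>2)"
    by (simp add: prod.distrib exp_sum)
  finally show ?thesis .
qed

text \<open>Chernoff's bound, stated as a count of sign patterns; the factor \<open>2\<close> comes
  from the two tails, \<open>c = 1\<close> and \<open>c = - 1\<close>.\<close>

lemma rademacher_tail: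
  assumes m: "1 \<le> m" and t: "0 < t"
  shows "real (card {\<theta> \<in> signs m. t \<le> \<bar>trig m \<theta> x\<bar>}) \<le> 2 * 2 ^ m * exp (- (t\<^sup>2 / (4 * real m)))"
proof -
  have one: "real (card {\<theta> \<in> signs m. t \<le> c * trig m \<theta> x}) \<le> 2 ^ m * exp (- (t\<^sup>2 / (4 * real m)))" if c: "c\<^sup>2 = 1" for c
  proof -
    \<comment> \<open>The minimiser of \<open>m * l\<^sup>2 - l * t\<close>; its minimum is the
      exponent in the claim.\<close>
    let ?l = "t / (2 * real m)"
    let ?s = "\<lambda>k. ?l * c * cos (2 * real k * x)"
    have l: "0 < ?l" using m t by simp
    have "real (card {\<theta> \<in> signs m. t \<le> c * trig m \<theta> x}) * exp (?l * t) = (\<Sum>\<theta>\<in>{\<theta> \<in> signs m. t \<le> c * trig m \<theta> x}. exp (?l * t))"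
      by simp
    also have "\<dots> \<le> (\<Sum>\<theta>\<in>{\<theta> \<in> signs m. t \<le> c * trig m \<theta> x}. exp (\<Sum>k\<in>{m + 1..2 * m}. \<theta> k * ?s k))"
    proof (rule sum_mono)
      fix \<theta> assume "\<theta> \<in> {\<theta> \<in> signs m. t \<le> c * trig m \<theta> x}"
      then have "?l * t \<le> ?l * (c * trig m \<theta> x)" using l by (intro mult_left_mono) auto
      also have "\<dots> = (\<Sum>k\<in>{m + 1..2 * m}. \<theta> k * ?s k)"
        unfolding trig_def sum_distrib_left by (intro sum.cong refl) simp
      finally show "exp (?l * t) \<le> exp (\<Sum>k\<in>{m + 1..2 * m}. \<theta> k * ?s k)" by simp
    qed
    also have "\<dots> \<le> (\<Sum>\<theta>\<in>signs m. exp (\<Sum>k\<in>{m + 1..2 * m}. \<theta> k * ?s k))"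
      by (intro sum_mono2) auto
    also have "\<dots> \<le> 2 ^ m * exp (\<Sum>k\<in>{m + 1..2 * m}. (?s k)\<^sup>2)" by (rule rademacher_mgf)
    also have "\<dots> \<le> 2 ^ m * exp (t\<^sup>2 / (4 * real m))"
    proof -
      have "(\<Sum>k\<in>{m + 1..2 * m}. (?s k)\<^sup>2) \<le> (\<Sum>k\<in>{m + 1..2 * m}. ?l\<^sup>2)"
      proof (rule sum_mono)
        fix k
        have "(cos (2 * real k * x))\<^sup>2 \<le> 1" by (simp add: abs_square_le_1)
        then show "(?s k)\<^sup>2 \<le> ?l\<^sup>2" unfolding power_mult_distrib c by (simp add: mult_left_le)
      qed
      also have "\<dots> = t\<^sup>2 / (4 * real m)" using m by (simp add: power2_eq_square)
      finally show ?thesis by simp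
    qed
    finally have "real (card {\<theta> \<in> signs m. t \<le> c * trig m \<theta> x}) * exp (?l * t) * exp (- (?l * t))
        \<le> 2 ^ m * exp (t\<^sup>2 / (4 * real m)) * exp (- (?l * t))" by (intro mult_right_mono) auto
    moreover have "t\<^sup>2 / (4 * real m) - ?l * t = - (t\<^sup>2 / (4 * real m))"
      using m by (simp add: power2_eq_square field_simps)
    then have "exp (t\<^sup>2 / (4 * real m)) * exp (- (?l * t)) = exp (- (t\<^sup>2 / (4 * real m)))"
      by (simp add: exp_add[symmetric])
    moreover have "real (card {\<theta> \<in> signs m. t \<le> c * trig m \<theta> x}) * exp (?l * t) * exp (- (?l * t)) = real (card {\<theta> \<in> signs m. t \<le> c * trig m \<theta> x})"
      by (simp add: mult.assoc exp_minus)
    ultimately show ?thesis by (simp only: mult.assoc)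
  qed
  have "{\<theta> \<in> signs m. t \<le> \<bar>trig m \<theta> x\<bar>} \<subseteq> {\<theta> \<in> signs m. t \<le> 1 * trig m \<theta> x} \<union> {\<theta> \<in> signs m. t \<le> (- 1) * trig m \<theta> x}"
    by (auto simp: abs_if split: if_splits)
  then have "card {\<theta> \<in> signs m. t \<le> \<bar>trig m \<theta> x\<bar>} \<le> card ({\<theta> \<in> signs m. t \<le> 1 * trig m \<theta> x} \<union> {\<theta> \<in> signs m. t \<le> (- 1) * trig m \<theta> x})"
    by (intro card_mono) auto
  also have "\<dots> \<le> card {\<theta> \<in> signs m. t \<le> 1 * trig m \<theta> x} + card {\<theta> \<in> signs m. t \<le> (- 1) * trig m \<theta> x}"
    by (rule card_Un_le)
  finally have "real (card {\<theta> \<in> signs m. t \<le> \<bar>trig m \<theta> x\<bar>})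
    \<le> real (card {\<theta> \<in> signs m. t \<le> 1 * trig m \<theta> x}) + real (card {\<theta> \<in> signs m. t \<le> (- 1) * trig m \<theta> x})"
    by linarith
  also have "\<dots> \<le> 2 ^ m * exp (- (t\<^sup>2 / (4 * real m))) + 2 ^ m * exp (- (t\<^sup>2 / (4 * real m)))"
    by (intro add_mono one) auto
  finally show ?thesis by simp
qed

lemma abs_cos_diff_le: "\<bar>cos a - cos b\<bar> \<le> \<bar>a - b\<bar>" for a b :: real
proof -
  have "\<bar>cos a - cos b\<bar> = 2 * \<bar>sin ((a + b) / 2)\<bar> * \<bar>sin ((b - a) / 2)\<bar>"
    by (subst cos_diff_cos) (simp add: abs_mult)
  also have "\<dots> \<le> 2 * 1 * \<bar>(b - a) / 2\<bar>"
    by (rule mult_mono[OF _ abs_sin_x_le_abs_x]) (auto simp: abs_sin_le_one)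
  finally show ?thesis by simp
qed

text \<open>All frequencies are even, so \<open>trig\<close> has period \<open>pi\<close>, and its
  Lipschitz constant is at most \<open>m * 4 * m\<close>. A grid of \<open>8 * m\<^sup>2\<close>
  points in one period has an error of at most \<open>pi / 2\<close>, below the allowance
  \<open>2\<close>.\<close>

lemma trig_approx:
  assumes m: "1 \<le> m" and \<theta>: "\<theta> \<in> signs m" and J: "J = 8 * m\<^sup>2"
  obtains j where "j < J" "\<bar>trig m \<theta> x\<bar> \<le> \<bar>trig m \<theta> (pi * real j / real J)\<bar> + 2"
proof -
  have J0: "0 < real J" using m by (simp add: J)
  define q where "q = \<lfloor>x / pi\<rfloor>"
  define y where "y = x - pi * of_int q"
  have qy: "0 \<le> x / pi - of_int q" "x / pi - of_int q < 1" unfolding q_def by linarith+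
  have yq: "y = pi * (x / pi - of_int q)" by (simp add: y_def field_simps)
  have y: "0 \<le> y / pi" "y / pi < 1" using qy unfolding yq by auto
  have per: "trig m \<theta> x = trig m \<theta> y"
    unfolding trig_def
  proof (intro sum.cong refl arg_cong[where f="\<lambda>z. _ * z"])
    fix k
    have "2 * real k * x = 2 * real k * y + 2 * pi * of_int (int k * q)" by (simp add: y_def algebra_simps)
    then show "cos (2 * real k * x) = cos (2 * real k * y)"
      by (simp only: cos_add sin_int_2pin cos_int_2pin mult_1_right mult_zero_right diff_zero)
  qed
  define j where "j = nat \<lfloor>y / pi * real J\<rfloor>"
  have yJ: "0 \<le> y / pi * real J" using y J0 by (intro mult_nonneg_nonneg) auto
  have j1: "real j \<le> y / pi * real J" "y / pi * real J < real j + 1" using yJ unfolding j_def by linarith+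
  have "y / pi * real J < 1 * real J" using y J0 by (intro mult_strict_right_mono) auto
  then have jJ: "j < J" using j1 by linarith
  have d: "\<bar>y - pi * real j / real J\<bar> \<le> pi / real J"
  proof -
    have "y - pi * real j / real J = pi / real J * (y / pi * real J - real j)" using J0 by (simp add: field_simps)
    also have "\<bar>\<dots>\<bar> \<le> pi / real J * 1" unfolding abs_mult using j1 J0 by (intro mult_mono) auto
    finally show ?thesis by simp
  qed
  have "\<bar>trig m \<theta> y - trig m \<theta> (pi * real j / real J)\<bar> \<le> (\<Sum>k\<in>{m + 1..2 * m}. 4 * real m * (pi / real J))"
    unfolding trig_def sum_subtractf[symmetric]
  proof (rule order_trans[OF sum_abs sum_mono])
    fix k assume k: "k \<in> {m + 1..2 * m}"
    have "\<bar>\<theta> k * cos (2 * real k * y) - \<theta> k * cos (2 * real k * (pi * real j / real J))\<bar>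
      = \<bar>\<theta> k\<bar> * \<bar>cos (2 * real k * y) - cos (2 * real k * (pi * real j / real J))\<bar>"
      by (simp add: abs_mult[symmetric] right_diff_distrib)
    also have "\<dots> = \<bar>cos (2 * real k * y) - cos (2 * real k * (pi * real j / real J))\<bar>"
      using signs_pm[OF \<theta> k] by auto
    also have "\<dots> \<le> \<bar>2 * real k * y - 2 * real k * (pi * real j / real J)\<bar>" by (rule abs_cos_diff_le)
    also have "\<dots> = 2 * real k * \<bar>y - pi * real j / real J\<bar>"
      unfolding right_diff_distrib[symmetric] abs_mult by simp
    also have "\<dots> \<le> 4 * real m * (pi / real J)" using k J0 by (intro mult_mono[OF _ d]) auto
    finally show "\<bar>\<theta> k * cos (2 * real k * y) - \<theta> k * cos (2 * real k * (pi * real j / real J))\<bar> \<le> 4 * real m * (pi / real J)" .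
  qed
  also have "\<dots> = pi / 2" using m by (simp add: J power2_eq_square)
  also have "\<dots> \<le> 2" using pi_less_4 by simp
  finally show ?thesis using per jJ by (intro that[of j]) auto
qed

definition good_signs :: "nat \<Rightarrow> real \<Rightarrow> (nat \<Rightarrow> real) set" where
  "good_signs m t = {\<theta> \<in> signs m. \<forall>x. \<bar>trig m \<theta> x\<bar> \<le> t + 2}"

text \<open>A union bound over the \<open>8 * m\<^sup>2\<close> grid points: the excluded proportion
  of sign patterns is at most \<open>16 * m\<^sup>2\<close> times the exponential, hence at most one
  half. Conditioning on good signs thus costs a factor two.\<close>

lemma card_good_signs:
  assumes m: "1 \<le> m" and t: "0 < t" and c: "32 * (real m)\<^sup>2 * exp (- (t\<^sup>2 / (4 * real m))) \<le> 1"
  shows "2 ^ m \<le> 2 * real (card (good_signs m t))"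
proof -
  define J where "J = 8 * m\<^sup>2"
  let ?B = "\<lambda>j. {\<theta> \<in> signs m. t \<le> \<bar>trig m \<theta> (pi * real j / real J)\<bar>}"
  have "signs m \<subseteq> good_signs m t \<union> (\<Union>j\<in>{..<J}. ?B j)"
  proof
    fix \<theta> assume \<theta>: "\<theta> \<in> signs m"
    show "\<theta> \<in> good_signs m t \<union> (\<Union>j\<in>{..<J}. ?B j)"
    proof (cases "\<theta> \<in> good_signs m t")
      case False
      then obtain x where x: "t + 2 < \<bar>trig m \<theta> x\<bar>" using \<theta> by (auto simp: good_signs_def not_le)
      obtain j where "j < J" "\<bar>trig m \<theta> x\<bar> \<le> \<bar>trig m \<theta> (pi * real j / real J)\<bar> + 2"
        using trig_approx[OF m \<theta> J_def] by blast
      then show ?thesis using x \<theta> by (auto intro!: bexI[of _ j])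
    qed simp
  qed
  then have "card (signs m) \<le> card (good_signs m t \<union> (\<Union>j\<in>{..<J}. ?B j))"
    by (intro card_mono) (auto simp: good_signs_def)
  also have "\<dots> \<le> card (good_signs m t) + card (\<Union>j\<in>{..<J}. ?B j)" by (rule card_Un_le)
  also have "card (\<Union>j\<in>{..<J}. ?B j) \<le> (\<Sum>j<J. card (?B j))" by (rule card_UN_le) simp
  finally have "real (card (signs m)) \<le> real (card (good_signs m t)) + (\<Sum>j<J. real (card (?B j)))"
    by (simp flip: of_nat_sum)
  also have "(\<Sum>j<J. real (card (?B j))) \<le> (\<Sum>j<J. 2 * 2 ^ m * exp (- (t\<^sup>2 / (4 * real m))))"
    by (intro sum_mono rademacher_tail m t)
  also have "\<dots> = 2 ^ m / 2 * (32 * (real m)\<^sup>2 * exp (- (t\<^sup>2 / (4 * real m))))" by (simp add: J_def)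
  also have "\<dots> \<le> 2 ^ m / 2 * 1" by (intro mult_left_mono c) simp
  finally show ?thesis by (simp add: card_signs)
qed

section \<open>Perturbations of the null density\<close>

lemma obs_law_eq_density:
  assumes f: "is_density f" and g: "is_density g"
  shows "obs_law g f = density lborel (\<lambda>x. \<integral>\<^sup>+y. ennreal (f (x - y)) * ennreal (g y) \<partial>lborel)"
proof -
  have "finite_measure (density lborel (\<lambda>x. ennreal (d x)))" if "is_density d" for d
    using prob_space_density_lborel[OF that] by (rule prob_space.finite_measure)
  then show ?thesis using is_densityD(1)[OF f] is_densityD(1)[OF g] f g by (intro convolution_density) auto
qed

lemma conv_finite_AE:
  assumes f: "is_density f" and g: "is_density g"
  shows "AE x in lborel. (\<integral>\<^sup>+y. ennreal (f (x - y)) * ennreal (g y) \<partial>lborel) \<noteq> \<infinity>"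
proof -
  let ?q = "\<lambda>x. \<integral>\<^sup>+y. ennreal (f (x - y)) * ennreal (g y) \<partial>lborel"
  note [measurable] = is_densityD(1)[OF f] is_densityD(1)[OF g]
  interpret P: prob_space "obs_law g f" by (rule prob_space_obs_law[OF f g])
  have m: "?q \<in> borel_measurable lborel" by measurable
  have "emeasure (obs_law g f) UNIV = 1" using P.emeasure_space_1 by simp
  then have "(\<integral>\<^sup>+x. ?q x \<partial>lborel) = 1"
    unfolding obs_law_eq_density[OF f g] using m by (simp add: emeasure_density)
  then show ?thesis by (intro nn_integral_PInf_AE[OF m]) simp
qed

text \<open>A quadratic tail survives convolution: more than half of the noise mass lies in a
  bounded interval, and shifting the argument by a bounded amount changes
  \<open>1 + x\<^sup>2\<close> by a bounded factor.\<close>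

lemma null_obs_density:
  assumes f: "is_density f0" and g: "is_density g" and c0: "0 < c0" and T: "\<And>x. c0 / (1 + x\<^sup>2) \<le> f0 x"
  obtains p0 c' where "0 < c'" "p0 \<in> borel_measurable borel" "\<And>x. c' / (1 + x\<^sup>2) \<le> p0 x"
    "AE x in lborel. ennreal (p0 x) = (\<integral>\<^sup>+y. ennreal (f0 (x - y)) * ennreal (g y) \<partial>lborel)"
proof -
  let ?q = "\<lambda>x. \<integral>\<^sup>+y. ennreal (f0 (x - y)) * ennreal (g y) \<partial>lborel"
  note [measurable] = is_densityD(1)[OF f] is_densityD(1)[OF g]
  have qm: "?q \<in> borel_measurable lborel" by measurable
  have "(\<lambda>n. \<integral>y. indicator {- real n..real n} y * g y \<partial>lborel) \<longlonglongrightarrow> (LBINT y. g y)"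
  proof (rule integral_dominated_convergence[where w="g"])
    show "AE y in lborel. (\<lambda>n. indicator {- real n..real n} y * g y) \<longlonglongrightarrow> g y"
    proof (rule AE_I2)
      fix y
      have "\<forall>\<^sub>F n in sequentially. indicator {- real n..real n} y * g y = g y"
        using eventually_ge_at_top[of "nat \<lceil>\<bar>y\<bar>\<rceil>"]
        by eventually_elim (auto simp: indicator_def nat_ceiling_le_eq abs_le_iff)
      then show "(\<lambda>n. indicator {- real n..real n} y * g y) \<longlonglongrightarrow> g y" by (rule tendsto_eventually)
    qed
    show "AE y in lborel. norm (indicator {- real n..real n} y * g y) \<le> g y" for n
      using is_densityD(2)[OF g] by (auto simp: indicator_def)
  qed (use is_densityD(3)[OF g] in auto)
  then have "\<forall>\<^sub>F n in sequentially. 1 / 2 < (LBINT y. indicator {- real n..real n} y * g y)"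
    using is_densityD(4)[OF g] by (intro order_tendstoD) auto
  then obtain n where n: "1 / 2 < (LBINT y. indicator {- real n..real n} y * g y)"
    by (auto simp: eventually_sequentially)
  let ?g = "\<lambda>y. indicator {- real n..real n} y * g y"
  have gi: "integrable lborel ?g"
    by (rule Bochner_Integration.integrable_bound[OF is_densityD(3)[OF g]]) (auto simp: indicator_def)
  \<comment> \<open>One factor \<open>2\<close> comes from comparing
    \<open>1 + (x - y)\<^sup>2\<close> with \<open>(1 + n\<^sup>2) * (1 + x\<^sup>2)\<close>, the
    other from the noise mass \<open>1 / 2\<close>.\<close>
  define c' where "c' = c0 / (4 * (1 + (real n)\<^sup>2))"
  have n1: "0 < 1 + (real n)\<^sup>2" by (intro add_pos_nonneg) auto
  have c': "0 < c'" using c0 n1 by (simp add: c'_def)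
  have lower: "ennreal (c' / (1 + x\<^sup>2)) \<le> ?q x" for x
  proof -
    let ?k = "2 * c' / (1 + x\<^sup>2)"
    have x1: "0 < 1 + x\<^sup>2" by (intro add_pos_nonneg) auto
    have k: "0 \<le> ?k" using c' x1 by simp
    have pt: "?k * ?g y \<le> f0 (x - y) * g y" for y
    proof (cases "y \<in> {- real n..real n}")
      case True
      then have "y\<^sup>2 \<le> (real n)\<^sup>2" by (intro abs_le_square_iff[THEN iffD1]) auto
      have "(x - y)\<^sup>2 \<le> 2 * x\<^sup>2 + 2 * y\<^sup>2"
        using zero_le_power2[of "x + y"] by (simp add: power2_eq_square algebra_simps)
      also have "\<dots> \<le> 2 * x\<^sup>2 + 2 * (real n)\<^sup>2" using \<open>y\<^sup>2 \<le> (real n)\<^sup>2\<close> by simp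
      finally have "(x - y)\<^sup>2 \<le> 2 * x\<^sup>2 + 2 * (real n)\<^sup>2" .
      then have "1 + (x - y)\<^sup>2 \<le> 2 * ((1 + (real n)\<^sup>2) * (1 + x\<^sup>2))"
      proof -
        assume a: "(x - y)\<^sup>2 \<le> 2 * x\<^sup>2 + 2 * (real n)\<^sup>2"
        have "2 * ((1 + (real n)\<^sup>2) * (1 + x\<^sup>2)) = 2 + 2 * x\<^sup>2 + 2 * (real n)\<^sup>2 + 2 * ((real n)\<^sup>2 * x\<^sup>2)"
          by (simp add: algebra_simps)
        moreover have "0 \<le> (real n)\<^sup>2 * x\<^sup>2" by (intro mult_nonneg_nonneg) auto
        ultimately show ?thesis using a by linarith
      qed
      then have "c0 / (2 * ((1 + (real n)\<^sup>2) * (1 + x\<^sup>2))) \<le> c0 / (1 + (x - y)\<^sup>2)"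
        using c0 n1 x1 by (intro divide_left_mono mult_pos_pos add_pos_nonneg) auto
      also have "c0 / (2 * ((1 + (real n)\<^sup>2) * (1 + x\<^sup>2))) = ?k"
        using n1 x1 by (simp add: c'_def divide_simps)
      finally have "?k \<le> f0 (x - y)" using T[of "x - y"] by simp
      from mult_right_mono[OF this is_densityD(2)[OF g, of y]] True show ?thesis by simp
    next
      case False
      then show ?thesis using is_densityD(2)[OF g, of y] is_densityD(2)[OF f, of "x - y"] by simp
    qed
    have "c' / (1 + x\<^sup>2) = ?k * (1 / 2)" using x1 by (simp add: divide_simps)
    then have "ennreal (c' / (1 + x\<^sup>2)) = ennreal (?k * (1 / 2))" by (rule arg_cong)
    also have "\<dots> \<le> ennreal (?k * (LBINT y. ?g y))"
      using n k by (intro ennreal_leI mult_left_mono) auto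
    also have "\<dots> = ennreal (LBINT y. ?k * ?g y)" by simp
    also have "\<dots> = (\<integral>\<^sup>+y. ennreal (?k * ?g y) \<partial>lborel)"
      using integrable_mult_right[OF gi, of ?k] k is_densityD(2)[OF g]
      by (intro nn_integral_eq_integral[symmetric] AE_I2 mult_nonneg_nonneg) auto
    also have "\<dots> \<le> ?q x"
      using pt is_densityD(2)[OF f]
      by (intro nn_integral_mono) (simp add: ennreal_mult'[symmetric] ennreal_leI)
    finally show ?thesis .
  qed
  \<comment> \<open>The conversion \<open>enn2real\<close> sends an infinite value to
    \<open>0\<close>; the maximum keeps the lower bound valid at such points, which form a null
    set.\<close>
  define p0 where "p0 x = max (c' / (1 + x\<^sup>2)) (enn2real (?q x))" for x
  show ?thesis
  proof (rule that[OF c', of p0])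
    show "p0 \<in> borel_measurable borel" unfolding p0_def[abs_def] using qm by simp
    show "c' / (1 + x\<^sup>2) \<le> p0 x" for x by (simp add: p0_def)
    show "AE x in lborel. ennreal (p0 x) = ?q x"
      using conv_finite_AE[OF f g]
    proof eventually_elim
      case (elim x)
      then have e: "ennreal (enn2real (?q x)) = ?q x" by (simp add: less_top)
      have "c' / (1 + x\<^sup>2) \<le> enn2real (?q x)"
        using order_trans[OF lower[of x] eq_refl[OF e[symmetric]]] by (simp only: ennreal_le_iff[OF enn2real_nonneg])
      then show ?case using e by (simp add: p0_def max_def)
    qed
  qed
qed

section \<open>Perturbed densities, their observation laws and likelihood ratios\<close>

locale lower_model = smooth_noise g \<sigma> D1 kP cP for g \<sigma> D1 kP cP +
  fixes f0 p0 :: "real \<Rightarrow> real" and c' :: real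
  assumes f0: "is_density f0" and c': "0 < c'" and p0m[measurable]: "p0 \<in> borel_measurable borel"
    and p0_ge: "\<And>x. c' / (1 + x\<^sup>2) \<le> p0 x"
    and p0_eq: "AE x in lborel. ennreal (p0 x) = (\<integral>\<^sup>+y. ennreal (f0 (x - y)) * ennreal (g y) \<partial>lborel)"
begin

lemma p0_pos: "0 < p0 x"
  using p0_ge[of x] c' by (meson add_pos_nonneg divide_pos_pos less_le_trans zero_le_power2 zero_less_one)

lemma null_law: "obs_law g f0 = density lborel (\<lambda>x. ennreal (p0 x))"
  unfolding obs_law_eq_density[OF f0 g]
  by (rule density_cong) (use p0_eq is_densityD(1)[OF f0] is_densityD(1)[OF g] in auto)

lemma p0_integral: "integrable lborel p0" "(LBINT x. p0 x) = 1"
proof -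
  interpret P: prob_space "obs_law g f0" by (rule prob_space_obs_law[OF f0 g])
  have "emeasure (obs_law g f0) UNIV = 1" using P.emeasure_space_1 by simp
  then have n: "(\<integral>\<^sup>+x. ennreal (p0 x) \<partial>lborel) = 1" unfolding null_law by (subst (asm) emeasure_density) simp_all
  show i: "integrable lborel p0" by (rule integrableI_nonneg) (use n less_imp_le[OF p0_pos] in auto)
  show "(LBINT x. p0 x) = 1"
    using nn_integral_eq_integral[OF i] less_imp_le[OF p0_pos] n by simp
qed

definition pert :: "nat set \<Rightarrow> (nat \<Rightarrow> real) \<Rightarrow> real \<Rightarrow> real" where
  "pert K co x = (\<Sum>k\<in>K. co k * bk k x)"

definition Dp :: "nat set \<Rightarrow> (nat \<Rightarrow> real) \<Rightarrow> real \<Rightarrow> real" where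
  "Dp K co x = (\<Sum>k\<in>K. co k * Ek k x)"

text \<open>The truncation at \<open>0\<close> and the representative \<open>p0\<close> of the null density only matter on a null set.\<close>

definition lr :: "nat set \<Rightarrow> (nat \<Rightarrow> real) \<Rightarrow> real \<Rightarrow> real" where
  "lr K co x = max 0 (1 + Dp K co x / p0 x)"

lemma pert_measurable [measurable]: "pert K co \<in> borel_measurable borel"
  and Dp_measurable [measurable]: "Dp K co \<in> borel_measurable borel"
  and lr_measurable [measurable]: "lr K co \<in> borel_measurable borel"
proof -
  show "pert K co \<in> borel_measurable borel" unfolding pert_def[abs_def] by measurable
  show d[measurable]: "Dp K co \<in> borel_measurable borel" unfolding Dp_def[abs_def] by measurable
  show "lr K co \<in> borel_measurable borel" unfolding lr_def[abs_def] by measurable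
qed

lemma pert_integrable: "integrable lborel (pert K co)"
  unfolding pert_def[abs_def] using bk_integrable by (intro Bochner_Integration.integrable_sum integrable_mult_right) auto

lemma fourier_pert: "fourier (pert K co) u = complex_of_real (\<Sum>k\<in>K. co k * beta k u)"
proof -
  have i: "integrable lborel (\<lambda>x. complex_of_real (bk k x))" for k using bk_integrable by simp
  have "fourier (pert K co) u = (LBINT x. (\<Sum>k\<in>K. complex_of_real (co k) * (iexp (u * x) * complex_of_real (bk k x))))"
    unfolding fourier_def pert_def by (simp add: sum_distrib_left ac_simps)
  also have "\<dots> = (\<Sum>k\<in>K. complex_of_real (co k) * fourier (bk k) u)"
    unfolding fourier_def
    using integrable_iexp_mult[OF i] by (subst Bochner_Integration.integral_sum) auto
  finally show ?thesis by (simp add: fourier_bk)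
qed

text \<open>The total mass is unchanged because the frequency blocks with \<open>k \<ge> 1\<close>
  avoid the origin.\<close>

lemma pert_density:
  assumes fin: "finite K" and K1: "\<And>k. k \<in> K \<Longrightarrow> 1 \<le> k" and nn: "\<And>x. 0 \<le> f0 x + pert K co x"
  shows "is_density (\<lambda>x. f0 x + pert K co x)"
proof -
  have "complex_of_real (LBINT x. pert K co x) = fourier (pert K co) 0"
    unfolding fourier_def using integral_of_real[OF pert_integrable[of K co]] by simp
  also have "\<dots> = 0" 
  proof -
    have "co k * beta k 0 = 0" if "k \<in> K" for k using K1[OF that] by (subst beta_outside) auto
    then show ?thesis unfolding fourier_pert by (simp add: sum.neutral)
  qed
  finally have "(LBINT x. pert K co x) = 0" by simp
  then show ?thesis
    using nn is_densityD(1,3,4)[OF f0] pert_integrable[of K co] by (simp add: is_density_def)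
qed

text \<open>Convolution with the noise is linear, so the perturbed observations have density
  \<open>p0 + Dp K co\<close> almost everywhere; dividing by \<open>p0\<close> gives the likelihood
  ratio.\<close>

lemma pert_law:
  assumes fin: "finite K" and d: "is_density (\<lambda>x. f0 x + pert K co x)"
  shows "AE x in lborel. 0 \<le> p0 x + Dp K co x"
    and "obs_law g (\<lambda>x. f0 x + pert K co x) = density (obs_law g f0) (\<lambda>x. ennreal (lr K co x))"
proof -
  note [measurable] = is_densityD(1)[OF f0] is_densityD(1)[OF g]
  obtain Cb where Cb: "0 < Cb" "\<And>x. \<bar>bhat x\<bar> \<le> Cb / (1 + x\<^sup>2)" using bhat_decay by blast
  have b: "\<bar>bk k x\<bar> \<le> Cb" for k x
  proof -
    have "\<bar>bk k x\<bar> \<le> \<bar>bhat x\<bar> * 1" unfolding bk_def abs_mult by (intro mult_left_mono) auto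
    also have "Cb / (1 + x\<^sup>2) \<le> Cb / 1" using Cb(1) by (intro divide_left_mono) (auto intro: add_pos_nonneg)
    then have "\<bar>bhat x\<bar> * 1 \<le> Cb" using Cb(2)[of x] by simp
    finally show ?thesis .
  qed
  have ib: "integrable lborel (\<lambda>y. bk k (x - y) * g y)" for k x
  proof (rule Bochner_Integration.integrable_bound[OF integrable_mult_right[OF is_densityD(3)[OF g], of Cb]])
    show "AE y in lborel. norm (bk k (x - y) * g y) \<le> norm (Cb * g y)"
      using b Cb(1) by (intro AE_I2) (auto simp: abs_mult intro!: mult_right_mono)
  qed measurable
  have e: "pert K co (x - y) * g y = (\<Sum>k\<in>K. co k * (bk k (x - y) * g y))" for x y
    by (simp add: pert_def sum_distrib_right mult.assoc)
  have ip: "integrable lborel (\<lambda>y. pert K co (x - y) * g y)" for x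
    unfolding e using ib by (intro Bochner_Integration.integrable_sum integrable_mult_right) auto
  have Dp_eq: "Dp K co x = (LBINT y. pert K co (x - y) * g y)" for x
    unfolding e Dp_def Ek_def using ib by (simp add: Bochner_Integration.integral_sum)
  have main: "AE x in lborel. 0 \<le> p0 x + Dp K co x \<and>
      (\<integral>\<^sup>+y. ennreal (f0 (x - y) + pert K co (x - y)) * ennreal (g y) \<partial>lborel) = ennreal (p0 x + Dp K co x)"
    using p0_eq
  proof eventually_elim
    case (elim x)
    have nn: "0 \<le> f0 (x - y) * g y" for y using is_densityD(2)[OF f0] is_densityD(2)[OF g] by simp
    have q: "(\<integral>\<^sup>+y. ennreal (f0 (x - y) * g y) \<partial>lborel) = ennreal (p0 x)"
      using elim is_densityD(2)[OF f0] by (simp add: ennreal_mult')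
    have i0: "integrable lborel (\<lambda>y. f0 (x - y) * g y)"
      by (rule integrableI_nonneg) (use nn q in auto)
    have v0: "(LBINT y. f0 (x - y) * g y) = p0 x"
      using q nn_integral_eq_integral[OF i0] nn p0_pos[of x] less_imp_le[OF p0_pos[of x]]
      by (simp add: integral_nonneg)
    have i1: "integrable lborel (\<lambda>y. (f0 (x - y) + pert K co (x - y)) * g y)"
      unfolding distrib_right by (rule Bochner_Integration.integrable_add[OF i0 ip])
    have v1: "(LBINT y. (f0 (x - y) + pert K co (x - y)) * g y) = p0 x + Dp K co x"
      unfolding distrib_right Bochner_Integration.integral_add[OF i0 ip] v0 Dp_eq ..
    have nn1: "0 \<le> (f0 (x - y) + pert K co (x - y)) * g y" for y
      using is_densityD(2)[OF d, of "x - y"] is_densityD(2)[OF g, of y] by simp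
    have "0 \<le> p0 x + Dp K co x" unfolding v1[symmetric] using nn1 by (intro Bochner_Integration.integral_nonneg)
    moreover have "(\<integral>\<^sup>+y. ennreal (f0 (x - y) + pert K co (x - y)) * ennreal (g y) \<partial>lborel)
      = (\<integral>\<^sup>+y. ennreal ((f0 (x - y) + pert K co (x - y)) * g y) \<partial>lborel)"
      using is_densityD(2)[OF d] by (simp add: ennreal_mult')
    then have "(\<integral>\<^sup>+y. ennreal (f0 (x - y) + pert K co (x - y)) * ennreal (g y) \<partial>lborel) = ennreal (p0 x + Dp K co x)"
      using nn_integral_eq_integral[OF i1] nn1 v1 by simp
    ultimately show ?case by simp
  qed
  then show "AE x in lborel. 0 \<le> p0 x + Dp K co x" by eventually_elim simp
  have "obs_law g (\<lambda>x. f0 x + pert K co x) = density lborel (\<lambda>x. ennreal (p0 x + Dp K co x))"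
    unfolding obs_law_eq_density[OF d g] by (rule density_cong) (use main in auto)
  also have "\<dots> = density lborel (\<lambda>x. ennreal (p0 x) * ennreal (lr K co x))"
  proof (rule density_cong)
    show "AE x in lborel. ennreal (p0 x + Dp K co x) = ennreal (p0 x) * ennreal (lr K co x)"
    proof (rule AE_I2)
      fix x
      have "p0 x * lr K co x = max 0 (p0 x + Dp K co x)"
        using p0_pos[of x] by (simp add: lr_def max_mult_distrib_left distrib_left)
      then show "ennreal (p0 x + Dp K co x) = ennreal (p0 x) * ennreal (lr K co x)"
        using p0_pos[of x] by (simp add: ennreal_mult'[symmetric] max_def ennreal_neg)
    qed
  qed measurable
  also have "\<dots> = density (obs_law g f0) (\<lambda>x. ennreal (lr K co x))"
    unfolding null_law by (rule density_density_eq[symmetric]) measurable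
  finally show "obs_law g (\<lambda>x. f0 x + pert K co x) = density (obs_law g f0) (\<lambda>x. ennreal (lr K co x))" .
qed

lemma Dp_weighted:
  assumes "finite K" "finite K'"
  shows "integrable lborel (\<lambda>x. Dp K co x * Dp K' co' x * ((1 + x\<^sup>2) / c'))"
    and "(LBINT x. Dp K co x * Dp K' co' x * ((1 + x\<^sup>2) / c')) = (\<Sum>k\<in>K \<inter> K'. co k * co' k * ak k) / c'"
proof -
  have e: "Dp K co x * Dp K' co' x * ((1 + x\<^sup>2) / c') = (\<Sum>k\<in>K. \<Sum>l\<in>K'. (co k * co' l / c') * (Ek k x * Ek l x * (1 + x\<^sup>2)))" for x
    unfolding Dp_def sum_product sum_distrib_right by (simp only: sum_distrib_left sum_distrib_right sum_divide_distrib[symmetric] times_divide_eq_right times_divide_eq_left)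
      (intro arg_cong[where f="\<lambda>z. z / c'"] sum.cong refl, simp)
  show "integrable lborel (\<lambda>x. Dp K co x * Dp K' co' x * ((1 + x\<^sup>2) / c'))"
    unfolding e by (intro Bochner_Integration.integrable_sum integrable_mult_right Ek_weighted)
  have "(LBINT x. Dp K co x * Dp K' co' x * ((1 + x\<^sup>2) / c')) = (\<Sum>k\<in>K. \<Sum>l\<in>K'. (co k * co' l / c') * (if k = l then ak k else 0))"
    unfolding e using Ek_weighted(1) by (simp add: Bochner_Integration.integral_sum Ek_orthogonal)
  also have "\<dots> = (\<Sum>k\<in>K. if k \<in> K' then co k * co' k * ak k / c' else 0)"
    using assms by (intro sum.cong refl) (simp add: if_distrib[of "\<lambda>z. _ * z"] sum.delta cong: if_cong)
  also have "\<dots> = (\<Sum>k\<in>K \<inter> K'. co k * co' k * ak k / c')"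
    using assms by (simp add: sum.inter_restrict)
  finally show "(LBINT x. Dp K co x * Dp K' co' x * ((1 + x\<^sup>2) / c')) = (\<Sum>k\<in>K \<inter> K'. co k * co' k * ak k) / c'"
    by (simp add: sum_divide_distrib)
qed

text \<open>Cauchy-Schwarz between the weights \<open>1 + x\<^sup>2\<close> and its reciprocal, in
  pointwise form: with \<open>w = 1 + x\<^sup>2\<close>, nonnegativity of the square of
  \<open>1 - \<bar>Dp\<bar> * w\<close> bounds \<open>\<bar>Dp\<bar>\<close> by two integrable
  terms.\<close>

lemma Dp_integrable:
  assumes "finite K"
  shows "integrable lborel (Dp K co)"
proof (rule Bochner_Integration.integrable_bound)
  show "integrable lborel (\<lambda>x. 1 / (1 + x\<^sup>2) + c' * (Dp K co x * Dp K co x * ((1 + x\<^sup>2) / c')))"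
    by (intro Bochner_Integration.integrable_add integrable_cauchy_weight integrable_mult_right Dp_weighted assms)
  show "AE x in lborel. norm (Dp K co x) \<le> norm (1 / (1 + x\<^sup>2) + c' * (Dp K co x * Dp K co x * ((1 + x\<^sup>2) / c')))"
  proof (rule AE_I2)
    fix x
    let ?w = "1 + x\<^sup>2" and ?d = "\<bar>Dp K co x\<bar>"
    have w: "0 < ?w" by (intro add_pos_nonneg) auto
    have "0 \<le> (1 - ?d * ?w)\<^sup>2 / ?w" using w by simp
    also have "\<dots> = 1 / ?w - 2 * ?d + ?d * ?d * ?w" using w by (simp add: power2_eq_square field_simps)
    finally have "?d \<le> 1 / ?w + ?d * ?d * ?w" using abs_ge_zero[of "Dp K co x"] by linarith
    moreover have "?d * ?d * ?w = c' * (Dp K co x * Dp K co x * (?w / c'))" using c' by simp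
    ultimately have "?d \<le> 1 / ?w + c' * (Dp K co x * Dp K co x * (?w / c'))" by (simp only:)
    then show "norm (Dp K co x) \<le> norm (1 / ?w + c' * (Dp K co x * Dp K co x * (?w / c')))"
      unfolding real_norm_def by (rule order_trans[OF _ abs_ge_self])
  qed
qed measurable

lemma inverse_p0_le: "1 / p0 x \<le> (1 + x\<^sup>2) / c'"
proof -
  have w: "0 < 1 + x\<^sup>2" by (intro add_pos_nonneg) auto
  have "1 / p0 x \<le> 1 / (c' / (1 + x\<^sup>2))" using p0_ge[of x] p0_pos[of x] c' w by (intro divide_left_mono mult_pos_pos divide_pos_pos) auto
  then show ?thesis by simp
qed

text \<open>The last claim follows from the other two: both observation laws have mass one, so the
  difference \<open>Dp\<close> of their densities has integral zero.\<close>

lemma lr_facts: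
  assumes fin: "finite K" and d: "is_density (\<lambda>x. f0 x + pert K co x)"
  shows "integrable (obs_law g f0) (lr K co)" "(\<integral>x. lr K co x \<partial>obs_law g f0) = 1" "(LBINT x. Dp K co x) = 0"
proof -
  let ?f = "\<lambda>x. f0 x + pert K co x"
  interpret Q: prob_space "obs_law g ?f" by (rule prob_space_obs_law[OF d g])
  have lr0: "0 \<le> lr K co x" for x by (simp add: lr_def)
  have "emeasure (obs_law g ?f) UNIV = 1" using Q.emeasure_space_1 by simp
  then have n: "(\<integral>\<^sup>+x. ennreal (lr K co x) \<partial>obs_law g f0) = 1"
    unfolding pert_law(2)[OF fin d] by (subst (asm) emeasure_density) simp_all
  show i: "integrable (obs_law g f0) (lr K co)"
    by (rule integrableI_nonneg) (use n lr0 in auto)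
  show v: "(\<integral>x. lr K co x \<partial>obs_law g f0) = 1"
    using nn_integral_eq_integral[OF i] lr0 n by simp
  have "(\<integral>x. lr K co x \<partial>obs_law g f0) = (LBINT x. p0 x * lr K co x)"
    unfolding null_law using less_imp_le[OF p0_pos] by (subst integral_density) auto
  also have "\<dots> = (LBINT x. p0 x + Dp K co x)"
  proof (rule integral_cong_AE)
    show "AE x in lborel. p0 x * lr K co x = p0 x + Dp K co x"
      using pert_law(1)[OF fin d]
    proof eventually_elim
      case (elim x)
      have "p0 x * lr K co x = max 0 (p0 x + Dp K co x)"
        using p0_pos[of x] by (simp add: lr_def max_mult_distrib_left distrib_left)
      then show ?case using elim by simp
    qed
  qed measurable
  also have "\<dots> = 1 + (LBINT x. Dp K co x)" using p0_integral Dp_integrable[OF fin] by simp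
  finally show "(LBINT x. Dp K co x) = 0" using v by simp
qed

text \<open>In the expanded product the linear terms integrate to zero, leaving the inner product of
  the perturbations with weight \<open>1 / p0\<close>.\<close>

lemma lr_product:
  assumes fin: "finite K" "finite K'" and d: "is_density (\<lambda>x. f0 x + pert K co x)" "is_density (\<lambda>x. f0 x + pert K' co' x)"
  shows "integrable (obs_law g f0) (\<lambda>x. lr K co x * lr K' co' x)"
    and "(\<integral>x. lr K co x * lr K' co' x \<partial>obs_law g f0) = 1 + (LBINT x. Dp K co x * Dp K' co' x * (1 / p0 x))"
proof -
  have iG: "integrable lborel (\<lambda>x. Dp K co x * Dp K' co' x * (1 / p0 x))"
  proof (rule Bochner_Integration.integrable_bound[OF Dp_weighted(1)[OF fin]])
    show "AE x in lborel. norm (Dp K co x * Dp K' co' x * (1 / p0 x)) \<le> norm (Dp K co x * Dp K' co' x * ((1 + x\<^sup>2) / c'))"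
    proof (rule AE_I2)
      fix x
      have "\<bar>Dp K co x * Dp K' co' x\<bar> * (1 / p0 x) \<le> \<bar>Dp K co x * Dp K' co' x\<bar> * ((1 + x\<^sup>2) / c')"
        by (intro mult_left_mono inverse_p0_le) simp
      moreover have "0 \<le> (1 + x\<^sup>2) / c'" using c' by (intro divide_nonneg_pos add_nonneg_nonneg) auto
      ultimately show "norm (Dp K co x * Dp K' co' x * (1 / p0 x)) \<le> norm (Dp K co x * Dp K' co' x * ((1 + x\<^sup>2) / c'))"
        using p0_pos[of x] c' unfolding real_norm_def abs_mult[of "Dp K co x * Dp K' co' x"] by simp
    qed
  qed measurable
  let ?R = "\<lambda>x. p0 x + Dp K co x + Dp K' co' x + Dp K co x * Dp K' co' x * (1 / p0 x)"
  have iR: "integrable lborel ?R" using p0_integral iG Dp_integrable[OF fin(1)] Dp_integrable[OF fin(2)] by simp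
  have ae: "AE x in lborel. p0 x * (lr K co x * lr K' co' x) = ?R x"
    using pert_law(1)[OF fin(1) d(1)] pert_law(1)[OF fin(2) d(2)]
  proof eventually_elim
    case (elim x)
    have "0 \<le> 1 + Dp K co x / p0 x" "0 \<le> 1 + Dp K' co' x / p0 x"
      using elim p0_pos[of x] by (simp_all add: field_simps)
    then have "lr K co x = 1 + Dp K co x / p0 x" "lr K' co' x = 1 + Dp K' co' x / p0 x" by (simp_all add: lr_def)
    then show ?case using p0_pos[of x] by (simp only:) (simp add: field_simps)
  qed
  have iD: "integrable lborel (\<lambda>x. p0 x * (lr K co x * lr K' co' x))"
    by (rule integrable_cong_AE_imp[OF iR]) (use ae in auto)
  show "integrable (obs_law g f0) (\<lambda>x. lr K co x * lr K' co' x)"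
    unfolding null_law using iD less_imp_le[OF p0_pos] by (subst integrable_density) auto
  have "(\<integral>x. lr K co x * lr K' co' x \<partial>obs_law g f0) = (LBINT x. p0 x * (lr K co x * lr K' co' x))"
    unfolding null_law using less_imp_le[OF p0_pos] by (subst integral_density) auto
  also have "\<dots> = (LBINT x. ?R x)" by (rule integral_cong_AE) (use ae in auto)
  also have "\<dots> = 1 + (LBINT x. Dp K co x * Dp K' co' x * (1 / p0 x))"
    using p0_integral iG Dp_integrable[OF fin(1)] Dp_integrable[OF fin(2)] lr_facts(3)[OF fin(1) d(1)] lr_facts(3)[OF fin(2) d(2)]
    by simp
  finally show "(\<integral>x. lr K co x * lr K' co' x \<partial>obs_law g f0) = 1 + (LBINT x. Dp K co x * Dp K' co' x * (1 / p0 x))" .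
qed

definition nu :: real where "nu = (LBINT u. (bump u)\<^sup>2)"

lemma bump_square_integrable: "integrable lborel (\<lambda>u. (bump u)\<^sup>2)"
  using bandlim_norm_square[OF bandlim_bump] by simp

lemma nu_pos: "0 < nu"
proof -
  have "(LBINT u. (3 / 4) ^ 6 * indicator {- (1 / 2)..1 / 2 :: real} u) \<le> nu"
    unfolding nu_def
  proof (rule integral_mono'[OF bump_square_integrable])
    fix u :: real
    show "(3 / 4) ^ 6 * indicator {- (1 / 2)..1 / 2} u \<le> (bump u)\<^sup>2"
    proof (cases "u \<in> {- (1 / 2)..1 / 2}")
      case True
      then have "u\<^sup>2 \<le> (1 / 2)\<^sup>2" by (intro abs_le_square_iff[THEN iffD1]) auto
      then have "3 / 4 \<le> max 0 (1 - u\<^sup>2)" by (simp add: power2_eq_square max_def)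
      then have "(3 / 4) ^ 6 \<le> (max 0 (1 - u\<^sup>2)) ^ 6" by (rule power_mono) simp
      moreover have "(bump u)\<^sup>2 = (max 0 (1 - u\<^sup>2)) ^ 6" by (simp add: bump_def power_mult[symmetric])
      ultimately have "(3 / 4) ^ 6 \<le> (bump u)\<^sup>2" by (simp only:)
      then show ?thesis using True by (simp only: indicator_simps mult_1_right)
    qed simp
  qed simp
  then have "(3 / 4) ^ 6 \<le> nu" by simp
  then show ?thesis by (rule less_le_trans[rotated]) simp
qed

text \<open>For \<open>k \<ge> 1\<close> the two bumps do not overlap, so squaring produces no cross
  term and the factor \<open>1 / 4\<close> meets two copies of \<open>nu\<close>.\<close>

lemma beta_square_integral:
  assumes "1 \<le> k"
  shows "integrable lborel (\<lambda>u. (beta k u)\<^sup>2)" "(LBINT u. (beta k u)\<^sup>2) = nu / 2"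
proof -
  have e: "(beta k u)\<^sup>2 = (1 / 4) * ((bump (u + (- 2 * real k)))\<^sup>2 + (bump (u + 2 * real k))\<^sup>2)" for u
  proof -
    have "bump (u - 2 * real k) = 0 \<or> bump (u + 2 * real k) = 0"
    proof (cases "0 \<le> u")
      case True
      then have "1 \<le> \<bar>u + 2 * real k\<bar>" using assms by simp
      then show ?thesis using bump_outside by blast
    next
      case False
      then have "1 \<le> \<bar>u - 2 * real k\<bar>" using assms by simp
      then show ?thesis using bump_outside by blast
    qed
    then show ?thesis by (auto simp: beta_def power2_eq_square)
  qed
  note i = integrable_translate[OF bump_square_integrable]
  show "integrable lborel (\<lambda>u. (beta k u)\<^sup>2)" unfolding e using i[of "- 2 * real k"] i[of "2 * real k"] by simp
  have "(LBINT u. (beta k u)\<^sup>2) = (1 / 4) * ((LBINT u. (bump (u + (- 2 * real k)))\<^sup>2) + (LBINT u. (bump (u + 2 * real k))\<^sup>2))"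
    unfolding e using i[of "- 2 * real k"] i[of "2 * real k"]
    by (simp only: integral_mult_right_zero Bochner_Integration.integral_add)
  also have "\<dots> = nu / 2"
    unfolding integral_translate[of "\<lambda>u. (bump u)\<^sup>2"] by (simp add: nu_def)
  finally show "(LBINT u. (beta k u)\<^sup>2) = nu / 2" .
qed

lemma sum_beta_square:
  assumes fin: "finite K"
  shows "(\<Sum>k\<in>K. co k * beta k u)\<^sup>2 = (\<Sum>k\<in>K. (co k)\<^sup>2 * (beta k u)\<^sup>2)"
proof -
  have "(\<Sum>k\<in>K. co k * beta k u)\<^sup>2 = (\<Sum>k\<in>K. \<Sum>l\<in>K. (co k * beta k u) * (co l * beta l u))"
    by (simp add: power2_eq_square sum_product)
  also have "\<dots> = (\<Sum>k\<in>K. \<Sum>l\<in>K. if k = l then (co k)\<^sup>2 * (beta k u)\<^sup>2 else 0)"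
  proof (intro sum.cong refl)
    fix k l
    show "(co k * beta k u) * (co l * beta l u) = (if k = l then (co k)\<^sup>2 * (beta k u)\<^sup>2 else 0)"
      using beta_disjoint[of k l u] by (auto simp: power2_eq_square)
  qed
  also have "\<dots> = (\<Sum>k\<in>K. (co k)\<^sup>2 * (beta k u)\<^sup>2)" using fin by (simp add: sum.delta)
  finally show ?thesis .
qed

lemma pert_L2:
  assumes fin: "finite K" and K1: "\<And>k. k \<in> K \<Longrightarrow> 1 \<le> k"
  shows "integrable lborel (\<lambda>x. (pert K co x)\<^sup>2)"
    and "(LBINT x. (pert K co x)\<^sup>2) = (\<Sum>k\<in>K. (co k)\<^sup>2) * nu / (4 * pi)"
proof -
  let ?P = "\<lambda>x. complex_of_real (pert K co x)"
  have "integrable lborel (\<lambda>x. (cmod (?P x))\<^sup>2)"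
  proof -
    have b: "(pert K co x)\<^sup>2 \<le> real (card K) * (\<Sum>k\<in>K. (co k)\<^sup>2 * (bk k x)\<^sup>2)" for x
      unfolding pert_def using Cauchy_Schwarz_ineq_sum[of "\<lambda>_. 1" "\<lambda>k. co k * bk k x" K]
      by (simp add: power_mult_distrib)
    have i: "integrable lborel (\<lambda>x. real (card K) * (\<Sum>k\<in>K. (co k)\<^sup>2 * (bk k x)\<^sup>2))"
      using bk_integrable(2) by (intro integrable_mult_right Bochner_Integration.integrable_sum) auto
    have "integrable lborel (\<lambda>x. (pert K co x)\<^sup>2)"
    proof (rule Bochner_Integration.integrable_bound[OF i])
      show "AE x in lborel. norm ((pert K co x)\<^sup>2) \<le> norm (real (card K) * (\<Sum>k\<in>K. (co k)\<^sup>2 * (bk k x)\<^sup>2))"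
        by (rule AE_I2, simp only: real_norm_def abs_power2, rule order_trans[OF b abs_ge_self])
    qed measurable
    then show ?thesis by simp
  qed
  then show i: "integrable lborel (\<lambda>x. (pert K co x)\<^sup>2)" by simp
  have "(LBINT u. (cmod (fourier (pert K co) u))\<^sup>2) = 2 * pi * (LBINT x. (pert K co x)\<^sup>2)"
    unfolding fourier_eq_cft using plancherel(2)[of ?P] pert_integrable[of K co] i by simp
  moreover have "(LBINT u. (cmod (fourier (pert K co) u))\<^sup>2) = (\<Sum>k\<in>K. (co k)\<^sup>2 * (nu / 2))"
    unfolding fourier_pert norm_of_real power2_abs sum_beta_square[OF fin]
    using beta_square_integral K1
    by (subst Bochner_Integration.integral_sum) (auto simp del: times_divide_eq_right intro!: sum.cong)
  ultimately have "2 * pi * (LBINT x. (pert K co x)\<^sup>2) = (\<Sum>k\<in>K. (co k)\<^sup>2) * (nu / 2)"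
    unfolding sum_distrib_right by linarith
  then show "(LBINT x. (pert K co x)\<^sup>2) = (\<Sum>k\<in>K. (co k)\<^sup>2) * nu / (4 * pi)"
    by (simp add: field_simps)
qed

lemma pert_signs: "pert {m + 1..2 * m} (\<lambda>k. a * \<theta> k) x = a * bhat x * trig m \<theta> x"
  unfolding pert_def trig_def bk_def sum_distrib_left by (intro sum.cong refl) simp

text \<open>Both \<open>bhat\<close> and the lower bound for \<open>f0\<close> are multiples of
  \<open>1 / (1 + x\<^sup>2)\<close>, so nonnegativity reduces to one inequality between
  constants.\<close>

lemma pert_signs_density:
  assumes \<theta>: "\<theta> \<in> good_signs m t" and a: "0 \<le> a" and t: "0 < t"
    and Cb: "0 < Cb" "\<And>x. \<bar>bhat x\<bar> \<le> Cb / (1 + x\<^sup>2)"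
    and c0: "\<And>x. c0 / (1 + x\<^sup>2) \<le> f0 x" and small: "a * Cb * (t + 2) \<le> c0"
  shows "is_density (\<lambda>x. f0 x + pert {m + 1..2 * m} (\<lambda>k. a * \<theta> k) x)"
proof (rule pert_density)
  fix x :: real
  have x1: "0 < 1 + x\<^sup>2" by (intro add_pos_nonneg) auto
  have "\<bar>bhat x\<bar> * \<bar>trig m \<theta> x\<bar> \<le> Cb / (1 + x\<^sup>2) * (t + 2)"
    using \<theta> Cb(1) x1 by (intro mult_mono Cb(2)) (auto simp: good_signs_def)
  then have "a * (\<bar>bhat x\<bar> * \<bar>trig m \<theta> x\<bar>) \<le> a * (Cb / (1 + x\<^sup>2) * (t + 2))"
    using a by (rule mult_left_mono)
  also have "\<dots> = a * Cb * (t + 2) / (1 + x\<^sup>2)" by simp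
  also have "\<dots> \<le> c0 / (1 + x\<^sup>2)" using small x1 by (intro divide_right_mono) auto
  also have "\<dots> \<le> f0 x" by (rule c0)
  also have "a * (\<bar>bhat x\<bar> * \<bar>trig m \<theta> x\<bar>) = \<bar>pert {m + 1..2 * m} (\<lambda>k. a * \<theta> k) x\<bar>"
    unfolding pert_signs using a by (simp add: abs_mult)
  finally show "0 \<le> f0 x + pert {m + 1..2 * m} (\<lambda>k. a * \<theta> k) x" by linarith
qed auto

text \<open>The powers are bounded by exponentials, which are positive, so the sum over good signs
  can be extended to all signs and evaluated by the moment generating function. Since at least half
  of the signs are good, the extension costs a factor two.\<close>

lemma sum_gram_same_scale:
  assumes m: "1 \<le> m" "kP \<le> real m" and \<theta>: "\<theta> \<in> signs m" and gd: "2 ^ m \<le> 2 * real (card (good_signs m t))"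
    and q: "q = a\<^sup>2 / c' * (67 * cP\<^sup>2 * real m powr (- 2 * \<sigma>))"
    and small: "real m * q \<le> 1" and B: "real m * (real n * q)\<^sup>2 \<le> B"
  shows "(\<Sum>\<theta>'\<in>good_signs m t. (1 + (\<Sum>k\<in>{m + 1..2 * m}. (a * \<theta> k) * (a * \<theta>' k) * ak k) / c') ^ n)
    \<le> 2 * real (card (good_signs m t)) * exp B"
proof -
  have akq: "a\<^sup>2 * ak k / c' \<le> q" if k: "k \<in> {m + 1..2 * m}" for k
  proof -
    have "ak k \<le> 67 * cP\<^sup>2 * real k powr (- 2 * \<sigma>)" using m k by (intro ak_le) auto
    also have "\<dots> \<le> 67 * cP\<^sup>2 * real m powr (- 2 * \<sigma>)"
      using m k \<sigma> by (intro mult_left_mono powr_mono2') auto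
    finally have "a\<^sup>2 / c' * ak k \<le> q" unfolding q using c' by (intro mult_left_mono) auto
    then show ?thesis by simp
  qed
  have "(\<Sum>\<theta>'\<in>good_signs m t. (1 + (\<Sum>k\<in>{m + 1..2 * m}. (a * \<theta> k) * (a * \<theta>' k) * ak k) / c') ^ n)
    \<le> (\<Sum>\<theta>'\<in>good_signs m t. exp (\<Sum>k\<in>{m + 1..2 * m}. \<theta>' k * (real n * (\<theta> k * (a\<^sup>2 * ak k / c')))))"
  proof (rule sum_mono)
    fix \<theta>' assume "\<theta>' \<in> good_signs m t"
    then have \<theta>': "\<theta>' \<in> signs m" by (simp add: good_signs_def)
    let ?G = "\<Sum>k\<in>{m + 1..2 * m}. \<theta>' k * (\<theta> k * (a\<^sup>2 * ak k / c'))"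
    have e: "(\<Sum>k\<in>{m + 1..2 * m}. (a * \<theta> k) * (a * \<theta>' k) * ak k) / c' = ?G"
      unfolding sum_divide_distrib by (intro sum.cong refl) (simp add: power2_eq_square)
    have "\<bar>?G\<bar> \<le> (\<Sum>k\<in>{m + 1..2 * m}. q)"
    proof (rule order_trans[OF sum_abs sum_mono])
      fix k assume k: "k \<in> {m + 1..2 * m}"
      have "\<bar>\<theta>' k * (\<theta> k * (a\<^sup>2 * ak k / c'))\<bar> = a\<^sup>2 * ak k / c'"
        using signs_pm[OF \<theta> k] signs_pm[OF \<theta>' k] ak_nonneg[of k] c' by (auto simp: abs_mult)
      then show "\<bar>\<theta>' k * (\<theta> k * (a\<^sup>2 * ak k / c'))\<bar> \<le> q" using akq[OF k] by simp
    qed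
    also have "\<dots> \<le> 1" using small by simp
    \<comment> \<open>Nonnegativity is what allows raising \<open>1 + ?G \<le> exp ?G\<close> to the
      power \<open>n\<close>.\<close>
    finally have "0 \<le> 1 + ?G" by linarith
    then have "(1 + ?G) ^ n \<le> exp ?G ^ n" by (intro power_mono exp_ge_add_one_self)
    also have "\<dots> = exp (\<Sum>k\<in>{m + 1..2 * m}. \<theta>' k * (real n * (\<theta> k * (a\<^sup>2 * ak k / c'))))"
      unfolding exp_of_nat_mult[symmetric] sum_distrib_left by (intro arg_cong[where f=exp] sum.cong refl) simp
    finally show "(1 + (\<Sum>k\<in>{m + 1..2 * m}. (a * \<theta> k) * (a * \<theta>' k) * ak k) / c') ^ n
      \<le> exp (\<Sum>k\<in>{m + 1..2 * m}. \<theta>' k * (real n * (\<theta> k * (a\<^sup>2 * ak k / c'))))" unfolding e .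
  qed
  also have "\<dots> \<le> (\<Sum>\<theta>'\<in>signs m. exp (\<Sum>k\<in>{m + 1..2 * m}. \<theta>' k * (real n * (\<theta> k * (a\<^sup>2 * ak k / c')))))"
    by (intro sum_mono2) (auto simp: good_signs_def)
  also have "\<dots> \<le> 2 ^ m * exp (\<Sum>k\<in>{m + 1..2 * m}. (real n * (\<theta> k * (a\<^sup>2 * ak k / c')))\<^sup>2)"
    by (rule rademacher_mgf)
  also have "\<dots> \<le> 2 ^ m * exp B"
  proof -
    have "(\<Sum>k\<in>{m + 1..2 * m}. (real n * (\<theta> k * (a\<^sup>2 * ak k / c')))\<^sup>2) \<le> (\<Sum>k\<in>{m + 1..2 * m}. (real n * q)\<^sup>2)"
    proof (rule sum_mono)
      fix k assume k: "k \<in> {m + 1..2 * m}"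
      have "(real n * (\<theta> k * (a\<^sup>2 * ak k / c')))\<^sup>2 = (real n * (a\<^sup>2 * ak k / c'))\<^sup>2"
        using signs_pm[OF \<theta> k] by auto
      also have "\<dots> \<le> (real n * q)\<^sup>2"
        using akq[OF k] ak_nonneg[of k] c' by (intro power_mono mult_left_mono) auto
      finally show "(real n * (\<theta> k * (a\<^sup>2 * ak k / c')))\<^sup>2 \<le> (real n * q)\<^sup>2" .
    qed
    then show ?thesis using B by simp
  qed
  also have "\<dots> \<le> 2 * real (card (good_signs m t)) * exp B" using gd by (intro mult_right_mono) auto
  finally show ?thesis .
qed

text \<open>The prior is uniform over the scales and, within a scale, uniform over the good signs.
  The maximal type two error dominates the one averaged over this prior, and
  \<open>gram_power\<close> replaces the weight \<open>1 / p0\<close> by a multiple of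
  \<open>1 + x\<^sup>2\<close> before the Gram entries are computed.\<close>

lemma total_error_lower:
  fixes Ms :: "nat set" and t a :: "nat \<Rightarrow> real" and H :: "(real \<Rightarrow> real) set"
  defines "alt \<equiv> \<lambda>m \<theta> x. f0 x + pert {m + 1..2 * m} (\<lambda>k. a m * \<theta> k) x"
  assumes Ms: "finite Ms" "Ms \<noteq> {}"
    and disj: "\<And>m m'. m \<in> Ms \<Longrightarrow> m' \<in> Ms \<Longrightarrow> m \<noteq> m' \<Longrightarrow> {m + 1..2 * m} \<inter> {m' + 1..2 * m'} = {}"
    and m: "\<And>m. m \<in> Ms \<Longrightarrow> 1 \<le> m" "\<And>m. m \<in> Ms \<Longrightarrow> kP \<le> real m"
    and gd: "\<And>m. m \<in> Ms \<Longrightarrow> 2 ^ m \<le> 2 * real (card (good_signs m (t m)))"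
    and small: "\<And>m. m \<in> Ms \<Longrightarrow> real m * ((a m)\<^sup>2 / c' * (67 * cP\<^sup>2 * real m powr (- 2 * \<sigma>))) \<le> 1"
    and B: "\<And>m. m \<in> Ms \<Longrightarrow> real m * (real n * ((a m)\<^sup>2 / c' * (67 * cP\<^sup>2 * real m powr (- 2 * \<sigma>))))\<^sup>2 \<le> B"
    and dens: "\<And>m \<theta>. m \<in> Ms \<Longrightarrow> \<theta> \<in> good_signs m (t m) \<Longrightarrow> is_density (alt m \<theta>)"
    and H: "\<And>m \<theta>. m \<in> Ms \<Longrightarrow> \<theta> \<in> good_signs m (t m) \<Longrightarrow> alt m \<theta> \<in> H"
    and \<Delta>: "\<Delta> \<in> tests n"
  shows "ennreal (1 - sqrt (2 * exp B / real (card Ms))) \<le> total_error g f0 H n \<Delta>"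
proof (cases "(SUP f\<in>H. test_prob g f n \<Delta> 0) = \<infinity>")
  case True
  show ?thesis unfolding total_error_def True by simp
next
  case False
  let ?M = "obs_law g f0" and ?s = "SUP f\<in>H. test_prob g f n \<Delta> 0"
  let ?S = "\<Pi>\<^sub>M j\<in>{1..n}. ?M"
  have slt: "?s < \<top>" using False unfolding infinity_ennreal_def by (rule less_top[THEN iffD1])
  let ?K = "\<lambda>i::nat \<times> (nat \<Rightarrow> real). {fst i + 1..2 * fst i}" and ?co = "\<lambda>i. \<lambda>k. a (fst i) * snd i k"
  let ?\<Theta> = "Sigma Ms (\<lambda>m. good_signs m (t m))"
  let ?c = "\<lambda>i. 1 / (real (card Ms) * real (card (good_signs (fst i) (t (fst i)))))"
  define W where "W i j = (\<Sum>k\<in>?K i \<inter> ?K j. ?co i k * ?co j k * ak k) / c'" for i j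
  have S: "?S = sample_law g f0 n" by (simp add: sample_law_def)
  have \<Delta>m: "\<Delta> \<in> measurable ?S (count_space {0, 1})"
    using \<Delta> sets_obs_law[of g f0] unfolding tests_def by (simp cong: measurable_cong_sets sets_PiM_cong)
  define A where "A = {y \<in> space ?S. \<Delta> y = 0}"
  have A: "A \<in> sets ?S"
  proof -
    have "\<Delta> -` {0} \<inter> space ?S \<in> sets ?S" by (rule measurable_sets[OF \<Delta>m]) simp
    also have "\<Delta> -` {0} \<inter> space ?S = A" by (auto simp: A_def)
    finally show ?thesis .
  qed
  have Ac: "space ?S - A = {y \<in> space ?S. \<Delta> y = 1}"
  proof -
    have "\<Delta> y = 0 \<or> \<Delta> y = 1" if "y \<in> space ?S" for y using measurable_space[OF \<Delta>m that] by simp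
    then show ?thesis unfolding A_def by fastforce
  qed
  have fin\<Theta>: "finite ?\<Theta>" using Ms by (intro finite_SigmaI) (auto simp: good_signs_def)
  have altd: "is_density (\<lambda>x. f0 x + pert (?K i) (?co i) x)" if "i \<in> ?\<Theta>" for i
    using dens[of "fst i" "snd i"] that by (auto simp: alt_def)
  have cardM: "0 < real (card Ms)" using Ms by (simp add: card_gt_0_iff)
  have cardg: "0 < real (card (good_signs m (t m)))" if "m \<in> Ms" for m
    using gd[OF that] zero_less_power[of "2::real" m] by linarith
  have c1: "(\<Sum>i\<in>?\<Theta>. ?c i) = 1"
  proof -
    have "(\<Sum>i\<in>?\<Theta>. ?c i) = (\<Sum>m\<in>Ms. \<Sum>\<theta>\<in>good_signs m (t m). ?c (m, \<theta>))"
      using Ms by (subst sum.Sigma) (auto simp: good_signs_def intro!: sum.cong)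
    also have "\<dots> = (\<Sum>m\<in>Ms. 1 / real (card Ms))" using cardg by (intro sum.cong refl) simp
    finally show ?thesis using cardM by simp
  qed
  \<comment> \<open>Scales other than that of \<open>i\<close> have Gram entries zero and contribute
    exactly \<open>1 / card Ms\<close> each; only the scale of \<open>i\<close> itself adds an
    excess.\<close>
  have row: "(\<Sum>j\<in>?\<Theta>. ?c j * (1 + W i j) ^ n) \<le> 1 + 2 * exp B / real (card Ms)" if i: "i \<in> ?\<Theta>" for i
  proof -
    obtain m\<^sub>0 \<theta>\<^sub>0 where i0: "i = (m\<^sub>0, \<theta>\<^sub>0)" "m\<^sub>0 \<in> Ms" "\<theta>\<^sub>0 \<in> good_signs m\<^sub>0 (t m\<^sub>0)" using i by auto
    have "(\<Sum>j\<in>?\<Theta>. ?c j * (1 + W i j) ^ n) = (\<Sum>m\<in>Ms. \<Sum>\<theta>\<in>good_signs m (t m). ?c (m, \<theta>) * (1 + W i (m, \<theta>)) ^ n)"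
      using Ms by (subst sum.Sigma) (auto simp: good_signs_def intro!: sum.cong)
    also have "\<dots> \<le> (\<Sum>m\<in>Ms. 1 / real (card Ms) + (if m = m\<^sub>0 then 2 * exp B / real (card Ms) else 0))"
    proof (rule sum_mono)
      fix m' assume m': "m' \<in> Ms"
      let ?g = "real (card (good_signs m' (t m')))"
      have "(\<Sum>\<theta>\<in>good_signs m' (t m'). ?c (m', \<theta>) * (1 + W i (m', \<theta>)) ^ n)
        = (\<Sum>\<theta>\<in>good_signs m' (t m'). (1 + W i (m', \<theta>)) ^ n) / (real (card Ms) * ?g)"
        by (simp add: sum_divide_distrib)
      also have "\<dots> \<le> 1 / real (card Ms) + (if m' = m\<^sub>0 then 2 * exp B / real (card Ms) else 0)"
      proof (cases "m' = m\<^sub>0")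
        case False
        then have "W i (m', \<theta>) = 0" for \<theta> using disj[OF i0(2) m'] i0(1) by (auto simp: W_def)
        then show ?thesis using False cardg[OF m'] by simp
      next
        case True
        have "(\<Sum>\<theta>\<in>good_signs m' (t m'). (1 + W i (m', \<theta>)) ^ n) \<le> 2 * ?g * exp B"
          unfolding W_def i0(1) True fst_conv snd_conv Int_absorb
          using i0 by (intro sum_gram_same_scale[OF m _ gd refl small B]) (auto simp: good_signs_def)
        then have "(\<Sum>\<theta>\<in>good_signs m' (t m'). (1 + W i (m', \<theta>)) ^ n) / (real (card Ms) * ?g) \<le> 2 * ?g * exp B / (real (card Ms) * ?g)"
          by (intro divide_right_mono) auto
        also have "\<dots> = 2 * exp B / real (card Ms)" using cardg[OF m'] by simp
        finally have "(\<Sum>\<theta>\<in>good_signs m' (t m'). (1 + W i (m', \<theta>)) ^ n) / (real (card Ms) * ?g) \<le> 2 * exp B / real (card Ms)" .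
        then show ?thesis using True cardM by (simp add: add_increasing)
      qed
      finally show "(\<Sum>\<theta>\<in>good_signs m' (t m'). ?c (m', \<theta>) * (1 + W i (m', \<theta>)) ^ n)
        \<le> 1 / real (card Ms) + (if m' = m\<^sub>0 then 2 * exp B / real (card Ms) else 0)" .
    qed
    also have "\<dots> = 1 + 2 * exp B / real (card Ms)"
      using Ms i0(2) cardM by (simp add: sum.distrib sum.delta)
    finally show ?thesis .
  qed
  have c0: "0 \<le> ?c i" for i by simp
  have chi: "(\<Sum>i\<in>?\<Theta>. \<Sum>j\<in>?\<Theta>. ?c i * ?c j * (1 + (LBINT x. Dp (?K i) (?co i) x * Dp (?K j) (?co j) x * (1 / p0 x))) ^ n)
      \<le> 1 + 2 * exp B / real (card Ms)"
  proof -
    have "(\<Sum>i\<in>?\<Theta>. \<Sum>j\<in>?\<Theta>. ?c i * ?c j * (1 + (LBINT x. Dp (?K i) (?co i) x * Dp (?K j) (?co j) x * (1 / p0 x))) ^ n)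
      \<le> (\<Sum>i\<in>?\<Theta>. \<Sum>j\<in>?\<Theta>. ?c i * ?c j * (1 + (LBINT x. Dp (?K i) (?co i) x * Dp (?K j) (?co j) x * ((1 + x\<^sup>2) / c'))) ^ n)"
      by (rule gram_power(2)[OF fin\<Theta> _ inverse_p0_le _ _ Dp_weighted(1)]) (use less_imp_le[OF p0_pos] in auto)
    also have "\<dots> = (\<Sum>i\<in>?\<Theta>. ?c i * (\<Sum>j\<in>?\<Theta>. ?c j * (1 + W i j) ^ n))"
      unfolding Dp_weighted(2)[OF finite_atLeastAtMost finite_atLeastAtMost] W_def[symmetric] sum_distrib_left
      by (simp only: mult.assoc)
    also have "\<dots> \<le> (\<Sum>i\<in>?\<Theta>. ?c i * (1 + 2 * exp B / real (card Ms)))"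
      by (intro sum_mono mult_left_mono row c0)
    also have "\<dots> = 1 + 2 * exp B / real (card Ms)" unfolding sum_distrib_right[symmetric] c1 by simp
    finally show ?thesis .
  qed
  have s: "measure (density ?S (\<lambda>y. ennreal (\<Prod>k\<in>{1..n}. lr (?K i) (?co i) (y k)))) A \<le> enn2real ?s" if i: "i \<in> ?\<Theta>" for i
  proof -
    let ?f = "\<lambda>x. f0 x + pert (?K i) (?co i) x"
    have law: "obs_law g ?f = density ?M (\<lambda>x. ennreal (lr (?K i) (?co i) x))"
      by (rule pert_law(2)[OF _ altd[OF i]]) simp
    have e: "density ?S (\<lambda>y. ennreal (\<Prod>k\<in>{1..n}. lr (?K i) (?co i) (y k))) = sample_law g ?f n"
      unfolding sample_law_def law
      using prob_space_obs_law[OF altd[OF i] g] unfolding law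
      by (intro PiM_density_prob[symmetric] prob_space_obs_law[OF f0 g]) (auto simp: lr_def)
    have sp: "space (sample_law g ?f n) = space ?S" unfolding e[symmetric] by simp
    have "emeasure (sample_law g ?f n) A = test_prob g ?f n \<Delta> 0"
      unfolding test_prob_def sp A_def ..
    also have "\<dots> \<le> ?s" using H[of "fst i" "snd i"] i by (intro SUP_upper) (auto simp: alt_def)
    finally show ?thesis unfolding e measure_def by (intro enn2real_mono slt)
  qed
  have "1 - sqrt (2 * exp B / real (card Ms)) \<le> measure ?S (space ?S - A) + enn2real ?s"
  proof (rule mixture_testing_bound[where \<Theta>="?\<Theta>" and r="\<lambda>i. lr (?K i) (?co i)" and c="?c"
        and K="\<lambda>i j. \<integral>x. Dp (?K i) (?co i) x * Dp (?K j) (?co j) x * (1 / p0 x) \<partial>lborel" and n=n])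
    show "prob_space ?M" by (rule prob_space_obs_law[OF f0 g])
    show "lr (?K i) (?co i) \<in> borel_measurable ?M" for i by simp
    show "0 \<le> lr (?K i) (?co i) x" for i x by (simp add: lr_def)
    fix i assume i: "i \<in> ?\<Theta>"
    show "integrable ?M (lr (?K i) (?co i))" by (rule lr_facts(1)[OF _ altd[OF i]]) simp
    show "(\<integral>x. lr (?K i) (?co i) x \<partial>?M) = 1" by (rule lr_facts(2)[OF _ altd[OF i]]) simp
    show "integrable ?M (\<lambda>x. lr (?K i) (?co i) x * lr (?K j) (?co j) x)" if "j \<in> ?\<Theta>" for j
      by (rule lr_product(1)[OF _ _ altd[OF i] altd[OF that]]) auto
    show "(\<integral>x. lr (?K i) (?co i) x * lr (?K j) (?co j) x \<partial>?M)
      = 1 + (LBINT x. Dp (?K i) (?co i) x * Dp (?K j) (?co j) x * (1 / p0 x))" if "j \<in> ?\<Theta>" for j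
      by (rule lr_product(2)[OF _ _ altd[OF i] altd[OF that]]) auto
  qed (use s c1 chi A fin\<Theta> in auto)
  then have "ennreal (1 - sqrt (2 * exp B / real (card Ms))) \<le> ennreal (measure ?S (space ?S - A) + enn2real ?s)"
    by (rule ennreal_leI)
  also have "\<dots> = ennreal (measure ?S (space ?S - A)) + ?s"
    using slt by (simp add: ennreal_plus)
  also have "ennreal (measure ?S (space ?S - A)) = test_prob g f0 n \<Delta> 1"
  proof -
    interpret prob_space ?S by (intro prob_space_PiM prob_space_obs_law f0 g)
    show ?thesis unfolding test_prob_def Ac S[symmetric] by (rule emeasure_eq_measure[symmetric])
  qed
  finally show ?thesis by (simp add: total_error_def)
qed

end

text \<open>With \<open>y = x powr (2 * \<beta>)\<close> and
  \<open>s = (\<gamma> - \<beta>) / \<beta>\<close>, the larger power is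
  \<open>y powr (1 + s)\<close>. It falls below \<open>y\<close> by at most
  \<open>s * y * ln (1 / y)\<close>, and \<open>y * ln (1 / y) \<le> 1\<close>.\<close>

lemma powr_sub_powr_le:
  fixes x \<beta> \<gamma> :: real
  assumes x: "0 \<le> x" "x \<le> 1" and b: "0 < \<beta>" "\<beta> \<le> \<gamma>"
  shows "x powr (2 * \<beta>) \<le> x powr (2 * \<gamma>) + (\<gamma> - \<beta>) / \<beta>"
proof (cases "x = 0")
  case True
  then show ?thesis using b by simp
next
  case False
  then have x0: "0 < x" using x by simp
  define y where "y = x powr (2 * \<beta>)"
  define s where "s = (\<gamma> - \<beta>) / \<beta>"
  have y: "0 < y" "y \<le> 1" using x x0 b by (auto simp: y_def powr_le1)
  have s: "0 \<le> s" using b by (simp add: s_def)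
  have "x powr (2 * \<gamma>) = y powr (1 + s)"
    using b by (simp add: y_def s_def powr_powr field_simps)
  also have "\<dots> = y * exp (s * ln y)" using y by (simp add: powr_add) (simp add: powr_def)
  also have "\<dots> \<ge> y * (1 + s * ln y)" using y by (intro mult_left_mono exp_ge_add_one_self) auto
  finally have 1: "y * (1 + s * ln y) \<le> x powr (2 * \<gamma>)" .
  have "ln (1 / y) \<le> 1 / y - 1" using y by (intro ln_le_minus_one) auto
  then have "y * (- ln y) \<le> y * (1 / y - 1)" using y by (intro mult_left_mono) (auto simp: ln_div)
  also have "\<dots> \<le> 1" using y by (simp add: right_diff_distrib)
  finally have "s * (y * (- ln y)) \<le> s * 1" using s by (intro mult_left_mono) auto
  moreover have "y * (1 + s * ln y) = y - s * (y * (- ln y))" by (simp add: algebra_simps)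
  ultimately show ?thesis using 1 unfolding y_def[symmetric] s_def[symmetric] by linarith
qed

text \<open>Lowering the index raises the weight only for \<open>\<bar>u\<bar> \<le> 1\<close>, and
  there by at most \<open>(\<beta>hi - \<beta>) / \<beta>\<close> times
  \<open>exp (2 * \<alpha>)\<close>, while the transform is at most \<open>1\<close> in modulus.
  Close to \<open>\<beta>hi\<close> this fits into the gap between \<open>L1\<close> and
  \<open>L2\<close>.\<close>

lemma smoothness_near_top:
  assumes f: "is_density f" and \<beta>hi: "0 < \<beta>hi" and L: "L1 < L2" "0 \<le> L1" and \<delta>: "0 < \<delta>"
    and cl: "ennreal (1 / (2 * pi)) * (\<integral>\<^sup>+u. ennreal ((cmod (fourier f u))\<^sup>2 * smoothness_weight \<alpha> 0 \<beta>hi u) \<partial>lborel) \<le> ennreal L1"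
  obtains \<eta> where "0 < \<eta>" "\<eta> \<le> \<delta>" "\<eta> \<le> \<beta>hi / 2"
    "\<And>\<beta>. \<beta>hi - \<eta> \<le> \<beta> \<Longrightarrow> \<beta> \<le> \<beta>hi \<Longrightarrow>
      ennreal (1 / (2 * pi)) * (\<integral>\<^sup>+u. ennreal ((cmod (fourier f u))\<^sup>2 * smoothness_weight \<alpha> 0 \<beta> u) \<partial>lborel) \<le> ennreal L2"
proof -
  define E where "E = exp (2 * \<alpha>)"
  have E: "0 < E" by (simp add: E_def)
  \<comment> \<open>The second entry keeps \<open>\<beta>\<close> above
    \<open>\<beta>hi / 2\<close>; the third makes the added weight \<open>R\<close> at most
    \<open>L2 - L1\<close>.\<close>
  define \<eta> where "\<eta> = min (min \<delta> (\<beta>hi / 2)) ((L2 - L1) * \<beta>hi / (2 * E))"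
  have \<eta>: "0 < \<eta>" "\<eta> \<le> \<delta>" "\<eta> \<le> \<beta>hi / 2" using \<delta> \<beta>hi L E by (auto simp: \<eta>_def)
  have \<eta>3: "\<eta> \<le> (L2 - L1) * \<beta>hi / (2 * E)" by (simp add: \<eta>_def)
  show ?thesis
  proof (rule that[OF \<eta>])
    fix \<beta> assume b: "\<beta>hi - \<eta> \<le> \<beta>" "\<beta> \<le> \<beta>hi"
    have b2: "\<beta>hi / 2 \<le> \<beta>" "0 < \<beta>" using b \<eta> \<beta>hi by auto
    let ?i = "\<lambda>u. indicator {- 1..1 :: real} u :: real"
    define R where "R = (\<beta>hi - \<beta>) / \<beta> * E"
    have R0: "0 \<le> R" using b b2 E by (simp add: R_def)
    have "(\<beta>hi - \<beta>) / \<beta> \<le> \<eta> / (\<beta>hi / 2)" using b b2 \<beta>hi by (intro frac_le) auto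
    also have "\<dots> \<le> (L2 - L1) * \<beta>hi / (2 * E) / (\<beta>hi / 2)" using \<eta>3 \<beta>hi by (intro divide_right_mono) auto
    also have "\<dots> = (L2 - L1) / E" using \<beta>hi E by simp
    finally have "R \<le> (L2 - L1) / E * E" unfolding R_def using E by (intro mult_right_mono) auto
    then have R1: "R \<le> L2 - L1" using E by simp
    have wt: "(cmod (fourier f u))\<^sup>2 * smoothness_weight \<alpha> 0 \<beta> u
      \<le> (cmod (fourier f u))\<^sup>2 * smoothness_weight \<alpha> 0 \<beta>hi u + R * ?i u" for u
    proof (cases "\<bar>u\<bar> \<le> 1")
      case True
      have "\<bar>u\<bar> powr (2 * \<beta>) * E \<le> (\<bar>u\<bar> powr (2 * \<beta>hi) + (\<beta>hi - \<beta>) / \<beta>) * E"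
        using True b b2 E by (intro mult_right_mono powr_sub_powr_le) auto
      also have "\<dots> = \<bar>u\<bar> powr (2 * \<beta>hi) * E + R" by (simp add: R_def distrib_right)
      finally have "smoothness_weight \<alpha> 0 \<beta> u \<le> smoothness_weight \<alpha> 0 \<beta>hi u + R"
        by (simp add: smoothness_weight_def E_def)
      then have "(cmod (fourier f u))\<^sup>2 * smoothness_weight \<alpha> 0 \<beta> u \<le> (cmod (fourier f u))\<^sup>2 * (smoothness_weight \<alpha> 0 \<beta>hi u + R)"
        by (intro mult_left_mono) auto
      also have "\<dots> \<le> (cmod (fourier f u))\<^sup>2 * smoothness_weight \<alpha> 0 \<beta>hi u + 1 * R"
        unfolding distrib_left
        using norm_fourier_le_1[OF f, of u] R0 by (intro add_left_mono mult_right_mono) (auto simp: abs_square_le_1)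
      finally show ?thesis using True by (simp add: indicator_def abs_le_iff)
    next
      case False
      have "\<bar>u\<bar> powr (2 * \<beta>) \<le> \<bar>u\<bar> powr (2 * \<beta>hi)" using False b by (intro powr_mono) auto
      then have "smoothness_weight \<alpha> 0 \<beta> u \<le> smoothness_weight \<alpha> 0 \<beta>hi u"
        unfolding smoothness_weight_def by (intro mult_right_mono) auto
      then have "(cmod (fourier f u))\<^sup>2 * smoothness_weight \<alpha> 0 \<beta> u \<le> (cmod (fourier f u))\<^sup>2 * smoothness_weight \<alpha> 0 \<beta>hi u"
        by (intro mult_left_mono) auto
      then show ?thesis using R0 by (simp add: add_increasing2)
    qed
    have mes: "(\<lambda>u. ennreal ((cmod (fourier f u))\<^sup>2 * smoothness_weight \<alpha> 0 \<beta>hi u)) \<in> borel_measurable lborel"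
      using borel_measurable_fourier[OF f] unfolding smoothness_weight_def by measurable
    have "(\<integral>\<^sup>+u. ennreal ((cmod (fourier f u))\<^sup>2 * smoothness_weight \<alpha> 0 \<beta> u) \<partial>lborel)
      \<le> (\<integral>\<^sup>+u. ennreal ((cmod (fourier f u))\<^sup>2 * smoothness_weight \<alpha> 0 \<beta>hi u) + ennreal R * indicator {- 1..1} u \<partial>lborel)"
    proof (rule nn_integral_mono)
      fix u
      have "ennreal ((cmod (fourier f u))\<^sup>2 * smoothness_weight \<alpha> 0 \<beta> u)
        \<le> ennreal ((cmod (fourier f u))\<^sup>2 * smoothness_weight \<alpha> 0 \<beta>hi u + R * ?i u)" by (rule ennreal_leI[OF wt])
      also have "\<dots> = ennreal ((cmod (fourier f u))\<^sup>2 * smoothness_weight \<alpha> 0 \<beta>hi u) + ennreal R * indicator {- 1..1} u"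
        using R0 by (subst ennreal_plus) (auto simp: smoothness_weight_def indicator_def)
      finally show "ennreal ((cmod (fourier f u))\<^sup>2 * smoothness_weight \<alpha> 0 \<beta> u)
        \<le> ennreal ((cmod (fourier f u))\<^sup>2 * smoothness_weight \<alpha> 0 \<beta>hi u) + ennreal R * indicator {- 1..1} u" .
    qed
    also have "\<dots> = (\<integral>\<^sup>+u. ennreal ((cmod (fourier f u))\<^sup>2 * smoothness_weight \<alpha> 0 \<beta>hi u) \<partial>lborel) + ennreal R * 2"
      using mes by (subst nn_integral_add) (auto simp: nn_integral_cmult)
    finally have "ennreal (1 / (2 * pi)) * (\<integral>\<^sup>+u. ennreal ((cmod (fourier f u))\<^sup>2 * smoothness_weight \<alpha> 0 \<beta> u) \<partial>lborel)
      \<le> ennreal (1 / (2 * pi)) * ((\<integral>\<^sup>+u. ennreal ((cmod (fourier f u))\<^sup>2 * smoothness_weight \<alpha> 0 \<beta>hi u) \<partial>lborel) + ennreal R * 2)"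
      by (rule mult_left_mono) simp
    also have "\<dots> \<le> ennreal L1 + ennreal (1 / (2 * pi)) * (ennreal R * 2)"
      unfolding distrib_left by (intro add_right_mono cl)
    also have "ennreal (1 / (2 * pi)) * (ennreal R * 2) = ennreal (1 / (2 * pi) * (R * 2))"
    proof -
      have "ennreal R * 2 = ennreal (R * 2)" using R0 by (simp add: ennreal_mult)
      then show ?thesis by (simp only:) (rule ennreal_mult'[symmetric], simp)
    qed
    also have "\<dots> \<le> ennreal (L2 - L1)"
    proof (rule ennreal_leI)
      have "1 / (2 * pi) * (R * 2) = R / pi" by simp
      also have "\<dots> \<le> R / 1" using R0 pi_gt3 by (intro divide_left_mono) auto
      finally show "1 / (2 * pi) * (R * 2) \<le> L2 - L1" using R1 by simp
    qed
    also have "ennreal L1 + ennreal (L2 - L1) = ennreal L2" using L by (simp flip: ennreal_plus)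
    finally show "ennreal (1 / (2 * pi)) * (\<integral>\<^sup>+u. ennreal ((cmod (fourier f u))\<^sup>2 * smoothness_weight \<alpha> 0 \<beta> u) \<partial>lborel) \<le> ennreal L2"
      by (simp add: add_left_mono)
  qed
qed

lemma norm_square_add_le:
  fixes a b :: complex
  assumes e: "0 < e"
  shows "(cmod (a + b))\<^sup>2 \<le> (1 + e) * (cmod a)\<^sup>2 + (1 + 1 / e) * (cmod b)\<^sup>2"
proof -
  have "0 \<le> e * (cmod a - cmod b / e)\<^sup>2" using e by simp
  moreover have "e * (cmod a - cmod b / e)\<^sup>2 = e * (cmod a)\<^sup>2 - 2 * cmod a * cmod b + 1 / e * (cmod b)\<^sup>2"
    using e by (simp add: power2_eq_square field_simps)
  ultimately have "2 * cmod a * cmod b \<le> e * (cmod a)\<^sup>2 + 1 / e * (cmod b)\<^sup>2" by linarith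
  then have "(cmod a + cmod b)\<^sup>2 \<le> (1 + e) * (cmod a)\<^sup>2 + (1 + 1 / e) * (cmod b)\<^sup>2"
    by (simp add: power2_sum distrib_right)
  moreover have "(cmod (a + b))\<^sup>2 \<le> (cmod a + cmod b)\<^sup>2" by (intro power_mono norm_triangle_ineq) simp
  ultimately show ?thesis by linarith
qed

context lower_model
begin

lemma pert_L2_norm:
  "(L2_norm (\<lambda>x. f0 x + pert {m + 1..2 * m} co x - f0 x))\<^sup>2 = (\<Sum>k\<in>{m + 1..2 * m}. (co k)\<^sup>2) * nu / (4 * pi)"
proof -
  have "(L2_norm (\<lambda>x. f0 x + pert {m + 1..2 * m} co x - f0 x))\<^sup>2 = (LBINT x. (pert {m + 1..2 * m} co x)\<^sup>2)"
    unfolding L2_norm_def by simp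
  also have "\<dots> = (\<Sum>k\<in>{m + 1..2 * m}. (co k)\<^sup>2) * nu / (4 * pi)" by (rule pert_L2(2)) auto
  finally show ?thesis .
qed

text \<open>The budget \<open>L\<close> is divided by Young's inequality with parameter
  \<open>e\<close>: \<open>(1 + e) * L1\<close> for the null density, the remainder for the packets,
  on whose support the weight is at most its value at \<open>5 * m\<close>.\<close>

lemma pert_smoothness_class:
  assumes m: "1 \<le> m" and d: "is_density (\<lambda>x. f0 x + pert {m + 1..2 * m} co x)"
    and f02: "integrable lborel (\<lambda>x. (f0 x)\<^sup>2)" and \<beta>: "0 \<le> \<beta>" and e: "0 < e" and L1: "0 \<le> L1"
    and cl: "ennreal (1 / (2 * pi)) * (\<integral>\<^sup>+u. ennreal ((cmod (fourier f0 u))\<^sup>2 * smoothness_weight \<alpha> 0 \<beta> u) \<partial>lborel) \<le> ennreal L1"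
    and bd: "(1 + e) * L1 + (1 + 1 / e) * (exp (2 * \<alpha>) * (5 * real m) powr (2 * \<beta>)) * ((\<Sum>k\<in>{m + 1..2 * m}. (co k)\<^sup>2) * nu / (4 * pi)) \<le> L"
  shows "(\<lambda>x. f0 x + pert {m + 1..2 * m} co x) \<in> smoothness_class (\<alpha>, 0, \<beta>) L"
proof -
  let ?K = "{m + 1..2 * m}" and ?w = "smoothness_weight \<alpha> 0 \<beta>"
  let ?p = "pert ?K co" and ?f = "\<lambda>x. f0 x + pert ?K co x"
  \<comment> \<open>Packets with \<open>k \<le> 2 * m\<close> vanish beyond
    \<open>4 * m + 1\<close>, which is at most \<open>5 * m\<close>.\<close>
  define Wm where "Wm = exp (2 * \<alpha>) * (5 * real m) powr (2 * \<beta>)"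
  have Wm: "0 \<le> Wm" by (simp add: Wm_def)
  let ?Q = "\<Sum>k\<in>?K. (co k)\<^sup>2"
  note [measurable] = is_densityD(1)[OF f0] borel_measurable_fourier[OF f0]
  have p2: "integrable lborel (\<lambda>x. (?p x)\<^sup>2)" by (rule pert_L2(1)) auto
  have "integrable lborel (\<lambda>x. (?f x)\<^sup>2)"
  proof (rule Bochner_Integration.integrable_bound)
    show "integrable lborel (\<lambda>x. 2 * (f0 x)\<^sup>2 + 2 * (?p x)\<^sup>2)" using f02 p2 by simp
    show "AE x in lborel. norm ((?f x)\<^sup>2) \<le> norm (2 * (f0 x)\<^sup>2 + 2 * (?p x)\<^sup>2)"
    proof (rule AE_I2)
      fix x
      have "(?f x)\<^sup>2 \<le> 2 * (f0 x)\<^sup>2 + 2 * (?p x)\<^sup>2"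
        using zero_le_power2[of "f0 x - ?p x"] by (simp add: power2_eq_square algebra_simps)
      then show "norm ((?f x)\<^sup>2) \<le> norm (2 * (f0 x)\<^sup>2 + 2 * (?p x)\<^sup>2)" by simp
    qed
  qed measurable
  moreover have "ennreal (1 / (2 * pi)) * (\<integral>\<^sup>+u. ennreal ((cmod (fourier ?f u))\<^sup>2 * ?w u) \<partial>lborel) \<le> ennreal L"
  proof -
    let ?b = "\<lambda>u. \<Sum>k\<in>?K. (co k)\<^sup>2 * (beta k u)\<^sup>2"
    have fe: "fourier ?f u = fourier f0 u + complex_of_real (\<Sum>k\<in>?K. co k * beta k u)" for u
    proof -
      have ip: "integrable lborel (\<lambda>x. complex_of_real (?p x))" using pert_integrable[of ?K co] by simp
      have "fourier ?f u = (LBINT x. iexp (u * x) * complex_of_real (f0 x) + iexp (u * x) * complex_of_real (?p x))"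
        unfolding fourier_def by (simp add: distrib_left)
      also have "\<dots> = fourier f0 u + fourier ?p u"
        unfolding fourier_def
        by (intro Bochner_Integration.integral_add integrable_iexp_mult is_densityD(5)[OF f0] ip)
      finally show ?thesis by (simp only: fourier_pert)
    qed
    have w0: "0 \<le> ?w u" for u by (simp add: smoothness_weight_def)
    have b0: "0 \<le> ?b u" for u by (intro sum_nonneg) simp
    have bw: "?b u * ?w u \<le> Wm * ?b u" for u
    proof (cases "\<bar>u\<bar> \<le> 5 * real m")
      case True
      have "\<bar>u\<bar> powr (2 * \<beta>) \<le> (5 * real m) powr (2 * \<beta>)" using True \<beta> by (intro powr_mono2) auto
      then have "?w u \<le> Wm" by (simp add: smoothness_weight_def Wm_def mult.commute)
      then show ?thesis using b0[of u] by (simp add: mult.commute mult_right_mono)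
    next
      case False
      have "beta k u = 0" if "k \<in> ?K" for k
        using False that m by (intro beta_outside) auto
      then have "?b u = 0" by (intro sum.neutral) auto
      then show ?thesis by simp
    qed
    have ib: "integrable lborel ?b" "(LBINT u. ?b u) = ?Q * nu / 2"
    proof -
      have i: "integrable lborel (\<lambda>u. (beta k u)\<^sup>2)" "(LBINT u. (beta k u)\<^sup>2) = nu / 2" if "k \<in> ?K" for k
        using beta_square_integral[of k] that by auto
      show "integrable lborel ?b" using i by (intro Bochner_Integration.integrable_sum integrable_mult_right) auto
      have "(LBINT u. ?b u) = (\<Sum>k\<in>?K. (co k)\<^sup>2 * (nu / 2))"
        using i by (subst Bochner_Integration.integral_sum) (auto simp del: times_divide_eq_right intro!: sum.cong)
      then show "(LBINT u. ?b u) = ?Q * nu / 2" unfolding sum_distrib_right[symmetric] by simp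
    qed
    let ?c = "(1 + 1 / e) * Wm"
    have c: "0 \<le> ?c" using e Wm by simp
    have "(\<integral>\<^sup>+u. ennreal ((cmod (fourier ?f u))\<^sup>2 * ?w u) \<partial>lborel)
      \<le> (\<integral>\<^sup>+u. ennreal (1 + e) * ennreal ((cmod (fourier f0 u))\<^sup>2 * ?w u) + ennreal (?c * ?b u) \<partial>lborel)"
    proof (rule nn_integral_mono)
      fix u
      have "(cmod (fourier ?f u))\<^sup>2 \<le> (1 + e) * (cmod (fourier f0 u))\<^sup>2 + (1 + 1 / e) * ?b u"
        using norm_square_add_le[OF e, of "fourier f0 u" "complex_of_real (\<Sum>k\<in>?K. co k * beta k u)"]
        unfolding fe norm_of_real power2_abs sum_beta_square[OF finite_atLeastAtMost] .
      then have "(cmod (fourier ?f u))\<^sup>2 * ?w u \<le> ((1 + e) * (cmod (fourier f0 u))\<^sup>2 + (1 + 1 / e) * ?b u) * ?w u"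
        using w0 by (rule mult_right_mono)
      also have "\<dots> = (1 + e) * ((cmod (fourier f0 u))\<^sup>2 * ?w u) + (1 + 1 / e) * (?b u * ?w u)"
        by (simp only: distrib_right mult.assoc)
      also have "\<dots> \<le> (1 + e) * ((cmod (fourier f0 u))\<^sup>2 * ?w u) + (1 + 1 / e) * (Wm * ?b u)"
        using e by (intro add_left_mono mult_left_mono bw) auto
      also have "\<dots> = (1 + e) * ((cmod (fourier f0 u))\<^sup>2 * ?w u) + ?c * ?b u" by (simp only: mult.assoc)
      finally have "ennreal ((cmod (fourier ?f u))\<^sup>2 * ?w u) \<le> ennreal ((1 + e) * ((cmod (fourier f0 u))\<^sup>2 * ?w u) + ?c * ?b u)"
        by (rule ennreal_leI)
      also have "\<dots> = ennreal ((1 + e) * ((cmod (fourier f0 u))\<^sup>2 * ?w u)) + ennreal (?c * ?b u)"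
        using e w0 by (intro ennreal_plus mult_nonneg_nonneg[OF c b0] mult_nonneg_nonneg) auto
      finally show "ennreal ((cmod (fourier ?f u))\<^sup>2 * ?w u) \<le> ennreal (1 + e) * ennreal ((cmod (fourier f0 u))\<^sup>2 * ?w u) + ennreal (?c * ?b u)"
        using e by (subst ennreal_mult'[symmetric]) auto
    qed
    also have "\<dots> = ennreal (1 + e) * (\<integral>\<^sup>+u. ennreal ((cmod (fourier f0 u))\<^sup>2 * ?w u) \<partial>lborel) + (\<integral>\<^sup>+u. ennreal (?c * ?b u) \<partial>lborel)"
    proof -
      have [measurable]: "?b \<in> borel_measurable lborel" using ib(1) by (rule borel_measurable_integrable)
      have [measurable]: "?w \<in> borel_measurable lborel" unfolding smoothness_weight_def by measurable
      show ?thesis by (subst nn_integral_add, simp, measurable) (subst nn_integral_cmult, auto)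
    qed
    also have "(\<integral>\<^sup>+u. ennreal (?c * ?b u) \<partial>lborel) = ennreal (LBINT u. ?c * ?b u)"
      using c b0 by (intro nn_integral_eq_integral integrable_mult_right ib(1) AE_I2 mult_nonneg_nonneg[OF c])
    also have "(LBINT u. ?c * ?b u) = ?c * (?Q * nu / 2)" by (simp only: integral_mult_right_zero ib(2))
    finally have "ennreal (1 / (2 * pi)) * (\<integral>\<^sup>+u. ennreal ((cmod (fourier ?f u))\<^sup>2 * ?w u) \<partial>lborel)
      \<le> ennreal (1 / (2 * pi)) * (ennreal (1 + e) * (\<integral>\<^sup>+u. ennreal ((cmod (fourier f0 u))\<^sup>2 * ?w u) \<partial>lborel) + ennreal (?c * (?Q * nu / 2)))"
      by (rule mult_left_mono) simp
    also have "\<dots> = ennreal (1 + e) * (ennreal (1 / (2 * pi)) * (\<integral>\<^sup>+u. ennreal ((cmod (fourier f0 u))\<^sup>2 * ?w u) \<partial>lborel))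
      + ennreal (1 / (2 * pi)) * ennreal (?c * (?Q * nu / 2))"
      by (simp only: distrib_left mult.left_commute)
    also have "\<dots> \<le> ennreal (1 + e) * ennreal L1 + ennreal (1 / (2 * pi)) * ennreal (?c * (?Q * nu / 2))"
      by (intro add_right_mono mult_left_mono cl) simp
    also have "\<dots> = ennreal ((1 + e) * L1 + 1 / (2 * pi) * (?c * (?Q * nu / 2)))"
      using e L1 c nu_pos by (simp add: ennreal_mult'[symmetric] ennreal_plus[symmetric] sum_nonneg del: ennreal_plus)
    also have "\<dots> \<le> ennreal L"
    proof (rule ennreal_leI)
      have "1 / (2 * pi) * (?c * (?Q * nu / 2)) = ?c * (?Q * nu / (4 * pi))" by simp
      then show "(1 + e) * L1 + 1 / (2 * pi) * (?c * (?Q * nu / 2)) \<le> L"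
        using bd unfolding Wm_def by linarith
    qed
    finally show ?thesis .
  qed
  ultimately show ?thesis using d by (simp add: smoothness_class_def)
qed

end

section \<open>The adaptive lower bound\<close>

context lower_model
begin

lemma sum_square_signs:
  assumes "\<theta> \<in> signs m"
  shows "(\<Sum>k\<in>{m + 1..2 * m}. (a * \<theta> k)\<^sup>2) = real m * a\<^sup>2"
proof -
  have "(\<Sum>k\<in>{m + 1..2 * m}. (a * \<theta> k)\<^sup>2) = (\<Sum>k\<in>{m + 1..2 * m}. a\<^sup>2)"
  proof (intro sum.cong refl)
    fix k assume "k \<in> {m + 1..2 * m}"
    from signs_pm[OF assms this] show "(a * \<theta> k)\<^sup>2 = a\<^sup>2" by (elim disjE) auto
  qed
  then show ?thesis by simp
qed

lemma scale_energy:
  assumes "\<theta> \<in> signs m" and m: "1 \<le> m" and a: "a\<^sup>2 = 4 * pi * C / nu * real m powr (- 2 * \<beta> - 1)"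
  shows "(\<Sum>k\<in>{m + 1..2 * m}. (a * \<theta> k)\<^sup>2) * nu / (4 * pi) = C * real m powr (- 2 * \<beta>)"
proof -
  have "real m powr (- 2 * \<beta>) = real m * real m powr (- 2 * \<beta> - 1)"
    using m powr_add[of "real m" 1 "- 2 * \<beta> - 1"] by simp
  then show ?thesis unfolding sum_square_signs[OF assms(1)] a using nu_pos by simp
qed

text \<open>Assumption \<open>X\<close> makes the rate at smoothness \<open>\<beta>\<close> equal to
  \<open>m powr (- \<beta>)\<close>. The perturbation has squared norm
  \<open>C * m powr (- 2 * \<beta>)\<close>, so the separation condition holds with
  equality.\<close>

lemma alternative_mem:
  assumes \<theta>: "\<theta> \<in> good_signs m t" and m: "1 \<le> m" and a: "a\<^sup>2 = 4 * pi * C / nu * real m powr (- 2 * \<beta> - 1)"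
    and d: "is_density (\<lambda>x. f0 x + pert {m + 1..2 * m} (\<lambda>k. a * \<theta> k) x)"
    and f02: "integrable lborel (\<lambda>x. (f0 x)\<^sup>2)" and \<beta>: "0 \<le> \<beta>" "\<beta>lo \<le> \<beta>" "\<beta> \<le> \<beta>hi" and \<alpha>: "\<alpha>lo \<le> \<alpha>0"
    and e: "0 < e" and L1: "0 \<le> L1" and C: "0 < C"
    and cl: "ennreal (1 / (2 * pi)) * (\<integral>\<^sup>+u. ennreal ((cmod (fourier f0 u))\<^sup>2 * smoothness_weight \<alpha>0 0 \<beta> u) \<partial>lborel) \<le> ennreal L1"
    and bd: "(1 + e) * L1 + (1 + 1 / e) * (exp (2 * \<alpha>0) * 5 powr (2 * \<beta>hi)) * C \<le> L"
    and X: "eff_n n = real m powr ((4 * \<beta> + 4 * \<sigma> + 1) / 2)"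
  shows "(\<lambda>x. f0 x + pert {m + 1..2 * m} (\<lambda>k. a * \<theta> k) x) \<in> alternatives ({\<alpha>lo..} \<times> {0} \<times> {\<beta>lo..\<beta>hi}) L f0 C (rate \<sigma> \<beta>hi n)"
proof -
  have \<theta>': "\<theta> \<in> signs m" using \<theta> by (simp add: good_signs_def)
  have m0: "0 < real m" using m by simp
  note en = scale_energy[OF \<theta>' m a]
  let ?f = "\<lambda>x. f0 x + pert {m + 1..2 * m} (\<lambda>k. a * \<theta> k) x"
  have "?f \<in> smoothness_class (\<alpha>0, 0, \<beta>) L"
  proof (rule pert_smoothness_class[OF m d f02 \<beta>(1) e L1 cl])
    have "(5 * real m) powr (2 * \<beta>) * (C * real m powr (- 2 * \<beta>)) = 5 powr (2 * \<beta>) * C * (real m powr (2 * \<beta>) * real m powr (- 2 * \<beta>))"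
      using m0 by (simp add: powr_mult)
    also have "real m powr (2 * \<beta>) * real m powr (- 2 * \<beta>) = 1"
      unfolding powr_add[symmetric] using m0 by simp
    finally have p: "(5 * real m) powr (2 * \<beta>) * (C * real m powr (- 2 * \<beta>)) = 5 powr (2 * \<beta>) * C" by simp
    have "(1 + 1 / e) * (exp (2 * \<alpha>0) * (5 * real m) powr (2 * \<beta>)) * (C * real m powr (- 2 * \<beta>))
      = (1 + 1 / e) * exp (2 * \<alpha>0) * (5 powr (2 * \<beta>) * C)" unfolding p[symmetric] by simp
    also have "\<dots> \<le> (1 + 1 / e) * exp (2 * \<alpha>0) * (5 powr (2 * \<beta>hi) * C)"
      using e \<beta> C by (intro mult_left_mono mult_right_mono powr_mono) auto
    also have "\<dots> = (1 + 1 / e) * (exp (2 * \<alpha>0) * 5 powr (2 * \<beta>hi)) * C" by simp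
    finally show "(1 + e) * L1 + (1 + 1 / e) * (exp (2 * \<alpha>0) * (5 * real m) powr (2 * \<beta>)) * ((\<Sum>k\<in>{m + 1..2 * m}. (a * \<theta> k)\<^sup>2) * nu / (4 * pi)) \<le> L"
      unfolding en using bd by linarith
  qed
  moreover have "C \<le> (L2_norm (\<lambda>x. ?f x - f0 x))\<^sup>2 / (rate \<sigma> \<beta>hi n (\<alpha>0, 0, \<beta>))\<^sup>2"
  proof -
    have s: "0 < 4 * \<beta> + 4 * \<sigma> + 1" using \<beta> \<sigma> by simp
    have "rate \<sigma> \<beta>hi n (\<alpha>0, 0, \<beta>) = real m powr (- \<beta>)"
    proof -
      have "(4 * \<beta> + 4 * \<sigma> + 1) / 2 * (- 2 * \<beta> / (4 * \<beta> + 4 * \<sigma> + 1)) = - \<beta>" using s by (simp add: divide_simps)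
      then show ?thesis unfolding rate_def X by (simp only: powr_powr prod.case) simp
    qed
    then have "(rate \<sigma> \<beta>hi n (\<alpha>0, 0, \<beta>))\<^sup>2 = real m powr (- 2 * \<beta>)"
      using m0 powr_add[of "real m" "- \<beta>" "- \<beta>"] by (simp add: power2_eq_square)
    then show ?thesis unfolding pert_L2_norm en using m0 by simp
  qed
  ultimately show ?thesis unfolding alternatives_def using \<beta> \<alpha> by (intro UN_I[of "(\<alpha>0, 0, \<beta>)"]) auto
qed

text \<open>\<open>X\<close> gives
  \<open>(eff_n n)\<^sup>2 = m powr (4 * \<beta> + 4 * \<sigma> + 1)\<close>, which cancels the
  power of \<open>m\<close> in the exponent. What remains is the square of the constant bounded in
  the assumption \<open>Q\<close> times \<open>ln (ln n)\<close>, the same at every scale, so the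
  same-scale excess is of order \<open>sqrt (ln n)\<close>.\<close>

lemma scale_bounds:
  assumes m: "1 \<le> m" and a: "a\<^sup>2 = 4 * pi * C / nu * real m powr (- 2 * \<beta> - 1)" and \<beta>: "0 \<le> \<beta>" and C: "0 < C"
    and Q: "4 * pi * 67 * cP\<^sup>2 / (nu * c') * C \<le> 1 / 2"
    and n: "large_n n" and X: "eff_n n = real m powr ((4 * \<beta> + 4 * \<sigma> + 1) / 2)"
  defines "q \<equiv> a\<^sup>2 / c' * (67 * cP\<^sup>2 * real m powr (- 2 * \<sigma>))"
  shows "real m * q \<le> 1" "real m * (real n * q)\<^sup>2 \<le> ln (ln (real n)) / 2"
proof -
  define Q where "Q = 4 * pi * 67 * cP\<^sup>2 / (nu * c') * C"
  have Q01: "0 \<le> Q" "Q \<le> 1 / 2" using Q C c' nu_pos unfolding Q_def by simp_all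
  have m0: "0 < real m" using m by simp
  have q: "q = Q * real m powr (- 2 * \<beta> - 1 - 2 * \<sigma>)"
  proof -
    have "real m powr (- 2 * \<beta> - 1 - 2 * \<sigma>) = real m powr (- 2 * \<beta> - 1) * real m powr (- 2 * \<sigma>)"
      unfolding powr_add[symmetric] by simp
    then show ?thesis unfolding q_def a Q_def using nu_pos c' by (simp add: field_simps)
  qed
  have "real m * q = Q * real m powr (- 2 * \<beta> - 2 * \<sigma>)"
    using m0 powr_add[of "real m" 1 "- 2 * \<beta> - 1 - 2 * \<sigma>"] unfolding q by simp
  also have "\<dots> \<le> 1 * 1"
  proof (rule mult_mono)
    show "real m powr (- 2 * \<beta> - 2 * \<sigma>) \<le> 1"
      using m \<beta> \<sigma> powr_mono[of "- 2 * \<beta> - 2 * \<sigma>" 0 "real m"] by simp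
  qed (use Q01 in auto)
  finally show "real m * q \<le> 1" by simp
  let ?s = "4 * \<beta> + 4 * \<sigma> + 1"
  have "(real m powr (- 2 * \<beta> - 1 - 2 * \<sigma>))\<^sup>2 = real m powr (- ?s - 1)"
    unfolding power2_eq_square powr_add[symmetric] by (rule arg_cong) simp
  then have mp: "real m * (real m powr (- 2 * \<beta> - 1 - 2 * \<sigma>))\<^sup>2 = real m powr (- ?s)"
    using m0 powr_add[of "real m" 1 "- ?s - 1"] by simp
  then have e1: "real m * (real n * q)\<^sup>2 = Q\<^sup>2 * (real n)\<^sup>2 * real m powr (- ?s)"
    unfolding q power_mult_distrib mp[symmetric] by (simp only: ac_simps)
  have X2: "(eff_n n)\<^sup>2 = real m powr ?s"
    unfolding X power2_eq_square powr_add[symmetric] by simp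
  have n2: "(real n)\<^sup>2 = real m powr ?s * ln (ln (real n))"
    using large_nD(4,8)[OF n] X2 by (metis power_mult_distrib real_sqrt_pow2 order_trans zero_le_one)
  have "real m powr ?s * real m powr (- ?s) = 1" unfolding powr_add[symmetric] using m0 by simp
  then have "real m * (real n * q)\<^sup>2 = Q\<^sup>2 * ln (ln (real n))"
    unfolding e1 n2 by (simp add: mult.assoc mult.left_commute)
  also have "\<dots> \<le> 1 / 2 * ln (ln (real n))"
  proof (rule mult_right_mono)
    have "Q\<^sup>2 \<le> (1 / 2)\<^sup>2" using Q01 by (intro power_mono) auto
    then show "Q\<^sup>2 \<le> 1 / 2" by (simp add: power2_eq_square)
  qed (use large_nD(4)[OF n] in auto)
  finally show "real m * (real n * q)\<^sup>2 \<le> ln (ln (real n)) / 2" by simp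
qed

end

lemma dyadic_blocks_disjoint:
  assumes "i \<noteq> j"
  shows "{4 ^ i + 1..2 * 4 ^ i} \<inter> {4 ^ j + 1..2 * 4 ^ j :: nat} = {}"
proof -
  have *: "2 * 4 ^ i < (4 ^ j :: nat)" if "i < j" for i j :: nat
  proof -
    have "(4::nat) * 4 ^ i \<le> 4 ^ j" using that power_increasing[of "Suc i" j "4::nat"] by simp
    moreover have "(0::nat) < 4 ^ i" by simp
    ultimately show ?thesis by linarith
  qed
  show ?thesis using assms *[of i j] *[of j i] by (cases "i < j") auto
qed

text \<open>With \<open>m = 4 ^ i\<close>, the equation \<open>X = m powr (s / 2)\<close> reads
  \<open>s = 2 * ln X / ln m\<close>. Requiring \<open>s\<close> between \<open>s1\<close> and
  \<open>s2\<close> confines \<open>i\<close> to an interval whose length is proportional to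
  \<open>ln X\<close>.\<close>

lemma scales_exist:
  fixes s1 s2 X :: real
  assumes s: "0 < s1" "s1 < s2" and X: "1 < X"
  obtains Ms :: "nat set" where "finite Ms"
    "2 / ln 4 * (1 / s1 - 1 / s2) * ln X - 1 \<le> real (card Ms)"
    "\<And>m m'. m \<in> Ms \<Longrightarrow> m' \<in> Ms \<Longrightarrow> m \<noteq> m' \<Longrightarrow> {m + 1..2 * m} \<inter> {m' + 1..2 * m'} = {}"
    "\<And>m. m \<in> Ms \<Longrightarrow> 1 < m" "\<And>m. m \<in> Ms \<Longrightarrow> X powr (2 / s2) \<le> real m"
    "\<And>m. m \<in> Ms \<Longrightarrow> s1 \<le> 2 * ln X / ln (real m) \<and> 2 * ln X / ln (real m) \<le> s2"
proof -
  have l4: "0 < ln (4::real)" by simp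
  have lX: "0 < ln X" using X by simp
  define lo where "lo = 2 * ln X / (s2 * ln 4)"
  define hi where "hi = 2 * ln X / (s1 * ln 4)"
  have lo: "0 < lo" using s lX l4 by (simp add: lo_def)
  have hi: "0 < hi" using s lX l4 by (simp add: hi_def)
  define Is where "Is = {nat \<lceil>lo\<rceil>..nat \<lfloor>hi\<rfloor>}"
  have I: "lo \<le> real i \<and> real i \<le> hi" if "i \<in> Is" for i
    using that lo hi unfolding Is_def atLeastAtMost_iff by linarith
  have inj: "inj_on (\<lambda>i::nat. 4 ^ i :: nat) Is" by (auto simp: inj_on_def)
  define Ms where "Ms = (\<lambda>i::nat. 4 ^ i :: nat) ` Is"
  have lnm: "ln (real (4 ^ i)) = real i * ln 4" for i by (simp add: ln_realpow)
  show ?thesis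
  proof (rule that[of Ms])
    show "finite Ms" by (simp add: Ms_def Is_def)
    have "card Ms = card Is" unfolding Ms_def by (rule card_image[OF inj])
    moreover have "real (nat \<lfloor>hi\<rfloor>) + 1 - real (nat \<lceil>lo\<rceil>) \<le> real (card Is)" by (simp add: Is_def)
    moreover have "hi - 1 \<le> real (nat \<lfloor>hi\<rfloor>)" "real (nat \<lceil>lo\<rceil>) \<le> lo + 1" using lo hi by linarith+
    moreover have "2 / ln 4 * (1 / s1 - 1 / s2) * ln X = hi - lo"
      using s l4 by (simp add: lo_def hi_def field_simps)
    ultimately show "2 / ln 4 * (1 / s1 - 1 / s2) * ln X - 1 \<le> real (card Ms)" by linarith
    show "{m + 1..2 * m} \<inter> {m' + 1..2 * m'} = {}" if mm: "m \<in> Ms" "m' \<in> Ms" "m \<noteq> m'" for m m'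
    proof -
      obtain i j where ij: "m = 4 ^ i" "m' = 4 ^ j" using mm(1,2) unfolding Ms_def by (elim imageE)
      then have "i \<noteq> j" using mm(3) by auto
      then show ?thesis unfolding ij by (rule dyadic_blocks_disjoint)
    qed
    fix m assume "m \<in> Ms"
    then obtain i where i: "i \<in> Is" "m = 4 ^ i" by (auto simp: Ms_def)
    have i0: "0 < real i" using I[OF i(1)] lo by linarith
    show "1 < m" unfolding i(2) using i0 by (intro one_less_power) auto
    have "X powr (2 / s2) = exp (2 / s2 * ln X)" using X by (simp add: powr_def)
    also have "2 / s2 * ln X = lo * ln 4" using s l4 by (simp add: lo_def)
    also have "exp (lo * ln 4) \<le> exp (real i * ln 4)" using I[OF i(1)] l4 by simp
    also have "\<dots> = real m" unfolding i(2) lnm[symmetric] by simp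
    finally show "X powr (2 / s2) \<le> real m" .
    show "s1 \<le> 2 * ln X / ln (real m) \<and> 2 * ln X / ln (real m) \<le> s2"
    proof -
      have d: "0 < real i * ln 4" using i0 l4 by simp
      have p: "0 < s2 * ln (4::real)" "0 < s1 * ln (4::real)" using s l4 by (intro mult_pos_pos; linarith)+
      have "2 * ln X \<le> real i * (s2 * ln 4)" "real i * (s1 * ln 4) \<le> 2 * ln X"
        using I[OF i(1), unfolded lo_def hi_def pos_divide_le_eq[OF p(1)] pos_le_divide_eq[OF p(2)]] by (rule conjunct1, rule conjunct2)
      then show ?thesis unfolding i(2) lnm pos_divide_le_eq[OF d] pos_le_divide_eq[OF d] by (simp only: ac_simps simp_thms)
    qed
  qed
qed

context lower_model
begin

text \<open>The condition \<open>eff_n n = m powr ((4 * \<beta> + 4 * \<sigma> + 1) / 2)\<close> ties the smoothness \<open>\<gamma> m\<close> to the dyadic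
  frequency \<open>m\<close>. Only smoothness indices close to \<open>\<beta>hi\<close> are used, where \<open>f0\<close> still has room in its class.\<close>

theorem adaptive_lower_bound:
  assumes L: "0 < L" and c: "0 < c" "c < 1" and f0c: "f0 \<in> smoothness_class (\<alpha>0, 0, \<beta>hi) (c * L)"
    and \<beta>: "0 \<le> \<beta>lo" "\<beta>lo < \<beta>hi" and \<alpha>: "\<alpha>lo \<le> \<alpha>0"
    and c0: "0 < c0" "\<And>x. c0 / (1 + x\<^sup>2) \<le> f0 x" and \<epsilon>: "\<epsilon> < 1"
  shows "\<exists>C0>0. \<forall>C. 0 < C \<and> C < C0 \<longrightarrow>
    ennreal \<epsilon> \<le> liminf (\<lambda>n. INF \<Delta>\<in>tests n.
      total_error g f0 (alternatives ({\<alpha>lo..} \<times> {0} \<times> {\<beta>lo..\<beta>hi}) L f0 C (rate \<sigma> \<beta>hi n)) n \<Delta>)"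
proof -
  have \<beta>hi: "0 < \<beta>hi" using \<beta> by simp
  have f02: "integrable lborel (\<lambda>x. (f0 x)\<^sup>2)"
    and cl0: "ennreal (1 / (2 * pi)) * (\<integral>\<^sup>+u. ennreal ((cmod (fourier f0 u))\<^sup>2 * smoothness_weight \<alpha>0 0 \<beta>hi u) \<partial>lborel) \<le> ennreal (c * L)"
    using f0c by (auto simp: smoothness_class_def)
  \<comment> \<open>The gap \<open>1 - c\<close> is cut into three parts \<open>e\<close>: with
    \<open>L1 = (c + e) * L\<close>, the enlarged share \<open>(1 + e) * L1\<close> is at most
    \<open>L - e * L\<close>, which leaves \<open>e * L\<close> for the packets.\<close>
  define e where "e = (1 - c) / 3"
  have e: "0 < e" "c = 1 - 3 * e" using c by (simp_all add: e_def field_simps)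
  define L1 where "L1 = (c + e) * L"
  have L1: "0 \<le> L1" "c * L < L1" using c e L by (simp_all add: L1_def)
  obtain \<eta> where \<eta>: "0 < \<eta>" "\<eta> \<le> \<beta>hi - \<beta>lo" "\<eta> \<le> \<beta>hi / 2"
    and cl: "\<And>\<beta>. \<beta>hi - \<eta> \<le> \<beta> \<Longrightarrow> \<beta> \<le> \<beta>hi \<Longrightarrow>
      ennreal (1 / (2 * pi)) * (\<integral>\<^sup>+u. ennreal ((cmod (fourier f0 u))\<^sup>2 * smoothness_weight \<alpha>0 0 \<beta> u) \<partial>lborel) \<le> ennreal L1"
    using smoothness_near_top[OF f0 \<beta>hi L1(2) _ _ cl0, of "\<beta>hi - \<beta>lo"] c L \<beta> by auto
  define b1 where "b1 = \<beta>hi - \<eta>"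
  have b1: "0 < b1" "\<beta>lo \<le> b1" "b1 < \<beta>hi" using \<eta> \<beta>hi by (auto simp: b1_def)
  define s1 where "s1 = 4 * b1 + 4 * \<sigma> + 1"
  define s2 where "s2 = 4 * \<beta>hi + 4 * \<sigma> + 1"
  have s: "0 < s1" "s1 < s2" "0 < s2" using b1 \<sigma> by (auto simp: s1_def s2_def)
  obtain Cb where Cb: "0 < Cb" "\<And>x. \<bar>bhat x\<bar> \<le> Cb / (1 + x\<^sup>2)" using bhat_decay by blast
  define Q where "Q = 4 * pi * 67 * cP\<^sup>2 / (nu * c')"
  have Q: "0 < Q" using cP nu_pos c' by (simp add: Q_def)
  define R where "R = (1 + 1 / e) * (exp (2 * \<alpha>0) * 5 powr (2 * \<beta>hi))"
  have R: "0 < R" using e by (simp add: R_def add_pos_pos)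
  \<comment> \<open>The first entry keeps the chi-square exponent below half of
    \<open>ln (ln n)\<close>, the second keeps the packets within their share of the smoothness
    budget.\<close>
  define C0 where "C0 = min (1 / (2 * Q)) (e * L / R)"
  have C0: "0 < C0" using Q R e L by (simp add: C0_def)
  define \<kappa> where "\<kappa> = 2 / ln 4 * (1 / s1 - 1 / s2)"
  have \<kappa>: "0 < \<kappa>"
  proof -
    have "1 / s2 < 1 / s1" using s by (intro divide_strict_left_mono) auto
    then show ?thesis unfolding \<kappa>_def by (intro mult_pos_pos) auto
  qed
  show ?thesis
  proof (intro exI[of _ C0] conjI C0 allI impI)
    fix C assume "0 < C \<and> C < C0"
    then have C: "0 < C" "C < C0" by auto
    have CQ: "Q * C \<le> 1 / 2"
    proof -
      have "Q * C \<le> Q * (1 / (2 * Q))" using C Q by (intro mult_left_mono) (auto simp: C0_def)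
      then show ?thesis using Q by simp
    qed
    have bd: "(1 + e) * L1 + R * C \<le> L"
    proof -
      have "R * C \<le> R * (e * L / R)" using C R by (intro mult_left_mono) (auto simp: C0_def)
      then have "R * C \<le> e * L" using R by simp
      moreover have "(1 + e) * L1 = L - e * L - 2 * (e * e * L)" by (simp add: L1_def e(2) algebra_simps)
      moreover have "0 \<le> e * e * L" using e L by simp
      ultimately show ?thesis by linarith
    qed
    define D where "D = sqrt (4 * pi * C / nu)"
    have D: "0 < D" "D\<^sup>2 = 4 * pi * C / nu" using C nu_pos by (simp_all add: D_def)
    \<comment> \<open>The level lies between two demands:
      \<open>t\<^sup>2 / (4 * m) = m powr b1 / 4\<close> outgrows the logarithm of the number of
      grid points, while the amplitude, at most \<open>D * m powr (- b1 - 1 / 2)\<close>, times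
      \<open>t\<close> still tends to zero. Both use \<open>b1 > 0\<close>.\<close>
    define t where "t m = real m powr ((1 + b1) / 2)" for m
    have t2: "(t m)\<^sup>2 = real m powr (1 + b1)" for m
      unfolding t_def power2_eq_square powr_add[symmetric] by (rule arg_cong) (simp add: field_simps)
    have "\<forall>\<^sub>F x in at_top. 32 * x\<^sup>2 * exp (- (x powr b1 / 4)) \<le> (1::real)"
      using b1(1) by real_asymp
    then have ev1: "\<forall>\<^sub>F m in sequentially. 32 * (real m)\<^sup>2 * exp (- (real m powr b1 / 4)) \<le> 1"
      by (rule eventually_compose_filterlim[OF _ filterlim_real_sequentially])
    have "((\<lambda>x::real. D * Cb * (x powr (- (b1 / 2)) + 2 * x powr (- (b1 + 1 / 2)))) \<longlongrightarrow> D * Cb * (0 + 2 * 0)) at_top"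
      using b1(1) by (intro tendsto_intros tendsto_neg_powr filterlim_ident) auto
    then have "\<forall>\<^sub>F x::real in at_top. D * Cb * (x powr (- (b1 / 2)) + 2 * x powr (- (b1 + 1 / 2))) < c0"
      using c0(1) by (intro order_tendstoD(2)) auto
    then have "\<forall>\<^sub>F x in at_top. D * x powr (- b1 - 1 / 2) * Cb * (x powr ((1 + b1) / 2) + 2) < c0"
      using eventually_gt_at_top[of 0]
    proof eventually_elim
      case (elim x)
      have "- b1 - 1 / 2 + (1 + b1) / 2 = - (b1 / 2)" by (simp add: field_simps)
      then have "x powr (- b1 - 1 / 2) * x powr ((1 + b1) / 2) = x powr (- (b1 / 2))"
        unfolding powr_add[symmetric] by (rule arg_cong)
      moreover have "- b1 - 1 / 2 = - (b1 + 1 / 2)" by simp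
      ultimately have "D * x powr (- b1 - 1 / 2) * Cb * (x powr ((1 + b1) / 2) + 2)
        = D * Cb * (x powr (- (b1 / 2)) + 2 * x powr (- (b1 + 1 / 2)))"
        by (simp only: distrib_left mult.assoc mult.commute mult.left_commute)
      then show ?case using elim(1) by (simp only:)
    qed
    then have ev2: "\<forall>\<^sub>F m in sequentially. D * real m powr (- b1 - 1 / 2) * Cb * (t m + 2) < c0"
      unfolding t_def by (rule eventually_compose_filterlim[OF _ filterlim_real_sequentially])
    have ev3: "\<forall>\<^sub>F m in sequentially. kP \<le> real m"
      using eventually_compose_filterlim[OF eventually_ge_at_top[of kP] filterlim_real_sequentially] .
    obtain M0 :: nat where M0: "\<And>m. M0 \<le> m \<Longrightarrow> 32 * (real m)\<^sup>2 * exp (- (real m powr b1 / 4)) \<le> 1"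
        "\<And>m. M0 \<le> m \<Longrightarrow> D * real m powr (- b1 - 1 / 2) * Cb * (t m + 2) < c0" "\<And>m. M0 \<le> m \<Longrightarrow> kP \<le> real m"
      using eventually_conj[OF ev1 eventually_conj[OF ev2 ev3]] unfolding eventually_sequentially by blast
    have "filterlim (\<lambda>n. real n powr (1 / s2)) at_top sequentially" using s(3) by real_asymp
    then have ev4: "\<forall>\<^sub>F n in sequentially. real M0 \<le> real n powr (1 / s2)"
      unfolding filterlim_at_top by blast
    \<comment> \<open>The numerator is \<open>2 * sqrt (ln n)\<close> and the denominator a lower
      bound for the number of scales.\<close>
    have "((\<lambda>n. 2 * exp (ln (ln (real n)) / 2) / (\<kappa> * (ln (real n) / 2) - 1)) \<longlongrightarrow> 0) sequentially"
      using \<kappa> by real_asymp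
    then have "\<forall>\<^sub>F n in sequentially. 2 * exp (ln (ln (real n)) / 2) / (\<kappa> * (ln (real n) / 2) - 1) < (1 - \<epsilon>)\<^sup>2"
      using \<epsilon> by (intro order_tendstoD(2)) auto
    moreover have "\<forall>\<^sub>F n in sequentially. 1 < \<kappa> * (ln (real n) / 2)" using \<kappa> by real_asymp
    ultimately have "\<forall>\<^sub>F n in sequentially. ennreal \<epsilon> \<le> (INF \<Delta>\<in>tests n.
      total_error g f0 (alternatives ({\<alpha>lo..} \<times> {0} \<times> {\<beta>lo..\<beta>hi}) L f0 C (rate \<sigma> \<beta>hi n)) n \<Delta>)"
      using ev4 eventually_large_n
    proof eventually_elim
      case (elim n)
      note n = elim(4)
      let ?X = "eff_n n" and ?B = "ln (ln (real n)) / 2"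
      have n1: "1 < real n" using large_nD(1)[OF n] by simp
      have "1 < sqrt (real n)" using n1 by simp
      then have X1: "1 < ?X" using large_nD(6)[OF n] by linarith
      have lX: "ln (real n) / 2 \<le> ln ?X"
      proof -
        have "ln (sqrt (real n)) \<le> ln ?X" using large_nD(6)[OF n] n1 by (intro ln_mono) auto
        then show ?thesis using n1 by (simp add: ln_sqrt)
      qed
      obtain Ms where Ms: "finite Ms" "\<kappa> * ln ?X - 1 \<le> real (card Ms)"
        and disj: "\<And>m m'. m \<in> Ms \<Longrightarrow> m' \<in> Ms \<Longrightarrow> m \<noteq> m' \<Longrightarrow> {m + 1..2 * m} \<inter> {m' + 1..2 * m'} = {}"
        and m1: "\<And>m. m \<in> Ms \<Longrightarrow> 1 < m" and mX: "\<And>m. m \<in> Ms \<Longrightarrow> ?X powr (2 / s2) \<le> real m"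
        and mS: "\<And>m. m \<in> Ms \<Longrightarrow> s1 \<le> 2 * ln ?X / ln (real m) \<and> 2 * ln ?X / ln (real m) \<le> s2"
        unfolding \<kappa>_def by (rule scales_exist[OF s(1,2) X1]) blast
      have mM: "M0 \<le> m" if "m \<in> Ms" for m
      proof -
        have "real n powr (1 / s2) = sqrt (real n) powr (2 / s2)" using n1 by (simp add: powr_half_sqrt[symmetric] powr_powr)
        also have "\<dots> \<le> ?X powr (2 / s2)" using large_nD(6)[OF n] s n1 by (intro powr_mono2) auto
        finally show ?thesis using mX[OF that] elim(3) by linarith
      qed
      \<comment> \<open>The smoothness index solving
        \<open>eff_n n = m powr ((4 * \<gamma> + 4 * \<sigma> + 1) / 2)\<close>; the range of scales
        places it in \<open>[b1, \<beta>hi]\<close>.\<close>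
      define \<gamma> where "\<gamma> m = (2 * ln ?X / ln (real m) - 4 * \<sigma> - 1) / 4" for m
      have \<gamma>: "b1 \<le> \<gamma> m" "\<gamma> m \<le> \<beta>hi" if "m \<in> Ms" for m
        using mS[OF that] unfolding \<gamma>_def s1_def s2_def by auto
      have X: "?X = real m powr ((4 * \<gamma> m + 4 * \<sigma> + 1) / 2)" if "m \<in> Ms" for m
      proof -
        have "0 < ln (real m)" using m1[OF that] by simp
        then have "(4 * \<gamma> m + 4 * \<sigma> + 1) / 2 * ln (real m) = ln ?X" by (simp add: \<gamma>_def field_simps)
        then show ?thesis using m1[OF that] X1 by (simp add: powr_def)
      qed
      define a where "a m = D * real m powr (- \<gamma> m - 1 / 2)" for m
      have a0: "0 \<le> a m" for m using D by (simp add: a_def)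
      have a2: "(a m)\<^sup>2 = 4 * pi * C / nu * real m powr (- 2 * \<gamma> m - 1)" for m
        unfolding a_def power_mult_distrib D(2) unfolding power2_eq_square powr_add[symmetric] by simp
      have cardM: "0 < \<kappa> * (ln (real n) / 2) - 1" "\<kappa> * (ln (real n) / 2) - 1 \<le> real (card Ms)"
        using elim(2) Ms(2) mult_left_mono[OF lX less_imp_le[OF \<kappa>]] by linarith+
      have tpos: "0 < t m" if "m \<in> Ms" for m using m1[OF that] by (simp add: t_def)
      have dens: "is_density (\<lambda>x. f0 x + pert {m + 1..2 * m} (\<lambda>k. a m * \<theta> k) x)"
        if "m \<in> Ms" "\<theta> \<in> good_signs m (t m)" for m \<theta>
      proof (rule pert_signs_density[OF that(2) a0 tpos[OF that(1)] Cb c0(2)])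
        have "a m \<le> D * real m powr (- b1 - 1 / 2)"
          unfolding a_def using D \<gamma>[OF that(1)] m1[OF that(1)] by (intro mult_left_mono powr_mono) auto
        then have "a m * (Cb * (t m + 2)) \<le> D * real m powr (- b1 - 1 / 2) * (Cb * (t m + 2))"
          using Cb(1) tpos[OF that(1)] by (intro mult_right_mono) auto
        then show "a m * Cb * (t m + 2) \<le> c0" using M0(2)[OF mM[OF that(1)]] by (simp only: mult.assoc)
      qed
      have gd: "2 ^ m \<le> 2 * real (card (good_signs m (t m)))" if "m \<in> Ms" for m
      proof (rule card_good_signs[OF _ tpos[OF that]])
        have "real m powr (1 + b1) = real m * real m powr b1" using m1[OF that] by (simp add: powr_add)
        then have "(t m)\<^sup>2 / (4 * real m) = real m powr b1 / 4" using m1[OF that] unfolding t2 by simp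
        then show "32 * (real m)\<^sup>2 * exp (- ((t m)\<^sup>2 / (4 * real m))) \<le> 1" using M0(1)[OF mM[OF that]] by (simp only:)
      qed (use m1[OF that] in simp)
      have mge: "1 \<le> m" if "m \<in> Ms" for m using m1[OF that] by simp
      have \<gamma>0: "0 \<le> \<gamma> m" if "m \<in> Ms" for m using \<gamma>(1)[OF that] b1 by simp
      note sb = scale_bounds[OF mge a2 \<gamma>0 C(1) CQ[unfolded Q_def] n X]
      have "ennreal \<epsilon> \<le> ennreal (1 - sqrt (2 * exp ?B / real (card Ms)))"
      proof (rule ennreal_leI)
        have "2 * exp ?B / real (card Ms) \<le> 2 * exp ?B / (\<kappa> * (ln (real n) / 2) - 1)"
          using cardM by (intro divide_left_mono) auto
        then have "2 * exp ?B / real (card Ms) \<le> (1 - \<epsilon>)\<^sup>2" using elim(1) by linarith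
        then have "sqrt (2 * exp ?B / real (card Ms)) \<le> 1 - \<epsilon>" using \<epsilon> by (intro real_le_lsqrt) auto
        then show "\<epsilon> \<le> 1 - sqrt (2 * exp ?B / real (card Ms))" by linarith
      qed
      also have "\<dots> \<le> (INF \<Delta>\<in>tests n.
        total_error g f0 (alternatives ({\<alpha>lo..} \<times> {0} \<times> {\<beta>lo..\<beta>hi}) L f0 C (rate \<sigma> \<beta>hi n)) n \<Delta>)"
      proof (rule INF_greatest)
        fix \<Delta> assume \<Delta>: "\<Delta> \<in> tests n"
        show "ennreal (1 - sqrt (2 * exp ?B / real (card Ms)))
          \<le> total_error g f0 (alternatives ({\<alpha>lo..} \<times> {0} \<times> {\<beta>lo..\<beta>hi}) L f0 C (rate \<sigma> \<beta>hi n)) n \<Delta>"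
        proof (rule total_error_lower[where t=t and a=a, OF Ms(1) _ disj mge M0(3)[OF mM] gd _ _ dens _ \<Delta>])
          show "Ms \<noteq> {}" using cardM by auto
          fix m assume m: "m \<in> Ms"
          show "real m * ((a m)\<^sup>2 / c' * (67 * cP\<^sup>2 * real m powr (- 2 * \<sigma>))) \<le> 1"
            by (rule sb(1)[OF m m m])
          show "real m * (real n * ((a m)\<^sup>2 / c' * (67 * cP\<^sup>2 * real m powr (- 2 * \<sigma>))))\<^sup>2 \<le> ?B"
            by (rule sb(2)[OF m m m])
          fix \<theta> assume \<theta>: "\<theta> \<in> good_signs m (t m)"
          show "(\<lambda>x. f0 x + pert {m + 1..2 * m} (\<lambda>k. a m * \<theta> k) x)
            \<in> alternatives ({\<alpha>lo..} \<times> {0} \<times> {\<beta>lo..\<beta>hi}) L f0 C (rate \<sigma> \<beta>hi n)"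
          proof (rule alternative_mem[OF \<theta> mge[OF m] a2 dens[OF m \<theta>] f02 \<gamma>0[OF m] _ \<gamma>(2)[OF m] \<alpha> e(1) L1(1) C(1) _ _ X[OF m]])
            show "\<beta>lo \<le> \<gamma> m" using \<gamma>(1)[OF m] b1 by simp
            show "ennreal (1 / (2 * pi)) * (\<integral>\<^sup>+u. ennreal ((cmod (fourier f0 u))\<^sup>2 * smoothness_weight \<alpha>0 0 (\<gamma> m) u) \<partial>lborel) \<le> ennreal L1"
              by (rule cl[OF \<gamma>(1)[OF m, unfolded b1_def] \<gamma>(2)[OF m]])
            show "(1 + e) * L1 + (1 + 1 / e) * (exp (2 * \<alpha>0) * 5 powr (2 * \<beta>hi)) * C \<le> L"
              using bd unfolding R_def .
          qed
        qed
      qed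
      finally show ?case .
    qed
    then show "ennreal \<epsilon> \<le> liminf (\<lambda>n. INF \<Delta>\<in>tests n.
      total_error g f0 (alternatives ({\<alpha>lo..} \<times> {0} \<times> {\<beta>lo..\<beta>hi}) L f0 C (rate \<sigma> \<beta>hi n)) n \<Delta>)"
      by (rule Liminf_bounded)
  qed
qed

end

lemma lower_model_exists:
  fixes g f0 :: "real \<Rightarrow> real"
  assumes g: "is_density g" and nz: "\<And>u. fourier g u \<noteq> 0" and cg: "0 < cg" and \<sigma>: "1 < \<sigma>"
    and as: "(\<lambda>u. cmod (fourier g u)) \<sim>[at_infinity] (\<lambda>u. cg * \<bar>u\<bar> powr (- \<sigma>))"
    and P: "assumption_P g \<sigma>" and f0: "is_density f0" and c0: "0 < c0" "\<And>x. c0 / (1 + x\<^sup>2) \<le> f0 x"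
  obtains D1 kP cP p0 c' where "lower_model g \<sigma> D1 kP cP f0 p0 c'"
proof -
  obtain U where U: "1 \<le> U" "\<And>u. U \<le> \<bar>u\<bar> \<Longrightarrow> cmod (fourier g u) \<le> 2 * cg * \<bar>u\<bar> powr (- \<sigma>)"
    using noise_bounds[OF g nz cg \<sigma> as] by metis
  obtain D1 D2 :: "real \<Rightarrow> complex" and A1 where D: "\<And>u. (fourier g has_vector_derivative D1 u) (at u)"
    "\<And>u. (D1 has_vector_derivative D2 u) (at u)"
    "\<forall>\<^sub>F u in at_infinity. cmod (D1 u) \<le> A1 * \<bar>u\<bar> powr (- \<sigma> - 1)"
    using P unfolding assumption_P_def by blast
  obtain V where V: "\<And>u. V \<le> \<bar>u\<bar> \<Longrightarrow> cmod (D1 u) \<le> A1 * \<bar>u\<bar> powr (- \<sigma> - 1)"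
    using D(3) unfolding eventually_at_infinity real_norm_def by blast
  obtain p0 c' where p0: "0 < c'" "p0 \<in> borel_measurable borel" "\<And>x. c' / (1 + x\<^sup>2) \<le> p0 x"
    "AE x in lborel. ennreal (p0 x) = (\<integral>\<^sup>+y. ennreal (f0 (x - y)) * ennreal (g y) \<partial>lborel)"
    by (rule null_obs_density[OF f0 g c0], rule that)
  \<comment> \<open>One threshold and one constant serve both decays. Since
    \<open>\<bar>u\<bar> \<ge> 1\<close> there, the power \<open>- \<sigma> - 1\<close> in the
    derivative bound is dominated by the power \<open>- \<sigma>\<close>.\<close>
  let ?k = "max U V" and ?c = "2 * cg + \<bar>A1\<bar> + 1"
  have "smooth_noise g \<sigma> D1 ?k ?c"
  proof
    show "continuous_on UNIV D1"
      using D(2) by (intro continuous_at_imp_continuous_on ballI has_vector_derivative_continuous)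
    fix u :: real assume u: "?k \<le> \<bar>u\<bar>"
    have u1: "1 \<le> \<bar>u\<bar>" using u U by simp
    have "cmod (fourier g u) \<le> 2 * cg * \<bar>u\<bar> powr (- \<sigma>)" using u by (intro U) simp
    also have "\<dots> \<le> ?c * \<bar>u\<bar> powr (- \<sigma>)" by (intro mult_right_mono) auto
    finally show "cmod (fourier g u) \<le> ?c * \<bar>u\<bar> powr (- \<sigma>)" .
    have "cmod (D1 u) \<le> A1 * \<bar>u\<bar> powr (- \<sigma> - 1)" using u by (intro V) simp
    also have "\<dots> \<le> ?c * \<bar>u\<bar> powr (- \<sigma>)"
      using u1 cg by (intro mult_mono powr_mono) auto
    finally show "cmod (D1 u) \<le> ?c * \<bar>u\<bar> powr (- \<sigma>)" .
  qed (use g \<sigma> D(1) U cg in auto)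
  then have "lower_model g \<sigma> D1 ?k ?c f0 p0 c'"
    using f0 p0 by (intro lower_model.intro lower_model_axioms.intro) auto
  then show ?thesis by (rule that)
qed

theorem theorem1:
  fixes \<sigma> cg L \<alpha>lo rlo rhi \<beta>lo \<beta>hi \<alpha>0 :: real
    and f0 g :: "real \<Rightarrow> real"
    and \<T> :: "(real \<times> real \<times> real) set"
  assumes "\<sigma> > 1"
    and "is_density g"
    and "\<forall>u. fourier g u \<noteq> 0"
    and "cg > 0"
    and "(\<lambda>u. cmod (fourier g u)) \<sim>[at_infinity] (\<lambda>u. cg * \<bar>u\<bar> powr (- \<sigma>))"
    and "L > 0"
    and "parameter_set \<alpha>lo rlo rhi \<beta>lo \<beta>hi \<T>"
    and "\<alpha>0 \<ge> \<alpha>lo"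
    and "f0 \<in> smoothness_class (\<alpha>0, 0, \<beta>hi) L"
  shows
    "(\<forall>\<epsilon>\<in>{0<..<1}. \<forall>\<^sub>F Cstar in at_top. \<exists>C0>0. \<forall>C>C0.
        limsup (\<lambda>n. total_error g f0 (alternatives \<T> L f0 C (rate \<sigma> \<beta>hi n)) n
                      (adaptive_test g f0 \<sigma> \<beta>lo \<beta>hi Cstar n)) \<le> ennreal \<epsilon>) \<and>
     ((\<exists>c. 0 < c \<and> c < 1 \<and> f0 \<in> smoothness_class (\<alpha>0, 0, \<beta>hi) (c * L)) \<and>
        assumption_T f0 \<and> assumption_P g \<sigma> \<longrightarrow>
      (\<forall>\<epsilon>\<in>{0<..<1}. \<exists>C0>0. \<forall>C. 0 < C \<and> C < C0 \<longrightarrow>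
        liminf (\<lambda>n. INF \<Delta>\<in>tests n.
          total_error g f0
            (alternatives ({\<alpha>lo..} \<times> {0} \<times> {\<beta>lo..\<beta>hi}) L f0 C (rate \<sigma> \<beta>hi n)) n \<Delta>)
        \<ge> ennreal \<epsilon>))"
proof (intro conjI impI ballI)
  fix \<epsilon> :: real assume \<epsilon>: "\<epsilon> \<in> {0<..<1}"
  obtain G Ig where "deconv g \<sigma> G Ig" by (rule deconv_exists[OF assms(2) _ assms(4,1,5)]) (use assms(3) in auto)
  then show "\<forall>\<^sub>F Cstar in at_top. \<exists>C0>0. \<forall>C>C0.
      limsup (\<lambda>n. total_error g f0 (alternatives \<T> L f0 C (rate \<sigma> \<beta>hi n)) n
                    (adaptive_test g f0 \<sigma> \<beta>lo \<beta>hi Cstar n)) \<le> ennreal \<epsilon>"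
    using \<epsilon> by (intro deconv.adaptive_upper_bound[OF _ assms(6-9)]) auto
next
  fix \<epsilon> :: real assume \<epsilon>: "\<epsilon> \<in> {0<..<1}"
  assume "(\<exists>c. 0 < c \<and> c < 1 \<and> f0 \<in> smoothness_class (\<alpha>0, 0, \<beta>hi) (c * L)) \<and> assumption_T f0 \<and> assumption_P g \<sigma>"
  then obtain c c0 where c: "0 < c" "c < 1" "f0 \<in> smoothness_class (\<alpha>0, 0, \<beta>hi) (c * L)"
    and c0: "0 < c0" "\<And>x. c0 / (1 + x\<^sup>2) \<le> f0 x" and P: "assumption_P g \<sigma>"
    by (auto simp: assumption_T_def)
  have f0: "is_density f0" using assms(9) by (simp add: smoothness_class_def)
  have \<beta>: "0 \<le> \<beta>lo" "\<beta>lo < \<beta>hi" using assms(7) by (auto simp: parameter_set_def)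
  obtain D1 kP cP p0 c' where "lower_model g \<sigma> D1 kP cP f0 p0 c'"
    using lower_model_exists[OF assms(2) _ assms(4,1,5) P f0 c0] assms(3) by blast
  then show "\<exists>C0>0. \<forall>C. 0 < C \<and> C < C0 \<longrightarrow>
      ennreal \<epsilon> \<le> liminf (\<lambda>n. INF \<Delta>\<in>tests n.
        total_error g f0 (alternatives ({\<alpha>lo..} \<times> {0} \<times> {\<beta>lo..\<beta>hi}) L f0 C (rate \<sigma> \<beta>hi n)) n \<Delta>)"
    using \<epsilon> by (intro lower_model.adaptive_lower_bound[OF _ assms(6) c \<beta> assms(8) c0]) auto
qed

end
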